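(* For each integer $k$ with $5\le k\le 20$ one has $\widetilde G(k)\le H(k)$, where $H(5)=28$, $H(6)=43$, $H(7)=61$, $H(8)=83$, $H(9)=107$, $H(10)=134$, $H(11)=165$, $H(12)=199$, $H(13)=236$, $H(14)=276$, $H(15)=320$, $H(16)=368$, $H(17)=418$, $H(18)=473$, $H(19)=530$, $H(20)=592$.
   Context: Write $e(z)=e^{2\pi i z}$. For natural numbers $s,k$, let $R_{s,k}(n)$ denote the number of representations of the natural number $n$ as the sum of $s$ $k$th powers of positive integers. Put $$\mathfrak S_{s,k}(n)=\sum_{q=1}^\infty\ \sum_{\substack{1\le a\le q\\ (a,q)=1}}\Bigl(q^{-1}\sum_{r=1}^q e(ar^k/q)\Bigr)^s e(-na/q).$$ Then $\widetilde G(k)$ denotes the least integer $t$ with the property that, for all integers $s\ge t$, and all sufficiently large natural numbers $n$, one has the asymptotic formula $$R_{s,k}(n)=\frac{\Gamma(1+1/k)^s}{\Gamma(s/k)}\mathfrak S_{s,k}(n)\,n^{s/k-1}+o(n^{s/k-1})\qquad (n\to\infty).$$ *)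

theory Defs
  imports "HOL-Analysis.Analysis" "HOL-Library.Landau_Symbols" "HOL-Library.Extended_Nat"
begin

definition e2pi :: "complex \<Rightarrow> complex" where
  "e2pi z = exp (2 * of_real pi * \<i> * z)"

(* Ordered representations are counted: lists are s-tuples of positive integers.
   The set is finite whenever k > 0. *)
definition waring_count :: "nat \<Rightarrow> nat \<Rightarrow> nat \<Rightarrow> nat" where
  "waring_count s k n =
     card {xs :: nat list. length xs = s \<and> (\<forall>x\<in>set xs. 1 \<le> x) \<and> (\<Sum>x\<leftarrow>xs. x ^ k) = n}"

definition singular_term :: "nat \<Rightarrow> nat \<Rightarrow> nat \<Rightarrow> nat \<Rightarrow> complex" where
  "singular_term s k n q =
     (\<Sum>a | 1 \<le> a \<and> a \<le> q \<and> coprime a q.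
        ((\<Sum>r = 1..q. e2pi (of_nat a * of_nat r ^ k / of_nat q)) / of_nat q) ^ s *
        e2pi (- (of_nat n * of_nat a / of_nat q)))"

(* Suc shifts the index so that the summation over q starts at 1. *)
definition singular_series :: "nat \<Rightarrow> nat \<Rightarrow> nat \<Rightarrow> complex" where
  "singular_series s k n = (\<Sum>q. singular_term s k n (Suc q))"

(* suminf takes an unspecified value on a divergent series, so the convergence that is
   implicit in writing down the singular series is demanded explicitly.  The singular series
   is a complex number here, hence the error term is a complex-valued function of n. *)
definition asymptotic_formula :: "nat \<Rightarrow> nat \<Rightarrow> bool" where
  "asymptotic_formula s k \<longleftrightarrow>
     (\<forall>\<^sub>F n in sequentially. summable (\<lambda>q. singular_term s k n (Suc q))) \<and>
     (\<lambda>n. of_nat (waring_count s k n) -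
           of_real (Gamma (1 + 1 / real k) ^ s / Gamma (real s / real k)) *
           singular_series s k n *
           of_real (real n powr (real s / real k - 1)))
       \<in> o[sequentially](\<lambda>n. complex_of_real (real n powr (real s / real k - 1)))"

(* The least t is taken in enat, so that it is infinite if there is no admissible t
   (LEAST on nat would be unspecified in that case).  The number of summands s is a positive
   integer, whence 1 \<le> t. *)
definition G_tilde :: "nat \<Rightarrow> enat" where
  "G_tilde k = Inf (enat ` {t. 1 \<le> t \<and> (\<forall>s\<ge>t. asymptotic_formula s k)})"

(* Only the values at 5, ..., 20 are meaningful. *)
definition H :: "nat \<Rightarrow> nat" where
  "H k = the (map_of
     [(5, 28), (6, 43), (7, 61), (8, 83), (9, 107), (10, 134), (11, 165), (12, 199),
      (13, 236), (14, 276), (15, 320), (16, 368), (17, 418), (18, 473), (19, 530), (20, 592)] k)"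

end

theory Submission
  imports Defs "HOL-Analysis.Analysis" "HOL-Analysis.Kronecker_Approximation_Theorem"
    "HOL-Number_Theory.Cong" "HOL-Computational_Algebra.Computational_Algebra"
begin

text \<open>
  The circle method is run on a finite grid: all exponential sums are evaluated at the points h/M
  for one large integer M, so that orthogonality and mean values become finite identities.

  Vinogradov's mean value theorem at the critical exponent k(k+1) is obtained from p-adic
  decoupling, in the spirit of Guo, Li, Yung and Zorin-Kranich: for curves over the integers that
  are congruent to the moment curve modulo p, an exponent of growth eta in the decoupling
  inequality feeds into a bilinear iteration whose gain is unbounded, so eta can be taken
  arbitrarily small.

  On the minor arcs one shifts the variable by z \<le> X and applies a large sieve to the power sum of
  degree k-1, on which the shift acts linearly; this saves the full Diophantine denominator over
  the mean value theorem. Together with the mean square, this suffices for k^2 + k - 2 variables,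
  which is at most H k in the range considered.

  On the major arcs the sum over k-th powers is replaced by a Gauss sum times the polynomial whose
  coefficients are those of (1-z)^(-1/k). The s-th power of the latter has coefficients of
  (1-z)^(-s/k), so completing an arc to the whole grid gives the singular integral exactly.
\<close>

section \<open>Finite norm inequalities\<close>

text \<open>The prime \<open>p\<close> is fixed, any prime above \<open>k\<close>; only the number N
  of digits grows. So factors depending on \<open>p\<close> alone are harmless, and k! is a unit
  modulo \<open>p\<close>, which makes the changes of coordinates invertible. The gain of the
  bilinear iteration comes from transversality. Seen from a class around \<xi>, suitable l linear
  forms in the k coordinates trace an l-dimensional curve; on a class modulo p^b around \<eta>, with
  \<xi> - \<eta> prime to p, the same forms are constant modulo p^((k-l+1) b). Translations along
  these forms leave the second factor unchanged, so the first factor can be decoupled in dimension l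
  < k, where the loss is known by induction to be p^(\<epsilon> N). Hoelder's inequality then
  exchanges the two factors and the step is repeated. On the minor arcs the moment of order 2 r =
  k^2 + k comes out as X^(2r-k+\<epsilon>) / W, smaller by W than the order of magnitude of the main
  term. This surplus pays for lowering the number of variables from 2 r to 2 r - 2.\<close>

lemma convex_on_power_nonneg: "convex_on {0..} (\<lambda>x::real. x ^ n)"
  by (cases "even n") (auto intro: convex_power_odd convex_on_subset[OF convex_power_even])

text \<open>Minkowski's inequality, from the convexity of t^r: once each g i is divided by its norm
  A i, the weights A i / S make the sum over i a convex combination, and Jensen's inequality summed
  over w gives total 1. Its main use is to move the sum over grid points inside the sum over residue
  classes.\<close>

lemma minkowski_sum:
  fixes g :: "'i \<Rightarrow> 'a \<Rightarrow> real"
  assumes I: "finite I" and W: "finite W" and r: "r > 0"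
    and nn: "\<And>i w. i \<in> I \<Longrightarrow> w \<in> W \<Longrightarrow> 0 \<le> g i w"
  shows "(\<Sum>w\<in>W. (\<Sum>i\<in>I. g i w) ^ r) \<le> (\<Sum>i\<in>I. root r (\<Sum>w\<in>W. g i w ^ r)) ^ r"
proof -
  define A where "A i = root r (\<Sum>w\<in>W. g i w ^ r)" for i
  have A0: "0 \<le> A i" if "i \<in> I" for i
    using nn that by (auto simp: A_def intro!: sum_nonneg real_root_ge_zero)
  have Ar: "A i ^ r = (\<Sum>w\<in>W. g i w ^ r)" if "i \<in> I" for i
    unfolding A_def using r nn that by (auto intro!: real_root_pow_pos2 sum_nonneg)
  have gz: "g i w = 0" if "i \<in> I" "A i = 0" "w \<in> W" for i w
  proof -
    have "(\<Sum>w\<in>W. g i w ^ r) = 0" using Ar[OF that(1), symmetric] that(2) r by (simp add: zero_power)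
    then have "\<forall>w\<in>W. g i w ^ r = 0"
      using nn that W by (subst (asm) sum_nonneg_eq_0_iff) auto
    then show ?thesis using that by simp
  qed
  \<comment> \<open>The normalisation divides by A i, so indices of norm zero are removed; their
    functions vanish on W by \<open>gz\<close>.\<close>
  define J where "J = {i\<in>I. A i \<noteq> 0}"
  have J: "finite J" "J \<subseteq> I" using I by (auto simp: J_def)
  have Apos: "0 < A i" if "i \<in> J" for i using A0[of i] that by (auto simp: J_def)
  define S where "S = (\<Sum>i\<in>J. A i)"
  have SI: "(\<Sum>i\<in>I. A i) = S"
    unfolding S_def by (rule sum.mono_neutral_right) (use I in \<open>auto simp: J_def\<close>)
  have gJ: "(\<Sum>i\<in>I. g i w) = (\<Sum>i\<in>J. g i w)" if "w \<in> W" for w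
    by (rule sum.mono_neutral_right) (use I gz that in \<open>auto simp: J_def\<close>)
  show ?thesis
  proof (cases "J = {}")
    case True
    then have z: "(\<Sum>i\<in>I. g i w) ^ r = 0" if "w \<in> W" for w using gJ[OF that] r by simp
    have "(\<Sum>w\<in>W. (\<Sum>i\<in>I. g i w) ^ r) = 0" by (rule sum.neutral) (use z in blast)
    moreover have "0 \<le> (\<Sum>i\<in>I. A i) ^ r" using A0 by (intro zero_le_power sum_nonneg)
    ultimately show ?thesis unfolding A_def by linarith
  next
    case False
    have Spos: "0 < S" unfolding S_def using J False Apos by (intro sum_pos) auto
    have pt: "(\<Sum>i\<in>J. g i w) ^ r \<le> S ^ r * (\<Sum>i\<in>J. (A i / S) * (g i w / A i) ^ r)" if w: "w \<in> W" for w
    proof -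
      have "(\<Sum>i\<in>J. (A i / S) *\<^sub>R (g i w / A i)) ^ r \<le> (\<Sum>i\<in>J. (A i / S) * (g i w / A i) ^ r)"
      proof (rule convex_on_sum[OF J(1) False convex_on_power_nonneg])
        show "(\<Sum>i\<in>J. A i / S) = 1" using Spos by (simp add: S_def flip: sum_divide_distrib)
        show "0 \<le> A i / S" if "i \<in> J" for i using Apos[OF that] Spos by simp
        show "g i w / A i \<in> {0..}" if "i \<in> J" for i using Apos[OF that] nn[of i w] w J that by (auto simp: subset_iff)
      qed
      also have "(\<Sum>i\<in>J. (A i / S) *\<^sub>R (g i w / A i)) = (\<Sum>i\<in>J. g i w) / S"
        unfolding sum_divide_distrib by (rule sum.cong) (use Apos in force)+
      finally show ?thesis using Spos by (simp add: power_divide field_simps)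
    qed
    have "(\<Sum>w\<in>W. (\<Sum>i\<in>I. g i w) ^ r) = (\<Sum>w\<in>W. (\<Sum>i\<in>J. g i w) ^ r)" using gJ by simp
    also have "\<dots> \<le> (\<Sum>w\<in>W. S ^ r * (\<Sum>i\<in>J. (A i / S) * (g i w / A i) ^ r))"
      by (rule sum_mono) (rule pt)
    also have "\<dots> = S ^ r * (\<Sum>i\<in>J. (A i / S) * ((\<Sum>w\<in>W. g i w ^ r) / A i ^ r))"
      by (subst sum_distrib_left[symmetric], subst sum.swap)
         (simp add: sum_distrib_left sum_divide_distrib power_divide)
    also have "(\<Sum>i\<in>J. (A i / S) * ((\<Sum>w\<in>W. g i w ^ r) / A i ^ r)) = (\<Sum>i\<in>J. A i / S)"
      by (rule sum.cong) (use Ar J Apos in \<open>force+\<close>)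
    also have "\<dots> = 1" using Spos by (simp add: S_def sum_divide_distrib[symmetric])
    finally show ?thesis using SI by (simp add: A_def)
  qed
qed

text \<open>Young's inequality for the normalised values u w / U and v w / V. Real exponents are
  used because the interpolation weights of the bilinear step are fractions such as
  1/(k-l+1).\<close>

lemma holder_sum_powr:
  fixes u v :: "'a \<Rightarrow> real"
  assumes W: "finite W" and u: "\<And>w. w \<in> W \<Longrightarrow> 0 \<le> u w" and v: "\<And>w. w \<in> W \<Longrightarrow> 0 \<le> v w"
    and th: "0 < \<theta>" "\<theta> < 1"
  shows "(\<Sum>w\<in>W. u w powr \<theta> * v w powr (1 - \<theta>)) \<le> (\<Sum>w\<in>W. u w) powr \<theta> * (\<Sum>w\<in>W. v w) powr (1 - \<theta>)"
proof -
  define U V where "U = (\<Sum>w\<in>W. u w)" and "V = (\<Sum>w\<in>W. v w)"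
  have UV: "0 \<le> U" "0 \<le> V" using u v by (auto simp: U_def V_def intro: sum_nonneg)
  show ?thesis
  proof (cases "U = 0 \<or> V = 0")
    case True
    then have "\<forall>w\<in>W. u w powr \<theta> * v w powr (1 - \<theta>) = 0"
      using W u v by (auto simp: U_def V_def sum_nonneg_eq_0_iff)
    then have "(\<Sum>w\<in>W. u w powr \<theta> * v w powr (1 - \<theta>)) = 0" by (intro sum.neutral)
    then show ?thesis by simp
  next
    case False
    then have pos: "0 < U" "0 < V" using UV by auto
    have "(u w / U) powr \<theta> * (v w / V) powr (1 - \<theta>) \<le> \<theta> * (u w / U) + (1 - \<theta>) * (v w / V)"
      if w: "w \<in> W" for w
    proof (cases "u w = 0 \<or> v w = 0")
      case True
      then show ?thesis using u[OF w] v[OF w] pos th by (auto intro!: mult_nonneg_nonneg)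
    next
      case False
      then have "0 < u w / U" "0 < v w / V" using u[OF w] v[OF w] pos by auto
      then show ?thesis using th by (intro Youngs_inequality_0) auto
    qed
    then have "(\<Sum>w\<in>W. (u w / U) powr \<theta> * (v w / V) powr (1 - \<theta>)) \<le> (\<Sum>w\<in>W. \<theta> * (u w / U) + (1 - \<theta>) * (v w / V))"
      by (rule sum_mono)
    also have "\<dots> = \<theta> * (U / U) + (1 - \<theta>) * (V / V)"
      unfolding sum.distrib sum_distrib_left[symmetric] sum_divide_distrib[symmetric] U_def V_def by simp
    also have "\<dots> = 1" using pos by simp
    also have "(\<Sum>w\<in>W. (u w / U) powr \<theta> * (v w / V) powr (1 - \<theta>))
        = (\<Sum>w\<in>W. u w powr \<theta> * v w powr (1 - \<theta>)) / (U powr \<theta> * V powr (1 - \<theta>))"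
      unfolding sum_divide_distrib by (rule sum.cong) (use u v pos in \<open>auto simp: powr_divide\<close>)
    finally show ?thesis using pos by (simp add: U_def[symmetric] V_def[symmetric] field_simps)
  qed
qed

section \<open>Integral curves close to the moment curve\<close>

text \<open>Only congruence modulo p is demanded: unlike the moment curve itself, this class is stable under
  translation to another base point, rescaling by powers of p and unimodular changes of coordinates.\<close>

definition ncurve :: "int \<Rightarrow> nat \<Rightarrow> (nat \<Rightarrow> int poly) \<Rightarrow> bool" where
  "ncurve p l \<phi> \<longleftrightarrow> (\<forall>j\<in>{1..l}. \<forall>i. [coeff (\<phi> j) i = (if i = j then 1 else 0)] (mod p))"

text \<open>Back substitution: a matrix that is upper triangular modulo \<open>p\<close> with unit
  diagonal has a left inverse, whose rows are found from the last one upwards.\<close>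

lemma triangular_inverse_mod:
  fixes G :: "nat \<Rightarrow> nat \<Rightarrow> int"
  assumes p: "prime p"
    and low: "\<And>i r. i \<in> {1..l} \<Longrightarrow> r \<in> {1..l} \<Longrightarrow> r < i \<Longrightarrow> [G i r = 0] (mod p)"
    and diag: "\<And>i. i \<in> {1..l} \<Longrightarrow> \<not> p dvd G i i"
  shows "\<exists>f. \<forall>i\<in>{1..l}. \<forall>r\<in>{1..l}. [(\<Sum>s\<in>{1..l}. f i s * G s r) = (if r = i then 1 else 0)] (mod p)"
proof -
  have "i \<in> {1..l} \<Longrightarrow> \<exists>f. \<forall>r\<in>{1..l}. [(\<Sum>s\<in>{1..l}. f s * G s r) = (if r = i then 1 else 0)] (mod p)" for i
  proof (induction "l - i" arbitrary: i rule: less_induct)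
    case less
    have "\<forall>t\<in>{i<..l}. \<exists>f. \<forall>r\<in>{1..l}. [(\<Sum>s\<in>{1..l}. f s * G s r) = (if r = t then 1 else 0)] (mod p)"
      using less.prems by (intro ballI less.hyps) auto
    then obtain F where F: "\<And>t r. t \<in> {i<..l} \<Longrightarrow> r \<in> {1..l} \<Longrightarrow>
        [(\<Sum>s\<in>{1..l}. F t s * G s r) = (if r = t then 1 else 0)] (mod p)"
      by metis
    obtain v where v: "[v * G i i = 1] (mod p)"
      using diag[OF less.prems] p
      by (metis cong_solve_coprime_int mult.commute prime_imp_coprime coprime_commute)
    define f where "f s = v * ((if s = i then 1 else 0) - (\<Sum>t\<in>{i<..l}. G i t * F t s))" for s
    have "[(\<Sum>s\<in>{1..l}. f s * G s r) = (if r = i then 1 else 0)] (mod p)" if r: "r \<in> {1..l}" for r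
    proof -
      have "(\<Sum>s\<in>{1..l}. f s * G s r) = v * ((\<Sum>s\<in>{1..l}. (if s = i then 1 else 0) * G s r)
              - (\<Sum>s\<in>{1..l}. (\<Sum>t\<in>{i<..l}. G i t * F t s) * G s r))"
        by (simp add: f_def algebra_simps sum_subtractf sum_distrib_left)
      also have "(\<Sum>s\<in>{1..l}. (if s = i then 1 else 0) * G s r) = G i r"
        using less.prems by (simp add: if_distrib[of "\<lambda>x. x * _"] cong: if_cong)
      also have "(\<Sum>s\<in>{1..l}. (\<Sum>t\<in>{i<..l}. G i t * F t s) * G s r)
          = (\<Sum>t\<in>{i<..l}. G i t * (\<Sum>s\<in>{1..l}. F t s * G s r))"
        by (simp add: sum_distrib_left sum_distrib_right mult.assoc) (rule sum.swap)
      finally have eq: "(\<Sum>s\<in>{1..l}. f s * G s r)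
          = v * (G i r - (\<Sum>t\<in>{i<..l}. G i t * (\<Sum>s\<in>{1..l}. F t s * G s r)))" .
      have "[(\<Sum>t\<in>{i<..l}. G i t * (\<Sum>s\<in>{1..l}. F t s * G s r)) = (\<Sum>t\<in>{i<..l}. G i t * (if r = t then 1 else 0))] (mod p)"
        by (intro cong_sum cong_mult cong_refl F r)
      also have "(\<Sum>t\<in>{i<..l}. G i t * (if r = t then 1 else 0)) = (if i < r then G i r else 0)"
        using r by (auto simp: if_distrib[of "\<lambda>x. _ * x"] cong: if_cong)
      finally have 1: "[v * (G i r - (\<Sum>t\<in>{i<..l}. G i t * (\<Sum>s\<in>{1..l}. F t s * G s r)))
           = v * (G i r - (if i < r then G i r else 0))] (mod p)"
        by (intro cong_mult cong_diff cong_refl)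
      have 2: "[v * (G i r - (if i < r then G i r else 0)) = (if r = i then 1 else 0)] (mod p)"
      proof (cases r i rule: linorder_cases)
        case less
        then have "[v * G i r = v * 0] (mod p)" using low[OF \<open>i \<in> {1..l}\<close> r] by (intro cong_mult cong_refl) auto
        then show ?thesis using less by simp
      qed (use v in auto)
      show ?thesis using cong_trans[OF 1 2] eq by simp
    qed
    then show ?case by blast
  qed
  then show ?thesis by metis
qed

text \<open>Newton's iteration for inverses: if e c = 1 + q E then (1 - q E) e c = 1 - q^2 E^2, and
  q^2 has at least one digit more than q. Rows and columns have separate index sets, because the
  lemma is applied to coordinates k-l+1..k against degrees 1..l.\<close>

lemma inverse_mod_lift:
  fixes c :: "nat \<Rightarrow> nat \<Rightarrow> int" and e :: "nat \<Rightarrow> nat \<Rightarrow> int"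
  assumes I: "finite I"
    and e: "\<And>i r. i \<in> I \<Longrightarrow> r \<in> I \<Longrightarrow> [(\<Sum>m\<in>J. e i m * c m r) = (if r = i then 1 else 0)] (mod p)"
  shows "\<exists>e. \<forall>i\<in>I. \<forall>r\<in>I. [(\<Sum>m\<in>J. e i m * c m r) = (if r = i then 1 else 0)] (mod p ^ Suc M)"
proof (induction M)
  case 0
  show ?case by (rule exI[of _ e]) (use e in simp)
next
  case (Suc M)
  then obtain e where e: "\<And>i r. i \<in> I \<Longrightarrow> r \<in> I \<Longrightarrow>
      [(\<Sum>m\<in>J. e i m * c m r) = (if r = i then 1 else 0)] (mod p ^ Suc M)" by blast
  define q where "q = p ^ Suc M"
  have "\<exists>E. (\<Sum>m\<in>J. e i m * c m r) = (if r = i then 1 else 0) + q * E" if "i \<in> I" "r \<in> I" for i r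
    using e[OF that] by (metis cong_iff_lin cong_sym q_def)
  then obtain E where E: "\<And>i r. i \<in> I \<Longrightarrow> r \<in> I \<Longrightarrow>
      (\<Sum>m\<in>J. e i m * c m r) = (if r = i then 1 else 0) + q * E i r" by metis
  define e' where "e' i m = e i m - q * (\<Sum>s\<in>I. E i s * e s m)" for i m
  have "[(\<Sum>m\<in>J. e' i m * c m r) = (if r = i then 1 else 0)] (mod p ^ Suc (Suc M))"
    if ir: "i \<in> I" "r \<in> I" for i r
  proof -
    have "(\<Sum>m\<in>J. e' i m * c m r) = (\<Sum>m\<in>J. e i m * c m r) - q * (\<Sum>s\<in>I. E i s * (\<Sum>m\<in>J. e s m * c m r))"
      by (simp add: e'_def algebra_simps sum_subtractf sum_distrib_left sum_distrib_right)
         (rule sum.swap)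
    also have "(\<Sum>s\<in>I. E i s * (\<Sum>m\<in>J. e s m * c m r)) = (\<Sum>s\<in>I. E i s * ((if r = s then 1 else 0) + q * E s r))"
      using ir by (intro sum.cong) (auto simp: E)
    also have "\<dots> = E i r + q * (\<Sum>s\<in>I. E i s * E s r)"
      using ir I by (simp add: algebra_simps sum.distrib sum_distrib_left if_distrib[of "\<lambda>x. _ * x"] cong: if_cong)
    finally have "(\<Sum>m\<in>J. e' i m * c m r) = (if r = i then 1 else 0) + (- q * q * (\<Sum>s\<in>I. E i s * E s r))"
      using E[OF ir] by (simp add: algebra_simps)
    moreover have "p ^ Suc (Suc M) dvd - q * q * (\<Sum>s\<in>I. E i s * E s r)"
    proof -
      have "p ^ Suc (Suc M) dvd q * q" unfolding q_def power_add[symmetric] by (rule le_imp_power_dvd) auto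
      then show ?thesis by (simp add: dvd_mult2)
    qed
    ultimately show ?thesis by (simp add: cong_iff_dvd_diff)
  qed
  then show ?case by blast
qed

text \<open>Comparison of coefficients in x^(i-1) = ((x + \<omega>) - \<omega>)^(i-1), expanded in
  powers of x + \<omega> and multiplied by (x + \<omega>)^n.\<close>

lemma binom_shift_sum:
  fixes \<omega> :: int
  assumes "1 \<le> i" "1 \<le> r"
  shows "(\<Sum>q<i. of_nat ((i - 1) choose q) * (-\<omega>) ^ (i - 1 - q) * coeff ([:\<omega>, 1:] ^ (n + q)) (r - 1))
     = coeff (monom 1 (i - 1) * [:\<omega>, 1:] ^ n) (r - 1)"
proof -
  have "monom 1 (i - 1) = ([:-\<omega>:] + [:\<omega>, 1:]) ^ (i - 1)"
    by (simp add: monom_altdef)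
  also have "\<dots> = (\<Sum>q\<le>i - 1. of_nat ((i - 1) choose q) * [:-\<omega>:] ^ (i - 1 - q) * [:\<omega>, 1:] ^ q)"
    by (subst add.commute, subst binomial_ring) (simp add: mult_ac)
  also have "\<dots> = (\<Sum>q<i. smult (of_nat ((i - 1) choose q) * (-\<omega>) ^ (i - 1 - q)) ([:\<omega>, 1:] ^ q))"
    using assms by (intro sum.cong) (auto simp: of_nat_poly poly_const_pow mult.commute)
  finally show ?thesis
    by (simp add: sum_distrib_left coeff_sum power_add mult_ac)
qed

lemma coeff_shift_power: "coeff ([:\<omega>, 1:] ^ N) r = of_nat (N choose r) * (\<omega>::int) ^ (N - r)"
proof (cases "r \<le> N")
  case False
  have "degree ([:\<omega>, 1:] ^ N) \<le> N" using degree_power_le[of "[:\<omega>, 1:]" N] by simp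
  then show ?thesis using False by (simp add: coeff_eq_0)
qed (simp add: coeff_linear_poly_power)

text \<open>The matrix entry is the coefficient of x^r in (x + \<omega>)^m. Since r C(m,r) = m
  C(m-1,r-1), dividing row m by m and multiplying column r by r yields the coefficients of (x +
  \<omega>)^(m-1) with n <= m-1 < n+l. Row operations turn these powers into x^(i-1) (x +
  \<omega>)^n, a triangular system with diagonal \<omega>^n. All m and r are units because n + l <
  p.\<close>

lemma binom_inverse:
  fixes p \<omega> :: int
  assumes p: "prime p" and pn: "int (n + l) < p" and w: "n = 0 \<or> \<not> p dvd \<omega>"
  shows "\<exists>e. \<forall>i\<in>{1..l}. \<forall>r\<in>{1..l}.
    [(\<Sum>m\<in>{n+1..n+l}. e i m * (of_nat (m choose r) * \<omega> ^ (m - r))) = (if r = i then 1 else 0)] (mod p)"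
proof -
  \<comment> \<open>A common multiple of the denominators m of the row scaling, itself prime to
    p.\<close>
  define L :: int where "L = fact (n + l)"
  define c where "c m r = of_nat (m choose r) * \<omega> ^ (m - r)" for m r
  define e0 where "e0 i m = (if m \<le> n + i then L div int m * (of_nat ((i - 1) choose (m - n - 1)) * (-\<omega>) ^ (i - 1 - (m - n - 1))) else 0)" for i m
  define G where "G i r = (\<Sum>m\<in>{n+1..n+l}. e0 i m * c m r)" for i r
  have rG: "int r * G i r = L * coeff (monom 1 (i - 1) * [:\<omega>, 1:] ^ n) (r - 1)"
    if ir: "i \<in> {1..l}" "r \<in> {1..l}" for i r
  proof -
    have Lm: "L div int m * (int r * int (m choose r)) = L * int ((m - 1) choose (r - 1))"
      if "m \<in> {n+1..n+l}" for m
    proof -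
      have "int m dvd L" using that unfolding L_def
        by (subst of_nat_fact[symmetric], subst of_nat_dvd_iff) (auto intro: dvd_fact)
      moreover have "int r * int (m choose r) = int m * int ((m - 1) choose (r - 1))"
        using that ir binomial_absorption[of "r - 1" m] Suc_pred'[of r]
        by (simp add: Suc_le_eq flip: of_nat_mult)
      ultimately show ?thesis by (metis dvd_div_mult_self mult.assoc)
    qed
    have "int r * G i r = (\<Sum>m\<in>{n+1..n+i}. int r * (e0 i m * c m r))"
      unfolding G_def sum_distrib_left by (rule sum.mono_neutral_right) (use ir in \<open>auto simp: e0_def\<close>)
    also have "\<dots> = (\<Sum>m\<in>{n+1..n+i}. L * (of_nat ((i - 1) choose (m - n - 1)) * (-\<omega>) ^ (i - 1 - (m - n - 1)) * coeff ([:\<omega>, 1:] ^ (m - 1)) (r - 1)))"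
    proof (rule sum.cong[OF refl])
      fix m assume m: "m \<in> {n+1..n+i}"
      then have m': "m \<in> {n+1..n+l}" using ir by auto
      have "m - 1 - (r - 1) = m - r" using ir m by auto
      then show "int r * (e0 i m * c m r) = L * (of_nat ((i - 1) choose (m - n - 1)) * (-\<omega>) ^ (i - 1 - (m - n - 1)) * coeff ([:\<omega>, 1:] ^ (m - 1)) (r - 1))"
        using Lm[OF m'] m by (simp add: e0_def c_def coeff_shift_power algebra_simps)
    qed
    also have "\<dots> = L * (\<Sum>m\<in>{n+1..n+i}. of_nat ((i - 1) choose (m - n - 1)) * (-\<omega>) ^ (i - 1 - (m - n - 1)) * coeff ([:\<omega>, 1:] ^ (m - 1)) (r - 1))"
      by (simp add: sum_distrib_left)
    also have "(\<Sum>m\<in>{n+1..n+i}. of_nat ((i - 1) choose (m - n - 1)) * (-\<omega>) ^ (i - 1 - (m - n - 1)) * coeff ([:\<omega>, 1:] ^ (m - 1)) (r - 1))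
       = (\<Sum>q<i. of_nat ((i - 1) choose q) * (-\<omega>) ^ (i - 1 - q) * coeff ([:\<omega>, 1:] ^ (n + q)) (r - 1))"
      by (rule sum.reindex_bij_witness[of _ "\<lambda>q. n + 1 + q" "\<lambda>m. m - n - 1"]) auto
    also have "\<dots> = coeff (monom 1 (i - 1) * [:\<omega>, 1:] ^ n) (r - 1)"
      using ir by (intro binom_shift_sum) auto
    finally show ?thesis .
  qed
  have pL: "\<not> p dvd L"
  proof
    assume "p dvd L"
    moreover have "p = int (nat p)" using p by (simp add: prime_ge_0_int)
    ultimately have "int (nat p) dvd int (fact (n + l))" unfolding L_def by simp
    then have "nat p dvd fact (n + l)" by (simp only: of_nat_dvd_iff)
    moreover have "prime (nat p)" using p prime_int_nat_transfer by blast
    ultimately have "nat p \<le> n + l" using prime_dvd_fact_iff by blast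
    then show False using pn by linarith
  qed
  have low: "[G i r = 0] (mod p)" if "i \<in> {1..l}" "r \<in> {1..l}" "r < i" for i r
  proof -
    have "int r * G i r = 0" using rG[OF that(1,2)] that by (simp add: coeff_monom_mult)
    then show ?thesis using that by simp
  qed
  have diag: "\<not> p dvd G i i" if i: "i \<in> {1..l}" for i
  proof
    assume "p dvd G i i"
    then have "p dvd int i * G i i" by simp
    then have "p dvd L * \<omega> ^ n" using rG[OF i i] by (simp add: coeff_monom_mult coeff_shift_power)
    then have "p dvd \<omega> ^ n" using p pL prime_dvd_mult_iff by blast
    then show False using w p by (metis not_prime_unit power_0 prime_dvd_power)
  qed
  obtain f where f: "\<And>i r. i \<in> {1..l} \<Longrightarrow> r \<in> {1..l} \<Longrightarrow>
      [(\<Sum>s\<in>{1..l}. f i s * G s r) = (if r = i then 1 else 0)] (mod p)"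
    using triangular_inverse_mod[where G = G and l = l, OF p] low diag by blast
  have "(\<Sum>m\<in>{n+1..n+l}. (\<Sum>s\<in>{1..l}. f i s * e0 s m) * c m r) = (\<Sum>s\<in>{1..l}. f i s * G s r)" for i r
    unfolding G_def by (simp add: sum_distrib_left sum_distrib_right mult.assoc) (rule sum.swap)
  then show ?thesis using f unfolding c_def
    by (intro exI[of _ "\<lambda>i m. \<Sum>s\<in>{1..l}. f i s * e0 s m"]) auto
qed

lemma pcompose_monom_1: "monom 1 j \<circ>\<^sub>p q = q ^ j" for q :: "int poly"
  by (induction j) (simp_all add: monom_Suc pcompose_pCons pcompose_1 monom_0 one_pCons)

lemma coeff_pcompose_shift_cong:
  fixes \<phi> :: "int poly"
  assumes "\<And>i. [coeff \<phi> i = (if i = j then 1 else 0)] (mod p)"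
  shows "[coeff (\<phi> \<circ>\<^sub>p [:\<omega>, 1:]) r = of_nat (j choose r) * \<omega> ^ (j - r)] (mod p)"
proof -
  have "\<forall>i. p dvd coeff (\<phi> - monom 1 j) i" using assms by (auto simp: cong_iff_dvd_diff coeff_diff eq_commute[of j])
  then have "[:p:] dvd \<phi> - monom 1 j" by (simp add: const_poly_dvd_iff)
  then obtain q where q: "\<phi> = monom 1 j + [:p:] * q" by (metis add_diff_cancel_left' dvdE diff_add_cancel add.commute)
  have "\<phi> \<circ>\<^sub>p [:\<omega>, 1:] = [:\<omega>, 1:] ^ j + smult p (q \<circ>\<^sub>p [:\<omega>, 1:])"
    by (simp add: q pcompose_add pcompose_smult pcompose_monom_1)
  then show ?thesis by (simp add: coeff_shift_power cong_iff_dvd_diff)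
qed

text \<open>Around the base point \<omega> the last l coordinates alone recover x, ..., x^l: modulo
  p they are the powers (x + \<omega>)^m, so \<open>binom_inverse\<close> with n = k - l solves for
  the monomials, and the solution is lifted to a high power of p. For l < k the base point must be
  prime to p, since at \<omega> = 0 these coordinates have no linear term modulo p. The constant
  terms and the degrees above l stay uncontrolled.\<close>

lemma normal_form:
  assumes p: "prime p" and k: "int k < p" and l: "l \<le> k" and w: "l = k \<or> \<not> p dvd \<omega>"
    and \<phi>: "ncurve p k \<phi>"
  shows "\<exists>e. \<forall>i\<in>{1..l}. \<forall>r\<in>{1..l}.
    [coeff (\<Sum>m\<in>{k-l+1..k}. smult (e i m) (\<phi> m \<circ>\<^sub>p [:\<omega>, 1:])) r = (if r = i then 1 else 0)] (mod p ^ Suc M)"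
proof -
  have "int (k - l + l) < p" "k - l = 0 \<or> \<not> p dvd \<omega>" using k l w by auto
  from binom_inverse[OF p this] l have "\<exists>e. \<forall>i\<in>{1..l}. \<forall>r\<in>{1..l}.
    [(\<Sum>m\<in>{k-l+1..k}. e i m * (of_nat (m choose r) * \<omega> ^ (m - r))) = (if r = i then 1 else 0)] (mod p)"
    by simp
  then obtain e where e: "\<And>i r. i \<in> {1..l} \<Longrightarrow> r \<in> {1..l} \<Longrightarrow>
    [(\<Sum>m\<in>{k-l+1..k}. e i m * (of_nat (m choose r) * \<omega> ^ (m - r))) = (if r = i then 1 else 0)] (mod p)"
    by blast
  have "[(\<Sum>m\<in>{k-l+1..k}. e i m * coeff (\<phi> m \<circ>\<^sub>p [:\<omega>, 1:]) r) = (if r = i then 1 else 0)] (mod p)"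
    if "i \<in> {1..l}" "r \<in> {1..l}" for i r
  proof (rule cong_trans[OF cong_sum[OF cong_mult[OF cong_refl]] e[OF that]])
    fix m assume "m \<in> {k-l+1..k}"
    then show "[coeff (\<phi> m \<circ>\<^sub>p [:\<omega>, 1:]) r = of_nat (m choose r) * \<omega> ^ (m - r)] (mod p)"
      using \<phi> by (intro coeff_pcompose_shift_cong) (auto simp: ncurve_def)
  qed
  from inverse_mod_lift[where I = "{1..l}" and M = M, OF _ this]
  show ?thesis unfolding coeff_sum coeff_smult by simp
qed

lemma poly_altdef_le:
  fixes q :: "int poly"
  assumes "degree q \<le> D"
  shows "poly q x = (\<Sum>r\<le>D. coeff q r * x ^ r)"
  unfolding poly_altdef by (rule sum.mono_neutral_left) (use assms in \<open>auto simp: coeff_eq_0\<close>)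

text \<open>Substituting p^a z multiplies degree r by p^(r a). Relative to the main term p^(i a)
  z^i, the uncontrolled degrees r > l carry p^((r-i) a), a multiple of p because a >= 1; hence the
  rescaled curve is again congruent to the moment curve.\<close>

lemma local_curve:
  fixes h :: "nat \<Rightarrow> int poly" and p :: int
  assumes a: "1 \<le> a"
    and h: "\<And>i r. i \<in> {1..l} \<Longrightarrow> r \<in> {1..l} \<Longrightarrow> [coeff (h i) r = (if r = i then 1 else 0)] (mod p ^ M)"
  shows "\<exists>\<psi>. ncurve p l \<psi> \<and> (\<forall>i\<in>{1..l}. \<forall>z.
    [poly (h i) (p ^ a * z) - poly (h i) 0 = p ^ (i * a) * poly (\<psi> i) z] (mod p ^ M))"
proof -
  define D where "D i = degree (h i) + l + 1" for i
  define \<psi> where "\<psi> i = monom 1 i + (\<Sum>r\<in>{l<..D i}. monom (coeff (h i) r * p ^ ((r - i) * a)) r)" for i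
  have "ncurve p l \<psi>"
    unfolding ncurve_def
  proof (intro ballI allI)
    fix i s assume i: "i \<in> {1..l}"
    have c: "coeff (\<psi> i) s = (if s = i then 1 else 0) + (if s \<in> {l<..D i} then coeff (h i) s * p ^ ((s - i) * a) else 0)"
      by (simp add: \<psi>_def coeff_sum if_distrib cong: if_cong)
    have "p dvd (if s \<in> {l<..D i} then coeff (h i) s * p ^ ((s - i) * a) else 0)"
      using i a by (simp add: dvd_power)
    then show "[coeff (\<psi> i) s = (if s = i then 1 else 0)] (mod p)"
      unfolding c by (simp add: cong_iff_dvd_diff)
  qed
  moreover have "[poly (h i) (p ^ a * z) - poly (h i) 0 = p ^ (i * a) * poly (\<psi> i) z] (mod p ^ M)"
    if i: "i \<in> {1..l}" for i z
  proof -
    let ?y = "p ^ a * z"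
    have "poly (h i) ?y = (\<Sum>r\<le>D i. coeff (h i) r * ?y ^ r)"
      by (rule poly_altdef_le) (simp add: D_def)
    also have "{..D i} = insert 0 ({1..l} \<union> {l<..D i})" by (auto simp: D_def)
    also have "(\<Sum>r\<in>insert 0 ({1..l} \<union> {l<..D i}). coeff (h i) r * ?y ^ r)
       = coeff (h i) 0 + ((\<Sum>r\<in>{1..l}. coeff (h i) r * ?y ^ r) + (\<Sum>r\<in>{l<..D i}. coeff (h i) r * ?y ^ r))"
      by (subst sum.insert, simp, simp, subst sum.union_disjoint) auto
    finally have "poly (h i) ?y - poly (h i) 0
       = (\<Sum>r\<in>{1..l}. coeff (h i) r * ?y ^ r) + (\<Sum>r\<in>{l<..D i}. coeff (h i) r * ?y ^ r)"
      by (simp add: poly_0_coeff_0)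
    also have "[\<dots> = (\<Sum>r\<in>{1..l}. (if r = i then 1 else 0) * ?y ^ r) + (\<Sum>r\<in>{l<..D i}. coeff (h i) r * ?y ^ r)] (mod p ^ M)"
      by (intro cong_add cong_sum cong_mult cong_refl h i)
    also have "(\<Sum>r\<in>{1..l}. (if r = i then 1 else 0) * ?y ^ r) = ?y ^ i"
      using i by (simp add: if_distrib[of "\<lambda>x. x * _"] cong: if_cong)
    also have "?y ^ i = p ^ (i * a) * z ^ i" by (simp add: power_mult_distrib mult.commute flip: power_mult)
    also have "(\<Sum>r\<in>{l<..D i}. coeff (h i) r * ?y ^ r)
        = (\<Sum>r\<in>{l<..D i}. p ^ (i * a) * (coeff (h i) r * p ^ ((r - i) * a) * z ^ r))"
    proof (rule sum.cong[OF refl])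
      fix r assume "r \<in> {l<..D i}"
      then have "a * r = i * a + (r - i) * a" using i by (simp add: algebra_simps diff_mult_distrib)
      then have "?y ^ r = p ^ (i * a) * p ^ ((r - i) * a) * z ^ r"
        by (simp add: power_mult_distrib power_add flip: power_mult)
      then show "coeff (h i) r * ?y ^ r = p ^ (i * a) * (coeff (h i) r * p ^ ((r - i) * a) * z ^ r)" by simp
    qed
    also have "p ^ (i * a) * z ^ i + \<dots> = p ^ (i * a) * poly (\<psi> i) z"
      by (simp add: \<psi>_def poly_sum poly_monom sum_distrib_left distrib_left)
    finally show ?thesis .
  qed
  ultimately show ?thesis by blast
qed

text \<open>Affine rescaling: in suitable coordinates a residue class modulo p^a carries a full
  k-dimensional curve whose coordinate i is contracted by p^(i a).\<close>

lemma curve_rescale: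
  assumes p: "prime p" and k: "int k < p" and \<phi>: "ncurve p k \<phi>" and a: "1 \<le> a"
  shows "\<exists>u \<psi>. ncurve p k \<psi> \<and> (\<forall>i\<in>{1..k}. \<forall>z.
    [(\<Sum>j\<in>{1..k}. u i j * (poly (\<phi> j) (\<xi> + p ^ a * z) - poly (\<phi> j) \<xi>)) = p ^ (i * a) * poly (\<psi> i) z] (mod p ^ M))"
proof -
  have "\<exists>e. \<forall>i\<in>{1..k}. \<forall>r\<in>{1..k}.
    [coeff (\<Sum>m\<in>{1..k}. smult (e i m) (\<phi> m \<circ>\<^sub>p [:\<xi>, 1:])) r = (if r = i then 1 else 0)] (mod p ^ Suc M)"
    using normal_form[OF p k order_refl _ \<phi>, of \<xi> M] by simp
  then obtain e where e: "\<And>i r. i \<in> {1..k} \<Longrightarrow> r \<in> {1..k} \<Longrightarrow>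
    [coeff (\<Sum>m\<in>{1..k}. smult (e i m) (\<phi> m \<circ>\<^sub>p [:\<xi>, 1:])) r = (if r = i then 1 else 0)] (mod p ^ Suc M)"
    by blast
  define h where "h i = (\<Sum>m\<in>{1..k}. smult (e i m) (\<phi> m \<circ>\<^sub>p [:\<xi>, 1:]))" for i
  have "[coeff (h i) r = (if r = i then 1 else 0)] (mod p ^ M)" if "i \<in> {1..k}" "r \<in> {1..k}" for i r
    using e[OF that] unfolding h_def by (rule cong_dvd_modulus) simp
  from local_curve[OF a, of k h p M, OF this] obtain \<psi> where "ncurve p k \<psi>"
    "\<And>i z. i\<in>{1..k} \<Longrightarrow> [poly (h i) (p ^ a * z) - poly (h i) 0 = p ^ (i * a) * poly (\<psi> i) z] (mod p ^ M)"
    by blast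
  moreover have "poly (h i) w - poly (h i) 0 = (\<Sum>j\<in>{1..k}. e i j * (poly (\<phi> j) (\<xi> + w) - poly (\<phi> j) \<xi>))" for i w
    by (simp add: h_def poly_sum poly_pcompose algebra_simps sum_subtractf)
  ultimately show ?thesis by (intro exI[of _ e] exI[of _ \<psi>]) (auto simp: algebra_simps)
qed

text \<open>The algebraic form of transversality: the same l linear forms trace an l-dimensional
  curve on the class of \<xi>, yet are constant modulo p^c on the class of \<eta>. The value (k-l+1)
  b is the order to which the last l normalised coordinates at \<eta> vanish at distance
  p^b.\<close>

lemma curve_lower:
  assumes p: "prime p" and k: "int k < p" and \<phi>: "ncurve p k \<phi>" and a: "1 \<le> a" and l: "l \<le> k"
    and sep: "\<not> p dvd \<xi> - \<eta>" and c: "c \<le> M" "c \<le> (k - l + 1) * b"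
  shows "\<exists>u \<psi>. ncurve p l \<psi> \<and> (\<forall>i\<in>{1..l}. \<forall>z.
    [(\<Sum>j\<in>{1..k}. u i j * (poly (\<phi> j) (\<xi> + p ^ a * z) - poly (\<phi> j) \<xi>)) = p ^ (i * a) * poly (\<psi> i) z] (mod p ^ M))
    \<and> (\<forall>i\<in>{1..l}. \<forall>z. p ^ c dvd (\<Sum>j\<in>{1..k}. u i j * (poly (\<phi> j) (\<eta> + p ^ b * z) - poly (\<phi> j) \<eta>)))"
proof -
  have "\<exists>e. \<forall>i\<in>{1..k}. \<forall>r\<in>{1..k}.
    [coeff (\<Sum>m\<in>{1..k}. smult (e i m) (\<phi> m \<circ>\<^sub>p [:\<eta>, 1:])) r = (if r = i then 1 else 0)] (mod p ^ Suc M)"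
    using normal_form[OF p k order_refl _ \<phi>, of \<eta> M] by simp
  then obtain e where e: "\<And>i r. i \<in> {1..k} \<Longrightarrow> r \<in> {1..k} \<Longrightarrow>
    [coeff (\<Sum>m\<in>{1..k}. smult (e i m) (\<phi> m \<circ>\<^sub>p [:\<eta>, 1:])) r = (if r = i then 1 else 0)] (mod p ^ Suc M)"
    by blast
  define g where "g i = (\<Sum>m\<in>{1..k}. smult (e i m) (\<phi> m \<circ>\<^sub>p [:\<eta>, 1:]))" for i
  \<comment> \<open>Coordinates normalised at \<eta>, with constant terms removed, so that \<gamma>
    m starts with x^m. The last l of them are small near \<eta>; expanded at \<xi> - \<eta>, which
    is prime to p, they still determine l degrees by \<open>normal_form\<close>.\<close>
  define \<gamma> where "\<gamma> i = g i - [:coeff (g i) 0:]" for i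
  have g1: "[coeff (\<gamma> i) r = (if r = i then 1 else 0)] (mod p ^ Suc M)"
    if "i \<in> {1..k}" "r \<in> {0..k}" for i r
    using e[of i r] that by (cases r) (auto simp: \<gamma>_def g_def)
  have "ncurve p k \<gamma>" unfolding ncurve_def
  proof (intro ballI allI)
    fix m r assume m: "m \<in> {1..k}"
    show "[coeff (\<gamma> m) r = (if r = m then 1 else 0)] (mod p)"
    proof (cases "r \<le> k")
      case True
      then show ?thesis using cong_dvd_modulus[OF g1[OF m], of r p] by auto
    next
      \<comment> \<open>\<open>normal_form\<close> says nothing about degrees above k; there the
        binomials C(j,r) with j <= k vanish.\<close>
      case False
      have "[(\<Sum>j\<in>{1..k}. e m j * coeff (\<phi> j \<circ>\<^sub>p [:\<eta>, 1:]) r) = (\<Sum>j\<in>{1..k}. e m j * (of_nat (j choose r) * \<eta> ^ (j - r)))] (mod p)"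
        using \<phi> by (intro cong_sum cong_mult cong_refl coeff_pcompose_shift_cong) (auto simp: ncurve_def)
      also have "(\<Sum>j\<in>{1..k}. e m j * (of_nat (j choose r) * \<eta> ^ (j - r))) = 0"
        by (rule sum.neutral) (use False in auto)
      finally show ?thesis using False m by (cases r) (auto simp: \<gamma>_def g_def coeff_sum)
    qed
  qed
  moreover have "l = k \<or> \<not> p dvd \<xi> - \<eta>" using sep by simp
  ultimately obtain f where f: "\<And>i r. i \<in> {1..l} \<Longrightarrow> r \<in> {1..l} \<Longrightarrow>
    [coeff (\<Sum>m\<in>{k-l+1..k}. smult (f i m) (\<gamma> m \<circ>\<^sub>p [:\<xi> - \<eta>, 1:])) r = (if r = i then 1 else 0)] (mod p ^ Suc M)"
    using normal_form[OF p k l, of "\<xi> - \<eta>" \<gamma> M] by blast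
  define h where "h i = (\<Sum>m\<in>{k-l+1..k}. smult (f i m) (\<gamma> m \<circ>\<^sub>p [:\<xi> - \<eta>, 1:]))" for i
  have "[coeff (h i) r = (if r = i then 1 else 0)] (mod p ^ M)" if "i \<in> {1..l}" "r \<in> {1..l}" for i r
    using f[OF that] unfolding h_def by (rule cong_dvd_modulus) simp
  from local_curve[OF a, of l h p M, OF this] obtain \<psi> where \<psi>: "ncurve p l \<psi>"
    "\<And>i z. i\<in>{1..l} \<Longrightarrow> [poly (h i) (p ^ a * z) - poly (h i) 0 = p ^ (i * a) * poly (\<psi> i) z] (mod p ^ M)"
    by blast
  define u where "u i j = (\<Sum>m\<in>{k-l+1..k}. f i m * e m j)" for i j
  have g\<gamma>: "poly (\<gamma> m) (x - \<eta>) - poly (\<gamma> m) (y - \<eta>) = (\<Sum>j\<in>{1..k}. e m j * (poly (\<phi> j) x - poly (\<phi> j) y))" for m x y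
    by (simp add: \<gamma>_def g_def poly_sum poly_pcompose algebra_simps sum_subtractf)
  have u\<gamma>: "(\<Sum>j\<in>{1..k}. u i j * (poly (\<phi> j) x - poly (\<phi> j) y))
      = (\<Sum>m\<in>{k-l+1..k}. f i m * (poly (\<gamma> m) (x - \<eta>) - poly (\<gamma> m) (y - \<eta>)))" for i x y
    unfolding g\<gamma> u_def sum_distrib_left sum_distrib_right mult.assoc by (rule sum.swap)
  have "(\<Sum>j\<in>{1..k}. u i j * (poly (\<phi> j) (\<xi> + w) - poly (\<phi> j) \<xi>)) = poly (h i) w - poly (h i) 0" for i w
    unfolding u\<gamma> by (simp add: h_def poly_sum poly_pcompose algebra_simps sum_subtractf)
  moreover have "p ^ c dvd (\<Sum>j\<in>{1..k}. u i j * (poly (\<phi> j) (\<eta> + p ^ b * z) - poly (\<phi> j) \<eta>))"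
    if "i \<in> {1..l}" for i z
    unfolding u\<gamma>
  proof (intro dvd_sum dvd_mult)
    fix m assume m: "m \<in> {k-l+1..k}"
    then have m1: "m \<in> {1..k}" by auto
    have "p ^ c dvd poly (\<gamma> m) (p ^ b * z)"
      unfolding poly_altdef
    proof (intro dvd_sum)
      fix r assume "r \<in> {..degree (\<gamma> m)}"
      show "p ^ c dvd coeff (\<gamma> m) r * (p ^ b * z) ^ r"
      \<comment> \<open>High degrees supply the power of p through p^(b r); the coefficients of low
        degree vanish modulo p^(M+1).\<close>
      proof (cases "k - l + 1 \<le> r")
        case True
        then have "c \<le> b * r" using c(2) by (metis le_trans mult.commute mult_le_mono2)
        then have "p ^ c dvd p ^ (b * r)" by (rule le_imp_power_dvd)
        then show ?thesis by (simp add: power_mult_distrib power_mult)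
      next
        case False
        then have "p ^ Suc M dvd coeff (\<gamma> m) r" using g1[OF m1, of r] m by (auto simp: cong_0_iff)
        then show ?thesis using c(1) by (meson dvd_mult2 dvd_trans le_SucI le_imp_power_dvd)
      qed
    qed
    moreover have "poly (\<gamma> m) 0 = 0" by (simp add: \<gamma>_def poly_0_coeff_0)
    ultimately show "p ^ c dvd poly (\<gamma> m) (\<eta> + p ^ b * z - \<eta>) - poly (\<gamma> m) (\<eta> - \<eta>)" by simp
  qed
  ultimately show ?thesis using \<psi> by (intro exI[of _ u] exI[of _ \<psi>]) auto
qed

section \<open>Decoupling over p-adic scales\<close>

definition ee :: "real \<Rightarrow> complex" where "ee x = cis (2 * pi * x)"

lemma ee_add: "ee (x + y) = ee x * ee y" by (simp add: ee_def cis_mult distrib_left)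

lemma norm_ee [simp]: "norm (ee x) = 1" by (simp add: ee_def)

lemma ee_of_int [simp]: "ee (of_int n) = 1"
  unfolding ee_def by (rule cis_multiple_2pi) simp

lemma ee_0 [simp]: "ee 0 = 1" by (simp add: ee_def)

lemma ee_minus: "ee (- x) = cnj (ee x)" by (simp add: ee_def cis_cnj)

lemma ee_add_of_int [simp]: "ee (x + of_int n) = ee x" by (simp add: ee_add)

lemma ee_power: "ee x ^ n = ee (of_nat n * x)" unfolding ee_def Complex.DeMoivre by (simp add: mult_ac)

definition emod :: "int \<Rightarrow> int \<Rightarrow> complex" where "emod q n = ee (of_int n / of_int q)"

lemma emod_add: "emod q (m + n) = emod q m * emod q n" by (simp add: emod_def add_divide_distrib ee_add)

lemma norm_emod [simp]: "norm (emod q n) = 1" by (simp add: emod_def)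

lemma emod_0 [simp]: "emod q 0 = 1" by (simp add: emod_def)

lemma emod_cong:
  assumes "[m = n] (mod q)" "q \<noteq> 0" shows "emod q m = emod q n"
proof -
  obtain d where "m = n + q * d" using assms by (metis cong_iff_lin cong_sym)
  then have "of_int m / of_int q = of_int n / of_int q + (of_int d :: real)" using assms(2) by (simp add: field_simps)
  then show ?thesis unfolding emod_def by (metis ee_add_of_int)
qed

lemma emod_mult_cancel: "d \<noteq> 0 \<Longrightarrow> emod (q * d) (n * d) = emod q n" by (simp add: emod_def)

text \<open>The grid of points \<alpha>/q in the k-dimensional torus, stored by numerators.
  \<open>PiE\<close> fixes the values outside 1..k, which makes the set finite.\<close>

definition torus :: "nat \<Rightarrow> int \<Rightarrow> (nat \<Rightarrow> int) set" where "torus k q = PiE {1..k} (\<lambda>_. {0..<q})"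

lemma finite_torus [simp]: "finite (torus k q)" by (simp add: torus_def finite_PiE)

lemma torus_ne: "0 < q \<Longrightarrow> torus k q \<noteq> {}" by (auto simp: torus_def PiE_eq_empty_iff)

definition tshift :: "nat \<Rightarrow> int \<Rightarrow> (nat \<Rightarrow> int) \<Rightarrow> (nat \<Rightarrow> int) \<Rightarrow> (nat \<Rightarrow> int)" where
  "tshift k q v \<alpha> = (\<lambda>j\<in>{1..k}. (\<alpha> j + v j) mod q)"

lemma bij_tshift:
  assumes "0 < q" shows "bij_betw (tshift k q v) (torus k q) (torus k q)"
proof (rule bij_betw_byWitness[of _ "tshift k q (\<lambda>j. - v j)"])
  show "\<forall>a\<in>torus k q. tshift k q (\<lambda>j. - v j) (tshift k q v a) = a"
    by (auto simp: torus_def tshift_def PiE_def extensional_def Pi_def mod_simps fun_eq_iff)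
  show "\<forall>a\<in>torus k q. tshift k q v (tshift k q (\<lambda>j. - v j) a) = a"
    by (auto simp: torus_def tshift_def PiE_def extensional_def Pi_def mod_simps fun_eq_iff)
qed (use assms in \<open>auto simp: torus_def tshift_def\<close>)

definition esum :: "int \<Rightarrow> nat \<Rightarrow> (nat \<Rightarrow> int poly) \<Rightarrow> (int \<Rightarrow> complex) \<Rightarrow> int set \<Rightarrow> (nat \<Rightarrow> int) \<Rightarrow> complex" where
  "esum q k \<phi> a X \<alpha> = (\<Sum>x\<in>X. a x * emod q (\<Sum>j\<in>{1..k}. \<alpha> j * poly (\<phi> j) x))"

text \<open>The total degree 1 + ... + k; twice this number is the critical exponent.\<close>

definition rr :: "nat \<Rightarrow> nat" where "rr k = k * (k + 1) div 2"

lemma rr_pos: "1 \<le> k \<Longrightarrow> 0 < rr k"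
proof -
  assume "1 \<le> k"
  then have "2 \<le> k * (k + 1)" using mult_le_mono[of 1 k 2 "k + 1"] by simp
  then show ?thesis by (simp add: rr_def)
qed

definition cell :: "int \<Rightarrow> nat \<Rightarrow> int \<Rightarrow> int set \<Rightarrow> int set" where
  "cell p N \<xi> X = {x\<in>X. [x = \<xi>] (mod p ^ N)}"

lemma finite_cell [simp]: "finite X \<Longrightarrow> finite (cell p N \<xi> X)" by (simp add: cell_def)

text \<open>This is l2 decoupling at the exponent 2 r = k (k + 1): after taking 2 r-th roots, the right-hand
  side is the square root of the sum of squares of the 2 r-norms of the pieces.\<close>

definition dec :: "int \<Rightarrow> nat \<Rightarrow> nat \<Rightarrow> real \<Rightarrow> bool" where
  "dec p k N c \<longleftrightarrow> (\<forall>\<phi> X a. ncurve p k \<phi> \<longrightarrow> finite X \<longrightarrow>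
     (\<Sum>\<alpha>\<in>torus k (p ^ (k * N)). cmod (esum (p ^ (k * N)) k \<phi> a X \<alpha>) ^ (2 * rr k))
      \<le> c * (\<Sum>\<xi>\<in>{0..<p ^ N}. root (rr k) (\<Sum>\<alpha>\<in>torus k (p ^ (k * N)).
             cmod (esum (p ^ (k * N)) k \<phi> a (cell p N \<xi> X) \<alpha>) ^ (2 * rr k))) ^ rr k)"

text \<open>Averaging over translations: for fixed \<omega>, the sum at \<tau> t \<omega> as a
  function of t is an exponential sum along \<psi> up to a phase of modulus 1, so the decoupling
  inequality holds for every \<omega> separately. As each \<tau> t permutes W and preserves w,
  summing over t multiplies both sides by the number of t. Minkowski's inequality then moves the sum
  over W inside.\<close>

lemma dec_transfer:
  fixes F :: "int \<Rightarrow> 'a \<Rightarrow> complex" and w :: "'a \<Rightarrow> real"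
  assumes dec: "dec p l N c" and l: "1 \<le> l" and c: "0 \<le> c" and p: "0 < p"
    and \<psi>: "ncurve p l \<psi>" and W: "finite W" and Z: "finite Z"
    and bij: "\<And>t. t \<in> torus l (p ^ (l * N)) \<Longrightarrow> bij_betw (\<tau> t) W W"
    and w0: "\<And>\<omega>. \<omega> \<in> W \<Longrightarrow> 0 \<le> w \<omega>"
    and wi: "\<And>t \<omega>. t \<in> torus l (p ^ (l * N)) \<Longrightarrow> \<omega> \<in> W \<Longrightarrow> w (\<tau> t \<omega>) = w \<omega>"
    and \<theta>: "\<And>t \<omega>. norm (\<theta> t \<omega>) = (1::real)"
    and F: "\<And>z t \<omega>. z \<in> Z \<Longrightarrow> t \<in> torus l (p ^ (l * N)) \<Longrightarrow> \<omega> \<in> W \<Longrightarrow>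
      F z (\<tau> t \<omega>) = (\<theta> t \<omega> :: complex) * (F z \<omega> * emod (p ^ (l * N)) (\<Sum>j\<in>{1..l}. t j * poly (\<psi> j) z))"
  shows "(\<Sum>\<omega>\<in>W. w \<omega> * cmod (\<Sum>z\<in>Z. F z \<omega>) ^ (2 * rr l))
    \<le> c * (\<Sum>\<xi>\<in>{0..<p ^ N}. root (rr l) (\<Sum>\<omega>\<in>W. w \<omega> * cmod (\<Sum>z\<in>cell p N \<xi> Z. F z \<omega>) ^ (2 * rr l))) ^ rr l"
proof -
  define T where "T = torus l (p ^ (l * N))"
  define E where "E Y \<omega> t = cmod (esum (p ^ (l * N)) l \<psi> (\<lambda>z. F z \<omega>) Y t) ^ (2 * rr l)" for Y \<omega> t
  have r: "0 < rr l" using l by (rule rr_pos)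
  have T: "finite T" "0 < real (card T)"
    using torus_ne[of "p ^ (l * N)" l] p by (auto simp: T_def card_gt_0_iff)
  have avg: "(\<Sum>\<omega>\<in>W. w \<omega> * (\<Sum>t\<in>T. E Y \<omega> t)) = card T * (\<Sum>\<omega>\<in>W. w \<omega> * cmod (\<Sum>z\<in>Y. F z \<omega>) ^ (2 * rr l))"
    if "Y \<subseteq> Z" for Y
  proof -
    have "(\<Sum>\<omega>\<in>W. w \<omega> * (\<Sum>t\<in>T. E Y \<omega> t)) = (\<Sum>t\<in>T. \<Sum>\<omega>\<in>W. w \<omega> * E Y \<omega> t)"
      by (simp add: sum_distrib_left) (rule sum.swap)
    also have "\<dots> = (\<Sum>t\<in>T. \<Sum>\<omega>\<in>W. w \<omega> * cmod (\<Sum>z\<in>Y. F z \<omega>) ^ (2 * rr l))"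
    proof (rule sum.cong[OF refl])
      fix t assume t: "t \<in> T"
      have "(\<Sum>\<omega>\<in>W. w \<omega> * E Y \<omega> t) = (\<Sum>\<omega>\<in>W. w (\<tau> t \<omega>) * cmod (\<Sum>z\<in>Y. F z (\<tau> t \<omega>)) ^ (2 * rr l))"
      proof (rule sum.cong[OF refl])
        fix \<omega> assume \<omega>: "\<omega> \<in> W"
        have "(\<Sum>z\<in>Y. F z (\<tau> t \<omega>)) = (\<Sum>z\<in>Y. \<theta> t \<omega> * (F z \<omega> * emod (p ^ (l * N)) (\<Sum>j\<in>{1..l}. t j * poly (\<psi> j) z)))"
          using that t \<omega> by (intro sum.cong refl F) (auto simp: T_def)
        also have "\<dots> = \<theta> t \<omega> * esum (p ^ (l * N)) l \<psi> (\<lambda>z. F z \<omega>) Y t"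
          by (simp add: esum_def sum_distrib_left)
        finally have "cmod (\<Sum>z\<in>Y. F z (\<tau> t \<omega>)) = cmod (esum (p ^ (l * N)) l \<psi> (\<lambda>z. F z \<omega>) Y t)"
          by (simp add: norm_mult \<theta>)
        then show "w \<omega> * E Y \<omega> t = w (\<tau> t \<omega>) * cmod (\<Sum>z\<in>Y. F z (\<tau> t \<omega>)) ^ (2 * rr l)"
          using wi t \<omega> by (simp add: E_def T_def)
      qed
      also have "\<dots> = (\<Sum>\<omega>\<in>W. w \<omega> * cmod (\<Sum>z\<in>Y. F z \<omega>) ^ (2 * rr l))"
        using bij t unfolding T_def by (intro sum.reindex_bij_betw) auto
      finally show "(\<Sum>\<omega>\<in>W. w \<omega> * E Y \<omega> t) = (\<Sum>\<omega>\<in>W. w \<omega> * cmod (\<Sum>z\<in>Y. F z \<omega>) ^ (2 * rr l))" .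
    qed
    finally show ?thesis by simp
  qed
  have E0: "0 \<le> E Y \<omega> t" for Y \<omega> t by (simp add: E_def)
  have "card T * (\<Sum>\<omega>\<in>W. w \<omega> * cmod (\<Sum>z\<in>Z. F z \<omega>) ^ (2 * rr l)) = (\<Sum>\<omega>\<in>W. w \<omega> * (\<Sum>t\<in>T. E Z \<omega> t))"
    by (rule avg[symmetric]) simp
  also have "\<dots> \<le> (\<Sum>\<omega>\<in>W. w \<omega> * (c * (\<Sum>\<xi>\<in>{0..<p ^ N}. root (rr l) (\<Sum>t\<in>T. E (cell p N \<xi> Z) \<omega> t)) ^ rr l))"
    using dec \<psi> Z w0 unfolding E_def T_def dec_def by (intro sum_mono mult_left_mono) auto
  \<comment> \<open>By homogeneity the weight goes under the roots, so that the next step is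
    Minkowski's inequality in \<omega> for weighted norms.\<close>
  also have "\<dots> = c * (\<Sum>\<omega>\<in>W. (\<Sum>\<xi>\<in>{0..<p ^ N}. root (rr l) (w \<omega> * (\<Sum>t\<in>T. E (cell p N \<xi> Z) \<omega> t))) ^ rr l)"
    unfolding sum_distrib_left[of c _ W]
  proof (rule sum.cong[OF refl])
    fix \<omega> assume \<omega>: "\<omega> \<in> W"
    have "w \<omega> = root (rr l) (w \<omega>) ^ rr l" using w0[OF \<omega>] r by simp
    then show "w \<omega> * (c * (\<Sum>\<xi>\<in>{0..<p ^ N}. root (rr l) (\<Sum>t\<in>T. E (cell p N \<xi> Z) \<omega> t)) ^ rr l)
      = c * (\<Sum>\<xi>\<in>{0..<p ^ N}. root (rr l) (w \<omega> * (\<Sum>t\<in>T. E (cell p N \<xi> Z) \<omega> t))) ^ rr l"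
      by (simp add: real_root_mult sum_distrib_left[symmetric] power_mult_distrib)
  qed
  also have "\<dots> \<le> c * (\<Sum>\<xi>\<in>{0..<p ^ N}. root (rr l) (\<Sum>\<omega>\<in>W. root (rr l) (w \<omega> * (\<Sum>t\<in>T. E (cell p N \<xi> Z) \<omega> t)) ^ rr l)) ^ rr l"
    using r c W w0 E0 by (intro mult_left_mono minkowski_sum) (auto intro!: real_root_ge_zero mult_nonneg_nonneg sum_nonneg)
  also have "(\<Sum>\<xi>\<in>{0..<p ^ N}. root (rr l) (\<Sum>\<omega>\<in>W. root (rr l) (w \<omega> * (\<Sum>t\<in>T. E (cell p N \<xi> Z) \<omega> t)) ^ rr l))
      = (\<Sum>\<xi>\<in>{0..<p ^ N}. root (rr l) (card T * (\<Sum>\<omega>\<in>W. w \<omega> * cmod (\<Sum>z\<in>cell p N \<xi> Z. F z \<omega>) ^ (2 * rr l))))"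
  proof (rule sum.cong[OF refl], rule arg_cong[of _ _ "root (rr l)"])
    fix \<xi>
    have "(\<Sum>\<omega>\<in>W. root (rr l) (w \<omega> * (\<Sum>t\<in>T. E (cell p N \<xi> Z) \<omega> t)) ^ rr l)
      = (\<Sum>\<omega>\<in>W. w \<omega> * (\<Sum>t\<in>T. E (cell p N \<xi> Z) \<omega> t))"
      using r w0 E0 by (intro sum.cong refl real_root_pow_pos2) (auto intro!: mult_nonneg_nonneg sum_nonneg)
    also have "\<dots> = card T * (\<Sum>\<omega>\<in>W. w \<omega> * cmod (\<Sum>z\<in>cell p N \<xi> Z. F z \<omega>) ^ (2 * rr l))"
      by (rule avg) (auto simp: cell_def)
    finally show "(\<Sum>\<omega>\<in>W. root (rr l) (w \<omega> * (\<Sum>t\<in>T. E (cell p N \<xi> Z) \<omega> t)) ^ rr l)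
      = card T * (\<Sum>\<omega>\<in>W. w \<omega> * cmod (\<Sum>z\<in>cell p N \<xi> Z. F z \<omega>) ^ (2 * rr l))" .
  qed
  also have "c * \<dots> ^ rr l = card T * (c * (\<Sum>\<xi>\<in>{0..<p ^ N}. root (rr l) (\<Sum>\<omega>\<in>W. w \<omega> * cmod (\<Sum>z\<in>cell p N \<xi> Z. F z \<omega>) ^ (2 * rr l))) ^ rr l)"
    using r by (simp add: real_root_mult sum_distrib_left[symmetric] power_mult_distrib)
  finally show ?thesis using T by simp
qed

lemma tshift_phase:
  assumes "0 < q"
  shows "emod q (\<Sum>j\<in>{1..k}. tshift k q v \<alpha> j * y j) = emod q (\<Sum>j\<in>{1..k}. v j * y j) * emod q (\<Sum>j\<in>{1..k}. \<alpha> j * y j)"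
proof -
  have "[(\<Sum>j\<in>{1..k}. tshift k q v \<alpha> j * y j) = (\<Sum>j\<in>{1..k}. (\<alpha> j + v j) * y j)] (mod q)"
    by (intro cong_sum cong_mult cong_refl) (auto simp: tshift_def cong_def)
  then have "emod q (\<Sum>j\<in>{1..k}. tshift k q v \<alpha> j * y j) = emod q (\<Sum>j\<in>{1..k}. (\<alpha> j + v j) * y j)"
    using assms by (intro emod_cong) auto
  also have "(\<Sum>j\<in>{1..k}. (\<alpha> j + v j) * y j) = (\<Sum>j\<in>{1..k}. v j * y j) + (\<Sum>j\<in>{1..k}. \<alpha> j * y j)"
    by (simp add: distrib_right sum.distrib)
  finally show ?thesis by (simp add: emod_add)
qed

text \<open>Decoupling of a class modulo p^a into classes modulo p^(a+n), with a weight. The weight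
  may be any function invariant under the l-parameter translations used; with weight 1 and l = k
  this is rescaling, and with the second bilinear factor as weight it is the dimension-lowering
  step.\<close>

lemma dec_cells:
  fixes \<phi> \<psi> :: "nat \<Rightarrow> int poly" and w :: "(nat \<Rightarrow> int) \<Rightarrow> real"
  assumes p: "0 < p" and dec: "dec p l n c" and l: "1 \<le> l" and c: "0 \<le> c" and \<psi>: "ncurve p l \<psi>"
    and X: "finite X" and M: "l * (a + n) \<le> M"
    and curve: "\<And>i z. i \<in> {1..l} \<Longrightarrow> [(\<Sum>j\<in>{1..k}. u i j * (poly (\<phi> j) (\<xi> + p ^ a * z) - poly (\<phi> j) \<xi>))
        = p ^ (i * a) * poly (\<psi> i) z] (mod p ^ M)"
    and w0: "\<And>\<alpha>. 0 \<le> w \<alpha>"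
    and wi: "\<And>t \<alpha>. \<alpha> \<in> torus k (p ^ M) \<Longrightarrow>
        w (tshift k (p ^ M) (\<lambda>j. \<Sum>i\<in>{1..l}. t i * p ^ (M - l * n - i * a) * u i j) \<alpha>) = w \<alpha>"
  shows "(\<Sum>\<alpha>\<in>torus k (p ^ M). w \<alpha> * cmod (esum (p ^ M) k \<phi> b (cell p a \<xi> X) \<alpha>) ^ (2 * rr l))
    \<le> c * (\<Sum>\<zeta>\<in>{0..<p ^ (a + n)}. root (rr l) (\<Sum>\<alpha>\<in>torus k (p ^ M). w \<alpha> *
          cmod (esum (p ^ M) k \<phi> b (cell p (a + n) \<zeta> (cell p a \<xi> X)) \<alpha>) ^ (2 * rr l))) ^ rr l"
proof -
  define Q where "Q = p ^ M"
  have Q: "0 < Q" using p by (simp add: Q_def)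
  define G where "G z = \<xi> + p ^ a * z" for z
  have injG: "inj G" using p by (auto simp: G_def inj_on_def)
  define Z where "Z = G -` X"
  have Z: "finite Z" unfolding Z_def using X injG by (rule finite_vimageI)
  \<comment> \<open>The exponent M - l n - i a is chosen so that, after the curve contributes p^(i
    a), the translation acts on the point z by the phase t i \<psi> i(z) / p^(l n). By M >= l (a +
    n) the subtraction is not truncated.\<close>
  define v where "v t j = (\<Sum>i\<in>{1..l}. t i * p ^ (M - l * n - i * a) * u i j)" for t j
  define F where "F z \<alpha> = b (G z) * emod Q (\<Sum>j\<in>{1..k}. \<alpha> j * poly (\<phi> j) (G z))" for z \<alpha>
  have FG: "(\<Sum>z\<in>Y. F z \<alpha>) = esum Q k \<phi> b (G ` Y) \<alpha>" for Y \<alpha>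
    unfolding esum_def F_def by (subst sum.reindex) (auto intro: inj_on_subset[OF injG])
  have GZ: "G ` Z = cell p a \<xi> X"
  proof -
    have "x \<in> range G \<longleftrightarrow> [x = \<xi>] (mod p ^ a)" for x
    proof -
      have "x \<in> range G \<longleftrightarrow> (\<exists>z. x - \<xi> = p ^ a * z)" unfolding G_def image_iff by (auto simp: algebra_simps)
      then show ?thesis by (simp add: cong_iff_dvd_diff dvd_def)
    qed
    then show ?thesis unfolding Z_def image_vimage_eq cell_def by auto
  qed
  have Gc: "G ` cell p n \<zeta> Z = cell p (a + n) (G \<zeta>) (cell p a \<xi> X)" for \<zeta>
  proof -
    have eq: "[G z = G \<zeta>] (mod p ^ (a + n)) \<longleftrightarrow> [z = \<zeta>] (mod p ^ n)" for z
    proof -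
      have "G z - G \<zeta> = p ^ a * (z - \<zeta>)" by (simp add: G_def right_diff_distrib)
      then show ?thesis using p unfolding cong_iff_dvd_diff power_add by simp
    qed
    have "G ` cell p n \<zeta> Z = {x \<in> G ` Z. [x = G \<zeta>] (mod p ^ (a + n))}"
      unfolding cell_def eq[symmetric] by auto
    then show ?thesis unfolding GZ cell_def[of p "a + n"] .
  qed
  have ph: "F z (tshift k Q (v t) \<alpha>) = emod Q (\<Sum>j\<in>{1..k}. v t j * poly (\<phi> j) \<xi>)
      * (F z \<alpha> * emod (p ^ (l * n)) (\<Sum>i\<in>{1..l}. t i * poly (\<psi> i) z))" for z t \<alpha>
  proof -
    define y where "y j = poly (\<phi> j) (G z) - poly (\<phi> j) \<xi>" for j
    have "(\<Sum>j\<in>{1..k}. v t j * y j) = (\<Sum>i\<in>{1..l}. t i * p ^ (M - l * n - i * a) * (\<Sum>j\<in>{1..k}. u i j * y j))"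
      unfolding v_def sum_distrib_left sum_distrib_right mult.assoc by (rule sum.swap)
    also have "[\<dots> = (\<Sum>i\<in>{1..l}. t i * p ^ (M - l * n - i * a) * (p ^ (i * a) * poly (\<psi> i) z))] (mod Q)"
      unfolding Q_def y_def G_def by (intro cong_sum cong_mult cong_refl curve)
    also have "(\<Sum>i\<in>{1..l}. t i * p ^ (M - l * n - i * a) * (p ^ (i * a) * poly (\<psi> i) z))
       = (\<Sum>i\<in>{1..l}. t i * poly (\<psi> i) z) * p ^ (M - l * n)"
      unfolding sum_distrib_right
    proof (rule sum.cong[OF refl])
      fix i assume "i \<in> {1..l}"
      then have "i * a \<le> l * a" by simp
      moreover have "l * a + l * n \<le> M" using M by (simp add: algebra_simps)
      ultimately have "M - l * n = M - l * n - i * a + i * a" by linarith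
      then have "p ^ (M - l * n) = p ^ (M - l * n - i * a) * p ^ (i * a)" by (metis power_add)
      then show "t i * p ^ (M - l * n - i * a) * (p ^ (i * a) * poly (\<psi> i) z) = t i * poly (\<psi> i) z * p ^ (M - l * n)"
        by simp
    qed
    finally have "emod Q (\<Sum>j\<in>{1..k}. v t j * y j) = emod Q ((\<Sum>i\<in>{1..l}. t i * poly (\<psi> i) z) * p ^ (M - l * n))"
      using Q by (intro emod_cong) auto
    also have "\<dots> = emod (p ^ (l * n) * p ^ (M - l * n)) ((\<Sum>i\<in>{1..l}. t i * poly (\<psi> i) z) * p ^ (M - l * n))"
      using M unfolding Q_def by (simp add: algebra_simps flip: power_add)
    also have "\<dots> = emod (p ^ (l * n)) (\<Sum>i\<in>{1..l}. t i * poly (\<psi> i) z)"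
      using p by (intro emod_mult_cancel) simp
    finally have e1: "emod Q (\<Sum>j\<in>{1..k}. v t j * y j) = emod (p ^ (l * n)) (\<Sum>i\<in>{1..l}. t i * poly (\<psi> i) z)" .
    have "(\<Sum>j\<in>{1..k}. v t j * poly (\<phi> j) (G z)) = (\<Sum>j\<in>{1..k}. v t j * poly (\<phi> j) \<xi>) + (\<Sum>j\<in>{1..k}. v t j * y j)"
      by (simp add: y_def algebra_simps sum_subtractf)
    then have "emod Q (\<Sum>j\<in>{1..k}. v t j * poly (\<phi> j) (G z))
      = emod Q (\<Sum>j\<in>{1..k}. v t j * poly (\<phi> j) \<xi>) * emod (p ^ (l * n)) (\<Sum>i\<in>{1..l}. t i * poly (\<psi> i) z)"
      using e1 by (simp add: emod_add)
    then show ?thesis unfolding F_def tshift_phase[OF Q] by simp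
  qed
  have wi': "w (tshift k Q (v t) \<alpha>) = w \<alpha>" if "\<alpha> \<in> torus k Q" for t \<alpha>
  proof -
    have "v t = (\<lambda>j. \<Sum>i\<in>{1..l}. t i * p ^ (M - l * n - i * a) * u i j)" by (simp add: v_def fun_eq_iff)
    then show ?thesis using wi[of \<alpha> t] that by (simp only: Q_def)
  qed
  define h where "h \<zeta> = root (rr l) (\<Sum>\<alpha>\<in>torus k Q. w \<alpha> * cmod (esum Q k \<phi> b (cell p (a + n) \<zeta> (cell p a \<xi> X)) \<alpha>) ^ (2 * rr l))" for \<zeta>
  have h0: "0 \<le> h \<zeta>" for \<zeta> unfolding h_def using w0 by (intro real_root_ge_zero sum_nonneg mult_nonneg_nonneg) auto
  have hmod: "h (\<zeta> mod p ^ (a + n)) = h \<zeta>" for \<zeta> by (simp add: h_def cell_def cong_def)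
  have "(\<Sum>\<alpha>\<in>torus k Q. w \<alpha> * cmod (\<Sum>z\<in>Z. F z \<alpha>) ^ (2 * rr l))
    \<le> c * (\<Sum>\<zeta>\<in>{0..<p ^ n}. root (rr l) (\<Sum>\<alpha>\<in>torus k Q. w \<alpha> * cmod (\<Sum>z\<in>cell p n \<zeta> Z. F z \<alpha>) ^ (2 * rr l))) ^ rr l"
    by (rule dec_transfer[OF dec l c p \<psi> _ Z, where \<tau> = "\<lambda>t. tshift k Q (v t)" and \<theta> = "\<lambda>t \<alpha>. emod Q (\<Sum>j\<in>{1..k}. v t j * poly (\<phi> j) \<xi>)"])
       (use w0 wi' bij_tshift[OF Q] ph in auto)
  also have "\<dots> = c * (\<Sum>\<zeta>\<in>{0..<p ^ n}. h (G \<zeta> mod p ^ (a + n))) ^ rr l"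
    unfolding FG Gc hmod by (simp only: h_def)
  also have "(\<Sum>\<zeta>\<in>{0..<p ^ n}. h (G \<zeta> mod p ^ (a + n))) = (\<Sum>\<zeta>\<in>(\<lambda>\<zeta>. G \<zeta> mod p ^ (a + n)) ` {0..<p ^ n}. h \<zeta>)"
  proof (subst sum.reindex)
    show "inj_on (\<lambda>\<zeta>. G \<zeta> mod p ^ (a + n)) {0..<p ^ n}"
    proof (rule inj_onI)
      fix x y assume xy: "x \<in> {0..<p ^ n}" "y \<in> {0..<p ^ n}" "G x mod p ^ (a + n) = G y mod p ^ (a + n)"
      then have "p ^ a * p ^ n dvd p ^ a * (x - y)"
        by (simp add: G_def mod_eq_dvd_iff power_add right_diff_distrib)
      then have "p ^ n dvd x - y" using p by simp
      then show "x = y" using xy by (simp add: mod_eq_dvd_iff[symmetric])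
    qed
  qed simp
  \<comment> \<open>The classes inside that of \<xi> are only some of the classes modulo p^(a+n);
    the others add nonnegative terms.\<close>
  also have "c * (\<Sum>\<zeta>\<in>(\<lambda>\<zeta>. G \<zeta> mod p ^ (a + n)) ` {0..<p ^ n}. h \<zeta>) ^ rr l \<le> c * (\<Sum>\<zeta>\<in>{0..<p ^ (a + n)}. h \<zeta>) ^ rr l"
    using p by (intro mult_left_mono power_mono sum_mono2 sum_nonneg h0 c) auto
  finally show ?thesis unfolding FG GZ h_def Q_def .
qed

definition fab :: "int \<Rightarrow> nat \<Rightarrow> nat \<Rightarrow> (nat \<Rightarrow> int poly) \<Rightarrow> (int \<Rightarrow> complex) \<Rightarrow> int set \<Rightarrow> (nat \<Rightarrow> int) \<Rightarrow> real" where
  "fab p k N \<phi> v Y \<alpha> = cmod (esum (p ^ (k * N)) k \<phi> v Y \<alpha>)"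

text \<open>The square sum of the decoupling inequality at the finest scale: the root of order
  \<open>rr k\<close> of a sum of 2 \<open>rr k\<close>-th powers is a squared norm.\<close>

definition qsum :: "int \<Rightarrow> nat \<Rightarrow> nat \<Rightarrow> (nat \<Rightarrow> int poly) \<Rightarrow> (int \<Rightarrow> complex) \<Rightarrow> int set \<Rightarrow> real" where
  "qsum p k N \<phi> v Y = (\<Sum>\<xi>\<in>{0..<p ^ N}. root (rr k) (\<Sum>\<alpha>\<in>torus k (p ^ (k * N)). fab p k N \<phi> v (cell p N \<xi> Y) \<alpha> ^ (2 * rr k)))"

lemma fab_nonneg [simp]: "0 \<le> fab p k N \<phi> v Y \<alpha>" by (simp add: fab_def)

lemma fab_empty [simp]: "fab p k N \<phi> v {} \<alpha> = 0" by (simp add: fab_def esum_def)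

lemma qsum_nonneg [simp]: "0 \<le> qsum p k N \<phi> v Y"
  by (auto simp: qsum_def intro!: sum_nonneg real_root_ge_zero)

lemma dec_alt: "dec p k N c \<longleftrightarrow> (\<forall>\<phi> X v. ncurve p k \<phi> \<longrightarrow> finite X \<longrightarrow>
     (\<Sum>\<alpha>\<in>torus k (p ^ (k * N)). fab p k N \<phi> v X \<alpha> ^ (2 * rr k)) \<le> c * qsum p k N \<phi> v X ^ rr k)"
  unfolding dec_def qsum_def fab_def ..

lemma cell_cell:
  assumes "b \<le> N"
  shows "cell p N \<xi> (cell p b \<eta> Y) = (if [\<xi> = \<eta>] (mod p ^ b) then cell p N \<xi> Y else {})"
proof -
  have "[x = \<xi>] (mod p ^ b)" if "[x = \<xi>] (mod p ^ N)" for x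
    using that assms by (meson cong_dvd_modulus le_imp_power_dvd)
  then have "[x = \<eta>] (mod p ^ b) \<longleftrightarrow> [\<xi> = \<eta>] (mod p ^ b)" if "[x = \<xi>] (mod p ^ N)" for x
    using that by (metis cong_def)
  then have "cell p N \<xi> (cell p b \<eta> Y) = {x \<in> Y. [\<xi> = \<eta>] (mod p ^ b) \<and> [x = \<xi>] (mod p ^ N)}"
    unfolding cell_def by blast
  then show ?thesis unfolding cell_def by simp
qed

text \<open>Every class modulo p^N lies in exactly one class modulo p^b. This additivity is the
  reason why decoupling at successive scales composes without loss.\<close>

lemma qsum_split:
  assumes p: "0 < p" and k: "1 \<le> k" and b: "b \<le> N"
  shows "(\<Sum>\<eta>\<in>{0..<p ^ b}. qsum p k N \<phi> v (cell p b \<eta> Y)) = qsum p k N \<phi> v Y"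
proof -
  let ?R = "\<lambda>Z. root (rr k) (\<Sum>\<alpha>\<in>torus k (p ^ (k * N)). fab p k N \<phi> v Z \<alpha> ^ (2 * rr k))"
  have "(\<Sum>\<eta>\<in>{0..<p ^ b}. ?R (cell p N \<xi> (cell p b \<eta> Y))) = ?R (cell p N \<xi> Y)" for \<xi>
  proof -
    have e: "?R {} = 0" using rr_pos[OF k] by simp
    have "(\<Sum>\<eta>\<in>{0..<p ^ b}. ?R (cell p N \<xi> (cell p b \<eta> Y)))
        = (\<Sum>\<eta>\<in>{0..<p ^ b}. if \<eta> = \<xi> mod p ^ b then ?R (cell p N \<xi> Y) else 0)"
    proof (rule sum.cong[OF refl])
      fix \<eta> assume "\<eta> \<in> {0..<p ^ b}"
      then have "[\<xi> = \<eta>] (mod p ^ b) \<longleftrightarrow> \<eta> = \<xi> mod p ^ b" by (auto simp: cong_def)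
      then show "?R (cell p N \<xi> (cell p b \<eta> Y)) = (if \<eta> = \<xi> mod p ^ b then ?R (cell p N \<xi> Y) else 0)"
        using e by (simp add: cell_cell[OF b])
    qed
    also have "\<dots> = ?R (cell p N \<xi> Y)" using p by (subst sum.delta) auto
    finally show ?thesis .
  qed
  then show ?thesis unfolding qsum_def by (subst sum.swap) simp
qed

lemma esum_cells:
  assumes p: "0 < p" and X: "finite X"
  shows "esum q k \<phi> v X \<alpha> = (\<Sum>\<xi>\<in>{0..<p ^ b}. esum q k \<phi> v (cell p b \<xi> X) \<alpha>)"
proof -
  have "(\<Sum>\<xi>\<in>{0..<p ^ b}. esum q k \<phi> v (cell p b \<xi> X) \<alpha>)
     = (\<Sum>\<xi>\<in>{0..<p ^ b}. \<Sum>x\<in>{x\<in>X. x mod p ^ b = \<xi>}. v x * emod q (\<Sum>j\<in>{1..k}. \<alpha> j * poly (\<phi> j) x))"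
    unfolding esum_def by (intro sum.cong refl) (auto simp: cell_def cong_def)
  also have "\<dots> = esum q k \<phi> v X \<alpha>"
    unfolding esum_def using p X by (intro sum.group) auto
  finally show ?thesis by simp
qed

lemma sum_power_le_power_sum:
  fixes f :: "'a \<Rightarrow> real"
  assumes "finite A" "\<And>x. x \<in> A \<Longrightarrow> 0 \<le> f x" "1 \<le> n"
  shows "(\<Sum>x\<in>A. f x ^ n) \<le> (\<Sum>x\<in>A. f x) ^ n"
proof -
  have "f x ^ n \<le> f x * (\<Sum>x\<in>A. f x) ^ (n - 1)" if x: "x \<in> A" for x
  proof -
    have "f x \<le> (\<Sum>x\<in>A. f x)" using assms x by (intro member_le_sum) auto
    then have "f x * f x ^ (n - 1) \<le> f x * (\<Sum>x\<in>A. f x) ^ (n - 1)"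
      using assms(2)[OF x] by (intro mult_left_mono power_mono) auto
    then show ?thesis using assms(3) by (simp flip: power_Suc)
  qed
  then have "(\<Sum>x\<in>A. f x ^ n) \<le> (\<Sum>x\<in>A. f x * (\<Sum>x\<in>A. f x) ^ (n - 1))" by (rule sum_mono)
  also have "\<dots> = (\<Sum>x\<in>A. f x) ^ n" using assms(3) by (simp flip: sum_distrib_right power_Suc)
  finally show ?thesis .
qed

text \<open>Every term is bounded by the largest one. The power of the cardinality is one higher
  than in Hoelder's inequality, which is harmless where the lemma is applied.\<close>

lemma power_sum_le_card:
  fixes f :: "'a \<Rightarrow> real"
  assumes "finite A" "\<And>x. x \<in> A \<Longrightarrow> 0 \<le> f x" "1 \<le> n"
  shows "(\<Sum>x\<in>A. f x) ^ n \<le> real (card A) ^ n * (\<Sum>x\<in>A. f x ^ n)"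
proof (cases "A = {}")
  case True
  then show ?thesis using assms(3) by (simp add: zero_power)
next
  case False
  then obtain y where y: "y \<in> A" "\<And>x. x \<in> A \<Longrightarrow> f x \<le> f y"
  proof -
    have "Max (f ` A) \<in> f ` A" using assms(1) False by (intro Max_in) auto
    moreover have "f x \<le> Max (f ` A)" if "x \<in> A" for x using assms(1) that by simp
    ultimately show ?thesis using that by (metis imageE)
  qed
  have "(\<Sum>x\<in>A. f x) \<le> card A * f y" using y by (intro sum_bounded_above) auto
  then have "(\<Sum>x\<in>A. f x) ^ n \<le> (card A * f y) ^ n" using assms by (intro power_mono sum_nonneg) auto
  also have "\<dots> = real (card A) ^ n * f y ^ n" by (simp add: power_mult_distrib)
  also have "f y ^ n \<le> (\<Sum>x\<in>A. f x ^ n)" using assms y by (intro member_le_sum) auto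
  finally show ?thesis by (simp add: mult_left_mono)
qed

text \<open>A class modulo p^a is, after affine rescaling, a whole curve with N - a scales left, so
  it costs the constant for N - a.\<close>

lemma dec_rescale:
  assumes p: "prime p" and kp: "int k < p" and k: "1 \<le> k" and a: "1 \<le> a" "a \<le> N"
    and dec: "dec p k (N - a) c" and c: "0 \<le> c" and \<phi>: "ncurve p k \<phi>" and X: "finite X"
  shows "(\<Sum>\<alpha>\<in>torus k (p ^ (k * N)). fab p k N \<phi> v (cell p a \<xi> X) \<alpha> ^ (2 * rr k))
     \<le> c * qsum p k N \<phi> v (cell p a \<xi> X) ^ rr k"
proof -
  obtain u \<psi> where u: "ncurve p k \<psi>" "\<And>i z. i\<in>{1..k} \<Longrightarrow>
    [(\<Sum>j\<in>{1..k}. u i j * (poly (\<phi> j) (\<xi> + p ^ a * z) - poly (\<phi> j) \<xi>)) = p ^ (i * a) * poly (\<psi> i) z] (mod p ^ (k * N))"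
    using curve_rescale[OF p kp \<phi> a(1), of \<xi> "k * N"] by blast
  have p0: "0 < p" using p by (rule prime_gt_0_int)
  show ?thesis
    using dec_cells[OF p0 dec k c u(1) X _ u(2), of "\<lambda>_. 1" v] a unfolding fab_def qsum_def by simp
qed

text \<open>The bilinear inequality: one piece lives on a residue class modulo p^a, the other on one modulo
  p^b, and these classes are transversal, that is, distinct modulo p.\<close>

definition mb :: "int \<Rightarrow> nat \<Rightarrow> nat \<Rightarrow> nat \<Rightarrow> nat \<Rightarrow> nat \<Rightarrow> real \<Rightarrow> bool" where
  "mb p k N l a b c \<longleftrightarrow> (\<forall>\<phi> v X \<xi> \<eta>. ncurve p k \<phi> \<longrightarrow> finite X \<longrightarrow> \<not> p dvd \<xi> - \<eta> \<longrightarrow>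
     (\<Sum>\<alpha>\<in>torus k (p ^ (k * N)). fab p k N \<phi> v (cell p a \<xi> X) \<alpha> ^ (2 * rr l) *
        fab p k N \<phi> v (cell p b \<eta> X) \<alpha> ^ (2 * (rr k - rr l)))
      \<le> c * (qsum p k N \<phi> v (cell p a \<xi> X) ^ rr l * qsum p k N \<phi> v (cell p b \<eta> X) ^ (rr k - rr l)))"

lemma mbD:
  assumes "mb p k N l a b c" "ncurve p k \<phi>" "finite X" "\<not> p dvd \<xi> - \<eta>"
  shows "(\<Sum>\<alpha>\<in>torus k (p ^ (k * N)). fab p k N \<phi> v (cell p a \<xi> X) \<alpha> ^ (2 * rr l) *
        fab p k N \<phi> v (cell p b \<eta> X) \<alpha> ^ (2 * (rr k - rr l)))
      \<le> c * (qsum p k N \<phi> v (cell p a \<xi> X) ^ rr l * qsum p k N \<phi> v (cell p b \<eta> X) ^ (rr k - rr l))"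
  using assms unfolding mb_def by blast

lemma mb_0:
  assumes "prime p" "int k < p" "1 \<le> k" "1 \<le> b" "b \<le> N" "dec p k (N - b) c" "0 \<le> c"
  shows "mb p k N 0 a b c"
  unfolding mb_def using dec_rescale[OF assms(1-7)] by (simp add: rr_def)

text \<open>On the class of \<eta> the linear forms vary by multiples of p^c, and the translation
  multiplies them by p^(e i) with e i + c >= k N; so the phase is the same for all points of the
  class and the absolute value does not change.\<close>

lemma fab_tshift:
  assumes p: "0 < p" and cM: "\<And>i. i \<in> {1..l} \<Longrightarrow> k * N \<le> e i + c"
    and van: "\<And>i z. i \<in> {1..l} \<Longrightarrow> p ^ c dvd (\<Sum>j\<in>{1..k}. u i j * (poly (\<phi> j) (\<eta> + p ^ b * z) - poly (\<phi> j) \<eta>))"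
  shows "fab p k N \<phi> v (cell p b \<eta> X) (tshift k (p ^ (k * N)) (\<lambda>j. \<Sum>i\<in>{1..l}. t i * p ^ e i * u i j) \<alpha>)
     = fab p k N \<phi> v (cell p b \<eta> X) \<alpha>"
proof -
  define s where "s j = (\<Sum>i\<in>{1..l}. t i * p ^ e i * u i j)" for j
  define q where "q = p ^ (k * N)"
  have q: "0 < q" using p by (simp add: q_def)
  have "emod q (\<Sum>j\<in>{1..k}. s j * poly (\<phi> j) y) = emod q (\<Sum>j\<in>{1..k}. s j * poly (\<phi> j) \<eta>)"
    if y: "y \<in> cell p b \<eta> X" for y
  proof (rule emod_cong)
    obtain z where z: "y = \<eta> + p ^ b * z"
      using y by (auto simp: cell_def cong_iff_dvd_diff dvd_def) (metis add.commute diff_add_cancel)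
    have "(\<Sum>j\<in>{1..k}. s j * poly (\<phi> j) y) - (\<Sum>j\<in>{1..k}. s j * poly (\<phi> j) \<eta>)
       = (\<Sum>j\<in>{1..k}. s j * (poly (\<phi> j) y - poly (\<phi> j) \<eta>))"
      by (simp add: sum_subtractf right_diff_distrib)
    also have "\<dots> = (\<Sum>i\<in>{1..l}. t i * p ^ e i * (\<Sum>j\<in>{1..k}. u i j * (poly (\<phi> j) y - poly (\<phi> j) \<eta>)))"
      unfolding s_def sum_distrib_left sum_distrib_right mult.assoc by (rule sum.swap)
    finally have eq: "(\<Sum>j\<in>{1..k}. s j * poly (\<phi> j) y) - (\<Sum>j\<in>{1..k}. s j * poly (\<phi> j) \<eta>)
       = (\<Sum>i\<in>{1..l}. t i * p ^ e i * (\<Sum>j\<in>{1..k}. u i j * (poly (\<phi> j) y - poly (\<phi> j) \<eta>)))" .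
    show "[(\<Sum>j\<in>{1..k}. s j * poly (\<phi> j) y) = (\<Sum>j\<in>{1..k}. s j * poly (\<phi> j) \<eta>)] (mod q)"
      unfolding cong_iff_dvd_diff eq
    proof (rule dvd_sum)
      fix i assume i: "i \<in> {1..l}"
      have "q dvd p ^ e i * p ^ c" unfolding q_def power_add[symmetric] using cM[OF i] by (rule le_imp_power_dvd)
      also have "\<dots> dvd p ^ e i * (\<Sum>j\<in>{1..k}. u i j * (poly (\<phi> j) y - poly (\<phi> j) \<eta>))"
        using van[OF i, of z] unfolding z by (intro mult_dvd_mono) auto
      finally show "q dvd t i * p ^ e i * (\<Sum>j\<in>{1..k}. u i j * (poly (\<phi> j) y - poly (\<phi> j) \<eta>))"
        by (simp add: mult.assoc)
    qed
  qed (use q in simp)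
  then have "esum q k \<phi> v (cell p b \<eta> X) (tshift k q s \<alpha>)
      = emod q (\<Sum>j\<in>{1..k}. s j * poly (\<phi> j) \<eta>) * esum q k \<phi> v (cell p b \<eta> X) \<alpha>"
    unfolding esum_def tshift_phase[OF q] sum_distrib_left by (intro sum.cong) auto
  then show ?thesis unfolding fab_def q_def[symmetric] s_def[symmetric] by (simp add: norm_mult)
qed

lemma rr_mono: "l \<le> k \<Longrightarrow> rr l \<le> rr k"
  unfolding rr_def by (intro div_le_mono mult_le_mono) auto

lemma rr_double: "2 * rr k = k * (k + 1)"
  by (simp add: rr_def)

lemma rr_Suc: "rr (Suc l) = rr l + Suc l"
  using rr_double[of l] rr_double[of "Suc l"] by (simp add: algebra_simps)

lemma rr_less: "l < k \<Longrightarrow> rr l < rr k"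
  using rr_mono[of "Suc l" k] rr_Suc[of l] by simp

text \<open>The factor on the class of \<eta> is invariant under the translations which decouple an
  l-dimensional curve on the class of \<xi>, so l-dimensional decoupling applies with this factor as
  weight and refines the first class from p^a to p^a'. The condition l a' <= (k-l+1) b keeps the
  translations within the precision to which the second class is constant. The cost d belongs to a
  dimension below k.\<close>

lemma mb_lower:
  assumes p: "prime p" and kp: "int k < p" and l: "1 \<le> l" "l < k" and a: "1 \<le> a" "a \<le> a'"
    and b: "b \<le> N" and la: "l * a' \<le> (k - l + 1) * b"
    and d: "dec p l (a' - a) d" "0 \<le> d" and c: "mb p k N l a' b c" "0 \<le> c"
    and aN: "a' \<le> N"
  shows "mb p k N l a b (d * c)"
  unfolding mb_def
proof (intro allI impI)
  fix \<phi> :: "nat \<Rightarrow> int poly" and v :: "int \<Rightarrow> complex" and X :: "int set" and \<xi> \<eta> :: int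
  assume \<phi>: "ncurve p k \<phi>" and X: "finite X" and sep: "\<not> p dvd \<xi> - \<eta>"
  have p0: "0 < p" using p by (rule prime_gt_0_int)
  have k: "1 \<le> k" using l by simp
  have r: "0 < rr l" using l(1) by (rule rr_pos)
  define C where "C = (k - l + 1) * b"
  have CM: "C \<le> k * N" unfolding C_def using l b by (intro mult_le_mono) auto
  have lk: "l \<le> k" using l by simp
  obtain u \<psi> where u: "ncurve p l \<psi>" "\<And>i z. i\<in>{1..l} \<Longrightarrow>
    [(\<Sum>j\<in>{1..k}. u i j * (poly (\<phi> j) (\<xi> + p ^ a * z) - poly (\<phi> j) \<xi>)) = p ^ (i * a) * poly (\<psi> i) z] (mod p ^ (k * N))"
    "\<And>i z. i\<in>{1..l} \<Longrightarrow> p ^ C dvd (\<Sum>j\<in>{1..k}. u i j * (poly (\<phi> j) (\<eta> + p ^ b * z) - poly (\<phi> j) \<eta>))"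
    using curve_lower[OF p kp \<phi> a(1) lk sep CM eq_refl[OF C_def]] by blast
  define w where "w \<alpha> = fab p k N \<phi> v (cell p b \<eta> X) \<alpha> ^ (2 * (rr k - rr l))" for \<alpha>
  define I where "I = cell p a \<xi> X"
  define QI where "QI = qsum p k N \<phi> v I"
  define Q' where "Q' = qsum p k N \<phi> v (cell p b \<eta> X)"
  have la': "l * a' = l * a + l * (a' - a)" using a by (simp flip: distrib_left)
  have wi: "w (tshift k (p ^ (k * N)) (\<lambda>j. \<Sum>i\<in>{1..l}. t i * p ^ (k * N - l * (a' - a) - i * a) * u i j) \<alpha>) = w \<alpha>" for t \<alpha>
  proof -
    have "k * N \<le> (k * N - l * (a' - a) - i * a) + C" if "i \<in> {1..l}" for i
    proof -
      have "i * a \<le> l * a" using that by simp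
      then show ?thesis using la la' unfolding C_def by linarith
    qed
    from fab_tshift[where l = l and e = "\<lambda>i. k * N - l * (a' - a) - i * a", OF p0 this u(3)]
    show ?thesis unfolding w_def by simp
  qed
  have M: "l * (a + (a' - a)) \<le> k * N" using la a CM unfolding C_def by simp
  have nn: "a + (a' - a) = a'" using a by simp
  have "(\<Sum>\<alpha>\<in>torus k (p ^ (k * N)). w \<alpha> * fab p k N \<phi> v I \<alpha> ^ (2 * rr l))
     \<le> d * (\<Sum>\<zeta>\<in>{0..<p ^ a'}. root (rr l) (\<Sum>\<alpha>\<in>torus k (p ^ (k * N)). w \<alpha> *
        fab p k N \<phi> v (cell p a' \<zeta> I) \<alpha> ^ (2 * rr l))) ^ rr l"
    using dec_cells[OF p0 d(1) l(1) d(2) u(1) X M u(2) _ wi, of v] unfolding nn fab_def[symmetric] I_def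
    by (simp add: w_def)
  also have "\<dots> \<le> d * (\<Sum>\<zeta>\<in>{0..<p ^ a'}. root (rr l) (c * Q' ^ (rr k - rr l)) * qsum p k N \<phi> v (cell p a' \<zeta> I)) ^ rr l"
  proof (intro mult_left_mono power_mono sum_mono d sum_nonneg real_root_ge_zero mult_nonneg_nonneg)
    fix \<zeta>
    have "(\<Sum>\<alpha>\<in>torus k (p ^ (k * N)). w \<alpha> * fab p k N \<phi> v (cell p a' \<zeta> I) \<alpha> ^ (2 * rr l))
       \<le> c * Q' ^ (rr k - rr l) * qsum p k N \<phi> v (cell p a' \<zeta> I) ^ rr l"
    proof (cases "[\<zeta> = \<xi>] (mod p ^ a)")
      case True
      then have eq: "cell p a' \<zeta> I = cell p a' \<zeta> X" unfolding I_def by (simp add: cell_cell[OF a(2)])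
      \<comment> \<open>A subclass of the class of \<xi> is still transversal to \<eta>, since both
        differ modulo p and a >= 1.\<close>
      have "p dvd p ^ a" using a(1) by (simp add: dvd_power)
      then have "p dvd \<zeta> - \<xi>" using True by (meson cong_iff_dvd_diff dvd_trans)
      then have "\<not> p dvd \<zeta> - \<eta>" using sep
        by (metis (no_types, opaque_lifting) diff_diff_eq2 diff_add_cancel dvd_diff dvd_diff_commute add_diff_cancel_left')
      from mbD[OF c(1) \<phi> X this, of v] show ?thesis unfolding eq w_def Q'_def by (simp add: mult_ac)
    next
      case False
      then have eq: "cell p a' \<zeta> I = {}" unfolding I_def by (simp add: cell_cell[OF a(2)])
      have "(\<Sum>\<alpha>\<in>torus k (p ^ (k * N)). w \<alpha> * fab p k N \<phi> v (cell p a' \<zeta> I) \<alpha> ^ (2 * rr l)) = 0"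
        unfolding eq using r by (simp add: zero_power)
      then show ?thesis using c(2) by (simp add: Q'_def)
    qed
    then have "root (rr l) (\<Sum>\<alpha>\<in>torus k (p ^ (k * N)). w \<alpha> * fab p k N \<phi> v (cell p a' \<zeta> I) \<alpha> ^ (2 * rr l))
        \<le> root (rr l) (c * Q' ^ (rr k - rr l) * qsum p k N \<phi> v (cell p a' \<zeta> I) ^ rr l)"
      using r by simp
    also have "\<dots> = root (rr l) (c * Q' ^ (rr k - rr l)) * qsum p k N \<phi> v (cell p a' \<zeta> I)"
      using r by (simp add: real_root_mult real_root_power_cancel)
    finally show "root (rr l) (\<Sum>\<alpha>\<in>torus k (p ^ (k * N)). w \<alpha> * fab p k N \<phi> v (cell p a' \<zeta> I) \<alpha> ^ (2 * rr l))
        \<le> root (rr l) (c * Q' ^ (rr k - rr l)) * qsum p k N \<phi> v (cell p a' \<zeta> I)" .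
  qed (auto simp: w_def)
  also have "\<dots> = d * (root (rr l) (c * Q' ^ (rr k - rr l)) * QI) ^ rr l"
    unfolding sum_distrib_left[symmetric] QI_def by (simp add: qsum_split[OF p0 k aN])
  also have "\<dots> = d * c * (QI ^ rr l * Q' ^ (rr k - rr l))"
    using r c(2) by (simp add: power_mult_distrib Q'_def)
  finally show "(\<Sum>\<alpha>\<in>torus k (p ^ (k * N)). fab p k N \<phi> v (cell p a \<xi> X) \<alpha> ^ (2 * rr l) *
        fab p k N \<phi> v (cell p b \<eta> X) \<alpha> ^ (2 * (rr k - rr l)))
      \<le> d * c * (qsum p k N \<phi> v (cell p a \<xi> X) ^ rr l * qsum p k N \<phi> v (cell p b \<eta> X) ^ (rr k - rr l))"
    unfolding w_def I_def QI_def Q'_def by (simp add: mult.commute)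
qed

lemma power_powr_combine:
  fixes x y :: real and i j i1 j1 i2 j2 :: nat
  assumes x: "0 \<le> x" and y: "0 \<le> y" and i: "0 < i" and j: "0 < j" and \<theta>: "0 < \<theta>" "\<theta> < 1"
    and ei: "real i = \<theta> * real i1 + (1 - \<theta>) * real i2" and ej: "real j = \<theta> * real j1 + (1 - \<theta>) * real j2"
  shows "x ^ i * y ^ j = (x ^ i1 * y ^ j1) powr \<theta> * (x ^ i2 * y ^ j2) powr (1 - \<theta>)"
proof (cases "x = 0 \<or> y = 0")
  case True
  have "0 < i1 \<or> 0 < i2" by (rule ccontr) (use ei i in auto)
  moreover have "0 < j1 \<or> 0 < j2" by (rule ccontr) (use ej j in auto)
  ultimately show ?thesis using True i j by (auto simp: zero_power)
next
  case False
  then have pos: "0 < x" "0 < y" using x y by auto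
  have "x ^ i = x powr (\<theta> * real i1) * x powr ((1 - \<theta>) * real i2)"
    using pos by (simp add: powr_add[symmetric] ei[symmetric] powr_realpow)
  moreover have "y ^ j = y powr (\<theta> * real j1) * y powr ((1 - \<theta>) * real j2)"
    using pos by (simp add: powr_add[symmetric] ej[symmetric] powr_realpow)
  ultimately show ?thesis using pos
    by (simp add: powr_mult powr_realpow[symmetric] powr_powr mult_ac)
qed

lemma mb_interpolate:
  assumes c: "0 \<le> c1" "0 \<le> c2" and \<theta>: "0 < \<theta>" "\<theta> < 1" and l: "0 < rr l" "rr l < rr k"
    and e1: "real (rr l) = \<theta> * real i1 + (1 - \<theta>) * real i2" and e2: "i1 + j1 = rr k" "i2 + j2 = rr k"
    and h1: "(\<Sum>w\<in>W. f w ^ (2 * i1) * g w ^ (2 * j1)) \<le> c1 * (P ^ i1 * Q ^ j1)"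
    and h2: "(\<Sum>w\<in>W. f w ^ (2 * i2) * g w ^ (2 * j2)) \<le> c2 * (P ^ i2 * Q ^ j2)"
    and nn: "\<And>w. 0 \<le> f w" "\<And>w. 0 \<le> g w" "0 \<le> P" "0 \<le> Q" and W: "finite W"
  shows "(\<Sum>w\<in>W. f w ^ (2 * rr l) * g w ^ (2 * (rr k - rr l)))
     \<le> c1 powr \<theta> * c2 powr (1 - \<theta>) * (P ^ rr l * (Q::real) ^ (rr k - rr l))"
proof -
  have e3: "real (rr k - rr l) = \<theta> * real j1 + (1 - \<theta>) * real j2"
  proof -
    have j: "real j1 = real (rr k) - real i1" "real j2 = real (rr k) - real i2" using e2 by linarith+
    have "real (rr k - rr l) = real (rr k) - real (rr l)" using l by simp
    then show ?thesis unfolding j e1 by (simp add: algebra_simps)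
  qed
  have "(\<Sum>w\<in>W. f w ^ (2 * rr l) * g w ^ (2 * (rr k - rr l)))
      = (\<Sum>w\<in>W. (f w ^ (2 * i1) * g w ^ (2 * j1)) powr \<theta> * (f w ^ (2 * i2) * g w ^ (2 * j2)) powr (1 - \<theta>))"
    using l e1 e3 nn \<theta> by (intro sum.cong refl power_powr_combine) (auto simp: algebra_simps)
  also have "\<dots> \<le> (\<Sum>w\<in>W. f w ^ (2 * i1) * g w ^ (2 * j1)) powr \<theta> * (\<Sum>w\<in>W. f w ^ (2 * i2) * g w ^ (2 * j2)) powr (1 - \<theta>)"
    using nn W \<theta> by (intro holder_sum_powr) auto
  also have "\<dots> \<le> (c1 * (P ^ i1 * Q ^ j1)) powr \<theta> * (c2 * (P ^ i2 * Q ^ j2)) powr (1 - \<theta>)"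
    using h1 h2 nn \<theta> by (intro mult_mono powr_mono2) (auto intro!: sum_nonneg)
  also have "\<dots> = c1 powr \<theta> * c2 powr (1 - \<theta>) * ((P ^ i1 * Q ^ j1) powr \<theta> * (P ^ i2 * Q ^ j2) powr (1 - \<theta>))"
    using c nn by (subst powr_mult, simp, simp, subst powr_mult) (auto simp: mult_ac)
  also have "(P ^ i1 * Q ^ j1) powr \<theta> * (P ^ i2 * Q ^ j2) powr (1 - \<theta>) = P ^ rr l * Q ^ (rr k - rr l)"
    using l e1 e3 nn \<theta> by (intro power_powr_combine[symmetric]) auto
  finally show ?thesis .
qed

text \<open>Interpolation between the bilinear form of index k - l with the two classes exchanged
  and the form of index l - 1 in the given order. In either one, the class that carries the smaller
  index can be refined further by \<open>mb_lower\<close>.\<close>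

lemma mb_holder:
  assumes l: "1 \<le> l" "l < k" and c1: "mb p k N (k - l) b a c1" "0 \<le> c1"
    and c2: "mb p k N (l - 1) a b c2" "0 \<le> c2"
  shows "mb p k N l a b (c1 powr (1 / real (k - l + 1)) * c2 powr (real (k - l) / real (k - l + 1)))"
  unfolding mb_def
proof (intro allI impI)
  fix \<phi> :: "nat \<Rightarrow> int poly" and v :: "int \<Rightarrow> complex" and X :: "int set" and \<xi> \<eta> :: int
  assume \<phi>: "ncurve p k \<phi>" and X: "finite X" and sep: "\<not> p dvd \<xi> - \<eta>"
  have sep': "\<not> p dvd \<eta> - \<xi>" using sep by (simp add: dvd_diff_commute)
  define \<theta> where "\<theta> = 1 / real (k - l + 1)"
  have \<theta>: "0 < \<theta>" "\<theta> < 1" using l by (auto simp: \<theta>_def)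
  have \<theta>': "1 - \<theta> = real (k - l) / real (k - l + 1)" using l by (simp add: \<theta>_def field_simps)
  \<comment> \<open>The identity (k-l+1) rr l = (rr k - rr (k-l)) + (k-l) rr (l-1), which dictates
    the weight \<theta> = 1/(k-l+1).\<close>
  have eq: "real (rr l) = \<theta> * real (rr k - rr (k - l)) + (1 - \<theta>) * real (rr (l - 1))"
  proof -
    have R: "real (rr m) = real m * (real m + 1) / 2" for m
    proof -
      have "2 * real (rr m) = real m * (real m + 1)"
        using arg_cong[OF rr_double[of m], of real] by (simp add: algebra_simps)
      then show ?thesis by simp
    qed
    define d where "d = k - l"
    have d: "k = d + l" "0 < d" using l by (auto simp: d_def)
    obtain m where m: "l = Suc m" using l by (cases l) auto
    have "real (rr k - rr (k - l)) = real (rr k) - real (rr (k - l))" by (simp add: rr_mono of_nat_diff)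
    then have "real (rr l) * (real d + 1) = real (rr k - rr (k - l)) + real d * real (rr (l - 1))"
      using d unfolding d_def[symmetric] R m by (simp add: field_simps)
    then have "real (rr l) = (real (rr k - rr (k - l)) + real d * real (rr (l - 1))) / (real d + 1)"
      by (subst nonzero_eq_divide_eq) auto
    then show ?thesis unfolding \<theta>' unfolding \<theta>_def d_def[symmetric] by (simp add: add_divide_distrib add.commute)
  qed
  show "(\<Sum>\<alpha>\<in>torus k (p ^ (k * N)). fab p k N \<phi> v (cell p a \<xi> X) \<alpha> ^ (2 * rr l) *
        fab p k N \<phi> v (cell p b \<eta> X) \<alpha> ^ (2 * (rr k - rr l)))
      \<le> c1 powr (1 / real (k - l + 1)) * c2 powr (real (k - l) / real (k - l + 1)) *
        (qsum p k N \<phi> v (cell p a \<xi> X) ^ rr l * qsum p k N \<phi> v (cell p b \<eta> X) ^ (rr k - rr l))"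
    unfolding \<theta>'[symmetric] unfolding \<theta>_def[symmetric]
  proof (rule mb_interpolate[OF c1(2) c2(2) \<theta> rr_pos[OF l(1)] rr_less[OF l(2)] eq])
    show "(\<Sum>\<alpha>\<in>torus k (p ^ (k * N)). fab p k N \<phi> v (cell p a \<xi> X) \<alpha> ^ (2 * (rr k - rr (k - l))) *
        fab p k N \<phi> v (cell p b \<eta> X) \<alpha> ^ (2 * rr (k - l)))
      \<le> c1 * (qsum p k N \<phi> v (cell p a \<xi> X) ^ (rr k - rr (k - l)) * qsum p k N \<phi> v (cell p b \<eta> X) ^ rr (k - l))"
      using mbD[OF c1(1) \<phi> X sep', of v] by (simp add: mult_ac)
    show "(\<Sum>\<alpha>\<in>torus k (p ^ (k * N)). fab p k N \<phi> v (cell p a \<xi> X) \<alpha> ^ (2 * rr (l - 1)) *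
        fab p k N \<phi> v (cell p b \<eta> X) \<alpha> ^ (2 * (rr k - rr (l - 1))))
      \<le> c2 * (qsum p k N \<phi> v (cell p a \<xi> X) ^ rr (l - 1) * qsum p k N \<phi> v (cell p b \<eta> X) ^ (rr k - rr (l - 1)))"
      by (rule mbD[OF c2(1) \<phi> X sep])
  qed (use l in \<open>auto simp: rr_mono\<close>)
qed

text \<open>Hoelder's inequality between the linear estimates for the two classes, with weight rr l
  / rr k; this is the start of the iteration.\<close>

lemma mb_trivial:
  assumes p: "prime p" and kp: "int k < p" and l: "1 \<le> l" "l < k" and ab: "1 \<le> a" "a \<le> N" "1 \<le> b" "b \<le> N"
    and d: "dec p k (N - a) c" "dec p k (N - b) c" "0 \<le> c"
  shows "mb p k N l a b c"
  unfolding mb_def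
proof (intro allI impI)
  fix \<phi> :: "nat \<Rightarrow> int poly" and v :: "int \<Rightarrow> complex" and X :: "int set" and \<xi> \<eta> :: int
  assume \<phi>: "ncurve p k \<phi>" and X: "finite X" and sep: "\<not> p dvd \<xi> - \<eta>"
  have k: "1 \<le> k" using l by simp
  define \<theta> where "\<theta> = real (rr l) / real (rr k)"
  have lk: "0 < rr l" "rr l < rr k" using rr_pos[OF l(1)] rr_less[OF l(2)] .
  then have \<theta>: "0 < \<theta>" "\<theta> < 1" by (auto simp: \<theta>_def)
  have eq: "real (rr l) = \<theta> * real (rr k) + (1 - \<theta>) * real 0" using lk by (simp add: \<theta>_def)
  have "(\<Sum>\<alpha>\<in>torus k (p ^ (k * N)). fab p k N \<phi> v (cell p a \<xi> X) \<alpha> ^ (2 * rr l) *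
        fab p k N \<phi> v (cell p b \<eta> X) \<alpha> ^ (2 * (rr k - rr l)))
      \<le> c powr \<theta> * c powr (1 - \<theta>) * (qsum p k N \<phi> v (cell p a \<xi> X) ^ rr l * qsum p k N \<phi> v (cell p b \<eta> X) ^ (rr k - rr l))"
  proof (rule mb_interpolate[OF d(3,3) \<theta> lk eq, of 0 "rr k"])
  qed (use dec_rescale[OF p kp k ab(1,2) d(1,3) \<phi> X] dec_rescale[OF p kp k ab(3,4) d(2,3) \<phi> X] in auto)
  also have "c powr \<theta> * c powr (1 - \<theta>) = c" using d(3) by (cases "c = 0") (auto simp flip: powr_add)
  finally show "(\<Sum>\<alpha>\<in>torus k (p ^ (k * N)). fab p k N \<phi> v (cell p a \<xi> X) \<alpha> ^ (2 * rr l) *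
        fab p k N \<phi> v (cell p b \<eta> X) \<alpha> ^ (2 * (rr k - rr l)))
      \<le> c * (qsum p k N \<phi> v (cell p a \<xi> X) ^ rr l * qsum p k N \<phi> v (cell p b \<eta> X) ^ (rr k - rr l))" .
qed

text \<open>Passage from the scale b0 of the broad-narrow step to a scale b proportional to N, by
  the triangle inequality over subclasses. The loss is exponential in b, and the iteration has to
  gain more than that.\<close>

lemma mb_split:
  assumes p: "0 < p" and k: "1 \<le> k" and l: "l < k" and b: "b0 \<le> b" "b \<le> N" "1 \<le> b0"
    and c: "mb p k N l a b c" "0 \<le> c"
  shows "mb p k N l a b0 (real_of_int p ^ (b * (2 * rr k)) * c)"
  unfolding mb_def
proof (intro allI impI)
  fix \<phi> :: "nat \<Rightarrow> int poly" and v :: "int \<Rightarrow> complex" and X :: "int set" and \<xi> \<eta> :: int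
  assume \<phi>: "ncurve p k \<phi>" and X: "finite X" and sep: "\<not> p dvd \<xi> - \<eta>"
  define m where "m = rr k - rr l"
  have m: "1 \<le> m" "m \<le> rr k" using rr_less[OF l] by (auto simp: m_def)
  define I' where "I' = cell p b0 \<eta> X"
  define A where "A = torus k (p ^ (k * N))"
  define f where "f = fab p k N \<phi> v"
  define Q where "Q = qsum p k N \<phi> v"
  define PP where "PP = real_of_int p ^ (b * (2 * rr k))"
  have finI: "finite I'" using X by (simp add: I'_def)
  have split: "f I' \<alpha> ^ (2 * m) \<le> PP * (\<Sum>\<zeta>\<in>{0..<p ^ b}. f (cell p b \<zeta> I') \<alpha> ^ (2 * m))" for \<alpha>
  proof -
    have "f I' \<alpha> \<le> (\<Sum>\<zeta>\<in>{0..<p ^ b}. f (cell p b \<zeta> I') \<alpha>)"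
      unfolding f_def fab_def by (subst esum_cells[OF p finI, of _ _ _ _ _ b]) (rule norm_sum)
    then have "f I' \<alpha> ^ (2 * m) \<le> (\<Sum>\<zeta>\<in>{0..<p ^ b}. f (cell p b \<zeta> I') \<alpha>) ^ (2 * m)"
      by (intro power_mono) (auto simp: f_def)
    also have "\<dots> \<le> real (card {0..<p ^ b}) ^ (2 * m) * (\<Sum>\<zeta>\<in>{0..<p ^ b}. f (cell p b \<zeta> I') \<alpha> ^ (2 * m))"
      using m by (intro power_sum_le_card) (auto simp: f_def)
    also have "real (card {0..<p ^ b}) ^ (2 * m) \<le> PP"
    proof -
      have "real (card {0..<p ^ b}) ^ (2 * m) = real_of_int p ^ (b * (2 * m))" using p by (simp add: power_mult)
      also have "\<dots> \<le> PP" unfolding PP_def using p m by (intro power_increasing) auto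
      finally show ?thesis .
    qed
    finally show ?thesis by (simp add: f_def sum_nonneg mult_right_mono)
  qed
  have "(\<Sum>\<alpha>\<in>A. f (cell p a \<xi> X) \<alpha> ^ (2 * rr l) * f I' \<alpha> ^ (2 * m))
     \<le> (\<Sum>\<alpha>\<in>A. f (cell p a \<xi> X) \<alpha> ^ (2 * rr l) * (PP * (\<Sum>\<zeta>\<in>{0..<p ^ b}. f (cell p b \<zeta> I') \<alpha> ^ (2 * m))))"
    by (intro sum_mono mult_left_mono split) (auto simp: f_def)
  also have "\<dots> = PP * (\<Sum>\<zeta>\<in>{0..<p ^ b}. \<Sum>\<alpha>\<in>A. f (cell p a \<xi> X) \<alpha> ^ (2 * rr l) * f (cell p b \<zeta> I') \<alpha> ^ (2 * m))"
    by (subst sum.swap) (simp add: sum_distrib_left mult_ac)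
  also have "\<dots> \<le> PP * (\<Sum>\<zeta>\<in>{0..<p ^ b}. c * (Q (cell p a \<xi> X) ^ rr l * Q (cell p b \<zeta> I') ^ m))"
  proof (intro mult_left_mono sum_mono)
    fix \<zeta>
    show "(\<Sum>\<alpha>\<in>A. f (cell p a \<xi> X) \<alpha> ^ (2 * rr l) * f (cell p b \<zeta> I') \<alpha> ^ (2 * m))
       \<le> c * (Q (cell p a \<xi> X) ^ rr l * Q (cell p b \<zeta> I') ^ m)"
    proof (cases "[\<zeta> = \<eta>] (mod p ^ b0)")
      case True
      then have eq: "cell p b \<zeta> I' = cell p b \<zeta> X" unfolding I'_def by (simp add: cell_cell[OF b(1)])
      have "p dvd p ^ b0" using b(3) by (simp add: dvd_power)
      then have "p dvd \<zeta> - \<eta>" using True by (meson cong_iff_dvd_diff dvd_trans)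
      then have "\<not> p dvd \<xi> - \<zeta>" using sep dvd_add[of p "\<xi> - \<zeta>" "\<zeta> - \<eta>"] by auto
      from mbD[OF c(1) \<phi> X this, of v] show ?thesis unfolding eq A_def f_def m_def Q_def .
    next
      case False
      then have eq: "cell p b \<zeta> I' = {}" unfolding I'_def by (simp add: cell_cell[OF b(1)])
      have "(\<Sum>\<alpha>\<in>A. f (cell p a \<xi> X) \<alpha> ^ (2 * rr l) * f (cell p b \<zeta> I') \<alpha> ^ (2 * m)) = 0"
        unfolding eq using m by (simp add: f_def zero_power)
      then show ?thesis using c(2) by (simp add: Q_def)
    qed
  qed (use p in \<open>simp add: PP_def\<close>)
  also have "\<dots> = PP * c * (Q (cell p a \<xi> X) ^ rr l * (\<Sum>\<zeta>\<in>{0..<p ^ b}. Q (cell p b \<zeta> I') ^ m))"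
    by (simp add: sum_distrib_left mult_ac)
  also have "\<dots> \<le> PP * c * (Q (cell p a \<xi> X) ^ rr l * (\<Sum>\<zeta>\<in>{0..<p ^ b}. Q (cell p b \<zeta> I')) ^ m)"
    using c(2) m p by (intro mult_left_mono sum_power_le_power_sum) (auto simp: Q_def PP_def)
  also have "(\<Sum>\<zeta>\<in>{0..<p ^ b}. Q (cell p b \<zeta> I')) = Q I'" unfolding Q_def by (rule qsum_split[OF p k b(2)])
  finally show "(\<Sum>\<alpha>\<in>torus k (p ^ (k * N)). fab p k N \<phi> v (cell p a \<xi> X) \<alpha> ^ (2 * rr l) *
        fab p k N \<phi> v (cell p b0 \<eta> X) \<alpha> ^ (2 * (rr k - rr l)))
      \<le> real_of_int p ^ (b * (2 * rr k)) * c * (qsum p k N \<phi> v (cell p a \<xi> X) ^ rr l * qsum p k N \<phi> v (cell p b0 \<eta> X) ^ (rr k - rr l))"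
    unfolding A_def f_def Q_def PP_def m_def I'_def .
qed

lemma dec_trivial:
  assumes p: "0 < p" and k: "1 \<le> k"
  shows "dec p k N (real_of_int p ^ (N * (2 * rr k)))"
  unfolding dec_alt
proof (intro allI impI)
  fix \<phi> :: "nat \<Rightarrow> int poly" and v :: "int \<Rightarrow> complex" and X :: "int set"
  assume "ncurve p k \<phi>" and X: "finite X"
  let ?f = "fab p k N \<phi> v" and ?A = "torus k (p ^ (k * N))"
  have r: "0 < rr k" using k by (rule rr_pos)
  have "?f X \<alpha> ^ (2 * rr k) \<le> real_of_int p ^ (N * (2 * rr k)) * (\<Sum>\<xi>\<in>{0..<p ^ N}. ?f (cell p N \<xi> X) \<alpha> ^ (2 * rr k))" for \<alpha>
  proof -
    have "?f X \<alpha> \<le> (\<Sum>\<xi>\<in>{0..<p ^ N}. ?f (cell p N \<xi> X) \<alpha>)"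
      unfolding fab_def by (subst esum_cells[OF p X, of _ _ _ _ _ N]) (rule norm_sum)
    then have "?f X \<alpha> ^ (2 * rr k) \<le> (\<Sum>\<xi>\<in>{0..<p ^ N}. ?f (cell p N \<xi> X) \<alpha>) ^ (2 * rr k)"
      by (intro power_mono) auto
    also have "\<dots> \<le> real (card {0..<p ^ N}) ^ (2 * rr k) * (\<Sum>\<xi>\<in>{0..<p ^ N}. ?f (cell p N \<xi> X) \<alpha> ^ (2 * rr k))"
      using r by (intro power_sum_le_card) auto
    also have "real (card {0..<p ^ N}) ^ (2 * rr k) = real_of_int p ^ (N * (2 * rr k))"
      using p by (simp add: power_mult)
    finally show ?thesis .
  qed
  then have "(\<Sum>\<alpha>\<in>?A. ?f X \<alpha> ^ (2 * rr k)) \<le> (\<Sum>\<alpha>\<in>?A. real_of_int p ^ (N * (2 * rr k)) * (\<Sum>\<xi>\<in>{0..<p ^ N}. ?f (cell p N \<xi> X) \<alpha> ^ (2 * rr k)))"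
    by (intro sum_mono) auto
  also have "\<dots> = real_of_int p ^ (N * (2 * rr k)) * (\<Sum>\<xi>\<in>{0..<p ^ N}. root (rr k) (\<Sum>\<alpha>\<in>?A. ?f (cell p N \<xi> X) \<alpha> ^ (2 * rr k)) ^ rr k)"
    unfolding sum_distrib_left[symmetric] using r by (subst sum.swap) (simp add: sum_nonneg)
  also have "\<dots> \<le> real_of_int p ^ (N * (2 * rr k)) * qsum p k N \<phi> v X ^ rr k"
    unfolding qsum_def using r p
    by (intro mult_left_mono sum_power_le_power_sum) (auto intro!: real_root_ge_zero sum_nonneg)
  finally show "(\<Sum>\<alpha>\<in>?A. ?f X \<alpha> ^ (2 * rr k)) \<le> real_of_int p ^ (N * (2 * rr k)) * qsum p k N \<phi> v X ^ rr k" .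
qed

text \<open>The dichotomy of Bourgain and Guth. The largest term m is at most the norm of the whole
  family; any other term satisfies x j^(2r) <= x m^r x j^r, which is part of the bilinear sum. The
  norm term has coefficient 1, while the bilinear term may carry the number of classes.\<close>

lemma broad_narrow:
  fixes x :: "'a \<Rightarrow> real"
  assumes I: "finite I" "I \<noteq> {}" and x: "\<And>i. i \<in> I \<Longrightarrow> 0 \<le> x i" and r: "0 < r"
  shows "(\<Sum>i\<in>I. x i) \<le> root (2 * r) (\<Sum>i\<in>I. x i ^ (2 * r))
    + card I * root (2 * r) (\<Sum>i\<in>I. \<Sum>j\<in>I - {i}. x i ^ r * x j ^ r)"
proof -
  obtain m where m: "m \<in> I" "\<And>i. i \<in> I \<Longrightarrow> x i \<le> x m"
  proof -
    have "Max (x ` I) \<in> x ` I" using I by (intro Max_in) auto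
    moreover have "x i \<le> Max (x ` I)" if "i \<in> I" for i using I(1) that by simp
    ultimately show ?thesis using that by (metis imageE)
  qed
  let ?B = "root (2 * r) (\<Sum>i\<in>I. \<Sum>j\<in>I - {i}. x i ^ r * x j ^ r)"
  have "x m = root (2 * r) (x m ^ (2 * r))" using r x[OF m(1)] by (simp add: real_root_power_cancel)
  also have "\<dots> \<le> root (2 * r) (\<Sum>i\<in>I. x i ^ (2 * r))"
    using r I x m member_le_sum[of m I "\<lambda>i. x i ^ (2 * r)"] by simp
  finally have 1: "x m \<le> root (2 * r) (\<Sum>i\<in>I. x i ^ (2 * r))" .
  have 2: "x j \<le> ?B" if j: "j \<in> I - {m}" for j
  proof -
    have "x j = root (2 * r) (x j ^ (2 * r))" using r x[of j] j by (simp add: real_root_power_cancel)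
    also have "x j ^ (2 * r) = x j ^ r * x j ^ r" by (simp add: mult_2 power_add)
    also have "\<dots> \<le> x m ^ r * x j ^ r" using x j m by (intro mult_right_mono power_mono) auto
    also have "\<dots> \<le> (\<Sum>j\<in>I - {m}. x m ^ r * x j ^ r)"
      using I x m j by (intro member_le_sum) auto
    also have "\<dots> \<le> (\<Sum>i\<in>I. \<Sum>j\<in>I - {i}. x i ^ r * x j ^ r)"
      using I x m by (intro member_le_sum[of m]) (auto intro!: sum_nonneg)
    finally show ?thesis using r by (simp add: mult.commute)
  qed
  have B0: "0 \<le> ?B" using x by (auto intro!: real_root_ge_zero sum_nonneg)
  have "(\<Sum>i\<in>I. x i) = x m + (\<Sum>j\<in>I - {m}. x j)" using I m by (simp add: sum.remove)
  also have "(\<Sum>j\<in>I - {m}. x j) \<le> card (I - {m}) * ?B" using 2 by (intro sum_bounded_above) auto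
  also have "\<dots> \<le> card I * ?B" using I B0 by (intro mult_right_mono) (auto simp: card_mono)
  finally show ?thesis using 1 by simp
qed

text \<open>Broad-narrow at the first digit. The narrow part consists of single classes modulo p and
  costs just the constant d for N - 1, by \<open>dec_rescale\<close> and the additivity of
  \<open>qsum\<close>; all powers of p fall on the bilinear part. Because d is not multiplied by
  anything, the step can be repeated N times.\<close>

lemma dec_step:
  assumes p: "prime p" and kp: "int k < p" and l: "1 \<le> l" "l < k" and N: "1 \<le> N"
    and d: "dec p k (N - 1) d" "0 \<le> d" and c: "mb p k N l 1 1 c" "0 \<le> c"
  shows "dec p k N ((root (2 * rr k) d + real_of_int p * root (2 * rr k) (real_of_int p ^ 2 * c)) ^ (2 * rr k))"
  unfolding dec_alt
proof (intro allI impI)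
  fix \<phi> :: "nat \<Rightarrow> int poly" and v :: "int \<Rightarrow> complex" and X :: "int set"
  assume \<phi>: "ncurve p k \<phi>" and X: "finite X"
  define A where "A = torus k (p ^ (k * N))"
  define f where "f \<xi> = fab p k N \<phi> v (cell p 1 \<xi> X)" for \<xi>
  define Q where "Q \<xi> = qsum p k N \<phi> v (cell p 1 \<xi> X)" for \<xi>
  define QX where "QX = qsum p k N \<phi> v X"
  define r where "r = rr k"
  have p0: "0 < p" using p by (rule prime_gt_0_int)
  have k: "1 \<le> k" using l by simp
  have r: "0 < r" unfolding r_def using k by (rule rr_pos)
  have f0: "0 \<le> f \<xi> \<alpha>" and Q0: "0 \<le> Q \<xi>" and QX0: "0 \<le> QX" for \<xi> \<alpha> by (simp_all add: f_def Q_def QX_def)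
  have QX: "(\<Sum>\<xi>\<in>{0..<p}. Q \<xi>) = QX" unfolding Q_def QX_def using qsum_split[OF p0 k N] by simp
  have QleX: "Q \<xi> \<le> QX" if "\<xi> \<in> {0..<p}" for \<xi>
    unfolding QX[symmetric] using that Q0 by (intro member_le_sum) auto
  define h1 where "h1 \<alpha> = root (2 * r) (\<Sum>i\<in>{0..<p}. f i \<alpha> ^ (2 * r))" for \<alpha>
  define h2 where "h2 \<alpha> = p * root (2 * r) (\<Sum>i\<in>{0..<p}. \<Sum>j\<in>{0..<p} - {i}. f i \<alpha> ^ r * f j \<alpha> ^ r)" for \<alpha>
  have h0: "0 \<le> h1 \<alpha>" "0 \<le> h2 \<alpha>" for \<alpha>
    using f0 p0 by (auto simp: h1_def h2_def intro!: mult_nonneg_nonneg real_root_ge_zero sum_nonneg)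
  have fX: "fab p k N \<phi> v X \<alpha> \<le> h1 \<alpha> + h2 \<alpha>" for \<alpha>
  proof -
    have "fab p k N \<phi> v X \<alpha> \<le> (\<Sum>\<xi>\<in>{0..<p ^ 1}. f \<xi> \<alpha>)"
      unfolding f_def fab_def by (subst esum_cells[OF p0 X, of _ _ _ _ _ 1]) (rule norm_sum)
    also have "\<dots> \<le> h1 \<alpha> + h2 \<alpha>"
      using broad_narrow[of "{0..<p}" "\<lambda>i. f i \<alpha>" r] f0 r p0 unfolding h1_def h2_def by simp
    finally show ?thesis .
  qed
  have H1: "(\<Sum>\<alpha>\<in>A. h1 \<alpha> ^ (2 * r)) \<le> d * QX ^ r"
  proof -
    have "(\<Sum>\<alpha>\<in>A. h1 \<alpha> ^ (2 * r)) = (\<Sum>\<alpha>\<in>A. \<Sum>i\<in>{0..<p}. f i \<alpha> ^ (2 * r))"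
      unfolding h1_def using r f0 by (intro sum.cong refl real_root_pow_pos2) (auto intro!: sum_nonneg)
    also have "\<dots> = (\<Sum>i\<in>{0..<p}. \<Sum>\<alpha>\<in>A. f i \<alpha> ^ (2 * r))" by (rule sum.swap)
    also have "\<dots> \<le> (\<Sum>i\<in>{0..<p}. d * Q i ^ r)"
      unfolding A_def f_def Q_def r_def
      by (intro sum_mono dec_rescale[OF p kp k _ N d \<phi> X]) auto
    also have "\<dots> \<le> d * QX ^ r"
      unfolding sum_distrib_left[symmetric] QX[symmetric] using d Q0 r
      by (intro mult_left_mono sum_power_le_power_sum) auto
    finally show ?thesis .
  qed
  have H2: "(\<Sum>\<alpha>\<in>A. h2 \<alpha> ^ (2 * r)) \<le> p ^ (2 * r) * (p ^ 2 * c * QX ^ r)"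
  proof -
    have "(\<Sum>\<alpha>\<in>A. h2 \<alpha> ^ (2 * r)) = (\<Sum>\<alpha>\<in>A. p ^ (2 * r) * (\<Sum>i\<in>{0..<p}. \<Sum>j\<in>{0..<p} - {i}. f i \<alpha> ^ r * f j \<alpha> ^ r))"
    proof (rule sum.cong[OF refl])
      fix \<alpha>
      have "root (2 * r) (\<Sum>i\<in>{0..<p}. \<Sum>j\<in>{0..<p} - {i}. f i \<alpha> ^ r * f j \<alpha> ^ r) ^ (2 * r) = (\<Sum>i\<in>{0..<p}. \<Sum>j\<in>{0..<p} - {i}. f i \<alpha> ^ r * f j \<alpha> ^ r)"
        using r f0 by (intro real_root_pow_pos2) (auto intro!: sum_nonneg)
      then show "h2 \<alpha> ^ (2 * r) = p ^ (2 * r) * (\<Sum>i\<in>{0..<p}. \<Sum>j\<in>{0..<p} - {i}. f i \<alpha> ^ r * f j \<alpha> ^ r)"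
        unfolding h2_def power_mult_distrib by simp
    qed
    also have "\<dots> = p ^ (2 * r) * (\<Sum>i\<in>{0..<p}. \<Sum>j\<in>{0..<p} - {i}. \<Sum>\<alpha>\<in>A. f i \<alpha> ^ r * f j \<alpha> ^ r)"
      unfolding sum_distrib_left[where r = "real_of_int (p ^ (2 * r))", symmetric]
      by (rule arg_cong[of _ _ "\<lambda>x. real_of_int (p ^ (2 * r)) * x"], subst sum.swap, intro sum.cong refl sum.swap)
    also have "\<dots> \<le> p ^ (2 * r) * (\<Sum>i\<in>{0..<p}. \<Sum>j\<in>{0..<p} - {i}. c * QX ^ r)"
    proof (intro mult_left_mono sum_mono)
      fix i j assume ij: "i \<in> {0..<p}" "j \<in> {0..<p} - {i}"
      have sep: "\<not> p dvd i - j" "\<not> p dvd j - i"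
        using ij by (auto simp: mod_eq_dvd_iff[symmetric])
      have rl: "rr l \<le> r" using l unfolding r_def by (intro rr_mono) simp
      have QQ: "Q i' ^ rr l * Q j' ^ (r - rr l) \<le> QX ^ r" if "i' \<in> {0..<p}" "j' \<in> {0..<p}" for i' j'
      proof -
        have "Q i' ^ rr l * Q j' ^ (r - rr l) \<le> QX ^ rr l * QX ^ (r - rr l)"
          using QleX that Q0 QX0 by (intro mult_mono power_mono) auto
        then show ?thesis using rl by (simp flip: power_add)
      qed
      \<comment> \<open>The symmetric product equals s t with unequal exponents; the
        arithmetic-geometric mean inequality yields the two products to which \<open>mb\<close>
        applies, for (i, j) and for (j, i).\<close>
      have "f i \<alpha> ^ r * f j \<alpha> ^ r \<le> (f i \<alpha> ^ (2 * rr l) * f j \<alpha> ^ (2 * (r - rr l)) + f j \<alpha> ^ (2 * rr l) * f i \<alpha> ^ (2 * (r - rr l))) / 2" for \<alpha>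
      proof -
        define s t where "s = f i \<alpha> ^ rr l * f j \<alpha> ^ (r - rr l)" and "t = f j \<alpha> ^ rr l * f i \<alpha> ^ (r - rr l)"
        have "f i \<alpha> ^ r = f i \<alpha> ^ rr l * f i \<alpha> ^ (r - rr l)" "f j \<alpha> ^ r = f j \<alpha> ^ rr l * f j \<alpha> ^ (r - rr l)"
          using rl by (simp_all flip: power_add)
        then have "f i \<alpha> ^ r * f j \<alpha> ^ r = s * t" by (simp add: s_def t_def mult_ac)
        also have "\<dots> \<le> (s\<^sup>2 + t\<^sup>2) / 2" using sum_squares_bound[of s t] by simp
        also have "s\<^sup>2 + t\<^sup>2 = f i \<alpha> ^ (2 * rr l) * f j \<alpha> ^ (2 * (r - rr l)) + f j \<alpha> ^ (2 * rr l) * f i \<alpha> ^ (2 * (r - rr l))"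
          by (simp add: s_def t_def power_mult_distrib mult.commute flip: power_mult)
        finally show ?thesis .
      qed
      then have "(\<Sum>\<alpha>\<in>A. f i \<alpha> ^ r * f j \<alpha> ^ r) \<le> (\<Sum>\<alpha>\<in>A. (f i \<alpha> ^ (2 * rr l) * f j \<alpha> ^ (2 * (r - rr l)) + f j \<alpha> ^ (2 * rr l) * f i \<alpha> ^ (2 * (r - rr l))) / 2)"
        by (rule sum_mono)
      also have "\<dots> = ((\<Sum>\<alpha>\<in>A. f i \<alpha> ^ (2 * rr l) * f j \<alpha> ^ (2 * (r - rr l))) + (\<Sum>\<alpha>\<in>A. f j \<alpha> ^ (2 * rr l) * f i \<alpha> ^ (2 * (r - rr l)))) / 2"
        by (simp add: sum.distrib flip: sum_divide_distrib)
      also have "\<dots> \<le> (c * (Q i ^ rr l * Q j ^ (r - rr l)) + c * (Q j ^ rr l * Q i ^ (r - rr l))) / 2"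
        using mbD[OF c(1) \<phi> X sep(1), of v] mbD[OF c(1) \<phi> X sep(2), of v]
        unfolding A_def f_def Q_def r_def by (intro divide_right_mono add_mono) auto
      also have "\<dots> \<le> (c * QX ^ r + c * QX ^ r) / 2"
        using c(2) ij by (intro divide_right_mono add_mono mult_left_mono QQ) auto
      finally show "(\<Sum>\<alpha>\<in>A. f i \<alpha> ^ r * f j \<alpha> ^ r) \<le> c * QX ^ r" by simp
    qed (use p0 in auto)
    also have "\<dots> \<le> p ^ (2 * r) * (\<Sum>i\<in>{0..<p}. \<Sum>j\<in>{0..<p}. c * QX ^ r)"
      using p0 c(2) QX0 by (intro mult_left_mono sum_mono sum_mono2) auto
    also have "\<dots> = p ^ (2 * r) * (p ^ 2 * c * QX ^ r)" using p0 by (simp add: power2_eq_square)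
    finally show ?thesis .
  qed
  have "(\<Sum>\<alpha>\<in>A. fab p k N \<phi> v X \<alpha> ^ (2 * r)) \<le> (\<Sum>\<alpha>\<in>A. (\<Sum>b\<in>UNIV. if b then h1 \<alpha> else h2 \<alpha>) ^ (2 * r))"
    using fX by (intro sum_mono power_mono) (auto simp: UNIV_bool add.commute)
  also have "\<dots> \<le> (\<Sum>b\<in>UNIV. root (2 * r) (\<Sum>\<alpha>\<in>A. (if b then h1 \<alpha> else h2 \<alpha>) ^ (2 * r))) ^ (2 * r)"
    using r h0 by (intro minkowski_sum) (auto simp: A_def)
  also have "\<dots> = (root (2 * r) (\<Sum>\<alpha>\<in>A. h1 \<alpha> ^ (2 * r)) + root (2 * r) (\<Sum>\<alpha>\<in>A. h2 \<alpha> ^ (2 * r))) ^ (2 * r)"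
    by (simp add: UNIV_bool add.commute)
  also have "\<dots> \<le> (root (2 * r) (d * QX ^ r) + root (2 * r) (p ^ (2 * r) * (p ^ 2 * c * QX ^ r))) ^ (2 * r)"
    using r H1 H2 h0 by (intro power_mono add_mono) (auto intro!: add_nonneg_nonneg real_root_ge_zero sum_nonneg)
  also have "root (2 * r) (p ^ (2 * r) * (p ^ 2 * c * QX ^ r)) = p * root (2 * r) (p ^ 2 * c) * root (2 * r) (QX ^ r)"
    using r p0 by (simp add: real_root_mult real_root_power_cancel)
  also have "root (2 * r) (d * QX ^ r) = root (2 * r) d * root (2 * r) (QX ^ r)" by (rule real_root_mult)
  also have "(root (2 * r) d * root (2 * r) (QX ^ r) + p * root (2 * r) (p ^ 2 * c) * root (2 * r) (QX ^ r)) ^ (2 * r)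
     = (root (2 * r) d + p * root (2 * r) (p ^ 2 * c)) ^ (2 * r) * root (2 * r) (QX ^ r) ^ (2 * r)"
    unfolding power_mult_distrib[symmetric] by (simp add: distrib_right)
  also have "root (2 * r) (QX ^ r) ^ (2 * r) = QX ^ r" using r QX0 by (intro real_root_pow_pos2) auto
  finally show "(\<Sum>\<alpha>\<in>torus k (p ^ (k * N)). fab p k N \<phi> v X \<alpha> ^ (2 * rr k)) \<le>
      (root (2 * rr k) d + real_of_int p * root (2 * rr k) (real_of_int p ^ 2 * c)) ^ (2 * rr k) * qsum p k N \<phi> v X ^ rr k"
    unfolding A_def r_def QX_def by simp
qed

section \<open>Orthogonality and decoupling in dimension one\<close>

lemma ee_eq_1_iff: "ee x = 1 \<longleftrightarrow> x \<in> \<int>"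
proof
  assume "ee x = 1"
  then have "cos (2 * pi * x) = 1" by (auto simp: ee_def cis_def complex_eq_iff)
  then obtain n :: int where "2 * pi * x = of_int n * 2 * pi" by (auto simp: cos_one_2pi_int)
  then have "x = of_int n" by simp
  then show "x \<in> \<int>" by simp
qed (auto elim!: Ints_cases)

lemma emod_eq_1_iff: "0 < q \<Longrightarrow> emod q m = 1 \<longleftrightarrow> q dvd m"
proof -
  assume q: "0 < q"
  have "of_int m / of_int q \<in> (\<int> :: real set) \<longleftrightarrow> q dvd m"
  proof
    assume "of_int m / of_int q \<in> (\<int> :: real set)"
    then obtain n where "of_int m / of_int q = (of_int n :: real)" by (auto elim: Ints_cases)
    then have "(of_int m :: real) = of_int (n * q)" using q by (simp add: field_simps)
    then show "q dvd m" by (simp only: of_int_eq_iff) simp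
  next
    assume "q dvd m"
    then show "of_int m / of_int q \<in> (\<int> :: real set)" using q by (auto simp: dvd_def)
  qed
  then show ?thesis unfolding emod_def ee_eq_1_iff .
qed

lemma emod_power: "emod q m ^ n = emod q (int n * m)"
  unfolding emod_def ee_power by simp

lemma sum_emod:
  assumes q: "0 < q"
  shows "(\<Sum>t\<in>{0..<q}. emod q (t * m)) = (if q dvd m then of_int q else 0)"
proof -
  have "(\<Sum>t\<in>{0..<q}. emod q (t * m)) = (\<Sum>t<nat q. emod q m ^ t)"
    unfolding emod_power by (rule sum.reindex_bij_witness[of _ int nat]) (use q in auto)
  also have "\<dots> = (if q dvd m then of_int q else 0)"
  proof (cases "q dvd m")
    case True
    then have "emod q m = 1" using emod_eq_1_iff[OF q] by simp
    then show ?thesis using True q by simp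
  next
    case False
    then have "emod q m \<noteq> 1" using emod_eq_1_iff[OF q] by simp
    moreover have "emod q m ^ nat q = 1" unfolding emod_power using q emod_eq_1_iff[OF q, of "q * m"] by simp
    ultimately show ?thesis using False by (simp add: geometric_sum)
  qed
  finally show ?thesis .
qed

lemma cnj_emod: "cnj (emod q m) = emod q (- m)"
  by (simp add: emod_def ee_minus[symmetric])

lemma norm_sum_square:
  "complex_of_real ((cmod (\<Sum>i\<in>I. g i))\<^sup>2) = (\<Sum>i\<in>I. \<Sum>j\<in>I. g i * cnj (g j))"
  unfolding complex_norm_square cnj_sum sum_product ..

lemma parseval:
  assumes q: "0 < q" and I: "finite I" and inj: "\<And>i j. i \<in> I \<Longrightarrow> j \<in> I \<Longrightarrow> q dvd m i - m j \<Longrightarrow> i = j"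
  shows "(\<Sum>t\<in>{0..<q}. (cmod (\<Sum>i\<in>I. c i * emod q (t * m i)))\<^sup>2) = of_int q * (\<Sum>i\<in>I. (cmod (c i))\<^sup>2)"
proof -
  have "complex_of_real (\<Sum>t\<in>{0..<q}. (cmod (\<Sum>i\<in>I. c i * emod q (t * m i)))\<^sup>2)
      = (\<Sum>t\<in>{0..<q}. \<Sum>i\<in>I. \<Sum>j\<in>I. c i * cnj (c j) * emod q (t * (m i - m j)))"
    unfolding of_real_sum norm_sum_square
    by (intro sum.cong refl) (simp add: cnj_emod emod_add[symmetric] algebra_simps)
  also have "\<dots> = (\<Sum>i\<in>I. \<Sum>j\<in>I. \<Sum>t\<in>{0..<q}. c i * cnj (c j) * emod q (t * (m i - m j)))"
    by (subst sum.swap, intro sum.cong refl sum.swap)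
  also have "\<dots> = (\<Sum>i\<in>I. \<Sum>j\<in>I. if i = j then of_int q * (c i * cnj (c j)) else 0)"
  proof (intro sum.cong refl)
    fix i j assume ij: "i \<in> I" "j \<in> I"
    show "(\<Sum>t\<in>{0..<q}. c i * cnj (c j) * emod q (t * (m i - m j))) = (if i = j then of_int q * (c i * cnj (c j)) else 0)"
      unfolding sum_distrib_left[symmetric] sum_emod[OF q] using inj[OF ij] by auto
  qed
  also have "\<dots> = complex_of_real (of_int q * (\<Sum>i\<in>I. (cmod (c i))\<^sup>2))"
    using I by (simp add: sum.delta sum_distrib_left complex_norm_square[symmetric])
  finally show ?thesis unfolding of_real_eq_iff .
qed

lemma poly_diff_dvd: "(x - y :: int) dvd poly g x - poly g y"
proof (induction g)
  case (pCons a g)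
  have "poly (pCons a g) x - poly (pCons a g) y = (x - y) * poly g x + y * (poly g x - poly g y)"
    by (simp add: algebra_simps)
  then show ?case using pCons.IH by simp
qed simp

text \<open>In dimension one the exponent is 2 and decoupling is Parseval's identity: \<phi> 1 = x +
  p g permutes the residue classes modulo p^N, so different classes have different
  frequencies.\<close>

lemma dec_1:
  assumes p: "prime p"
  shows "dec p 1 N 1"
  unfolding dec_alt
proof (intro allI impI)
  fix \<phi> :: "nat \<Rightarrow> int poly" and v :: "int \<Rightarrow> complex" and X :: "int set"
  assume \<phi>: "ncurve p 1 \<phi>" and X: "finite X"
  have p0: "0 < p" using p by (rule prime_gt_0_int)
  define q where "q = p ^ N"
  have q: "0 < q" using p0 by (simp add: q_def)
  have "\<forall>i. p dvd coeff (\<phi> 1 - monom 1 1) i"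
    using \<phi> by (auto simp: ncurve_def cong_iff_dvd_diff coeff_diff eq_commute[of "Suc 0"])
  then have "[:p:] dvd \<phi> 1 - monom 1 1" by (simp add: const_poly_dvd_iff)
  then obtain g where "\<phi> 1 - monom 1 1 = [:p:] * g" by (rule dvdE)
  then have g: "\<phi> 1 = monom 1 1 + smult p g" by (simp add: algebra_simps)
  have diff: "\<exists>s. poly (\<phi> 1) x - poly (\<phi> 1) y = (x - y) * (1 + p * s)" for x y
  proof -
    obtain s where "poly g x - poly g y = (x - y) * s"
      using poly_diff_dvd[of x y g] by (meson dvdE)
    moreover have "poly (\<phi> 1) x - poly (\<phi> 1) y = (x - y) + p * (poly g x - poly g y)"
      unfolding g by (simp add: poly_monom algebra_simps)
    ultimately have "poly (\<phi> 1) x - poly (\<phi> 1) y = (x - y) * (1 + p * s)"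
      by (simp only: distrib_left mult_1_right mult.left_commute)
    then show ?thesis ..
  qed
  have inj: "q dvd poly (\<phi> 1) x - poly (\<phi> 1) y \<longleftrightarrow> q dvd x - y" for x y
  proof -
    obtain s where s: "poly (\<phi> 1) x - poly (\<phi> 1) y = (x - y) * (1 + p * s)" using diff by blast
    have "coprime (1 + p * s) p"
    proof (rule coprimeI)
      fix d assume "d dvd 1 + p * s" "d dvd p"
      then have "d dvd 1 + p * s - p * s" by (intro dvd_diff) auto
      then show "is_unit d" by simp
    qed
    then have "coprime q (1 + p * s)" unfolding q_def by (simp add: coprime_commute)
    then show ?thesis unfolding s by (rule coprime_dvd_mult_left_iff)
  qed
  define F where "F Y t = (\<Sum>x\<in>Y. v x * emod q (t * poly (\<phi> 1) x))" for Y t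
  have tor: "(\<Sum>\<alpha>\<in>torus 1 (p ^ (1 * N)). fab p 1 N \<phi> v Y \<alpha> ^ (2 * rr 1)) = (\<Sum>t\<in>{0..<q}. (cmod (F Y t))\<^sup>2)" for Y
  proof (rule sum.reindex_bij_witness[of _ "\<lambda>t. \<lambda>j\<in>{1..1}. t" "\<lambda>\<alpha>. \<alpha> 1"])
  qed (auto simp: torus_def q_def PiE_def extensional_def fun_eq_iff fab_def esum_def F_def rr_def)
  \<comment> \<open>On a class modulo q the character is constant, so each of the finest pieces is a
    single frequency with this coefficient.\<close>
  define c where "c \<xi> = (\<Sum>x\<in>cell p N \<xi> X. v x)" for \<xi>
  have Fc: "F (cell p N \<xi> X) t = c \<xi> * emod q (t * poly (\<phi> 1) \<xi>)" for \<xi> t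
    unfolding F_def c_def sum_distrib_right
  proof (rule sum.cong[OF refl])
    fix x assume "x \<in> cell p N \<xi> X"
    then have "q dvd x - \<xi>" by (simp add: cell_def q_def cong_iff_dvd_diff)
    then have "[t * poly (\<phi> 1) x = t * poly (\<phi> 1) \<xi>] (mod q)"
      using inj[of x \<xi>] by (intro cong_mult cong_refl) (simp add: cong_iff_dvd_diff)
    then show "v x * emod q (t * poly (\<phi> 1) x) = v x * emod q (t * poly (\<phi> 1) \<xi>)"
      using q by (simp add: emod_cong)
  qed
  have FX: "F X t = (\<Sum>\<xi>\<in>{0..<q}. c \<xi> * emod q (t * poly (\<phi> 1) \<xi>))" for t
  proof -
    have "F X t = (\<Sum>\<xi>\<in>{0..<q}. \<Sum>x\<in>{x\<in>X. x mod q = \<xi>}. v x * emod q (t * poly (\<phi> 1) x))"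
      unfolding F_def by (subst sum.group) (use q X in auto)
    also have "\<dots> = (\<Sum>\<xi>\<in>{0..<q}. F (cell p N \<xi> X) t)"
      unfolding F_def by (intro sum.cong refl) (auto simp: cell_def cong_def q_def)
    finally show ?thesis unfolding Fc .
  qed
  have "(\<Sum>\<alpha>\<in>torus 1 (p ^ (1 * N)). fab p 1 N \<phi> v X \<alpha> ^ (2 * rr 1)) = of_int q * (\<Sum>\<xi>\<in>{0..<q}. (cmod (c \<xi>))\<^sup>2)"
    unfolding tor FX
  proof (rule parseval[OF q])
    fix i j assume ij: "i \<in> {0..<q}" "j \<in> {0..<q}" "q dvd poly (\<phi> 1) i - poly (\<phi> 1) j"
    then have "i mod q = j mod q" unfolding mod_eq_dvd_iff using inj by blast
    then show "i = j" using ij by simp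
  qed simp
  also have "\<dots> = qsum p 1 N \<phi> v X"
    unfolding qsum_def tor Fc using q by (simp add: norm_mult sum_distrib_left rr_def q_def)
  finally show "(\<Sum>\<alpha>\<in>torus 1 (p ^ (1 * N)). fab p 1 N \<phi> v X \<alpha> ^ (2 * rr 1)) \<le> 1 * qsum p 1 N \<phi> v X ^ rr 1"
    by (simp add: rr_def)
qed

lemma dec_mono:
  assumes "dec p k N c" "c \<le> c'" shows "dec p k N c'"
  unfolding dec_alt
proof (intro allI impI)
  fix \<phi> :: "nat \<Rightarrow> int poly" and v :: "int \<Rightarrow> complex" and X :: "int set"
  assume "ncurve p k \<phi>" "finite X"
  then have "(\<Sum>\<alpha>\<in>torus k (p ^ (k * N)). fab p k N \<phi> v X \<alpha> ^ (2 * rr k)) \<le> c * qsum p k N \<phi> v X ^ rr k"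
    using assms(1) unfolding dec_alt by blast
  also have "\<dots> \<le> c' * qsum p k N \<phi> v X ^ rr k" using assms(2) by (intro mult_right_mono) auto
  finally show "(\<Sum>\<alpha>\<in>torus k (p ^ (k * N)). fab p k N \<phi> v X \<alpha> ^ (2 * rr k)) \<le> c' * qsum p k N \<phi> v X ^ rr k" .
qed

lemma mb_mono:
  assumes "mb p k N l a b c" "c \<le> c'" shows "mb p k N l a b c'"
  unfolding mb_def
proof (intro allI impI)
  fix \<phi> :: "nat \<Rightarrow> int poly" and v :: "int \<Rightarrow> complex" and X :: "int set" and \<xi> \<eta> :: int
  assume h: "ncurve p k \<phi>" "finite X" "\<not> p dvd \<xi> - \<eta>"
  have "(\<Sum>\<alpha>\<in>torus k (p ^ (k * N)). fab p k N \<phi> v (cell p a \<xi> X) \<alpha> ^ (2 * rr l) *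
        fab p k N \<phi> v (cell p b \<eta> X) \<alpha> ^ (2 * (rr k - rr l)))
      \<le> c * (qsum p k N \<phi> v (cell p a \<xi> X) ^ rr l * qsum p k N \<phi> v (cell p b \<eta> X) ^ (rr k - rr l))"
    by (rule mbD[OF assms(1) h])
  also have "\<dots> \<le> c' * (qsum p k N \<phi> v (cell p a \<xi> X) ^ rr l * qsum p k N \<phi> v (cell p b \<eta> X) ^ (rr k - rr l))"
    using assms(2) by (intro mult_right_mono) auto
  finally show "(\<Sum>\<alpha>\<in>torus k (p ^ (k * N)). fab p k N \<phi> v (cell p a \<xi> X) \<alpha> ^ (2 * rr l) *
        fab p k N \<phi> v (cell p b \<eta> X) \<alpha> ^ (2 * (rr k - rr l)))
      \<le> c' * (qsum p k N \<phi> v (cell p a \<xi> X) ^ rr l * qsum p k N \<phi> v (cell p b \<eta> X) ^ (rr k - rr l))" .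
qed

section \<open>Iteration of the bilinear inequality and the decoupling exponent\<close>

definition decexp :: "int \<Rightarrow> nat \<Rightarrow> real \<Rightarrow> bool" where
  "decexp p k \<eta> \<longleftrightarrow> (\<exists>C\<ge>1. \<forall>N. dec p k N (C * real_of_int p powr (\<eta> * real N)))"

lemma powr_interpolate:
  assumes "0 < K" "0 < (P::real)"
  shows "(K * P powr x) powr \<theta> * (K * P powr y) powr (1 - \<theta>) = K * P powr (\<theta> * x + (1 - \<theta>) * y)"
proof -
  have "(K * P powr x) powr \<theta> * (K * P powr y) powr (1 - \<theta>) = (K powr \<theta> * K powr (1 - \<theta>)) * (P powr (x * \<theta>) * P powr (y * (1 - \<theta>)))"
    using assms by (simp add: powr_mult powr_powr mult_ac)
  also have "\<dots> = K * P powr (x * \<theta> + y * (1 - \<theta>))" using assms by (simp flip: powr_add)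
  finally show ?thesis by (simp add: mult.commute)
qed

text \<open>The factor on a class modulo p^a sees only an l-dimensional curve up to the scale
  a = (k - l + 1) b / l; demanding a high power of k! in b keeps this division exact when iterated.\<close>

definition ascale :: "nat \<Rightarrow> nat \<Rightarrow> nat \<Rightarrow> nat" where "ascale k l b = (k - l + 1) * b div l"

lemma ascale:
  assumes l: "1 \<le> l" "l < k" and b: "fact k dvd b" "1 \<le> b"
  shows "l * ascale k l b = (k - l + 1) * b" "1 \<le> ascale k l b" "ascale k l b \<le> k * b"
    "fact k ^ Suc R dvd b \<Longrightarrow> fact k ^ R dvd ascale k l b"
proof -
  have lk: "l dvd fact k" using l by (intro dvd_fact) auto
  then have lb: "l dvd b" using b(1) by (rule dvd_trans)
  then have "l dvd (k - l + 1) * b" by (rule dvd_mult)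
  then show 1: "l * ascale k l b = (k - l + 1) * b" unfolding ascale_def by (rule dvd_mult_div_cancel)
  then show "1 \<le> ascale k l b" using b(2) l by (cases "ascale k l b") auto
  have "ascale k l b \<le> (k - l + 1) * b" unfolding ascale_def by (rule div_le_dividend)
  also have "\<dots> \<le> k * b" using l by (intro mult_right_mono) auto
  finally show "ascale k l b \<le> k * b" .
  assume "fact k ^ Suc R dvd b"
  then have "l * fact k ^ R dvd b" using lk by (metis dvd_trans mult_dvd_mono dvd_refl power_Suc)
  then have "l * fact k ^ R dvd l * ascale k l b" unfolding 1 by simp
  then show "fact k ^ R dvd ascale k l b" using l by simp
qed

text \<open>Provides a <= a' for \<open>mb_lower\<close> in the term of index l - 1, where the first
  class starts at the scale belonging to l.\<close>

lemma ascale_mono: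
  assumes l: "1 \<le> l" "l < k" and b: "fact k dvd b" "1 \<le> b" and m: "2 \<le> l"
  shows "ascale k l b \<le> ascale k (l - 1) b"
proof -
  have "l * (l - 1) * ascale k l b = (l - 1) * ((k - l + 1) * b)"
    using ascale(1)[OF l b] by (simp add: mult_ac)
  also have "\<dots> \<le> l * ((k - (l - 1) + 1) * b)" by (intro mult_le_mono) auto
  also have "\<dots> = l * (l - 1) * ascale k (l - 1) b"
    using ascale(1)[of "l - 1" k b] l m b by (simp add: mult_ac)
  finally show ?thesis using m by simp
qed

text \<open>Provides a <= a' for \<open>mb_lower\<close> after the exchange of the classes; it
  amounts to l (k-l) <= (l+1) (k-l+1).\<close>

lemma ascale_swap:
  assumes l: "1 \<le> l" "l < k" and b: "fact k dvd b" "1 \<le> b" "fact k dvd ascale k l b"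
  shows "b \<le> ascale k (k - l) (ascale k l b)"
proof -
  have kl: "1 \<le> k - l" "k - l < k" using l by auto
  have "l * (k - l) * b \<le> (k - (k - l) + 1) * ((k - l + 1) * b)"
    unfolding mult.assoc[symmetric] using l by (intro mult_le_mono) auto
  also have "\<dots> = (k - (k - l) + 1) * (l * ascale k l b)" using ascale(1)[OF l b(1,2)] by simp
  also have "\<dots> = l * ((k - l) * ascale k (k - l) (ascale k l b))"
    unfolding ascale(1)[OF kl b(3) ascale(2)[OF l b(1,2)]] by (rule mult.left_commute)
  finally show ?thesis using l by (simp add: mult.assoc)
qed

text \<open>With m = k - l in the first part and m = l - 1 in the second, A m has coefficients
  1/(k-m) and 1 - 1/(k-m), which add up to 1. The term m = 0, where A is replaced by 1, is left over
  and equals 1 - 1/k. So each round adds the same amount to the sum.\<close>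

lemma weight_sum:
  fixes A :: "nat \<Rightarrow> real"
  assumes k: "2 \<le> k"
  shows "(\<Sum>l\<in>{1..<k}. A (k - l) / real l + real (k - l) / real (k - l + 1) * (if l = 1 then 1 else A (l - 1)))
     = real (k - 1) / real k + (\<Sum>l\<in>{1..<k}. A l)"
proof -
  define B where "B l = (if l = 0 then 1 else A l)" for l
  have "(\<Sum>l\<in>{1..<k}. A (k - l) / real l) = (\<Sum>m\<in>{1..<k}. A m / real (k - m))"
    by (rule sum.reindex_bij_witness[of _ "\<lambda>m. k - m" "\<lambda>l. k - l"]) auto
  moreover have "(\<Sum>l\<in>{1..<k}. real (k - l) / real (k - l + 1) * (if l = 1 then 1 else A (l - 1)))
      = (\<Sum>m\<in>{0..<k-1}. real (k - m - 1) / real (k - m) * B m)"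
    by (rule sum.reindex_bij_witness[of _ "\<lambda>m. m + 1" "\<lambda>l. l - 1"]) (auto simp: B_def)
  moreover have "(\<Sum>m\<in>{0..<k-1}. real (k - m - 1) / real (k - m) * B m) = (\<Sum>m\<in>{0..<k}. real (k - m - 1) / real (k - m) * B m)"
    by (rule sum.mono_neutral_left) auto
  moreover have "{0..<k} = insert 0 {1..<k}" using k by auto
  moreover have "(\<Sum>m\<in>{1..<k}. real (k - m - 1) / real (k - m) * B m) = (\<Sum>m\<in>{1..<k}. A m - A m / real (k - m))"
  proof (rule sum.cong[OF refl])
    fix m assume m: "m \<in> {1..<k}"
    then have "real (k - m - 1) = real (k - m) - 1" by auto
    then show "real (k - m - 1) / real (k - m) * B m = A m - A m / real (k - m)"
      using m by (simp add: B_def field_simps)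
  qed
  ultimately show ?thesis by (simp add: sum.distrib sum_subtractf B_def)
qed

text \<open>After R rounds the loss eta is incurred only on the length N - A l * b. The sum of the A l grows
  linearly in R, which is what eventually excludes a positive optimal eta.\<close>

definition itclaim :: "int \<Rightarrow> nat \<Rightarrow> real \<Rightarrow> nat \<Rightarrow> (nat \<Rightarrow> real) \<Rightarrow> bool" where
  "itclaim p k \<eta> R A \<longleftrightarrow> (\<forall>\<epsilon>>0. \<exists>C\<ge>1. \<forall>N b l. 1 \<le> b \<longrightarrow> fact k ^ Suc R dvd b \<longrightarrow> k ^ Suc R * b \<le> N \<longrightarrow>
     l \<in> {1..<k} \<longrightarrow> mb p k N l (ascale k l b) b (C * real_of_int p powr (\<eta> * (real N - A l * real b) + \<epsilon> * real N)))"

lemma itclaim_0: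
  assumes p: "prime p" and kp: "int k < p" and \<eta>: "0 \<le> \<eta>" "decexp p k \<eta>"
  shows "itclaim p k \<eta> 0 (\<lambda>_. 0)"
  unfolding itclaim_def
proof (intro allI impI)
  fix \<epsilon> :: real assume \<epsilon>: "0 < \<epsilon>"
  obtain C where C: "1 \<le> C" "\<And>N. dec p k N (C * real_of_int p powr (\<eta> * real N))" using \<eta>(2) by (auto simp: decexp_def)
  have p1: "1 < real_of_int p" using p by (simp add: prime_gt_1_int)
  show "\<exists>C\<ge>1. \<forall>N b l. 1 \<le> b \<longrightarrow> fact k ^ Suc 0 dvd b \<longrightarrow> k ^ Suc 0 * b \<le> N \<longrightarrow>
     l \<in> {1..<k} \<longrightarrow> mb p k N l (ascale k l b) b (C * real_of_int p powr (\<eta> * (real N - 0 * real b) + \<epsilon> * real N))"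
  proof (intro exI[of _ C] conjI allI impI C(1))
    fix N b l assume b: "1 \<le> b" "fact k ^ Suc 0 dvd b" "k ^ Suc 0 * b \<le> N" and l: "l \<in> {1..<k}"
    have fb: "fact k dvd b" using b(2) by simp
    have l': "1 \<le> l" "l < k" using l by auto
    have le: "C * real_of_int p powr (\<eta> * real (N - x)) \<le> C * real_of_int p powr (\<eta> * (real N - 0 * real b) + \<epsilon> * real N)" for x
    proof -
      have "\<eta> * real (N - x) \<le> \<eta> * real N" using \<eta> by (intro mult_left_mono) auto
      then have "\<eta> * real (N - x) \<le> \<eta> * (real N - 0 * real b) + \<epsilon> * real N" using \<epsilon> by (simp add: add_increasing2)
      then show ?thesis using C p1 by (intro mult_left_mono powr_mono) auto
    qed
    have bN: "b \<le> N"
    proof -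
      have "1 * b \<le> k * b" using l' by (intro mult_le_mono) auto
      moreover have "k * b \<le> N" using b(3) by simp
      ultimately show ?thesis by linarith
    qed
    have aN: "ascale k l b \<le> N" using ascale(3)[OF l' fb b(1)] b(3) by simp
    show "mb p k N l (ascale k l b) b (C * real_of_int p powr (\<eta> * (real N - 0 * real b) + \<epsilon> * real N))"
      by (rule mb_trivial[OF p kp l' ascale(2)[OF l' fb b(1)] aN b(1) bN dec_mono[OF C(2) le] dec_mono[OF C(2) le]])
         (use C in simp)
  qed
qed

text \<open>One round. With b' = \<open>ascale k l b\<close>, \<open>mb_holder\<close> leads to
  index k - l with the classes exchanged and to index l - 1. In each, \<open>mb_lower\<close>
  refines the first class to the scale at which the previous claim holds, at a cost of only
  p^(\<delta> N) because the dimension is below k. For l = 1 the second term is linear and saves b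
  whole scales, hence the value 1.\<close>

lemma itclaim_Suc:
  assumes p: "prime p" and kp: "int k < p" and k: "2 \<le> k" and \<eta>: "0 \<le> \<eta>" "decexp p k \<eta>"
    and IH: "\<And>l \<epsilon>. 1 \<le> l \<Longrightarrow> l < k \<Longrightarrow> 0 < \<epsilon> \<Longrightarrow> decexp p l \<epsilon>"
    and cl: "itclaim p k \<eta> R A"
  shows "itclaim p k \<eta> (Suc R) (\<lambda>l. A (k - l) / real l + real (k - l) / real (k - l + 1) * (if l = 1 then 1 else A (l - 1)))"
  unfolding itclaim_def
proof (intro allI impI)
  fix \<epsilon> :: real assume \<epsilon>: "0 < \<epsilon>"
  define \<delta> where "\<delta> = \<epsilon> / 2"
  have \<delta>: "0 < \<delta>" using \<epsilon> by (simp add: \<delta>_def)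
  define P where "P = real_of_int p"
  have P1: "1 < P" unfolding P_def using p by (simp add: prime_gt_1_int)
  obtain C0 where C0: "1 \<le> C0" "\<And>N. dec p k N (C0 * P powr (\<eta> * real N))"
    using \<eta>(2) by (auto simp: decexp_def P_def)
  obtain C1 where C1: "1 \<le> C1" "\<And>N b l. 1 \<le> b \<Longrightarrow> fact k ^ Suc R dvd b \<Longrightarrow> k ^ Suc R * b \<le> N \<Longrightarrow>
     l \<in> {1..<k} \<Longrightarrow> mb p k N l (ascale k l b) b (C1 * P powr (\<eta> * (real N - A l * real b) + \<delta> * real N))"
    using cl \<delta> unfolding itclaim_def P_def by blast
  have "\<forall>l\<in>{1..<k}. \<exists>C\<ge>1. \<forall>N. dec p l N (C * P powr (\<delta> * real N))"
    using IH[OF _ _ \<delta>] by (auto simp: decexp_def P_def)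
  then obtain D where D: "\<And>l. l \<in> {1..<k} \<Longrightarrow> 1 \<le> D l" "\<And>l N. l \<in> {1..<k} \<Longrightarrow> dec p l N (D l * P powr (\<delta> * real N))"
    by metis
  define C2 where "C2 = (\<Sum>l\<in>{1..<k}. D l)"
  have D2: "D l \<le> C2" if "l \<in> {1..<k}" for l
    unfolding C2_def by (rule member_le_sum) (use that D(1) in \<open>force+\<close>)
  have C2: "1 \<le> C2" using D2[of 1] D(1)[of 1] k by simp
  have dec2: "dec p l m (C2 * P powr (\<delta> * real N))" if "l \<in> {1..<k}" "m \<le> N" for l m N
  proof (rule dec_mono[OF D(2)[OF that(1)]])
    show "D l * P powr (\<delta> * real m) \<le> C2 * P powr (\<delta> * real N)"
      using D2[OF that(1)] D(1)[OF that(1)] that P1 \<delta> by (intro mult_mono powr_mono) auto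
  qed
  define K where "K = C2 * C1 * C0"
  have K1: "1 \<le> C2 * C1" using mult_mono[of 1 C2 1 C1] C1 C2 by simp
  then have K: "1 \<le> K" unfolding K_def using mult_mono[of 1 "C2 * C1" 1 C0] C0 by simp
  have KC: "C2 * C1 \<le> K" "C0 \<le> K" unfolding K_def
    using C0 K1 mult_left_mono[of 1 C0 "C2 * C1"] mult_right_mono[of 1 "C2 * C1" C0] by auto
  define A0 where "A0 l = (if l = 0 then 1 else A l)" for l
  show "\<exists>C\<ge>1. \<forall>N b l. 1 \<le> b \<longrightarrow> fact k ^ Suc (Suc R) dvd b \<longrightarrow> k ^ Suc (Suc R) * b \<le> N \<longrightarrow>
     l \<in> {1..<k} \<longrightarrow> mb p k N l (ascale k l b) b (C * real_of_int p powr (\<eta> * (real N -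
       (A (k - l) / real l + real (k - l) / real (k - l + 1) * (if l = 1 then 1 else A (l - 1))) * real b) + \<epsilon> * real N))"
  proof (intro exI[of _ K] conjI allI impI K)
    fix N b l assume b: "1 \<le> b" "fact k ^ Suc (Suc R) dvd b" "k ^ Suc (Suc R) * b \<le> N" and l: "l \<in> {1..<k}"
    have l': "1 \<le> l" "l < k" using l by auto
    have kl: "k - l \<in> {1..<k}" "1 \<le> k - l" "k - l < k" using l by auto
    have fb: "fact k dvd b" by (rule dvd_trans[OF _ b(2)]) simp
    have b2: "fact k ^ Suc R dvd b" by (rule dvd_trans[OF le_imp_power_dvd b(2)]) simp
    define b' where "b' = ascale k l b"
    note as = ascale[OF l' fb b(1), folded b'_def]
    have fb': "fact k ^ Suc R dvd b'" using as(4)[of "Suc R"] b(2) by simp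
    have fb'1: "fact k dvd b'" by (rule dvd_trans[OF _ fb']) simp
    \<comment> \<open>A round enlarges scales at most by the factor k; one power of k in the bound
      on b is used up for it.\<close>
    have kN: "k ^ Suc R * b' \<le> N" "k ^ Suc R * b \<le> N" "k * b' \<le> N" "b' \<le> N" "b \<le> N" "k * b \<le> N"
    proof -
      have "k ^ Suc R * b' \<le> k ^ Suc R * (k * b)" using as(3) by (intro mult_le_mono) auto
      also have "\<dots> = k ^ Suc (Suc R) * b" by simp
      finally show 1: "k ^ Suc R * b' \<le> N" using b(3) by (rule le_trans)
      have "k ^ Suc R * b \<le> k ^ Suc (Suc R) * b" using k by (intro mult_le_mono power_increasing) auto
      then show 2: "k ^ Suc R * b \<le> N" using b(3) by (rule le_trans)
      have kk: "k \<le> k ^ Suc R" using k by simp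
      then show 3: "k * b' \<le> N" using 1 by (meson le_trans mult_le_mono1)
      show 4: "k * b \<le> N" using 2 kk by (meson le_trans mult_le_mono1)
      show "b' \<le> N" using 3 k by (metis le_trans mult_le_mono1 nat_mult_1 one_le_numeral)
      show "b \<le> N" using 4 k by (metis le_trans mult_le_mono1 nat_mult_1 one_le_numeral)
    qed
    define X1 where "X1 = \<eta> * (real N - A (k - l) * real b') + \<delta> * real N + \<delta> * real N"
    define X2 where "X2 = \<eta> * (real N - A0 (l - 1) * real b) + \<delta> * real N + \<delta> * real N"
    have M1: "mb p k N (k - l) b b' (K * P powr X1)"
    proof -
      let ?a = "ascale k (k - l) b'"
      have a2: "b \<le> ?a" unfolding b'_def by (rule ascale_swap[OF l' fb b(1) fb'1[unfolded b'_def]])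
      have a3: "?a \<le> N" using ascale(3)[OF kl(2,3) fb'1 as(2)] kN(3) by simp
      have "mb p k N (k - l) b b' (C2 * P powr (\<delta> * real N) * (C1 * P powr (\<eta> * (real N - A (k - l) * real b') + \<delta> * real N)))"
      proof (rule mb_lower[OF p kp kl(2,3) b(1) a2 kN(4) _ dec2[OF kl(1)] _ C1(2)[OF as(2) fb' kN(1) kl(1)] _ a3])
        show "(k - l) * ?a \<le> (k - (k - l) + 1) * b'" using ascale(1)[OF kl(2,3) fb'1 as(2)] by simp
        show "?a - b \<le> N" using a3 by simp
      qed (use C1 C2 in auto)
      then show ?thesis
      proof (rule mb_mono)
        have "C2 * P powr (\<delta> * real N) * (C1 * P powr (\<eta> * (real N - A (k - l) * real b') + \<delta> * real N)) = C2 * C1 * P powr X1"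
          unfolding X1_def powr_add by (simp only: mult_ac)
        also have "\<dots> \<le> K * P powr X1" using KC by (intro mult_right_mono) auto
        finally show "C2 * P powr (\<delta> * real N) * (C1 * P powr (\<eta> * (real N - A (k - l) * real b') + \<delta> * real N)) \<le> K * P powr X1" .
      qed
    qed
    have M2: "mb p k N (l - 1) b' b (K * P powr X2)"
    proof (cases "l = 1")
      case True
      have "dec p k (N - b) (K * P powr X2)"
      proof (rule dec_mono[OF C0(2)])
        have "\<eta> * real (N - b) = \<eta> * (real N - A0 (l - 1) * real b)" using True kN(5) by (simp add: A0_def of_nat_diff)
        also have "\<dots> \<le> X2" unfolding X2_def using \<delta> by simp
        finally show "C0 * P powr (\<eta> * real (N - b)) \<le> K * P powr X2"
          using KC C0 P1 by (intro mult_mono powr_mono) auto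
      qed
      then show ?thesis using True K k
        by (simp add: mb_0[OF p kp _ b(1) kN(5)])
    next
      case False
      then have l2: "2 \<le> l" "l - 1 \<in> {1..<k}" "1 \<le> l - 1" "l - 1 < k" using l by auto
      let ?a = "ascale k (l - 1) b"
      have a2: "b' \<le> ?a" unfolding b'_def by (rule ascale_mono[OF l' fb b(1) l2(1)])
      have a3: "?a \<le> N" using ascale(3)[OF l2(3,4) fb b(1)] kN(6) by simp
      have "mb p k N (l - 1) b' b (C2 * P powr (\<delta> * real N) * (C1 * P powr (\<eta> * (real N - A (l - 1) * real b) + \<delta> * real N)))"
      proof (rule mb_lower[OF p kp l2(3,4) as(2) a2 kN(5) _ dec2[OF l2(2)] _ C1(2)[OF b(1) b2 kN(2) l2(2)] _ a3])
        show "(l - 1) * ?a \<le> (k - (l - 1) + 1) * b" using ascale(1)[OF l2(3,4) fb b(1)] by simp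
        show "?a - b' \<le> N" using a3 by simp
      qed (use C1 C2 in auto)
      then show ?thesis
      proof (rule mb_mono)
        have "C2 * P powr (\<delta> * real N) * (C1 * P powr (\<eta> * (real N - A (l - 1) * real b) + \<delta> * real N)) = C2 * C1 * P powr X2"
          unfolding X2_def A0_def powr_add using l2 by (simp add: mult_ac del: powr_add)
        also have "\<dots> \<le> K * P powr X2" using KC by (intro mult_right_mono) auto
        finally show "C2 * P powr (\<delta> * real N) * (C1 * P powr (\<eta> * (real N - A (l - 1) * real b) + \<delta> * real N)) \<le> K * P powr X2" .
      qed
    qed
    define \<theta> where "\<theta> = 1 / real (k - l + 1)"
    have \<theta>': "real (k - l) / real (k - l + 1) = 1 - \<theta>" using l by (simp add: \<theta>_def field_simps)
    \<comment> \<open>Since l b' = (k-l+1) b, the saving at the larger scale b' weighted by \<theta>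
      counts as b / l, the first coefficient of the recursion.\<close>
    have bb: "\<theta> * real b' = real b / real l"
    proof -
      have "real l * real b' = real (k - l + 1) * real b" using as(1) by (metis of_nat_mult)
      then show ?thesis using l' unfolding \<theta>_def by (simp add: field_simps)
    qed
    have "mb p k N l b' b ((K * P powr X1) powr (1 / real (k - l + 1)) * (K * P powr X2) powr (real (k - l) / real (k - l + 1)))"
      using K by (intro mb_holder[OF l' M1 _ M2]) auto
    also have "(K * P powr X1) powr (1 / real (k - l + 1)) * (K * P powr X2) powr (real (k - l) / real (k - l + 1))
       = K * P powr (\<theta> * X1 + (1 - \<theta>) * X2)"
      unfolding \<theta>' unfolding \<theta>_def[symmetric] using K P1 by (intro powr_interpolate) auto
    also have "\<theta> * X1 + (1 - \<theta>) * X2 = \<eta> * (real N - (A (k - l) * (\<theta> * real b') + (1 - \<theta>) * A0 (l - 1) * real b)) + \<epsilon> * real N"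
      by (simp add: X1_def X2_def \<delta>_def algebra_simps)
    also have "A (k - l) * (\<theta> * real b') + (1 - \<theta>) * A0 (l - 1) * real b
       = (A (k - l) / real l + real (k - l) / real (k - l + 1) * (if l = 1 then 1 else A (l - 1))) * real b"
      unfolding bb \<theta>' using l' by (simp add: A0_def algebra_simps)
    finally show "mb p k N l (ascale k l b) b (K * real_of_int p powr (\<eta> * (real N -
       (A (k - l) / real l + real (k - l) / real (k - l + 1) * (if l = 1 then 1 else A (l - 1))) * real b) + \<epsilon> * real N))"
      unfolding b'_def P_def .
  qed
qed

lemma itclaim_ex:
  assumes p: "prime p" and kp: "int k < p" and k: "2 \<le> k" and \<eta>: "0 \<le> \<eta>" "decexp p k \<eta>"
    and IH: "\<And>l \<epsilon>. 1 \<le> l \<Longrightarrow> l < k \<Longrightarrow> 0 < \<epsilon> \<Longrightarrow> decexp p l \<epsilon>"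
  shows "\<exists>A. (\<Sum>l\<in>{1..<k}. A l) = real R * (real (k - 1) / real k) \<and> itclaim p k \<eta> R A"
proof (induction R)
  case 0
  show ?case by (rule exI[of _ "\<lambda>_. 0"]) (simp add: itclaim_0[OF p kp \<eta>])
next
  case (Suc R)
  then obtain A where A: "(\<Sum>l\<in>{1..<k}. A l) = real R * (real (k - 1) / real k)" "itclaim p k \<eta> R A" by blast
  have "itclaim p k \<eta> (Suc R) (\<lambda>l. A (k - l) / real l + real (k - l) / real (k - l + 1) * (if l = 1 then 1 else A (l - 1)))"
    by (rule itclaim_Suc[OF p kp k \<eta> IH A(2)])
  moreover have "(\<Sum>l\<in>{1..<k}. A (k - l) / real l + real (k - l) / real (k - l + 1) * (if l = 1 then 1 else A (l - 1)))
      = real (Suc R) * (real (k - 1) / real k)"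
    unfolding weight_sum[OF k] A(1) of_nat_Suc unfolding distrib_right by simp
  ultimately show ?case by blast
qed

text \<open>By \<open>dec_step\<close> the roots of order n = 2 rr k of the constants satisfy D(N)
  <= D(N-1) + L E^N with E = p^(\<eta>/n) > 1. The geometric series is of the order of its last
  term, so the linear exponent is no worse than the bilinear one.\<close>

lemma decexp_induct:
  assumes p: "prime p" and kp: "int k < p" and l: "1 \<le> l" "l < k" and \<eta>: "0 < \<eta>" and K: "0 \<le> K"
    and mb: "\<And>N. N0 \<le> N \<Longrightarrow> mb p k N l 1 1 (K * real_of_int p powr (\<eta> * real N))" and N0: "1 \<le> N0"
  shows "decexp p k \<eta>"
proof -
  define P where "P = real_of_int p"
  have P1: "1 < P" unfolding P_def using p by (simp add: prime_gt_1_int)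
  define n where "n = 2 * rr k"
  have n: "0 < n" using rr_pos[of k] l by (simp add: n_def)
  define E where "E = P powr (\<eta> / real n)"
  have E1: "1 < E" unfolding E_def using P1 \<eta> n by (intro gr_one_powr) auto
  have EN: "P powr (\<eta> * real N) = (E ^ N) ^ n" for N
    unfolding E_def using P1 n by (simp add: powr_power mult.commute)
  define L where "L = P * root n (P ^ 2 * K)"
  have L0: "0 \<le> L" unfolding L_def using P1 K by (intro mult_nonneg_nonneg real_root_ge_zero) auto
  \<comment> \<open>The second summand gives G / E + L <= G, which closes the recursion; the first
    covers N < N0 by the trivial bound.\<close>
  define G where "G = P ^ N0 + L * E / (E - 1)"
  have GP: "P ^ N0 \<le> G" unfolding G_def using L0 E1 by simp
  have G1: "1 \<le> G" using GP P1 by (meson le_less_trans less_imp_le not_le one_le_power order_trans)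
  have GL: "G / E + L \<le> G"
  proof -
    have "L * E = (L * E / (E - 1)) * (E - 1)" using E1 by simp
    also have "\<dots> \<le> G * (E - 1)" unfolding G_def using E1 P1 by (intro mult_right_mono) auto
    finally show ?thesis using E1 by (simp add: field_simps)
  qed
  have main: "dec p k N ((G * E ^ N) ^ n)" for N
  proof (induction N)
    case 0
    have "dec p k 0 (real_of_int p ^ (0 * (2 * rr k)))" using p l by (intro dec_trivial) (auto simp: prime_gt_0_int)
    then show ?case by (rule dec_mono) (use G1 in simp)
  next
    case (Suc N)
    show ?case
    proof (cases "N0 \<le> Suc N")
      case False
      have "dec p k (Suc N) (real_of_int p ^ (Suc N * (2 * rr k)))" using p l by (intro dec_trivial) (auto simp: prime_gt_0_int)
      then show ?thesis
      proof (rule dec_mono)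
        have "P ^ Suc N \<le> P ^ N0" using P1 False by (intro power_increasing) auto
        also have "\<dots> \<le> G * 1" using GP by simp
        also have "\<dots> \<le> G * E ^ Suc N" using G1 E1 by (intro mult_left_mono one_le_power) auto
        finally have "(P ^ Suc N) ^ n \<le> (G * E ^ Suc N) ^ n" using P1 by (intro power_mono) auto
        then show "real_of_int p ^ (Suc N * (2 * rr k)) \<le> (G * E ^ Suc N) ^ n"
          by (simp only: P_def n_def power_mult)
      qed
    next
      case True
      have "dec p k (Suc N) ((root (2 * rr k) ((G * E ^ N) ^ n) + real_of_int p * root (2 * rr k) (real_of_int p ^ 2 * (K * real_of_int p powr (\<eta> * real (Suc N))))) ^ (2 * rr k))"
        using Suc.IH K G1 E1 by (intro dec_step[OF p kp l _ _ _ mb[OF True]]) auto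
      then show ?thesis
      proof (rule dec_mono)
        have "root n ((G * E ^ N) ^ n) = G * E ^ N" using n G1 E1 by (intro real_root_power_cancel) auto
        moreover have "P * root n (P ^ 2 * (K * P powr (\<eta> * real (Suc N)))) = L * E ^ Suc N"
          unfolding EN mult.assoc[symmetric] real_root_mult[of n _ "(E ^ Suc N) ^ n"] L_def
          using n E1 by (simp add: real_root_power_cancel del: power_Suc)
        ultimately have "root n ((G * E ^ N) ^ n) + P * root n (P ^ 2 * (K * P powr (\<eta> * real (Suc N)))) = (G / E + L) * E ^ Suc N"
          using E1 by (simp add: field_simps)
        also have "\<dots> \<le> G * E ^ Suc N" using GL E1 by (intro mult_right_mono) auto
        finally show "(root (2 * rr k) ((G * E ^ N) ^ n) + real_of_int p * root (2 * rr k) (real_of_int p ^ 2 * (K * real_of_int p powr (\<eta> * real (Suc N))))) ^ (2 * rr k)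
          \<le> (G * E ^ Suc N) ^ n"
          unfolding P_def n_def using P1 G1 E1 K
          by (intro power_mono) (auto intro!: add_nonneg_nonneg mult_nonneg_nonneg real_root_ge_zero simp: P_def)
      qed
    qed
  qed
  show ?thesis unfolding decexp_def
  proof (intro exI[of _ "G ^ n"] conjI allI)
    show "1 \<le> G ^ n" using G1 by simp
    show "dec p k N (G ^ n * real_of_int p powr (\<eta> * real N))" for N
      using main[of N] unfolding P_def[symmetric] EN power_mult_distrib .
  qed
qed

text \<open>The iteration saves p^(\<eta> A b) with A >= R/k for some index, against the loss p^(2
  rr k b) of \<open>mb_split\<close>. As R is determined by k and \<eta>0, the net saving is at
  least p^b for all \<eta> >= \<eta>0 at once, with b a fixed proportion of N. This uniformity is
  what the infimum argument requires.\<close>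

lemma decexp_improve:
  assumes p: "prime p" and kp: "int k < p" and k: "2 \<le> k" and \<eta>0: "0 < \<eta>0"
    and IH: "\<And>l \<epsilon>. 1 \<le> l \<Longrightarrow> l < k \<Longrightarrow> 0 < \<epsilon> \<Longrightarrow> decexp p l \<epsilon>"
  shows "\<exists>\<kappa>>0. \<forall>\<eta>\<ge>\<eta>0. decexp p k \<eta> \<longrightarrow> decexp p k (max (\<eta> - \<kappa>) (\<eta>0 / 2))"
proof -
  obtain R :: nat where "real k * (real (2 * rr k) + 1) / \<eta>0 \<le> real R" using real_arch_simple by blast
  then have R: "real (2 * rr k) + 1 \<le> \<eta>0 * (real R / real k)" using \<eta>0 k by (simp add: field_simps)
  define \<kappa> where "\<kappa> = 1 / real (k ^ Suc R)"
  have \<kappa>: "0 < \<kappa>" using k by (simp add: \<kappa>_def)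
  define P where "P = real_of_int p"
  have P1: "1 < P" unfolding P_def using p by (simp add: prime_gt_1_int)
  have p0: "0 < p" using p by (rule prime_gt_0_int)
  have "decexp p k (max (\<eta> - \<kappa> / 2) (\<eta>0 / 2))" if \<eta>: "\<eta>0 \<le> \<eta>" "decexp p k \<eta>" for \<eta>
  proof -
    \<comment> \<open>The maximum keeps the new exponent positive, as \<open>decexp_induct\<close>
      demands.\<close>
    define \<eta>' where "\<eta>' = max (\<eta> - \<kappa> / 2) (\<eta>0 / 2)"
    have \<eta>': "0 < \<eta>'" using \<eta>0 by (simp add: \<eta>'_def)
    have \<eta>00: "0 \<le> \<eta>" using \<eta> \<eta>0 by simp
    obtain A where A: "(\<Sum>l\<in>{1..<k}. A l) = real R * (real (k - 1) / real k)" "itclaim p k \<eta> R A"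
      using itclaim_ex[OF p kp k \<eta>00 \<eta>(2) IH] by blast
    \<comment> \<open>R/k is the mean of the k - 1 numbers A l.\<close>
    have "\<exists>l\<in>{1..<k}. real R / real k \<le> A l"
    proof (rule ccontr)
      assume "\<not> ?thesis"
      then have "(\<Sum>l\<in>{1..<k}. A l) < (\<Sum>l\<in>{1..<k}. real R / real k)"
        using k by (intro sum_strict_mono) (auto simp: not_le)
      moreover have "(\<Sum>l\<in>{1..<k}. real R / real k) = real R * (real (k - 1) / real k)" by simp
      ultimately show False using A(1) by linarith
    qed
    then obtain l where l: "l \<in> {1..<k}" "real R / real k \<le> A l" by blast
    have l': "1 \<le> l" "l < k" using l by auto
    \<comment> \<open>Two losses p^(\<epsilon> N) occur, one in the claim and one in the
      l-dimensional constant; together they consume half of \<kappa>.\<close>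
    define \<epsilon> where "\<epsilon> = \<kappa> / 4"
    have \<epsilon>: "0 < \<epsilon>" using \<kappa> by (simp add: \<epsilon>_def)
    obtain C where C: "1 \<le> C" "\<And>N b l. 1 \<le> b \<Longrightarrow> fact k ^ Suc R dvd b \<Longrightarrow> k ^ Suc R * b \<le> N \<Longrightarrow>
     l \<in> {1..<k} \<Longrightarrow> mb p k N l (ascale k l b) b (C * P powr (\<eta> * (real N - A l * real b) + \<epsilon> * real N))"
      using A(2) \<epsilon> unfolding itclaim_def P_def by blast
    obtain D where D: "1 \<le> D" "\<And>N. dec p l N (D * P powr (\<epsilon> * real N))"
      using IH[OF l' \<epsilon>] by (auto simp: decexp_def P_def)
    define B :: nat where "B = fact k ^ Suc R"
    define N0 where "N0 = B * k ^ Suc R"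
    have B1: "1 \<le> B" "1 \<le> N0" using k by (auto simp: B_def N0_def)
    have "mb p k N l 1 1 (D * C * P powr real B * P powr (\<eta>' * real N))" if N: "N0 \<le> N" for N
    proof -
      \<comment> \<open>About N / k^(R+1) = \<kappa> N, rounded down to a multiple of B so that the
        divisions in \<open>ascale\<close> are exact.\<close>
      define b where "b = B * (N div N0)"
      have "1 \<le> N div N0" using N B1 by (simp add: div_greater_zero_iff Suc_le_eq)
      then have b1: "1 \<le> b" unfolding b_def using B1 by (metis mult_le_mono nat_mult_1)
      have bd: "fact k ^ Suc R dvd b" unfolding b_def B_def by simp
      have fb: "fact k dvd b" by (rule dvd_trans[OF _ bd]) simp
      have "k ^ Suc R * b = N0 * (N div N0)" by (simp add: b_def N0_def)
      then have bN: "k ^ Suc R * b \<le> N" by simp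
      have "k * b \<le> k ^ Suc R * b" using k by (intro mult_le_mono) auto
      then have kb: "k * b \<le> N" using bN by (rule le_trans)
      have b2: "b \<le> N"
      proof -
        have "1 * b \<le> k * b" using k by (intro mult_le_mono) auto
        then show ?thesis using kb by linarith
      qed
      note as = ascale[OF l' fb b1]
      have aN: "ascale k l b \<le> N" using as(3) kb by (rule le_trans)
      let ?d = "D * P powr (\<epsilon> * real N)" and ?c = "C * P powr (\<eta> * (real N - A l * real b) + \<epsilon> * real N)"
      have "dec p l (ascale k l b - 1) ?d"
        by (rule dec_mono[OF D(2)]) (use D P1 \<epsilon> aN in \<open>auto intro!: mult_left_mono powr_mono\<close>)
      then have "mb p k N l 1 b (?d * ?c)"
        using D C by (intro mb_lower[OF p kp l' _ as(2) b2 _ _ _ C(2)[OF b1 bd bN l(1)] _ aN]) (auto simp: as(1))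
      then have "mb p k N l 1 1 (real_of_int p ^ (b * (2 * rr k)) * (?d * ?c))"
        using D C k by (intro mb_split[OF p0 _ l'(2) b1 b2]) auto
      then show ?thesis
      proof (rule mb_mono)
        have "real_of_int p ^ (b * (2 * rr k)) = P powr (real b * real (2 * rr k))"
          using P1 by (simp add: P_def powr_realpow[symmetric])
        then have "real_of_int p ^ (b * (2 * rr k)) * (?d * ?c) = D * C * P powr (real b * real (2 * rr k) + \<epsilon> * real N + (\<eta> * (real N - A l * real b) + \<epsilon> * real N))"
          unfolding powr_add by (simp only: mult_ac)
        also have "\<dots> \<le> D * C * P powr (real B + \<eta>' * real N)"
        proof (intro mult_left_mono powr_mono)
          have "\<eta>0 * (real R / real k) \<le> \<eta> * A l" using \<eta> \<eta>0 l by (intro mult_mono) auto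
          then have "real (2 * rr k) + 1 \<le> \<eta> * A l" using R by linarith
          then have "real b * (real (2 * rr k) + 1) \<le> real b * (\<eta> * A l)" by (intro mult_left_mono) auto
          then have "real b * real (2 * rr k) + \<epsilon> * real N + (\<eta> * (real N - A l * real b) + \<epsilon> * real N)
            \<le> (\<eta> + \<kappa> / 2) * real N - real b"
            by (simp add: \<epsilon>_def algebra_simps)
          also have "\<kappa> * real N - real B \<le> real b"
          proof -
            have "N < N0 + (N div N0) * N0" using B1(2) by (intro dividend_less_div_times) auto
            then have "real N \<le> real (N0 + (N div N0) * N0)" by (simp only: of_nat_le_iff)
            then have "real N / real N0 - 1 \<le> real (N div N0)" using B1(2) by (simp add: field_simps)
            then have "real B * (real N / real N0 - 1) \<le> real b" unfolding b_def of_nat_mult by (intro mult_left_mono) auto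
            moreover have "real B * (real N / real N0 - 1) = \<kappa> * real N - real B"
              using B1 unfolding N0_def \<kappa>_def by (simp add: right_diff_distrib)
            ultimately show ?thesis by simp
          qed
          then have "(\<eta> + \<kappa> / 2) * real N - real b \<le> real B + (\<eta> - \<kappa> / 2) * real N" by (simp add: algebra_simps)
          also have "\<dots> \<le> real B + \<eta>' * real N" unfolding \<eta>'_def by (intro add_left_mono mult_right_mono) auto
          finally show "real b * real (2 * rr k) + \<epsilon> * real N + (\<eta> * (real N - A l * real b) + \<epsilon> * real N) \<le> real B + \<eta>' * real N" .
        qed (use D C P1 in auto)
        also have "\<dots> = D * C * P powr real B * P powr (\<eta>' * real N)" by (simp add: powr_add mult_ac)
        finally show "real_of_int p ^ (b * (2 * rr k)) * (?d * ?c) \<le> D * C * P powr real B * P powr (\<eta>' * real N)" .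
      qed
    qed
    then show "decexp p k \<eta>'"
      using D C decexp_induct[OF p kp l' \<eta>' _ _ B1(2), where K = "D * C * P powr real B"] unfolding P_def by auto
  qed
  then show ?thesis using \<kappa> by (intro exI[of _ "\<kappa> / 2"]) auto
qed

text \<open>Induction on the dimension. The admissible exponents are closed upwards; were \<epsilon>
  not among them, their infimum would be positive, and an exponent within \<kappa> of the infimum
  could be improved past it.\<close>

theorem decexp_all:
  assumes p: "prime p"
  shows "1 \<le> k \<Longrightarrow> int k < p \<Longrightarrow> 0 < \<epsilon> \<Longrightarrow> decexp p k \<epsilon>"
proof (induction k arbitrary: \<epsilon> rule: less_induct)
  case (less k)
  have P1: "1 < real_of_int p" using p by (simp add: prime_gt_1_int)
  have up: "decexp p k y" if dx: "decexp p k x" and xy: "x \<le> y" for x y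
  proof -
    obtain C where C: "1 \<le> C" "\<And>N. dec p k N (C * real_of_int p powr (x * real N))" using dx unfolding decexp_def by blast
    have "dec p k N (C * real_of_int p powr (y * real N))" for N
    proof (rule dec_mono[OF C(2)])
      have "x * real N \<le> y * real N" using xy by (rule mult_right_mono) simp
      then have "real_of_int p powr (x * real N) \<le> real_of_int p powr (y * real N)" using P1 by (intro powr_mono) auto
      then show "C * real_of_int p powr (x * real N) \<le> C * real_of_int p powr (y * real N)" using C(1) by (intro mult_left_mono) auto
    qed
    then show ?thesis using C(1) by (auto simp: decexp_def)
  qed
  show ?case
  proof (cases "k = 1")
    case True
    have "decexp p 1 0" unfolding decexp_def using dec_1[OF p] P1 by (intro exI[of _ 1]) auto
    then show ?thesis using up[of 0 \<epsilon>] True less.prems by simp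
  next
    case False
    then have k: "2 \<le> k" using less.prems by simp
    have kp: "int k < p" using less.prems by simp
    have IH: "decexp p l \<delta>" if "1 \<le> l" "l < k" "0 < \<delta>" for l \<delta>
      using less.IH[OF that(2,1)] that kp by simp
    show ?thesis
    proof (rule ccontr)
      assume neg: "\<not> decexp p k \<epsilon>"
      define S where "S = {x. decexp p k x}"
      have "decexp p k (real (2 * rr k))"
        unfolding decexp_def
      proof (intro exI[of _ 1] conjI allI)
        show "dec p k N (1 * real_of_int p powr (real (2 * rr k) * real N))" for N
        proof -
          have "real_of_int p powr (real (2 * rr k) * real N) = real_of_int p ^ (N * (2 * rr k))"
            using P1 by (simp add: powr_realpow[symmetric] mult.commute)
          then show ?thesis using dec_trivial[of p k N] p k by (simp add: prime_gt_0_int)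
        qed
      qed simp
      then have Sne: "S \<noteq> {}" by (auto simp: S_def)
      have lb: "\<epsilon> \<le> x" if "x \<in> S" for x
        using up[of x \<epsilon>] neg that by (cases "x \<le> \<epsilon>") (auto simp: S_def)
      then have bdd: "bdd_below S" by (auto simp: bdd_below_def)
      define \<eta>0 where "\<eta>0 = Inf S"
      have "\<epsilon> \<le> \<eta>0" unfolding \<eta>0_def using Sne lb by (intro cInf_greatest) auto
      then have \<eta>0: "0 < \<eta>0" using less.prems by simp
      have low: "\<eta>0 \<le> x" if "x \<in> S" for x unfolding \<eta>0_def using that bdd by (rule cInf_lower)
      obtain \<kappa> where \<kappa>: "0 < \<kappa>" "\<And>\<eta>. \<eta>0 \<le> \<eta> \<Longrightarrow> decexp p k \<eta> \<Longrightarrow> decexp p k (max (\<eta> - \<kappa>) (\<eta>0 / 2))"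
        using decexp_improve[OF p kp k \<eta>0 IH] by blast
      obtain x where x: "x \<in> S" "x < \<eta>0 + \<kappa>"
        using cInf_less_iff[OF Sne bdd, of "\<eta>0 + \<kappa>"] \<kappa>(1) unfolding \<eta>0_def by auto
      have "decexp p k (max (x - \<kappa>) (\<eta>0 / 2))" using \<kappa>(2)[OF low[OF x(1)]] x(1) by (simp add: S_def)
      then have "\<eta>0 \<le> max (x - \<kappa>) (\<eta>0 / 2)" by (intro low) (simp add: S_def)
      then show False using x(2) \<eta>0 by auto
    qed
  qed
qed

section \<open>The mean value theorem\<close>

definition tup :: "nat \<Rightarrow> 'a set \<Rightarrow> 'a list set" where "tup n A = {xs. set xs \<subseteq> A \<and> length xs = n}"

lemma finite_tup [simp]: "finite A \<Longrightarrow> finite (tup n A)"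
  unfolding tup_def by (rule finite_lists_length_eq)

lemma sum_power_tup:
  fixes g :: "'a \<Rightarrow> 'b::comm_semiring_1"
  assumes "finite A"
  shows "(\<Sum>x\<in>A. g x) ^ n = (\<Sum>xs\<in>tup n A. prod_list (map g xs))"
proof (induction n)
  case 0
  have "tup 0 A = {[]}" by (auto simp: tup_def)
  then show ?case by simp
next
  case (Suc n)
  have "(\<Sum>xs\<in>tup (Suc n) A. prod_list (map g xs)) = (\<Sum>(xs, x)\<in>tup n A \<times> A. prod_list (map g (x # xs)))"
    unfolding tup_def lists_length_Suc_eq by (subst sum.reindex) (auto simp: inj_on_def case_prod_unfold)
  also have "\<dots> = (\<Sum>xs\<in>tup n A. \<Sum>x\<in>A. g x * prod_list (map g xs))"
    by (simp add: sum.cartesian_product)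
  also have "\<dots> = (\<Sum>x\<in>A. g x) * (\<Sum>xs\<in>tup n A. prod_list (map g xs))"
    unfolding sum_distrib_right[symmetric] sum_distrib_left[symmetric] ..
  finally show ?case using Suc.IH by simp
qed

lemma prod_list_emod: "prod_list (map (\<lambda>x. emod q (h x)) xs) = emod q (\<Sum>x\<leftarrow>xs. h x)"
  by (induction xs) (simp_all add: emod_add)

definition psum :: "nat \<Rightarrow> int list \<Rightarrow> int" where "psum j xs = (\<Sum>x\<leftarrow>xs. x ^ j)"

definition vset :: "nat \<Rightarrow> nat \<Rightarrow> nat \<Rightarrow> (int list \<times> int list) set" where
  "vset b k X = {(xs, ys) \<in> tup b {1..int X} \<times> tup b {1..int X}. \<forall>j\<in>{1..k}. psum j xs = psum j ys}"

lemma sum_list_scale_swap: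
  "(\<Sum>x\<leftarrow>xs. \<Sum>j\<in>J. \<alpha> j * (x::int) ^ j) = (\<Sum>j\<in>J. \<alpha> j * psum j xs)"
  by (induction xs) (simp_all add: psum_def distrib_left sum.distrib)

lemma prod_sum_torus:
  fixes g :: "nat \<Rightarrow> int \<Rightarrow> complex"
  shows "(\<Sum>\<alpha>\<in>torus k q. \<Prod>j\<in>{1..k}. g j (\<alpha> j)) = (\<Prod>j\<in>{1..k}. \<Sum>t\<in>{0..<q}. g j t)"
  unfolding torus_def by (rule prod_sum_PiE[symmetric]) auto

lemma emod_sum: "finite J \<Longrightarrow> emod q (\<Sum>j\<in>J. f j) = (\<Prod>j\<in>J. emod q (f j))"
  by (induction J rule: finite_induct) (simp_all add: emod_add)

lemma sum_torus_emod:
  assumes q: "0 < q"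
  shows "(\<Sum>\<alpha>\<in>torus k q. emod q (\<Sum>j\<in>{1..k}. \<alpha> j * d j)) = (if \<forall>j\<in>{1..k}. q dvd d j then of_int q ^ k else 0)"
proof -
  have "(\<Sum>\<alpha>\<in>torus k q. emod q (\<Sum>j\<in>{1..k}. \<alpha> j * d j)) = (\<Prod>j\<in>{1..k}. \<Sum>t\<in>{0..<q}. emod q (t * d j))"
    unfolding prod_sum_torus[symmetric] by (simp add: emod_sum)
  also have "\<dots> = (\<Prod>j\<in>{1..k}. if q dvd d j then of_int q else 0)"
    unfolding sum_emod[OF q] ..
  also have "\<dots> = (if \<forall>j\<in>{1..k}. q dvd d j then of_int q ^ k else 0)"
  proof (cases "\<forall>j\<in>{1..k}. q dvd d j")
    case True
    then have "(\<Prod>j\<in>{1..k}. if q dvd d j then of_int q else 0) = (\<Prod>j\<in>{1..k}. of_int q :: complex)"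
      by (intro prod.cong) auto
    then show ?thesis using True by simp
  qed (auto simp: prod_zero_iff)
  finally show ?thesis .
qed

lemma card_torus: "0 < q \<Longrightarrow> real (card (torus k q)) = of_int q ^ k"
  unfolding torus_def by (subst card_PiE) auto

text \<open>For X < p^N a class modulo p^N contains at most one of 1..X, so the right-hand side of
  decoupling is X^r times the number of grid points. The left-hand side counts solutions of the
  congruences modulo p^(k N), among which are all integral solutions. With N minimal, p^N is of
  order X and the loss p^(\<epsilon> N) becomes X^\<epsilon>.\<close>

theorem vinogradov_mean_value:
  assumes k: "1 \<le> k" and \<epsilon>: "0 < \<epsilon>"
  shows "\<exists>C\<ge>1. \<forall>X\<ge>1. real (card (vset (rr k) k X)) \<le> C * real X powr (real (rr k) + \<epsilon>)"
proof -
  obtain p' :: nat where p': "prime p'" "k < p'" using bigger_prime by blast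
  define p where "p = int p'"
  have p: "prime p" "int k < p" using p' by (auto simp: p_def)
  define P where "P = real_of_int p"
  have P1: "1 < P" unfolding P_def using p by (simp add: prime_gt_1_int)
  obtain C where C: "1 \<le> C" "\<And>N. dec p k N (C * P powr (\<epsilon> * real N))"
    using decexp_all[OF p(1) k p(2) \<epsilon>] unfolding decexp_def P_def by blast
  define r where "r = rr k"
  have r: "0 < r" unfolding r_def using k by (rule rr_pos)
  define K where "K = C * (P * real r) powr \<epsilon>"
  have "real (card (vset r k X)) \<le> K * real X powr (real r + \<epsilon>)" if X: "1 \<le> X" for X
  proof -
    define N where "N = (LEAST N. r * X < p' ^ N)"
    have "\<exists>N. r * X < p' ^ N"
    proof -
      have "r * X < 2 ^ (r * X)" by (rule less_exp)
      also have "\<dots> \<le> p' ^ (r * X)" using p'(1) by (intro power_mono) (auto simp: prime_ge_2_nat)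
      finally show ?thesis by blast
    qed
    then have N1: "r * X < p' ^ N" unfolding N_def by (rule LeastI_ex)
    have "N \<noteq> 0" using N1 r X by (intro notI) simp
    then obtain N' where N': "N = Suc N'" by (cases N) auto
    have "\<not> r * X < p' ^ N'" using N' unfolding N_def by (intro not_less_Least) simp
    then have "p' ^ N \<le> p' * (r * X)" unfolding N' by simp
    then have N2: "P ^ N \<le> P * (real r * real X)"
      unfolding P_def p_def by (metis of_int_of_nat_eq of_nat_le_iff of_nat_mult of_nat_power)
    define Q where "Q = p ^ (k * N)"
    have Q: "0 < Q" using p(1) by (simp add: Q_def prime_gt_0_int)
    define \<phi> :: "nat \<Rightarrow> int poly" where "\<phi> j = monom 1 j" for j
    have nc: "ncurve p k \<phi>" by (auto simp: ncurve_def \<phi>_def)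
    define I where "I = {1..int X}"
    define T where "T = real (card (torus k Q))"
    have T: "T = of_int Q ^ k" "0 < T" unfolding T_def card_torus[OF Q] using Q by auto
    let ?f = "fab p k N \<phi> (\<lambda>_. 1)"
    have XP: "int X < p ^ N"
    proof -
      have "1 * X \<le> r * X" using r by (intro mult_le_mono) auto
      then have "X < p' ^ N" using N1 by linarith
      then show ?thesis unfolding p_def by (metis of_nat_less_iff of_nat_power)
    qed
    have "(\<Sum>\<alpha>\<in>torus k Q. ?f I \<alpha> ^ (2 * r)) \<le> C * P powr (\<epsilon> * real N) * qsum p k N \<phi> (\<lambda>_. 1) I ^ r"
      using C(2)[of N] nc unfolding dec_alt Q_def r_def I_def by blast
    also have "qsum p k N \<phi> (\<lambda>_. 1) I = real X * root r T"
    proof -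
      have "root r (\<Sum>\<alpha>\<in>torus k Q. ?f (cell p N \<xi> I) \<alpha> ^ (2 * r)) = (if \<xi> \<in> I then root r T else 0)"
        if \<xi>: "\<xi> \<in> {0..<p ^ N}" for \<xi>
      proof (cases "\<xi> \<in> I")
        case True
        have "cell p N \<xi> I = {\<xi>}" using True \<xi> XP by (auto simp: cell_def I_def cong_def)
        then show ?thesis using True by (simp add: fab_def esum_def T_def)
      next
        case False
        have "cell p N \<xi> I = {}" using False \<xi> XP by (auto simp: cell_def I_def cong_def)
        then show ?thesis using False r by (simp add: zero_power)
      qed
      then have "qsum p k N \<phi> (\<lambda>_. 1) I = (\<Sum>\<xi>\<in>{0..<p ^ N}. if \<xi> \<in> I then root r T else 0)"
        unfolding qsum_def Q_def r_def by (intro sum.cong) auto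
      also have "\<dots> = (\<Sum>\<xi>\<in>I. root r T)"
        by (rule sum.mono_neutral_cong_right) (use XP in \<open>auto simp: I_def\<close>)
      finally show ?thesis by (simp add: I_def)
    qed
    also have "(real X * root r T) ^ r = real X ^ r * T" using r T(2) by (simp add: power_mult_distrib)
    finally have up: "(\<Sum>\<alpha>\<in>torus k Q. ?f I \<alpha> ^ (2 * r)) \<le> C * P powr (\<epsilon> * real N) * (real X ^ r * T)" .
    define S where "S = tup r I"
    have S: "finite S" unfolding S_def I_def by simp
    have "complex_of_real (\<Sum>\<alpha>\<in>torus k Q. ?f I \<alpha> ^ (2 * r)) =
      (\<Sum>\<alpha>\<in>torus k Q. \<Sum>xs\<in>S. \<Sum>ys\<in>S. emod Q (\<Sum>j\<in>{1..k}. \<alpha> j * (psum j xs - psum j ys)))"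
      unfolding of_real_sum
    proof (rule sum.cong[OF refl])
      fix \<alpha>
      have "esum Q k \<phi> (\<lambda>_. 1) I \<alpha> ^ r = (\<Sum>xs\<in>S. emod Q (\<Sum>j\<in>{1..k}. \<alpha> j * psum j xs))"
        unfolding esum_def S_def
        by (subst sum_power_tup) (simp_all add: I_def prod_list_emod \<phi>_def poly_monom sum_list_scale_swap)
      moreover have "?f I \<alpha> ^ (2 * r) = (cmod (esum Q k \<phi> (\<lambda>_. 1) I \<alpha> ^ r))\<^sup>2"
        by (simp add: fab_def Q_def norm_power power_mult[symmetric] mult.commute)
      ultimately show "complex_of_real (?f I \<alpha> ^ (2 * r)) = (\<Sum>xs\<in>S. \<Sum>ys\<in>S. emod Q (\<Sum>j\<in>{1..k}. \<alpha> j * (psum j xs - psum j ys)))"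
        by (simp only: norm_sum_square cnj_emod emod_add[symmetric])
           (simp add: right_diff_distrib sum_subtractf)
    qed
    also have "\<dots> = (\<Sum>xs\<in>S. \<Sum>ys\<in>S. \<Sum>\<alpha>\<in>torus k Q. emod Q (\<Sum>j\<in>{1..k}. \<alpha> j * (psum j xs - psum j ys)))"
      by (subst sum.swap, intro sum.cong refl sum.swap)
    also have "\<dots> = (\<Sum>xs\<in>S. \<Sum>ys\<in>S. complex_of_real (if \<forall>j\<in>{1..k}. Q dvd psum j xs - psum j ys then T else 0))"
      unfolding sum_torus_emod[OF Q] T(1) by (intro sum.cong refl) auto
    finally have eq: "(\<Sum>\<alpha>\<in>torus k Q. ?f I \<alpha> ^ (2 * r)) = (\<Sum>xs\<in>S. \<Sum>ys\<in>S. if \<forall>j\<in>{1..k}. Q dvd psum j xs - psum j ys then T else 0)"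
      by (simp only: of_real_sum[symmetric] of_real_eq_iff)
    \<comment> \<open>Equality of the power sums implies congruence modulo Q; the remaining pairs
      add nonnegative terms.\<close>
    have "real (card (vset r k X)) * T = (\<Sum>z\<in>vset r k X. T)" by simp
    also have "\<dots> = (\<Sum>(xs, ys)\<in>vset r k X. if \<forall>j\<in>{1..k}. Q dvd psum j xs - psum j ys then T else 0)"
      by (intro sum.cong) (auto simp: vset_def)
    also have "\<dots> \<le> (\<Sum>(xs, ys)\<in>S \<times> S. if \<forall>j\<in>{1..k}. Q dvd psum j xs - psum j ys then T else 0)"
      proof (rule sum_mono2)
      show "0 \<le> (case z of (xs, ys) \<Rightarrow> if \<forall>j\<in>{1..k}. Q dvd psum j xs - psum j ys then T else 0)" for z
        using T(2) by (cases z) simp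
    qed (use S in \<open>auto simp: vset_def S_def I_def\<close>)
    also have "\<dots> = (\<Sum>\<alpha>\<in>torus k Q. ?f I \<alpha> ^ (2 * r))" unfolding eq by (simp add: sum.cartesian_product)
    also note up
    finally have "real (card (vset r k X)) \<le> C * P powr (\<epsilon> * real N) * real X ^ r" using T by simp
    also have "\<dots> \<le> C * ((P * real r) powr \<epsilon> * real X powr \<epsilon>) * real X ^ r"
    proof (intro mult_left_mono mult_right_mono)
      have "P powr (\<epsilon> * real N) = (P ^ N) powr \<epsilon>" using P1 by (simp add: powr_realpow[symmetric] powr_powr mult.commute)
      also have "\<dots> \<le> (P * (real r * real X)) powr \<epsilon>" using N2 P1 \<epsilon> by (intro powr_mono2) auto
      also have "\<dots> = (P * real r) powr \<epsilon> * real X powr \<epsilon>" using P1 by (simp add: powr_mult mult.assoc[symmetric])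
      finally show "P powr (\<epsilon> * real N) \<le> (P * real r) powr \<epsilon> * real X powr \<epsilon>" .
    qed (use C in auto)
    also have "\<dots> = K * real X powr (real r + \<epsilon>)" using X by (simp add: K_def powr_add powr_realpow)
    finally show ?thesis .
  qed
  moreover have "1 \<le> K"
  proof -
    have "1 \<le> P * real r" using mult_mono[of 1 P 1 "real r"] P1 r by simp
    then have "1 \<le> (P * real r) powr \<epsilon>" using \<epsilon> by (intro ge_one_powr_ge_zero) auto
    then show ?thesis unfolding K_def using C mult_mono[of 1 C 1 "(P * real r) powr \<epsilon>"] by simp
  qed
  ultimately show ?thesis unfolding r_def by blast
qed

section \<open>Minor arcs\<close>

definition dn :: "real \<Rightarrow> real" where "dn x = \<bar>x - of_int (round x)\<bar>"

lemma dn_nonneg [simp]: "0 \<le> dn x" by (simp add: dn_def)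

lemma dn_le: "dn x \<le> \<bar>x - of_int n\<bar>"
  unfolding dn_def using round_diff_minimal[of x n] by simp

lemma dn_ex: "\<exists>n. dn x = \<bar>x - of_int n\<bar>" by (auto simp: dn_def)

lemma dn_le_half: "dn x \<le> 1 / 2"
  unfolding dn_def using of_int_round_abs_le[of x] by (simp add: abs_minus_commute)

lemma dn_add_int [simp]: "dn (x + of_int n) = dn x"
proof (rule antisym)
  obtain m where m: "dn x = \<bar>x - of_int m\<bar>" using dn_ex by blast
  show "dn (x + of_int n) \<le> dn x" unfolding m using dn_le[of "x + of_int n" "m + n"] by simp
  obtain m' where m': "dn (x + of_int n) = \<bar>x + of_int n - of_int m'\<bar>" using dn_ex by blast
  show "dn x \<le> dn (x + of_int n)" unfolding m' using dn_le[of x "m' - n"] by (simp add: algebra_simps)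
qed

lemma dn_minus [simp]: "dn (- x) = dn x"
proof -
  have "dn (- x) \<le> dn x" for x
  proof -
    obtain m where m: "dn x = \<bar>x - of_int m\<bar>" using dn_ex by blast
    show ?thesis unfolding m using dn_le[of "- x" "- m"] by (simp add: abs_minus_commute)
  qed
  from this[of x] this[of "- x"] show ?thesis by simp
qed

text \<open>Weaker than Jordan's inequality, but sufficient below. Up to pi/3 the derivative cos x -
  1/2 is nonnegative; beyond, monotonicity and numerical values suffice.\<close>

lemma sin_ge_half:
  assumes "0 \<le> x" "x \<le> pi / 2"
  shows "x / 2 \<le> sin x"
proof (cases "x \<le> pi / 3")
  case True
  have "1 / 2 \<le> cos y" if "0 \<le> y" "y \<le> pi / 3" for y
    using cos_monotone_0_pi_le[of y "pi / 3"] that pi_gt_zero cos_60 by simp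
  have "sin 0 - 0 / 2 \<le> sin x - x / 2"
  proof (rule DERIV_nonneg_imp_nondecreasing[OF assms(1)])
    fix y assume y: "0 \<le> y" "y \<le> x"
    have "((\<lambda>x. sin x - x / 2) has_real_derivative cos y - 1 / 2) (at y)"
      by (auto intro!: derivative_eq_intros)
    moreover have "0 \<le> cos y - 1 / 2"
      using \<open>\<And>y. 0 \<le> y \<Longrightarrow> y \<le> pi / 3 \<Longrightarrow> 1 / 2 \<le> cos y\<close>[of y] y True by simp
    ultimately show "\<exists>d. ((\<lambda>x. sin x - x / 2) has_real_derivative d) (at y) \<and> 0 \<le> d" by blast
  qed
  then show ?thesis by simp
next
  case False
  have "sin (pi / 3) \<le> sin x" using False assms by (intro sin_monotone_2pi_le) auto
  moreover have "1.7 \<le> sqrt (3::real)" by (rule real_le_rsqrt) (simp add: power2_eq_square)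
  moreover have "x / 2 \<le> 0.8" using assms pi_less_4 pi_approx by simp
  ultimately show ?thesis by (simp add: sin_60)
qed

lemma norm_ee_minus_1: "2 * dn \<theta> \<le> cmod (ee \<theta> - 1)"
proof -
  obtain n where n: "dn \<theta> = \<bar>\<theta> - of_int n\<bar>" using dn_ex by blast
  define y where "y = \<theta> - of_int n"
  have y: "\<bar>y\<bar> \<le> 1 / 2" using dn_le_half[of \<theta>] n y_def by simp
  have "ee \<theta> = ee y" unfolding y_def using ee_add_of_int[of "\<theta> - of_int n" n] by simp
  also have "cmod (ee y - 1) = 2 * \<bar>sin (pi * y)\<bar>"
  proof -
    have c: "cos (2 * (pi * y)) = 1 - 2 * (sin (pi * y))\<^sup>2" by (rule cos_double_sin)
    have s: "sin (2 * (pi * y)) = 2 * sin (pi * y) * cos (pi * y)" by (rule sin_double)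
    have "(cmod (ee y - 1))\<^sup>2 = (cos (2 * (pi * y)) - 1)\<^sup>2 + (sin (2 * (pi * y)))\<^sup>2"
      by (simp add: ee_def cmod_power2 mult.assoc)
    also have "\<dots> = 4 * (sin (pi * y))\<^sup>2 * ((sin (pi * y))\<^sup>2 + (cos (pi * y))\<^sup>2)"
    proof -
      have "(1 - 2 * S\<^sup>2 - 1)\<^sup>2 + (2 * S * C)\<^sup>2 = 4 * S\<^sup>2 * (S\<^sup>2 + C\<^sup>2)" for S C :: real
        by (simp add: power2_eq_square algebra_simps)
      then show ?thesis unfolding c s .
    qed
    also have "\<dots> = (2 * \<bar>sin (pi * y)\<bar>)\<^sup>2" by (simp add: power_mult_distrib)
    finally show ?thesis by (rule power2_eq_imp_eq) auto
  qed
  also have "\<bar>sin (pi * y)\<bar> = sin (pi * \<bar>y\<bar>)"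
  proof -
    have "0 \<le> sin (pi * \<bar>y\<bar>)" using y by (intro sin_ge_zero) (auto intro: mult_left_le)
    then show ?thesis by (cases "0 \<le> y") auto
  qed
  finally have e: "cmod (ee \<theta> - 1) = 2 * sin (pi * \<bar>y\<bar>)" .
  have "pi * \<bar>y\<bar> / 2 \<le> sin (pi * \<bar>y\<bar>)" using y by (intro sin_ge_half) auto
  then have "\<bar>y\<bar> \<le> sin (pi * \<bar>y\<bar>)" using pi_ge_two mult_right_mono[of 2 pi "\<bar>y\<bar>"] by linarith
  then show ?thesis unfolding e using n y_def by simp
qed

text \<open>The usual majorant min(B, 1/|x|) of a geometric sum, with the case split needed because 1/0 = 0.\<close>

definition nb :: "real \<Rightarrow> real \<Rightarrow> real" where
  "nb B x = (if dn x = 0 then B else min B (1 / dn x))"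

lemma nb_le: "nb B x \<le> B" and nb_le_inv: "0 < dn x \<Longrightarrow> nb B x \<le> 1 / dn x"
  by (auto simp: nb_def)

lemma nb_nonneg: "0 \<le> B \<Longrightarrow> 0 \<le> nb B x" by (auto simp: nb_def)

lemma nb_cong: "dn x = dn y \<Longrightarrow> nb B x = nb B y" by (simp add: nb_def)

lemma nb_ge: "y \<le> B \<Longrightarrow> (0 < dn x \<Longrightarrow> y \<le> 1 / dn x) \<Longrightarrow> y \<le> nb B x"
  by (auto simp: nb_def less_le)

lemma geometric_ee_bound:
  "cmod (\<Sum>m\<in>{a..<a + int n}. ee (\<theta> * of_int m)) \<le> nb (real n) \<theta>"
proof (rule nb_ge)
  show "cmod (\<Sum>m\<in>{a..<a + int n}. ee (\<theta> * of_int m)) \<le> real n"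
    by (rule order.trans[OF norm_sum]) simp
  assume d: "0 < dn \<theta>"
  have ne: "ee \<theta> \<noteq> 1" using norm_ee_minus_1[of \<theta>] d by auto
  have "(\<Sum>m\<in>{a..<a + int n}. ee (\<theta> * of_int m)) = (\<Sum>m<n. ee (\<theta> * of_int a) * ee \<theta> ^ m)"
  proof (rule sum.reindex_bij_witness[of _ "\<lambda>m. a + int m" "\<lambda>m. nat (m - a)"])
    fix m assume "m \<in> {a..<a + int n}"
    then show "ee (\<theta> * of_int a) * ee \<theta> ^ nat (m - a) = ee (\<theta> * of_int m)"
      by (simp add: ee_power ee_add[symmetric] algebra_simps)
  qed auto
  also have "\<dots> = ee (\<theta> * of_int a) * ((ee \<theta> ^ n - 1) / (ee \<theta> - 1))"
    unfolding sum_distrib_left[symmetric] by (simp add: geometric_sum ne)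
  finally have "cmod (\<Sum>m\<in>{a..<a + int n}. ee (\<theta> * of_int m)) = cmod (ee \<theta> ^ n - 1) / cmod (ee \<theta> - 1)"
    by (simp add: norm_mult norm_divide)
  also have "\<dots> \<le> 2 / (2 * dn \<theta>)"
  proof (rule frac_le)
    show "cmod (ee \<theta> ^ n - 1) \<le> 2" using norm_triangle_ineq4[of "ee \<theta> ^ n" 1] by (simp add: norm_power)
  qed (use d norm_ee_minus_1 in auto)
  finally show "cmod (\<Sum>m\<in>{a..<a + int n}. ee (\<theta> * of_int m)) \<le> 1 / dn \<theta>" by simp
qed

lemma dn_frac_lower:
  assumes "0 \<le> j" "j \<le> int q" "0 < q"
  shows "min (of_int j) (of_int (int q - j)) / real q - \<bar>e\<bar> \<le> dn (of_int j / real q + e)"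
proof -
  obtain n where n: "dn (of_int j / real q + e) = \<bar>of_int j / real q + e - of_int n\<bar>" using dn_ex by blast
  have "min (of_int j) (of_int (int q - j)) / real q \<le> \<bar>of_int j / real q - of_int n\<bar>"
  proof (cases "n \<le> 0")
    case True
    have "min (of_int j) (of_int (int q - j)) / real q \<le> of_int j / real q" by (intro divide_right_mono) auto
    also have "\<dots> \<le> of_int j / real q - of_int n" using True by simp
    finally show ?thesis by linarith
  next
    case False
    then have "1 \<le> n" by simp
    have "min (of_int j) (of_int (int q - j)) / real q \<le> of_int (int q - j) / real q" by (intro divide_right_mono) auto
    also have "\<dots> = 1 - of_int j / real q" using assms by (simp add: diff_divide_distrib)
    also have "\<dots> \<le> of_int n - of_int j / real q" using \<open>1 \<le> n\<close> by simp
    finally show ?thesis by linarith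
  qed
  then show ?thesis unfolding n by linarith
qed

lemma sum_inverse_le_harm:
  fixes c :: int
  shows "(\<Sum>j\<in>{3..<int q}. 1 / of_int (j - 2)) \<le> (harm q :: real)"
proof -
  have "(\<Sum>j\<in>{3..<int q}. 1 / of_int (j - 2)) = (\<Sum>i\<in>{1..<q - 2}. 1 / real i)"
    by (rule sum.reindex_bij_witness[of _ "\<lambda>i. int i + 2" "\<lambda>j. nat (j - 2)"]) auto
  also have "\<dots> \<le> (\<Sum>i\<in>{1..q}. 1 / real i)" by (intro sum_mono2) auto
  finally show ?thesis by (simp add: harm_def inverse_eq_divide)
qed

lemma sum_inverse_le_harm': "(\<Sum>j\<in>{3..<int q}. real q * (1 / of_int (j - 2))) \<le> real q * harm q"
  unfolding sum_distrib_left[symmetric] by (intro mult_left_mono sum_inverse_le_harm) auto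

lemma of_real_eq_norm: "complex_of_real t = z \<Longrightarrow> 0 \<le> t \<Longrightarrow> t = cmod z" by auto

text \<open>The points \<beta>0 + \<alpha> r lie within 2/q of fractions j/q with distinct j modulo
  q: 1/q for rounding \<beta>0, and 1/q for replacing \<alpha> by a/q over r < q. The five residues
  at distance at most 2 from 0 get the trivial bound B; the others give q / (|j| - 2), a harmonic
  sum on either side of 0.\<close>

lemma block_bound:
  assumes q: "0 < q" and cop: "coprime a (int q)" and \<alpha>: "\<bar>\<alpha> - of_int a / real q\<bar> \<le> 1 / (real q)\<^sup>2" and B: "0 \<le> B"
  shows "(\<Sum>r<q. nb B (\<beta>0 + \<alpha> * real r)) \<le> 5 * B + 2 * real q * harm q"
proof -
  define c where "c = \<lfloor>real q * \<beta>0\<rfloor>"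
  define \<rho> where "\<rho> = \<beta>0 - of_int c / real q"
  have "real q * \<beta>0 - 1 < of_int c" "of_int c \<le> real q * \<beta>0" unfolding c_def by linarith+
  moreover have "\<rho> = (real q * \<beta>0 - of_int c) / real q" using q by (simp add: \<rho>_def field_simps)
  ultimately have \<rho>: "0 \<le> \<rho>" "\<rho> \<le> 1 / real q" using q by (auto intro: divide_right_mono)
  define \<beta> where "\<beta> = \<alpha> - of_int a / real q"
  define J where "J r = (a * int r + c) mod int q" for r
  define h :: "int \<Rightarrow> real" where "h j = (if j \<in> {0, 1, 2, int q - 1, int q - 2} then B else 0)
     + (if j \<in> {3..<int q} then real q * (1 / of_int (j - 2)) else 0)
     + (if int q - j \<in> {3..<int q} then real q * (1 / of_int (int q - j - 2)) else 0)" for j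
  have pt: "nb B (\<beta>0 + \<alpha> * real r) \<le> h (J r)" if r: "r < q" for r
  proof -
    define j where "j = J r"
    have j: "0 \<le> j" "j < int q" using q by (auto simp: j_def J_def)
    define e where "e = \<rho> + \<beta> * real r"
    have e: "\<bar>e\<bar> \<le> 2 / real q"
    proof -
      have "\<bar>\<beta> * real r\<bar> \<le> 1 / (real q)\<^sup>2 * real q"
        using \<alpha> r unfolding abs_mult \<beta>_def by (intro mult_mono) auto
      also have "\<dots> = 1 / real q" by (simp add: power2_eq_square)
      finally show ?thesis using \<rho> unfolding e_def by linarith
    qed
    have "a * int r + c = j + int q * ((a * int r + c) div int q)" by (simp add: j_def J_def)
    then obtain m where m: "a * int r + c = j + int q * m" by blast
    have "\<beta>0 + \<alpha> * real r = of_int (a * int r + c) / real q + e"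
      using q by (simp add: e_def \<rho>_def \<beta>_def field_simps)
    also have "of_int (a * int r + c) / real q = of_int j / real q + of_int m"
      unfolding m using q by (simp add: field_simps)
    finally have "\<beta>0 + \<alpha> * real r = of_int j / real q + e + of_int m" by simp
    then have dnj: "dn (\<beta>0 + \<alpha> * real r) = dn (of_int j / real q + e)" by simp
    have low: "(min (of_int j) (of_int (int q - j)) - 2) / real q \<le> dn (\<beta>0 + \<alpha> * real r)"
      unfolding dnj using dn_frac_lower[of j q e] j q e by (simp add: diff_divide_distrib)
    show ?thesis
    proof (cases "j \<in> {0, 1, 2, int q - 1, int q - 2}")
      case True
      then have "B \<le> h j" using q by (auto simp: h_def)
      then show ?thesis using nb_le[of B "\<beta>0 + \<alpha> * real r"] by (simp add: j_def)
    next
      case False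
      then have j3: "j \<in> {3..<int q}" "int q - j \<in> {3..<int q}" using j by auto
      define m where "m = min j (int q - j)"
      have m: "1 \<le> m - 2" using j3 by (auto simp: m_def)
      have "of_int m = min (of_int j) (of_int (int q - j) :: real)" by (simp add: m_def of_int_min)
      then have low': "of_int (m - 2) / real q \<le> dn (\<beta>0 + \<alpha> * real r)" using low by simp
      have pos: "0 < of_int (m - 2) / real q" using m q by simp
      then have "nb B (\<beta>0 + \<alpha> * real r) \<le> 1 / dn (\<beta>0 + \<alpha> * real r)" using low' by (intro nb_le_inv) linarith
      also have "\<dots> \<le> 1 / (of_int (m - 2) / real q)" using low' pos by (intro frac_le) auto
      also have "\<dots> = real q * (1 / of_int (m - 2))" by simp
      also have "\<dots> \<le> h j" using False j3 unfolding h_def m_def by (auto simp: min_def)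
      finally show ?thesis by (simp add: j_def)
    qed
  qed
  have inj: "inj_on J {..<q}"
  proof (rule inj_onI)
    fix r s assume rs: "r \<in> {..<q}" "s \<in> {..<q}" "J r = J s"
    then have "int q dvd (a * int r + c) - (a * int s + c)" unfolding J_def mod_eq_dvd_iff by blast
    also have "(a * int r + c) - (a * int s + c) = a * (int r - int s)" by (simp add: right_diff_distrib)
    finally have "int q dvd a * (int r - int s)" .
    then have "int q dvd int r - int s" using cop by (simp add: coprime_commute coprime_dvd_mult_right_iff)
    then have "int r mod int q = int s mod int q" unfolding mod_eq_dvd_iff .
    then show "r = s" using rs by simp
  qed
  have h0: "0 \<le> h j" if "j \<in> {0..<int q}" for j using B by (auto simp: h_def)
  have "(\<Sum>r<q. nb B (\<beta>0 + \<alpha> * real r)) \<le> (\<Sum>r<q. h (J r))" by (intro sum_mono pt) auto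
  also have "\<dots> = (\<Sum>j\<in>J ` {..<q}. h j)" using inj by (simp add: sum.reindex)
  also have "\<dots> \<le> (\<Sum>j\<in>{0..<int q}. h j)" using q h0 by (intro sum_mono2) (auto simp: J_def)
  also have "\<dots> = (\<Sum>j\<in>{0..<int q}. if j \<in> {0, 1, 2, int q - 1, int q - 2} then B else 0)
      + (\<Sum>j\<in>{0..<int q}. if j \<in> {3..<int q} then real q * (1 / of_int (j - 2)) else 0)
      + (\<Sum>j\<in>{0..<int q}. if int q - j \<in> {3..<int q} then real q * (1 / of_int (int q - j - 2)) else 0)"
    unfolding h_def by (simp add: sum.distrib)
  also have "(\<Sum>j\<in>{0..<int q}. if j \<in> {0, 1, 2, int q - 1, int q - 2} then B else 0) \<le> 5 * B"
  proof -
    have "(\<Sum>j\<in>{0..<int q}. if j \<in> {0, 1, 2, int q - 1, int q - 2} then B else 0) = (\<Sum>j\<in>{0..<int q} \<inter> {0, 1, 2, int q - 1, int q - 2}. B)"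
      by (rule sum.inter_restrict[symmetric]) simp
    also have "\<dots> \<le> (\<Sum>j\<in>{0, 1, 2, int q - 1, int q - 2}. B)" using B by (intro sum_mono2) auto
    also have "\<dots> = real (card {0, 1, 2, int q - 1, int q - 2}) * B" by (rule sum_constant)
    also have "\<dots> \<le> 5 * B"
    proof -
      have e: "{0, 1, 2, int q - 1, int q - 2} = set [0, 1, 2, int q - 1, int q - 2]" by auto
      have "card {0, 1, 2, int q - 1, int q - 2} \<le> 5" unfolding e by (rule order.trans[OF card_length]) simp
      then show ?thesis using B by (intro mult_right_mono) auto
    qed
    finally show ?thesis .
  qed
  also have "(\<Sum>j\<in>{0..<int q}. if j \<in> {3..<int q} then real q * (1 / of_int (j - 2)) else 0) \<le> real q * harm q"
  proof -
    have "(\<Sum>j\<in>{0..<int q}. if j \<in> {3..<int q} then real q * (1 / of_int (j - 2)) else 0) = (\<Sum>j\<in>{3..<int q}. real q * (1 / of_int (j - 2)))"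
      by (rule sum.mono_neutral_cong_right) auto
    then show ?thesis using sum_inverse_le_harm'[of q] by linarith
  qed
  also have "(\<Sum>j\<in>{0..<int q}. if int q - j \<in> {3..<int q} then real q * (1 / of_int (int q - j - 2)) else 0) \<le> real q * harm q"
  proof -
    have "(\<Sum>j\<in>{0..<int q}. if int q - j \<in> {3..<int q} then real q * (1 / of_int (int q - j - 2)) else 0)
       = (\<Sum>j\<in>{0<..int q}. if j \<in> {3..<int q} then real q * (1 / of_int (j - 2)) else 0)"
      by (rule sum.reindex_bij_witness[of _ "\<lambda>j. int q - j" "\<lambda>j. int q - j"]) auto
    also have "\<dots> = (\<Sum>j\<in>{3..<int q}. real q * (1 / of_int (j - 2)))"
      by (rule sum.mono_neutral_cong_right) auto
    finally show ?thesis using sum_inverse_le_harm'[of q] by linarith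
  qed
  finally show ?thesis by (simp add: mult_ac)
qed

section \<open>The large sieve and shifted Weyl sums\<close>

lemma nb_sum_bound:
  assumes q: "0 < q" and cop: "coprime a (int q)" and \<alpha>: "\<bar>\<alpha> - of_int a / real q\<bar> \<le> 1 / (real q)\<^sup>2" and B: "0 \<le> B"
  shows "(\<Sum>m\<le>Y. nb B (\<alpha> * real m)) \<le> (real Y / real q + 1) * (5 * B + 2 * real q * harm q)"
proof -
  define T where "T = Y div q + 1"
  have "Y < T * q" using q by (simp add: T_def dividend_less_div_times)
  then have "(\<Sum>m\<le>Y. nb B (\<alpha> * real m)) \<le> (\<Sum>m<T * q. nb B (\<alpha> * real m))"
    using B by (intro sum_mono2) (auto simp: nb_nonneg)
  also have "\<dots> = (\<Sum>i<T. \<Sum>m\<in>{i * q..<i * q + q}. nb B (\<alpha> * real m))" by (rule sum.nat_group[symmetric])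
  also have "\<dots> \<le> (\<Sum>i<T. 5 * B + 2 * real q * harm q)"
  proof (rule sum_mono)
    fix i
    have "(\<Sum>m\<in>{i * q..<i * q + q}. nb B (\<alpha> * real m)) = (\<Sum>r<q. nb B (\<alpha> * real (i * q) + \<alpha> * real r))"
      by (rule sum.reindex_bij_witness[of _ "\<lambda>r. i * q + r" "\<lambda>m. m - i * q"]) (auto simp: algebra_simps)
    also have "\<dots> \<le> 5 * B + 2 * real q * harm q" by (rule block_bound[OF q cop \<alpha> B])
    finally show "(\<Sum>m\<in>{i * q..<i * q + q}. nb B (\<alpha> * real m)) \<le> 5 * B + 2 * real q * harm q" .
  qed
  also have "\<dots> = real T * (5 * B + 2 * real q * harm q)" by simp
  also have "\<dots> \<le> (real Y / real q + 1) * (5 * B + 2 * real q * harm q)"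
  proof (rule mult_right_mono)
    have "real (Y div q * q) \<le> real Y" by (simp only: of_nat_le_iff div_times_less_eq_dividend)
    then have "real (Y div q) \<le> real Y / real q" using q by (simp add: pos_le_divide_eq)
    then show "real T \<le> real Y / real q + 1" by (simp add: T_def)
    show "0 \<le> 5 * B + 2 * real q * harm q" using B harm_nonneg[of q, where 'a = real] by (intro add_nonneg_nonneg mult_nonneg_nonneg) auto
  qed
  finally show ?thesis .
qed

text \<open>Duality: T, the left-hand side, is written as the pairing of g with the dual sums U.
  Cauchy's inequality gives T^2 <= |g|^2 |U|^2, and Schur's test on the kernel of geometric sums,
  through |S z S z'| <= (|S z|^2 + |S z'|^2) / 2, bounds |U|^2 by \<Delta> T. Then one factor T
  cancels.\<close>

lemma dual_large_sieve:
  fixes g :: "int \<Rightarrow> complex" and Z :: "int set"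
  assumes Z: "finite Z" and \<Delta>: "\<And>z. z \<in> Z \<Longrightarrow> (\<Sum>z'\<in>Z. nb (real B) (\<theta> * of_int (z - z'))) \<le> \<Delta>" and \<Delta>0: "0 \<le> \<Delta>"
  shows "(\<Sum>z\<in>Z. (cmod (\<Sum>w\<in>{1..int B}. g w * ee (\<theta> * of_int z * of_int w)))\<^sup>2) \<le> \<Delta> * (\<Sum>w\<in>{1..int B}. (cmod (g w))\<^sup>2)"
proof -
  define S where "S z = (\<Sum>w\<in>{1..int B}. g w * ee (\<theta> * of_int z * of_int w))" for z
  define T where "T = (\<Sum>z\<in>Z. (cmod (S z))\<^sup>2)"
  define GG where "GG = (\<Sum>w\<in>{1..int B}. (cmod (g w))\<^sup>2)"
  define U where "U w = (\<Sum>z\<in>Z. cnj (S z) * ee (\<theta> * of_int z * of_int w))" for w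
  have T0: "0 \<le> T" "0 \<le> GG" by (auto simp: T_def GG_def sum_nonneg)
  have "complex_of_real T = (\<Sum>z\<in>Z. \<Sum>w\<in>{1..int B}. g w * (cnj (S z) * ee (\<theta> * of_int z * of_int w)))"
    unfolding T_def of_real_sum
  proof (rule sum.cong[OF refl])
    fix z
    have "complex_of_real ((cmod (S z))\<^sup>2) = S z * cnj (S z)" by (rule complex_norm_square)
    also have "S z * cnj (S z) = (\<Sum>w\<in>{1..int B}. g w * ee (\<theta> * of_int z * of_int w)) * cnj (S z)" by (simp only: S_def)
    finally show "complex_of_real ((cmod (S z))\<^sup>2) = (\<Sum>w\<in>{1..int B}. g w * (cnj (S z) * ee (\<theta> * of_int z * of_int w)))"
      by (simp add: sum_distrib_left mult_ac)
  qed
  also have "\<dots> = (\<Sum>w\<in>{1..int B}. g w * U w)"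
    by (subst sum.swap) (simp add: U_def sum_distrib_left)
  finally have "T = cmod (\<Sum>w\<in>{1..int B}. g w * U w)" by (rule of_real_eq_norm) (rule T0)
  also have "\<dots> \<le> (\<Sum>w\<in>{1..int B}. cmod (g w) * cmod (U w))"
    by (rule order.trans[OF norm_sum]) (simp add: norm_mult)
  finally have "T\<^sup>2 \<le> (\<Sum>w\<in>{1..int B}. cmod (g w) * cmod (U w))\<^sup>2" using T0 by (intro power_mono) auto
  also have "\<dots> \<le> GG * (\<Sum>w\<in>{1..int B}. (cmod (U w))\<^sup>2)" unfolding GG_def by (rule Cauchy_Schwarz_ineq_sum)
  finally have T2: "T\<^sup>2 \<le> GG * (\<Sum>w\<in>{1..int B}. (cmod (U w))\<^sup>2)" .
  have "complex_of_real (\<Sum>w\<in>{1..int B}. (cmod (U w))\<^sup>2)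
     = (\<Sum>w\<in>{1..int B}. \<Sum>z\<in>Z. \<Sum>z'\<in>Z. cnj (S z) * S z' * ee (\<theta> * of_int (z - z') * of_int w))"
    unfolding of_real_sum U_def norm_sum_square
    by (intro sum.cong refl) (simp add: ee_minus[symmetric] ee_add[symmetric] algebra_simps)
  also have "\<dots> = (\<Sum>z\<in>Z. \<Sum>z'\<in>Z. cnj (S z) * S z' * (\<Sum>w\<in>{1..int B}. ee (\<theta> * of_int (z - z') * of_int w)))"
    unfolding sum_distrib_left by (subst sum.swap, intro sum.cong refl sum.swap)
  finally have "(\<Sum>w\<in>{1..int B}. (cmod (U w))\<^sup>2) = cmod (\<Sum>z\<in>Z. \<Sum>z'\<in>Z. cnj (S z) * S z' * (\<Sum>w\<in>{1..int B}. ee (\<theta> * of_int (z - z') * of_int w)))"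
    by (rule of_real_eq_norm) (simp add: sum_nonneg)
  also have "\<dots> \<le> (\<Sum>z\<in>Z. \<Sum>z'\<in>Z. ((cmod (S z))\<^sup>2 + (cmod (S z'))\<^sup>2) / 2 * nb (real B) (\<theta> * of_int (z - z')))"
  proof (intro order.trans[OF norm_sum] sum_mono)
    fix z z'
    have "cmod (cnj (S z) * S z' * (\<Sum>w\<in>{1..int B}. ee (\<theta> * of_int (z - z') * of_int w)))
       = cmod (S z) * cmod (S z') * cmod (\<Sum>w\<in>{1..<1 + int B}. ee (\<theta> * of_int (z - z') * of_int w))"
      by (simp add: norm_mult atLeastLessThanPlusOne_atLeastAtMost_int[symmetric] add.commute)
    also have "\<dots> \<le> ((cmod (S z))\<^sup>2 + (cmod (S z'))\<^sup>2) / 2 * nb (real B) (\<theta> * of_int (z - z'))"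
      using sum_squares_bound[of "cmod (S z)" "cmod (S z')"] by (intro mult_mono geometric_ee_bound) auto
    finally show "cmod (cnj (S z) * S z' * (\<Sum>w\<in>{1..int B}. ee (\<theta> * of_int (z - z') * of_int w))) \<le> \<dots>" .
  qed
  also have "\<dots> = (\<Sum>z\<in>Z. \<Sum>z'\<in>Z. (cmod (S z))\<^sup>2 / 2 * nb (real B) (\<theta> * of_int (z - z')))
      + (\<Sum>z\<in>Z. \<Sum>z'\<in>Z. (cmod (S z'))\<^sup>2 / 2 * nb (real B) (\<theta> * of_int (z - z')))"
    by (simp add: sum.distrib[symmetric] algebra_simps add_divide_distrib)
  also have "(\<Sum>z\<in>Z. \<Sum>z'\<in>Z. (cmod (S z'))\<^sup>2 / 2 * nb (real B) (\<theta> * of_int (z - z')))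
     = (\<Sum>z\<in>Z. \<Sum>z'\<in>Z. (cmod (S z))\<^sup>2 / 2 * nb (real B) (\<theta> * of_int (z - z')))"
  proof (subst sum.swap, intro sum.cong refl arg_cong2[of _ _ _ _ times] nb_cong)
    fix z z'
    show "dn (\<theta> * of_int (z' - z)) = dn (\<theta> * of_int (z - z'))"
      using dn_minus[of "\<theta> * of_int (z - z')"] by (simp add: algebra_simps)
  qed
  also have "(\<Sum>z\<in>Z. \<Sum>z'\<in>Z. (cmod (S z))\<^sup>2 / 2 * nb (real B) (\<theta> * of_int (z - z'))) + \<dots>
     = (\<Sum>z\<in>Z. (cmod (S z))\<^sup>2 * (\<Sum>z'\<in>Z. nb (real B) (\<theta> * of_int (z - z'))))"
    by (simp add: sum_distrib_left sum.distrib[symmetric])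
  also have "\<dots> \<le> (\<Sum>z\<in>Z. (cmod (S z))\<^sup>2 * \<Delta>)" by (intro sum_mono mult_left_mono \<Delta>) auto
  also have "\<dots> = \<Delta> * T" by (simp add: T_def sum_distrib_left mult.commute)
  finally have "T\<^sup>2 \<le> GG * (\<Delta> * T)" using T2 T0 by (meson mult_left_mono order.trans)
  then have "T * T \<le> (\<Delta> * GG) * T" by (simp add: power2_eq_square mult_ac)
  moreover have "0 \<le> \<Delta> * GG"
    using \<Delta>0 T0 by simp
  ultimately have "T \<le> \<Delta> * GG" using T0 by (cases "T = 0") auto
  then show ?thesis unfolding T_def GG_def S_def .
qed

definition fW :: "nat \<Rightarrow> nat \<Rightarrow> real \<Rightarrow> complex" where
  "fW k X \<alpha> = (\<Sum>x\<in>{1..int X}. ee (\<alpha> * of_int (x ^ k)))"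

lemma harm_le: "0 < n \<Longrightarrow> harm n \<le> ln (real n) + 1"
  using decseqD[OF decseq_harm_diff_ln, of 0 "n - 1"] by (simp add: harm_def)

text \<open>Bounds the mean modulus of a Dirichlet kernel of length X over the 2 X frequencies t /
  (2 X); it comes from \<open>block_bound\<close> with q = 2 X.\<close>

definition Lam :: "nat \<Rightarrow> real" where "Lam X = 5 + 2 * ln (real (2 * X))"

text \<open>Extending the shifted sum to a full interval costs only a logarithm, the L1 norm of a Dirichlet
  kernel.\<close>

lemma shift_cutoff:
  assumes X: "1 \<le> X" and z: "z \<in> {1..int X}"
  shows "\<exists>t. cmod (fW k X \<alpha>) \<le> Lam X *
    cmod (\<Sum>u\<in>{1..int (2 * X)}. ee (\<alpha> * of_int ((u - z) ^ k) + of_int t / real (2 * X) * of_int u))"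
proof -
  \<comment> \<open>All x + z with x, z <= X lie in 1..2X, so the additive characters modulo 2 X
    detect the shifted interval inside the full one.\<close>
  define L where "L = int (2 * X)"
  have L: "0 < L" "real_of_int L = real (2 * X)" using X by (auto simp: L_def)
  define D where "D t = (\<Sum>m\<in>{z+1..<z + 1 + int X}. emod L (- (t * m)))" for t
  define F where "F t = (\<Sum>u\<in>{1..L}. ee (\<alpha> * of_int ((u - z) ^ k) + of_int t / real (2 * X) * of_int u))" for t :: int
  define e where "e u = ee (\<alpha> * of_int ((u - z) ^ k))" for u
  have "fW k X \<alpha> = (\<Sum>m\<in>{z+1..<z + 1 + int X}. e m)"
    unfolding fW_def e_def by (rule sum.reindex_bij_witness[of _ "\<lambda>m. m - z" "\<lambda>x. x + z"]) auto
  also have "of_int L * \<dots> = (\<Sum>m\<in>{z+1..<z + 1 + int X}. \<Sum>u\<in>{1..L}. e u * (\<Sum>t\<in>{0..<L}. emod L (t * (u - m))))"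
    unfolding sum_distrib_left[where r = "of_int L :: complex"]
  proof (rule sum.cong[OF refl])
    fix m assume m: "m \<in> {z+1..<z + 1 + int X}"
    have mL: "m \<in> {1..L}" using m z by (auto simp: L_def)
    have "(\<Sum>u\<in>{1..L}. e u * (\<Sum>t\<in>{0..<L}. emod L (t * (u - m)))) = (\<Sum>u\<in>{1..L}. if u = m then of_int L * e m else 0)"
    proof (rule sum.cong[OF refl])
      fix u assume u: "u \<in> {1..L}"
      have "L dvd u - m \<longleftrightarrow> u = m"
      proof
        assume "L dvd u - m"
        moreover have "\<bar>u - m\<bar> < L" using u mL by auto
        ultimately show "u = m" using zdvd_not_zless[of "\<bar>u - m\<bar>" L] by auto
      qed auto
      then show "e u * (\<Sum>t\<in>{0..<L}. emod L (t * (u - m))) = (if u = m then of_int L * e m else 0)"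
        by (simp add: sum_emod[OF L(1)])
    qed
    also have "\<dots> = of_int L * e m" using mL by (simp add: sum.delta)
    finally show "of_int L * e m = (\<Sum>u\<in>{1..L}. e u * (\<Sum>t\<in>{0..<L}. emod L (t * (u - m))))" ..
  qed
  also have "\<dots> = (\<Sum>t\<in>{0..<L}. D t * F t)"
  proof -
    have "D t * F t = (\<Sum>m\<in>{z+1..<z + 1 + int X}. \<Sum>u\<in>{1..L}. e u * emod L (t * (u - m)))" for t
    proof -
      have "ee (\<alpha> * of_int ((u - z) ^ k) + of_int t / real (2 * X) * of_int u) = e u * emod L (t * u)" for u
        using L by (simp add: ee_add e_def emod_def)
      then have "D t * F t = (\<Sum>m\<in>{z+1..<z + 1 + int X}. \<Sum>u\<in>{1..L}. emod L (- (t * m)) * (e u * emod L (t * u)))"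
        unfolding D_def F_def by (simp add: sum_product)
      also have "\<dots> = (\<Sum>m\<in>{z+1..<z + 1 + int X}. \<Sum>u\<in>{1..L}. e u * emod L (t * (u - m)))"
      proof (intro sum.cong refl)
        fix m u
        show "emod L (- (t * m)) * (e u * emod L (t * u)) = e u * emod L (t * (u - m))"
          using emod_add[of L "- (t * m)" "t * u"] by (simp add: algebra_simps)
      qed
      finally show ?thesis .
    qed
    then have "(\<Sum>t\<in>{0..<L}. D t * F t) = (\<Sum>t\<in>{0..<L}. \<Sum>m\<in>{z+1..<z + 1 + int X}. \<Sum>u\<in>{1..L}. e u * emod L (t * (u - m)))"
      by simp
    also have "\<dots> = (\<Sum>m\<in>{z+1..<z + 1 + int X}. \<Sum>u\<in>{1..L}. \<Sum>t\<in>{0..<L}. e u * emod L (t * (u - m)))"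
      by (subst sum.swap, intro sum.cong refl sum.swap)
    finally show ?thesis unfolding sum_distrib_left ..
  qed
  finally have "of_int L * cmod (fW k X \<alpha>) = cmod (\<Sum>t\<in>{0..<L}. D t * F t)"
    using L by (metis abs_of_pos norm_mult norm_of_int of_int_0_less_iff of_int_abs)
  also have "\<dots> \<le> (\<Sum>t\<in>{0..<L}. cmod (D t) * cmod (F t))" by (rule order.trans[OF norm_sum]) (simp add: norm_mult)
  finally have 1: "of_int L * cmod (fW k X \<alpha>) \<le> (\<Sum>t\<in>{0..<L}. cmod (D t) * cmod (F t))" .
  obtain t0 where t0: "\<And>t. t \<in> {0..<L} \<Longrightarrow> cmod (F t) \<le> cmod (F t0)"
  proof -
    let ?A = "(\<lambda>t. cmod (F t)) ` {0..<L}"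
    have "Max ?A \<in> ?A" using L by (intro Max_in) auto
    then obtain t1 where t1: "Max ?A = cmod (F t1)" by auto
    have le: "cmod (F t) \<le> Max ?A" if "t \<in> {0..<L}" for t using that by simp
    show ?thesis by (rule that[of t1]) (simp only: t1[symmetric] le)
  qed
  have "(\<Sum>t\<in>{0..<L}. cmod (D t)) \<le> (\<Sum>r<2 * X. nb (real X) (0 + 1 / real (2 * X) * real r))"
  proof -
    have "cmod (D t) \<le> nb (real X) (1 / real (2 * X) * of_int t)" for t
    proof -
      have "D t = (\<Sum>m\<in>{z+1..<z + 1 + int X}. ee (- (of_int t / real (2 * X)) * of_int m))"
        unfolding D_def emod_def using L by (intro sum.cong refl arg_cong[of _ _ ee]) simp
      then have "cmod (D t) \<le> nb (real X) (- (of_int t / real (2 * X)))" by (simp only: geometric_ee_bound)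
      also have "\<dots> = nb (real X) (1 / real (2 * X) * of_int t)" by (rule nb_cong) (simp only: dn_minus times_divide_eq_left mult_1)
      finally show ?thesis .
    qed
    then have "(\<Sum>t\<in>{0..<L}. cmod (D t)) \<le> (\<Sum>t\<in>{0..<L}. nb (real X) (1 / real (2 * X) * of_int t))" by (rule sum_mono)
    also have "\<dots> = (\<Sum>r<2 * X. nb (real X) (0 + 1 / real (2 * X) * real r))"
      by (rule sum.reindex_bij_witness[of _ int nat]) (auto simp: L_def)
    finally show ?thesis .
  qed
  also have "\<dots> \<le> 5 * real X + 2 * real (2 * X) * harm (2 * X)"
    using X by (intro block_bound[of _ 1]) auto
  also have "\<dots> \<le> real (2 * X) * Lam X"
  proof -
    have "harm (2 * X) \<le> ln (real (2 * X)) + 1" using X by (intro harm_le) auto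
    then have "2 * real (2 * X) * harm (2 * X) \<le> 2 * real (2 * X) * (ln (real (2 * X)) + 1)" by (intro mult_left_mono) auto
    then show ?thesis unfolding Lam_def by (simp add: algebra_simps)
  qed
  finally have 2: "(\<Sum>t\<in>{0..<L}. cmod (D t)) \<le> of_int L * Lam X" using L by simp
  have "of_int L * cmod (fW k X \<alpha>) \<le> (\<Sum>t\<in>{0..<L}. cmod (D t) * cmod (F t0))"
    using 1 t0 by (meson sum_mono mult_left_mono norm_ge_zero order.trans)
  also have "\<dots> \<le> of_int L * Lam X * cmod (F t0)"
    unfolding sum_distrib_right[symmetric] using 2 by (rule mult_right_mono) simp
  finally have "of_int L * cmod (fW k X \<alpha>) \<le> of_int L * (Lam X * cmod (F t0))" by (simp only: mult.assoc)
  then have "cmod (fW k X \<alpha>) \<le> Lam X * cmod (F t0)" using L(1) by simp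
  then show ?thesis unfolding F_def L_def by blast
qed

lemma psum_bounds:
  assumes "us \<in> tup b {1..L}"
  shows "int b \<le> psum j us" "psum j us \<le> int b * L ^ j"
proof -
  have "set us \<subseteq> {1..L} \<Longrightarrow> int (length us) \<le> psum j us \<and> psum j us \<le> int (length us) * L ^ j"
  proof (induction us)
    case (Cons a us)
    have a: "1 \<le> a ^ j" "a ^ j \<le> L ^ j" using Cons.prems by (auto intro: power_mono one_le_power)
    have IH: "int (length us) \<le> psum j us" "psum j us \<le> int (length us) * L ^ j" using Cons by auto
    have e: "psum j (a # us) = a ^ j + psum j us" "int (length (a # us)) = 1 + int (length us)"
      "int (length (a # us)) * L ^ j = L ^ j + int (length us) * L ^ j" by (simp_all add: psum_def algebra_simps)
    show ?case unfolding e(1,3) unfolding e(2) using a IH by linarith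
  qed (simp add: psum_def)
  then show "int b \<le> psum j us" "psum j us \<le> int b * L ^ j" using assms by (auto simp: tup_def)
qed

lemma prod_list_ee: "prod_list (map (\<lambda>x. ee (h x)) xs) = ee (\<Sum>x\<leftarrow>xs. h x)"
  by (induction xs) (simp_all add: ee_add)

text \<open>Degrees up to k - 2 only: the power sum of degree k - 1 is kept apart as the variable of
  the large sieve, and that of degree k enters as a phase.\<close>

definition vkey :: "nat \<Rightarrow> int list \<Rightarrow> nat \<Rightarrow> int" where "vkey k us = (\<lambda>j\<in>{1..k-2}. psum j us)"

definition vbox :: "nat \<Rightarrow> nat \<Rightarrow> nat \<Rightarrow> (nat \<Rightarrow> int) set" where
  "vbox k b X = PiE {1..k-2} (\<lambda>j. {1..int b * int (2 * X) ^ j})"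

definition vcls :: "nat \<Rightarrow> nat \<Rightarrow> nat \<Rightarrow> (nat \<Rightarrow> int) \<Rightarrow> int \<Rightarrow> int list set" where
  "vcls k b X v w = {us \<in> tup b {1..int (2 * X)}. vkey k us = v \<and> psum (k - 1) us = w}"

definition Gv :: "nat \<Rightarrow> nat \<Rightarrow> nat \<Rightarrow> real \<Rightarrow> (nat \<Rightarrow> int) \<Rightarrow> int \<Rightarrow> complex" where
  "Gv k b X \<alpha> v w = (\<Sum>us\<in>vcls k b X v w. ee (\<alpha> * of_int (psum k us)))"

lemma finite_vbox [simp]: "finite (vbox k b X)" by (simp add: vbox_def finite_PiE)

lemma finite_vcls [simp]: "finite (vcls k b X v w)" by (simp add: vcls_def)

lemma sum_vcls:
  fixes h :: "int list \<Rightarrow> 'a::comm_monoid_add"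
  assumes b: "1 \<le> b"
  shows "(\<Sum>us\<in>tup b {1..int (2 * X)}. h us) = (\<Sum>v\<in>vbox k b X. \<Sum>w\<in>{1..int (b * (2 * X) ^ (k - 1))}. \<Sum>us\<in>vcls k b X v w. h us)"
proof -
  let ?T = "tup b {1..int (2 * X)}" and ?R = "vbox k b X \<times> {1..int (b * (2 * X) ^ (k - 1))}"
  have "(\<Sum>us\<in>?T. h us) = (\<Sum>y\<in>?R. \<Sum>us\<in>{us\<in>?T. (vkey k us, psum (k - 1) us) = y}. h us)"
  proof (rule sum.group[symmetric])
    have "psum j us \<in> {1..int b * int (2 * X) ^ j}" if "us \<in> ?T" for us j
      using psum_bounds[OF that, of j] b by auto
    then show "(\<lambda>us. (vkey k us, psum (k - 1) us)) ` ?T \<subseteq> ?R"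
      by (auto simp: vkey_def vbox_def)
  qed auto
  also have "\<dots> = (\<Sum>(v, w)\<in>?R. \<Sum>us\<in>vcls k b X v w. h us)"
    by (intro sum.cong refl) (auto simp: vcls_def intro!: sum.cong)
  finally show ?thesis by (simp add: sum.cartesian_product)
qed

text \<open>The binomial theorem, sorted by the role of the terms: degree k has coefficient 1 for
  every z, degree k - 1 depends linearly on z, and the rest is a function of z and the key.\<close>

lemma shifted_power_sum:
  assumes k: "3 \<le> k" and us: "us \<in> tup b A"
  shows "(\<Sum>u\<leftarrow>us. (u - z) ^ k) = psum k us - int k * z * psum (k - 1) us
     + ((- z) ^ k * int b + (\<Sum>j\<in>{1..k-2}. int (k choose j) * (- z) ^ (k - j) * vkey k us j))"
proof -
  define c where "c j = int (k choose j) * (- z) ^ (k - j)" for j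
  have "(u - z) ^ k = (\<Sum>j\<le>k. c j * u ^ j)" for u
    using binomial_ring[of u "- z" k] by (simp add: c_def mult_ac)
  then have "(\<Sum>u\<leftarrow>us. (u - z) ^ k) = (\<Sum>j\<le>k. c j * psum j us)" by (simp add: sum_list_scale_swap)
  also have "{..k} = insert 0 (insert k (insert (k - 1) {1..k-2}))" using k by auto
  also have "(\<Sum>j\<in>insert 0 (insert k (insert (k - 1) {1..k-2})). c j * psum j us)
     = c 0 * psum 0 us + (c k * psum k us + (c (k - 1) * psum (k - 1) us + (\<Sum>j\<in>{1..k-2}. c j * psum j us)))"
    using k by (subst sum.insert, simp, force, subst sum.insert, simp, force, subst sum.insert) auto
  also have "psum 0 us = int b" using us by (simp add: psum_def tup_def sum_list_triv)
  also have "c 0 = (- z) ^ k" by (simp add: c_def)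
  also have "c k = 1" by (simp add: c_def)
  also have "c (k - 1) = - int k * z" using k binomial_symmetric[of 1 k] by (simp add: c_def)
  also have "(\<Sum>j\<in>{1..k-2}. c j * psum j us) = (\<Sum>j\<in>{1..k-2}. c j * vkey k us j)"
    by (intro sum.cong) (auto simp: vkey_def)
  finally show ?thesis by (simp add: c_def algebra_simps)
qed

text \<open>The sum f is estimated through each of its X shifts z, and the estimates are added up.
  Cauchy's inequality over the keys v costs their number; for fixed v the sum over z is a large
  sieve with points z and frequencies w, the power sums of degree k - 1.\<close>

lemma pointwise_shift:
  assumes k: "3 \<le> k" and b: "1 \<le> b" and X: "1 \<le> X"
    and \<Delta>: "\<And>z. z \<in> {1..int X} \<Longrightarrow> (\<Sum>z'\<in>{1..int X}. nb (real (b * (2 * X) ^ (k - 1))) (- real k * \<alpha> * of_int (z - z'))) \<le> \<Delta>" "0 \<le> \<Delta>"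
  shows "real X * cmod (fW k X \<alpha>) ^ (2 * b) \<le> Lam X ^ (2 * b) * (real (card (vbox k b X)) *
    (\<Delta> * (\<Sum>v\<in>vbox k b X. \<Sum>w\<in>{1..int (b * (2 * X) ^ (k - 1))}. (cmod (Gv k b X \<alpha> v w))\<^sup>2)))"
proof -
  define L where "L = int (2 * X)"
  define B where "B = b * (2 * X) ^ (k - 1)"
  define \<theta> where "\<theta> = - real k * \<alpha>"
  define S where "S z v = (\<Sum>w\<in>{1..int B}. Gv k b X \<alpha> v w * ee (\<theta> * of_int z * of_int w))" for z :: int and v
  have Lam: "0 \<le> Lam X" unfolding Lam_def using X by simp
  have pt: "cmod (fW k X \<alpha>) ^ (2 * b) \<le> Lam X ^ (2 * b) * (real (card (vbox k b X)) * (\<Sum>v\<in>vbox k b X. (cmod (S z v))\<^sup>2))"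
    if z: "z \<in> {1..int X}" for z
  proof -
    obtain t where t: "cmod (fW k X \<alpha>) \<le> Lam X * cmod (\<Sum>u\<in>{1..L}. ee (\<alpha> * of_int ((u - z) ^ k) + of_int t / real (2 * X) * of_int u))"
      using shift_cutoff[OF X z] unfolding L_def by blast
    define F where "F = (\<Sum>u\<in>{1..L}. ee (\<alpha> * of_int ((u - z) ^ k) + of_int t / real (2 * X) * of_int u))"
    \<comment> \<open>Everything in the phase that is constant on a key. The linear phase t of the
      cut-off belongs here because degree 1 is part of the key for k >= 3.\<close>
    define \<rho> where "\<rho> v = ee (\<alpha> * of_int ((- z) ^ k * int b + (\<Sum>j\<in>{1..k-2}. int (k choose j) * (- z) ^ (k - j) * v j))
        + of_int t / real (2 * X) * of_int (v 1))" for v :: "nat \<Rightarrow> int"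
    have "F ^ b = (\<Sum>us\<in>tup b {1..L}. ee (\<Sum>u\<leftarrow>us. \<alpha> * of_int ((u - z) ^ k) + of_int t / real (2 * X) * of_int u))"
      unfolding F_def by (subst sum_power_tup) (simp_all add: prod_list_ee)
    also have "\<dots> = (\<Sum>us\<in>tup b {1..L}. \<rho> (vkey k us) * (ee (\<alpha> * of_int (psum k us)) * ee (\<theta> * of_int z * of_int (psum (k - 1) us))))"
    proof (rule sum.cong[OF refl])
      fix us assume us: "us \<in> tup b {1..L}"
      have "(\<Sum>u\<leftarrow>us. \<alpha> * of_int ((u - z) ^ k) + of_int t / real (2 * X) * of_int u)
         = \<alpha> * of_int (\<Sum>u\<leftarrow>us. (u - z) ^ k) + of_int t / real (2 * X) * of_int (psum 1 us)"
        by (induction us) (simp_all add: psum_def distrib_left)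
      also have "psum 1 us = vkey k us 1"
        proof -
          have "1 \<in> {1..k-2}" using k by auto
          then show ?thesis by (simp add: vkey_def)
        qed
      finally have e: "(\<Sum>u\<leftarrow>us. \<alpha> * of_int ((u - z) ^ k) + of_int t / real (2 * X) * of_int u)
         = \<alpha> * of_int (\<Sum>u\<leftarrow>us. (u - z) ^ k) + of_int t / real (2 * X) * of_int (vkey k us 1)" .
      show "ee (\<Sum>u\<leftarrow>us. \<alpha> * of_int ((u - z) ^ k) + of_int t / real (2 * X) * of_int u)
        = \<rho> (vkey k us) * (ee (\<alpha> * of_int (psum k us)) * ee (\<theta> * of_int z * of_int (psum (k - 1) us)))"
        unfolding e shifted_power_sum[OF k us] \<rho>_def \<theta>_def ee_add[symmetric] of_int_add of_int_diff of_int_mult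
        by (rule arg_cong[of _ _ ee]) (simp only: of_int_of_nat_eq, algebra)
    qed
    also have "\<dots> = (\<Sum>v\<in>vbox k b X. \<rho> v * S z v)"
      unfolding L_def sum_vcls[OF b, of _ X k] S_def B_def sum_distrib_left
      by (intro sum.cong refl) (auto simp: Gv_def vcls_def sum_distrib_left sum_distrib_right intro!: sum.cong)
    finally have "cmod F ^ b \<le> (\<Sum>v\<in>vbox k b X. cmod (S z v))"
      unfolding norm_power[symmetric] by (simp only:) (rule order.trans[OF norm_sum], simp add: norm_mult \<rho>_def)
    then have "(cmod F ^ b)\<^sup>2 \<le> (\<Sum>v\<in>vbox k b X. cmod (S z v))\<^sup>2" by (intro power_mono) auto
    also have "\<dots> \<le> (\<Sum>v\<in>vbox k b X. (cmod (S z v))\<^sup>2) * card (vbox k b X)"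
      by (rule sum_squared_le_sum_of_squares)
    finally have F: "cmod F ^ (2 * b) \<le> card (vbox k b X) * (\<Sum>v\<in>vbox k b X. (cmod (S z v))\<^sup>2)"
      by (simp add: power_mult[symmetric] mult.commute)
    have "cmod (fW k X \<alpha>) ^ (2 * b) \<le> (Lam X * cmod F) ^ (2 * b)" using t unfolding F_def by (intro power_mono) auto
    also have "\<dots> \<le> Lam X ^ (2 * b) * (card (vbox k b X) * (\<Sum>v\<in>vbox k b X. (cmod (S z v))\<^sup>2))"
      unfolding power_mult_distrib using F Lam by (intro mult_left_mono) auto
    finally show ?thesis .
  qed
  have "real X * cmod (fW k X \<alpha>) ^ (2 * b) = (\<Sum>z\<in>{1..int X}. cmod (fW k X \<alpha>) ^ (2 * b))" by simp
  also have "\<dots> \<le> (\<Sum>z\<in>{1..int X}. Lam X ^ (2 * b) * (real (card (vbox k b X)) * (\<Sum>v\<in>vbox k b X. (cmod (S z v))\<^sup>2)))"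
    by (intro sum_mono pt)
  also have "\<dots> = Lam X ^ (2 * b) * (real (card (vbox k b X)) * (\<Sum>v\<in>vbox k b X. \<Sum>z\<in>{1..int X}. (cmod (S z v))\<^sup>2))"
    unfolding sum_distrib_left[symmetric] by (subst sum.swap) (rule refl)
  also have "\<dots> \<le> Lam X ^ (2 * b) * (real (card (vbox k b X)) * (\<Sum>v\<in>vbox k b X. \<Delta> * (\<Sum>w\<in>{1..int B}. (cmod (Gv k b X \<alpha> v w))\<^sup>2)))"
    unfolding S_def using Lam \<Delta>
    by (intro mult_left_mono sum_mono dual_large_sieve) (auto simp: B_def \<theta>_def)
  finally show ?thesis unfolding B_def sum_distrib_left[of \<Delta>] .
qed

text \<open>Orthogonality in h forces equality of the power sums of degree k, while membership in a
  common class forces it in the degrees below; so exactly the Vinogradov system is counted. M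
  exceeds all power sums of degree k, hence congruence modulo M is equality.\<close>

lemma mean_Gv:
  assumes k: "3 \<le> k" and b: "1 \<le> b" and X: "1 \<le> X" and M: "int b * int (2 * X) ^ k < M"
  shows "(\<Sum>h\<in>{0..<M}. \<Sum>v\<in>vbox k b X. \<Sum>w\<in>{1..int (b * (2 * X) ^ (k - 1))}. (cmod (Gv k b X (of_int h / of_int M) v w))\<^sup>2)
     = of_int M * real (card (vset b k (2 * X)))"
proof -
  let ?V = "vbox k b X" and ?W = "{1..int (b * (2 * X) ^ (k - 1))}" and ?T = "tup b {1..int (2 * X)}"
  have M0: "0 < M" using M by (meson le_less_trans mult_nonneg_nonneg of_nat_0_le_iff zero_le_power)
  have inner: "(\<Sum>h\<in>{0..<M}. (cmod (Gv k b X (of_int h / of_int M) v w))\<^sup>2)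
     = (\<Sum>us\<in>vcls k b X v w. \<Sum>vs\<in>vcls k b X v w. if psum k us = psum k vs then of_int M else 0)" for v w
  proof -
    have "complex_of_real (\<Sum>h\<in>{0..<M}. (cmod (Gv k b X (of_int h / of_int M) v w))\<^sup>2)
      = (\<Sum>h\<in>{0..<M}. \<Sum>us\<in>vcls k b X v w. \<Sum>vs\<in>vcls k b X v w. emod M (h * (psum k us - psum k vs)))"
      unfolding of_real_sum Gv_def norm_sum_square
      by (intro sum.cong refl) (simp add: ee_minus[symmetric] ee_add[symmetric] emod_def algebra_simps diff_divide_distrib)
    also have "\<dots> = (\<Sum>us\<in>vcls k b X v w. \<Sum>vs\<in>vcls k b X v w. \<Sum>h\<in>{0..<M}. emod M (h * (psum k us - psum k vs)))"
      by (subst sum.swap, intro sum.cong refl sum.swap)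
    also have "\<dots> = (\<Sum>us\<in>vcls k b X v w. \<Sum>vs\<in>vcls k b X v w. complex_of_real (if psum k us = psum k vs then of_int M else 0))"
    proof (intro sum.cong refl)
      fix us vs assume "us \<in> vcls k b X v w" "vs \<in> vcls k b X v w"
      then have T: "us \<in> ?T" "vs \<in> ?T" by (auto simp: vcls_def)
      have "\<bar>psum k us - psum k vs\<bar> < M"
        using psum_bounds[OF T(1), of k] psum_bounds[OF T(2), of k] M by auto
      then have "M dvd psum k us - psum k vs \<longleftrightarrow> psum k us = psum k vs"
        using zdvd_not_zless[of "\<bar>psum k us - psum k vs\<bar>" M] by auto
      then show "(\<Sum>h\<in>{0..<M}. emod M (h * (psum k us - psum k vs))) = complex_of_real (if psum k us = psum k vs then of_int M else 0)"
        unfolding sum_emod[OF M0] by simp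
    qed
    finally show ?thesis by (simp only: of_real_sum[symmetric] of_real_eq_iff)
  qed
  have "(\<Sum>h\<in>{0..<M}. \<Sum>v\<in>?V. \<Sum>w\<in>?W. (cmod (Gv k b X (of_int h / of_int M) v w))\<^sup>2)
     = (\<Sum>v\<in>?V. \<Sum>w\<in>?W. \<Sum>h\<in>{0..<M}. (cmod (Gv k b X (of_int h / of_int M) v w))\<^sup>2)"
    by (subst sum.swap, intro sum.cong refl sum.swap)
  also have "\<dots> = (\<Sum>v\<in>?V. \<Sum>w\<in>?W. \<Sum>us\<in>vcls k b X v w. \<Sum>vs\<in>?T. if (\<forall>j\<in>{1..k}. psum j us = psum j vs) then of_int M else 0)"
    unfolding inner
  proof (rule sum.cong[OF refl], rule sum.cong[OF refl], rule sum.cong[OF refl])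
    fix v w us assume us: "us \<in> vcls k b X v w"
    have "(\<Sum>vs\<in>?T. if (\<forall>j\<in>{1..k}. psum j us = psum j vs) then of_int M else 0) = (\<Sum>vs\<in>vcls k b X v w. if (\<forall>j\<in>{1..k}. psum j us = psum j vs) then of_int M else (0::real))"
    proof (rule sum.mono_neutral_right)
      show "\<forall>vs\<in>?T - vcls k b X v w. (if (\<forall>j\<in>{1..k}. psum j us = psum j vs) then of_int M else (0::real)) = 0"
      proof
        fix vs assume vs: "vs \<in> ?T - vcls k b X v w"
        have "\<not> (\<forall>j\<in>{1..k}. psum j us = psum j vs)"
        proof
          assume eq: "\<forall>j\<in>{1..k}. psum j us = psum j vs"
          then have "psum (k - 1) us = psum (k - 1) vs" using k by auto
          moreover have "vkey k us = vkey k vs" using eq by (auto simp: vkey_def restrict_def fun_eq_iff)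
          ultimately show False using us vs by (auto simp: vcls_def)
        qed
        then show "(if (\<forall>j\<in>{1..k}. psum j us = psum j vs) then of_int M else (0::real)) = 0" by (rule if_not_P)
      qed
    qed (auto simp: vcls_def)
    also have "\<dots> = (\<Sum>vs\<in>vcls k b X v w. if psum k us = psum k vs then of_int M else 0)"
    proof (rule sum.cong[OF refl])
      fix vs assume vs: "vs \<in> vcls k b X v w"
      have "psum j us = psum j vs" if "j \<in> {1..k}" "j \<noteq> k" for j
      proof (cases "j = k - 1")
        case False
        then have j: "j \<in> {1..k-2}" using that by auto
        have "vkey k us j = vkey k vs j" using us vs by (auto simp: vcls_def)
        then show ?thesis using j by (simp add: vkey_def)
      qed (use us vs in \<open>auto simp: vcls_def\<close>)
      then have "(\<forall>j\<in>{1..k}. psum j us = psum j vs) \<longleftrightarrow> psum k us = psum k vs" using k by force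
      then show "(if (\<forall>j\<in>{1..k}. psum j us = psum j vs) then of_int M else 0) = (if psum k us = psum k vs then of_int M else (0::real))" by simp
    qed
    finally show "(\<Sum>vs\<in>vcls k b X v w. if psum k us = psum k vs then of_int M else 0) = (\<Sum>vs\<in>?T. if (\<forall>j\<in>{1..k}. psum j us = psum j vs) then of_int M else (0::real))" ..
  qed
  also have "\<dots> = (\<Sum>us\<in>?T. \<Sum>vs\<in>?T. if (\<forall>j\<in>{1..k}. psum j us = psum j vs) then of_int M else 0)"
    by (rule sum_vcls[OF b, symmetric])
  also have "\<dots> = (\<Sum>z\<in>?T \<times> ?T. if z \<in> vset b k (2 * X) then of_int M else 0)"
    unfolding sum.cartesian_product
  proof (rule sum.cong[OF refl])
    fix z assume "z \<in> ?T \<times> ?T"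
    then show "(case z of (us, vs) \<Rightarrow> if \<forall>j\<in>{1..k}. psum j us = psum j vs then of_int M else 0) = (if z \<in> vset b k (2 * X) then of_int M else (0::real))"
      by (cases z) (simp add: vset_def)
  qed
  also have "\<dots> = (\<Sum>z\<in>(?T \<times> ?T) \<inter> vset b k (2 * X). of_int M)"
    by (rule sum.inter_restrict[symmetric]) simp
  also have "(?T \<times> ?T) \<inter> vset b k (2 * X) = vset b k (2 * X)" by (auto simp: vset_def)
  finally show ?thesis by simp
qed

text \<open>Each distance |z - z'| occurs at most twice, once on either side of z, and k times a
  distance is one of the m <= k X. The factor k comes from the coefficient of degree k - 1 in the
  shift.\<close>

lemma spacing_sum:
  assumes k: "1 \<le> k" and z: "z \<in> {1..int X}" and B: "0 \<le> B"
  shows "(\<Sum>z'\<in>{1..int X}. nb B (- real k * \<alpha> * of_int (z - z'))) \<le> 2 * (\<Sum>m\<le>k * X. nb B (\<alpha> * real m))"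
proof -
  define g where "g d = nb B (\<alpha> * real (k * d))" for d
  have g0: "0 \<le> g d" for d unfolding g_def using B by (rule nb_nonneg)
  have gz: "nb B (- real k * \<alpha> * of_int (z - z')) = g (nat \<bar>z - z'\<bar>)" for z'
    unfolding g_def
  proof (rule nb_cong, cases "z' \<le> z")
    case True
    then have "real (nat \<bar>z - z'\<bar>) = of_int (z - z')" by simp
    then have "- real k * \<alpha> * of_int (z - z') = - (\<alpha> * real (k * nat \<bar>z - z'\<bar>))" by (simp add: algebra_simps)
    then show "dn (- real k * \<alpha> * of_int (z - z')) = dn (\<alpha> * real (k * nat \<bar>z - z'\<bar>))" by (simp only: dn_minus)
  next
    case False
    then have "real (nat \<bar>z - z'\<bar>) = - of_int (z - z')" by simp
    then show "dn (- real k * \<alpha> * of_int (z - z')) = dn (\<alpha> * real (k * nat \<bar>z - z'\<bar>))"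
      by (intro arg_cong[of _ _ dn]) (simp add: algebra_simps)
  qed
  have gX: "(\<Sum>d\<le>X. g d) \<le> (\<Sum>m\<le>k * X. nb B (\<alpha> * real m))"
  proof -
    have "(\<Sum>d\<le>X. g d) = (\<Sum>m\<in>(\<lambda>d. k * d) ` {..X}. nb B (\<alpha> * real m))"
      using k by (subst sum.reindex) (auto simp: inj_on_def g_def)
    also have "\<dots> \<le> (\<Sum>m\<le>k * X. nb B (\<alpha> * real m))"
      using B by (intro sum_mono2) (auto simp: nb_nonneg)
    finally show ?thesis .
  qed
  have part: "(\<Sum>z'\<in>A. g (nat \<bar>z - z'\<bar>)) \<le> (\<Sum>d\<le>X. g d)"
    if iA: "inj_on (\<lambda>z'. nat \<bar>z - z'\<bar>) A" and sA: "A \<subseteq> {1..int X}" for A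
  proof -
    have "(\<Sum>z'\<in>A. g (nat \<bar>z - z'\<bar>)) = (\<Sum>d\<in>(\<lambda>z'. nat \<bar>z - z'\<bar>) ` A. g d)"
      using iA by (simp add: sum.reindex)
    also have "\<dots> \<le> (\<Sum>d\<le>X. g d)"
    proof (rule sum_mono2)
      show "(\<lambda>z'. nat \<bar>z - z'\<bar>) ` A \<subseteq> {..X}"
      proof
        fix d assume "d \<in> (\<lambda>z'. nat \<bar>z - z'\<bar>) ` A"
        then obtain z' where "z' \<in> {1..int X}" "d = nat \<bar>z - z'\<bar>" using sA by blast
        then show "d \<in> {..X}" using z by auto
      qed
    qed (use g0 in auto)
    finally show ?thesis .
  qed
  have "{1..int X} = {1..z} \<union> {z<..int X}" using z by auto
  then have "(\<Sum>z'\<in>{1..int X}. g (nat \<bar>z - z'\<bar>)) = (\<Sum>z'\<in>{1..z}. g (nat \<bar>z - z'\<bar>)) + (\<Sum>z'\<in>{z<..int X}. g (nat \<bar>z - z'\<bar>))"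
    by (simp only:) (rule sum.union_disjoint, auto)
  also have "\<dots> \<le> (\<Sum>d\<le>X. g d) + (\<Sum>d\<le>X. g d)"
    using z by (intro add_mono part) (auto simp: inj_on_def)
  finally show ?thesis unfolding gz using gX by linarith
qed

lemma one_plus_ln_le:
  assumes "1 \<le> (y::real)" "0 < \<delta>"
  shows "1 + ln y \<le> (1 + 1 / \<delta>) * y powr \<delta>"
proof -
  have "ln y \<le> y powr \<delta> / \<delta>" using assms by (rule ln_powr_bound)
  moreover have "1 \<le> y powr \<delta>" using assms by (intro ge_one_powr_ge_zero) auto
  ultimately show ?thesis by (simp add: algebra_simps)
qed

lemma rr_sum: "(\<Sum>j\<in>{1..m}. j) = rr m"
  by (induction m) (auto simp: rr_def rr_Suc)

lemma card_vbox: "card (vbox k b X) = b ^ (k - 2) * (2 * X) ^ rr (k - 2)"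
proof -
  have "card (vbox k b X) = (\<Prod>j\<in>{1..k-2}. b * (2 * X) ^ j)"
    unfolding vbox_def by (subst card_PiE) (auto simp: nat_mult_distrib nat_power_eq)
  also have "\<dots> = b ^ (k - 2) * (\<Prod>j\<in>{1..k-2}. (2 * X) ^ j)" by (simp add: prod.distrib)
  also have "(\<Prod>j\<in>{1..k-2}. (2 * X) ^ j) = (2 * X) ^ rr (k - 2)"
    unfolding rr_sum[symmetric] by (rule power_sum[symmetric])
  finally show ?thesis .
qed

text \<open>The factors are X^(rr (k-2)) for the number of keys, X^k / W from the large sieve and
  X^(rr k + \<epsilon>/2) from the mean value theorem, up to constants and logarithms. As rr (k-2) +
  k + rr k = 2 rr k - k + 1, dividing by the number X of shifts leaves X^(2 rr k - k) / W.\<close>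

theorem minor_arc_mean:
  assumes k: "3 \<le> k" and \<epsilon>: "0 < \<epsilon>"
  shows "\<exists>C>0. \<forall>X W n M HH. 1 \<le> X \<longrightarrow> 1 \<le> W \<longrightarrow> W \<le> real X \<longrightarrow> n \<le> real (2 * X) ^ k \<longrightarrow>
    int (rr k) * int (2 * X) ^ k < M \<longrightarrow> HH \<subseteq> {0..<M} \<longrightarrow>
    (\<forall>h\<in>HH. \<exists>a q. 0 < q \<and> coprime a (int q) \<and> W < real q \<and> real q \<le> n / W \<and> \<bar>of_int h / of_int M - of_int a / real q\<bar> \<le> 1 / (real q)\<^sup>2) \<longrightarrow>
    (\<Sum>h\<in>HH. cmod (fW k X (of_int h / of_int M)) ^ (2 * rr k)) \<le> of_int M * (C * real X powr (real (2 * rr k) - real k + \<epsilon>) / W)"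
proof -
  define b where "b = rr k"
  have b: "1 \<le> b" unfolding b_def using rr_pos[of k] k by simp
  obtain C1 where C1: "1 \<le> C1" "\<And>X. 1 \<le> X \<Longrightarrow> real (card (vset b k X)) \<le> C1 * real X powr (real b + \<epsilon> / 2)"
    using vinogradov_mean_value[of k "\<epsilon> / 2"] k \<epsilon> unfolding b_def by auto
  \<comment> \<open>There are 2 b + 1 logarithmic factors, 2 b from \<open>Lam\<close> and one from
    the harmonic sum; together they are absorbed in half of \<epsilon>.\<close>
  define \<delta> where "\<delta> = \<epsilon> / 2 / real (2 * b + 1)"
  have \<delta>: "0 < \<delta>" using \<epsilon> by (simp add: \<delta>_def)
  define A where "A = (5 + real k) * (1 + 1 / \<delta>)"
  define D where "D = 2 * (5 * real k * real b + 2 * real k + 5 * real b + 2)"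
  define K where "K = 2 * (A ^ (2 * b + 1) * real b ^ (k - 2) * D * C1)"
  have A0: "0 < A" unfolding A_def using \<delta> by (intro mult_pos_pos) (auto intro: add_pos_pos)
  have D0: "0 < D" unfolding D_def using k by (auto intro!: add_pos_pos add_nonneg_pos)
  have K0: "0 < K" unfolding K_def using A0 D0 C1 b by (auto intro!: mult_pos_pos)
  define e where "e = real (2 * b) - real k + \<epsilon>"
  show ?thesis
  proof (intro exI[of _ "K * 2 powr e"] conjI allI impI)
    show "0 < K * 2 powr e" using K0 by simp
    fix X :: nat and W n :: real and M :: int and HH :: "int set"
    assume X: "1 \<le> X" and W: "1 \<le> W" "W \<le> real X" and n: "n \<le> real (2 * X) ^ k" and M: "int (rr k) * int (2 * X) ^ k < M"
      and HH: "HH \<subseteq> {0..<M}" and dio: "\<forall>h\<in>HH. \<exists>a q. 0 < q \<and> coprime a (int q) \<and> W < real q \<and> real q \<le> n / W \<and>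
        \<bar>of_int h / of_int M - of_int a / real q\<bar> \<le> 1 / (real q)\<^sup>2"
    define x where "x = real (2 * X)"
    have x: "2 \<le> x" "0 < x" "1 \<le> x" using X by (auto simp: x_def)
    define B where "B = b * (2 * X) ^ (k - 1)"
    \<comment> \<open>The common bound, up to constants and \<open>Hh\<close>, for the four terms
      that arise on multiplying out \<open>nb_sum_bound\<close>: W < q handles the term with 1/q, q
      <= n / W the term with q, and W <= X the remaining two.\<close>
    define Y where "Y = x ^ k / W"
    define Hh where "Hh = real k * ln x + 1"
    have Hh: "1 \<le> Hh" unfolding Hh_def using x by simp
    have xk: "x ^ k = x * x ^ (k - 1)" using k by (metis Suc_pred' less_le_trans power_Suc zero_less_numeral)
    have WY: "W * Y = x ^ k" using W by (simp add: Y_def)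
    have Wx: "W \<le> x" using W X by (simp add: x_def)
    have xY: "x ^ (k - 1) \<le> Y"
    proof -
      have "W * x ^ (k - 1) \<le> x ^ k" unfolding xk using Wx x by (intro mult_right_mono) auto
      then show ?thesis unfolding Y_def using W by (simp add: field_simps)
    qed
    have XY: "real X \<le> Y"
    proof -
      have "real X \<le> x ^ 1" by (simp add: x_def)
      also have "\<dots> \<le> x ^ (k - 1)" using x k by (intro power_increasing) auto
      finally show ?thesis using xY by linarith
    qed
    have Y0: "0 < Y" using XY X by simp
    define \<Delta> where "\<Delta> = D * Hh * Y"
    have \<Delta>0: "0 \<le> \<Delta>" unfolding \<Delta>_def using D0 Hh Y0 by simp
    have Bx: "real B = real b * x ^ (k - 1)" by (simp add: B_def x_def)
    have Del: "(\<Sum>z'\<in>{1..int X}. nb (real B) (- real k * (of_int h / of_int M) * of_int (z - z'))) \<le> \<Delta>"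
      if h: "h \<in> HH" and z: "z \<in> {1..int X}" for h z
    proof -
      obtain a q where q: "0 < q" "coprime a (int q)" "W < real q" "real q \<le> n / W" "\<bar>of_int h / of_int M - of_int a / real q\<bar> \<le> 1 / (real q)\<^sup>2"
        using dio h by blast
      have q1: "1 \<le> real q" using q(1) by simp
      have qY: "real q \<le> Y"
      proof -
        have "n / W \<le> x ^ k / W" using n W unfolding x_def by (intro divide_right_mono) auto
        then show ?thesis using q(4) unfolding Y_def by linarith
      qed
      have hq: "harm q \<le> Hh"
      proof -
        have "real q \<le> x ^ k" using qY W Y0 WY mult_right_mono[of 1 W Y] by simp
        then have "ln (real q) \<le> ln (x ^ k)" using q1 x by (subst ln_le_cancel_iff) auto
        also have "\<dots> = real k * ln x" using x by (simp add: ln_realpow)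
        finally show ?thesis using harm_le[OF q(1)] unfolding Hh_def by linarith
      qed
      have "(\<Sum>z'\<in>{1..int X}. nb (real B) (- real k * (of_int h / of_int M) * of_int (z - z')))
         \<le> 2 * (\<Sum>m\<le>k * X. nb (real B) (of_int h / of_int M * real m))"
        using k z by (intro spacing_sum) auto
      also have "\<dots> \<le> 2 * ((real (k * X) / real q + 1) * (5 * real B + 2 * real q * harm q))"
        using q by (intro mult_left_mono nb_sum_bound) auto
      also have "(real (k * X) / real q + 1) * (5 * real B + 2 * real q * harm q)
         = 5 * real k * (real X * real B / real q) + 2 * real k * (real X * harm q) + 5 * real B + 2 * (real q * harm q)"
        using q(1) by (simp add: field_simps)
      also have "\<dots> \<le> 5 * real k * (real b * Y * Hh) + 2 * real k * (Y * Hh) + 5 * (real b * Y * Hh) + 2 * (Y * Hh)"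
      proof (intro add_mono mult_left_mono)
        have bY: "real b * Y * 1 \<le> real b * Y * Hh" using Hh Y0 by (intro mult_left_mono) auto
        have "real X * real B / real q \<le> x * real B / W"
          using q(3) W X by (intro frac_le mult_right_mono) (auto simp: x_def)
        also have "x * real B / W = real b * Y" unfolding Bx Y_def xk by simp
        finally show "real X * real B / real q \<le> real b * Y * Hh" using bY by linarith
        show "real X * harm q \<le> Y * Hh" using XY hq Y0 by (intro mult_mono harm_nonneg) auto
        have "real B \<le> real b * Y" unfolding Bx using xY by (intro mult_left_mono) auto
        then show "real B \<le> real b * Y * Hh" using bY by linarith
        show "real q * harm q \<le> Y * Hh" using qY hq Y0 by (intro mult_mono harm_nonneg) auto
      qed auto
      also have "2 * (5 * real k * (real b * Y * Hh) + 2 * real k * (Y * Hh) + 5 * (real b * Y * Hh) + 2 * (Y * Hh)) = \<Delta>"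
        unfolding \<Delta>_def D_def by (simp add: algebra_simps)
      finally show ?thesis by simp
    qed
    define GG where "GG h = (\<Sum>v\<in>vbox k b X. \<Sum>w\<in>{1..int B}. (cmod (Gv k b X (of_int h / of_int M) v w))\<^sup>2)" for h :: int
    have GG0: "0 \<le> GG h" for h unfolding GG_def by (intro sum_nonneg) auto
    have Lam0: "0 \<le> Lam X" unfolding Lam_def using X by simp
    have fin: "finite HH" using HH by (rule finite_subset) simp
    have M0: "0 < M" using M by (meson le_less_trans mult_nonneg_nonneg of_nat_0_le_iff zero_le_power)
    have "real X * (\<Sum>h\<in>HH. cmod (fW k X (of_int h / of_int M)) ^ (2 * b)) \<le> (\<Sum>h\<in>HH. Lam X ^ (2 * b) * (real (card (vbox k b X)) * (\<Delta> * GG h)))"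
      unfolding sum_distrib_left[of "real X"] GG_def B_def
      by (intro sum_mono pointwise_shift[OF k b X] \<Delta>0) (use Del in \<open>auto simp: B_def\<close>)
    also have "\<dots> = Lam X ^ (2 * b) * (real (card (vbox k b X)) * (\<Delta> * (\<Sum>h\<in>HH. GG h)))"
      by (simp add: sum_distrib_left)
    also have "\<dots> \<le> Lam X ^ (2 * b) * (real (card (vbox k b X)) * (\<Delta> * (of_int M * (C1 * x powr (real b + \<epsilon> / 2)))))"
    proof (intro mult_left_mono)
      have "(\<Sum>h\<in>HH. GG h) \<le> (\<Sum>h\<in>{0..<M}. GG h)" using HH GG0 by (intro sum_mono2) auto
      also have "\<dots> = of_int M * real (card (vset b k (2 * X)))"
        unfolding GG_def B_def using M unfolding b_def[symmetric] by (intro mean_Gv[OF k b X])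
      also have "\<dots> \<le> of_int M * (C1 * x powr (real b + \<epsilon> / 2))"
        unfolding x_def using M0 X by (intro mult_left_mono C1(2)) auto
      finally show "(\<Sum>h\<in>HH. GG h) \<le> of_int M * (C1 * x powr (real b + \<epsilon> / 2))" .
    qed (use \<Delta>0 Lam0 in auto)
    also have "\<dots> = of_int M * C1 * D * real b ^ (k - 2) / W * ((Lam X ^ (2 * b) * Hh) * (x ^ rr (k - 2) * x ^ k * x powr (real b + \<epsilon> / 2)))"
      unfolding card_vbox \<Delta>_def Y_def x_def by simp
    also have "\<dots> \<le> of_int M * C1 * D * real b ^ (k - 2) / W * ((A ^ (2 * b + 1) * x powr (\<epsilon> / 2)) * (x ^ rr (k - 2) * x ^ k * x powr (real b + \<epsilon> / 2)))"
    proof (intro mult_left_mono mult_right_mono)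
      define t where "t = (5 + real k) * (1 + ln x)"
      have lnx: "0 \<le> ln x" using x by simp
      have tA: "t \<le> A * x powr \<delta>"
        unfolding t_def A_def using one_plus_ln_le[OF x(3) \<delta>] by (simp add: mult.assoc mult_left_mono)
      have "Lam X \<le> t" unfolding Lam_def t_def x_def[symmetric] using lnx k by (simp add: algebra_simps)
      moreover have "Hh \<le> t" unfolding Hh_def t_def using lnx by (simp add: algebra_simps)
      ultimately have "Lam X ^ (2 * b) * Hh \<le> t ^ (2 * b) * t" using Lam0 Hh by (intro mult_mono power_mono) auto
      also have "\<dots> = t ^ (2 * b + 1)" by simp
      also have "\<dots> \<le> (A * x powr \<delta>) ^ (2 * b + 1)" using tA lnx by (intro power_mono) (auto simp: t_def)
      also have "\<dots> = A ^ (2 * b + 1) * x powr (\<epsilon> / 2)"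
      proof -
        have "(x powr \<delta>) ^ (2 * b + 1) = x powr (\<delta> * real (2 * b + 1))"
          using x by (subst powr_realpow[symmetric]) (simp_all add: powr_powr)
        moreover have "\<delta> * real (2 * b + 1) = \<epsilon> / 2"
        proof -
          have n0: "real (2 * b + 1) \<noteq> 0" by linarith
          show ?thesis using nonzero_eq_divide_eq[OF n0, of \<delta> "\<epsilon> / 2"] \<delta>_def by blast
        qed
        ultimately show ?thesis by (simp only: power_mult_distrib)
      qed
      finally show "Lam X ^ (2 * b) * Hh \<le> A ^ (2 * b + 1) * x powr (\<epsilon> / 2)" .
    qed (use M0 C1 D0 W x in auto)
    also have "x powr (\<epsilon> / 2) * (x ^ rr (k - 2) * x ^ k * x powr (real b + \<epsilon> / 2)) = x * x powr e"
    proof -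
      have "real (rr (k - 2)) + real k = real b - real k + 1"
      proof -
        define m where "m = k - 2"
        have m: "k = Suc (Suc m)" using k by (simp add: m_def)
        show ?thesis unfolding b_def m by (simp add: rr_Suc)
      qed
      then have ex: "1 + e = real (rr (k - 2)) + real k + (real b + \<epsilon> / 2) + \<epsilon> / 2" by (simp add: e_def)
      have "x powr (1 + e) = x ^ rr (k - 2) * x ^ k * x powr (real b + \<epsilon> / 2) * x powr (\<epsilon> / 2)"
        unfolding ex powr_add using x by (simp only: powr_realpow)
      moreover have "x powr (1 + e) = x * x powr e" using x by (simp add: powr_add)
      ultimately show ?thesis by (simp only: mult_ac)
    qed
    then have "of_int M * C1 * D * real b ^ (k - 2) / W * ((A ^ (2 * b + 1) * x powr (\<epsilon> / 2)) * (x ^ rr (k - 2) * x ^ k * x powr (real b + \<epsilon> / 2)))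
       = of_int M * C1 * D * real b ^ (k - 2) / W * (A ^ (2 * b + 1) * (x * x powr e))" by (simp only: mult.assoc)
    also have "\<dots> = real X * (of_int M * (K * 2 powr e * real X powr e / W))"
    proof -
      have "x powr e = 2 powr e * real X powr e" unfolding x_def by (simp add: powr_mult)
      then show ?thesis by (simp add: K_def x_def)
    qed
    finally have "real X * (\<Sum>h\<in>HH. cmod (fW k X (of_int h / of_int M)) ^ (2 * b)) \<le> real X * (of_int M * (K * 2 powr e * real X powr e / W))" .
    then have "(\<Sum>h\<in>HH. cmod (fW k X (of_int h / of_int M)) ^ (2 * b)) \<le> of_int M * (K * 2 powr e * real X powr e / W)"
      by (rule mult_left_le_imp_le) (use X in simp)
    then show "(\<Sum>h\<in>HH. cmod (fW k X (of_int h / of_int M)) ^ (2 * rr k)) \<le> of_int M * (K * 2 powr e * real X powr (real (2 * rr k) - real k + \<epsilon>) / W)"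
      unfolding b_def e_def .
  qed
qed

section \<open>Gauss sums and the singular series\<close>

definition gS :: "nat \<Rightarrow> int \<Rightarrow> int \<Rightarrow> complex" where
  "gS k q a = (\<Sum>r\<in>{0..<q}. emod q (a * r ^ k))"

lemma finite_Ico_filter: "finite {x\<in>{a..<b::int}. P x}"
  by (rule finite_subset[of _ "{a..<b}"]) auto

lemma int_div_less:
  fixes w q b :: int
  assumes "0 < q" "w < b * q"
  shows "w div q < b"
proof (rule ccontr)
  assume "\<not> ?thesis"
  then have "b * q \<le> (w div q) * q" using assms by (intro mult_right_mono) auto
  also have "\<dots> \<le> w" using assms(1) pos_mod_sign[of q w] div_mult_mod_eq[of w q] by linarith
  finally show False using assms(2) by simp
qed

lemma emod_pow_cong: "0 < q \<Longrightarrow> [x = y] (mod q) \<Longrightarrow> emod q (a * x ^ k) = emod q (a * y ^ k)"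
  by (intro emod_cong cong_mult cong_pow) auto

text \<open>An injection between finite sets of suitable size is a bijection; this is how
  multiplication by units, changes of residue system and rotations of the grid are handled.\<close>

lemma sum_mod_inj:
  fixes g :: "int \<Rightarrow> 'a::comm_monoid_add"
  assumes fin: "finite A" and inj: "inj_on f A" and im: "f ` A \<subseteq> B" and B: "finite B" "card B \<le> card A"
  shows "(\<Sum>x\<in>A. g (f x)) = (\<Sum>y\<in>B. g y)"
proof -
  have "card (f ` A) \<le> card B" using B(1) im by (rule card_mono)
  then have "card (f ` A) = card B" using B(2) inj by (simp add: card_image)
  with B(1) im have "f ` A = B" by (rule card_subset_eq)
  then show ?thesis using inj by (metis sum.reindex_cong)
qed

text \<open>Chinese remainder theorem with r = q2 r1 + q1 r2: the cross terms of r^k are divisible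
  by q1 q2, and cancelling q2 in a (q2 r1)^k / (q1 q2) leaves the factor q2^(k-1) in the first sum,
  and likewise in the second.\<close>

lemma gS_mult:
  assumes q: "0 < q1" "0 < q2" and cop: "coprime q1 q2" and k: "1 \<le> k"
  shows "gS k (q1 * q2) a = gS k q1 (a * q2 ^ (k - 1)) * gS k q2 (a * q1 ^ (k - 1))"
proof -
  define f where "f = (\<lambda>(r1, r2). (q2 * r1 + q1 * r2) mod (q1 * q2))"
  have Q: "0 < q1 * q2" using q by simp
  have cong1: "q1 dvd x - y" if "(q2 * x + q1 * z) mod (q1 * q2) = (q2 * y + q1 * w) mod (q1 * q2)"
    "coprime q1 q2" for q1 q2 x y z w :: int
  proof -
    have "q1 * q2 dvd (q2 * x + q1 * z) - (q2 * y + q1 * w)" using that(1) unfolding mod_eq_dvd_iff .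
    then have "q1 dvd (q2 * x + q1 * z) - (q2 * y + q1 * w)" by (rule dvd_mult_left)
    moreover have "(q2 * x + q1 * z) - (q2 * y + q1 * w) = q2 * (x - y) + q1 * (z - w)" by (simp add: algebra_simps)
    ultimately have "q1 dvd q2 * (x - y)" by (simp add: dvd_add_left_iff)
    then show ?thesis using that(2) by (simp add: coprime_dvd_mult_right_iff)
  qed
  have eqI: "x = y" if "x \<in> {0..<q}" "y \<in> {0..<q}" "q dvd x - y" for x y q :: int
  proof -
    have "x mod q = y mod q" using that(3) unfolding mod_eq_dvd_iff .
    then show ?thesis using that by simp
  qed
  have "gS k q1 (a * q2 ^ (k - 1)) * gS k q2 (a * q1 ^ (k - 1))
     = (\<Sum>(r1, r2)\<in>{0..<q1} \<times> {0..<q2}. emod q1 (a * q2 ^ (k - 1) * r1 ^ k) * emod q2 (a * q1 ^ (k - 1) * r2 ^ k))"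
    unfolding gS_def sum_product by (simp add: sum.cartesian_product)
  also have "\<dots> = (\<Sum>z\<in>{0..<q1} \<times> {0..<q2}. emod (q1 * q2) (a * f z ^ k))"
  proof (rule sum.cong[OF refl], clarify)
    fix r1 r2
    have "emod q1 (a * q2 ^ (k - 1) * r1 ^ k) = emod (q1 * q2) (a * q2 ^ (k - 1) * r1 ^ k * q2)"
      using q by (intro emod_mult_cancel[symmetric]) auto
    also have "a * q2 ^ (k - 1) * r1 ^ k * q2 = a * (q2 * r1) ^ k"
      using k by (cases k) (auto simp: power_mult_distrib)
    finally have e1: "emod q1 (a * q2 ^ (k - 1) * r1 ^ k) = emod (q1 * q2) (a * (q2 * r1) ^ k)" .
    have "emod q2 (a * q1 ^ (k - 1) * r2 ^ k) = emod (q2 * q1) (a * q1 ^ (k - 1) * r2 ^ k * q1)"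
      using q by (intro emod_mult_cancel[symmetric]) auto
    also have "a * q1 ^ (k - 1) * r2 ^ k * q1 = a * (q1 * r2) ^ k"
      using k by (cases k) (auto simp: power_mult_distrib)
    finally have e2: "emod q2 (a * q1 ^ (k - 1) * r2 ^ k) = emod (q1 * q2) (a * (q1 * r2) ^ k)" by (simp add: mult.commute)
    have "[(q2 * r1 + q1 * r2) ^ k = (q2 * r1) ^ k + (q1 * r2) ^ k] (mod q1 * q2)"
    proof -
      \<comment> \<open>Induction on the exponent; n = 0 is treated separately because 1 + 1 is not
        (x + y)^0.\<close>
      have "[x ^ k + y ^ k = (x + y) ^ k] (mod q1 * q2)" if xy: "q1 * q2 dvd x * y" for x y
        using k
      proof (induction k rule: dec_induct)
        case (step n)
        have "(x + y) ^ Suc n - (x ^ Suc n + y ^ Suc n) = (x + y) * ((x + y) ^ n - (x ^ n + y ^ n)) + x * y * (if n = 0 then 2 else x ^ (n - 1) + y ^ (n - 1))"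
          using step by (cases n) (auto simp: algebra_simps)
        moreover have "q1 * q2 dvd (x + y) ^ n - (x ^ n + y ^ n)" using step.IH by (metis cong_iff_dvd_diff cong_sym)
        ultimately have "q1 * q2 dvd (x + y) ^ Suc n - (x ^ Suc n + y ^ Suc n)" using xy by (metis dvd_add dvd_mult dvd_mult2)
        then show ?case by (metis cong_iff_dvd_diff cong_sym)
      qed simp
      then show ?thesis by (metis cong_sym dvd_triv_left mult.assoc mult.commute mult.left_commute)
    qed
    then have "[a * f (r1, r2) ^ k = a * (q2 * r1) ^ k + a * (q1 * r2) ^ k] (mod q1 * q2)"
      unfolding f_def distrib_left[symmetric] prod.case
      by (intro cong_mult cong_refl) (metis cong_def power_mod)
    then have "emod (q1 * q2) (a * f (r1, r2) ^ k) = emod (q1 * q2) (a * (q2 * r1) ^ k) * emod (q1 * q2) (a * (q1 * r2) ^ k)"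
      unfolding emod_add[symmetric] using Q by (intro emod_cong) auto
    then show "emod q1 (a * q2 ^ (k - 1) * r1 ^ k) * emod q2 (a * q1 ^ (k - 1) * r2 ^ k) = emod (q1 * q2) (a * f (r1, r2) ^ k)"
      using e1 e2 by simp
  qed
  also have "\<dots> = (\<Sum>y\<in>{0..<q1 * q2}. emod (q1 * q2) (a * y ^ k))"
  proof (rule sum_mod_inj[of _ f])
    show "inj_on f ({0..<q1} \<times> {0..<q2})"
    proof (rule inj_onI, clarify)
      fix r1 r2 s1 s2 assume h: "r1 \<in> {0..<q1}" "r2 \<in> {0..<q2}" "s1 \<in> {0..<q1}" "s2 \<in> {0..<q2}" "f (r1, r2) = f (s1, s2)"
      then have e: "(q2 * r1 + q1 * r2) mod (q1 * q2) = (q2 * s1 + q1 * s2) mod (q1 * q2)" by (simp add: f_def)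
      then have "q1 dvd r1 - s1" using cop by (rule cong1)
      moreover have "q2 dvd r2 - s2"
        using e cop by (intro cong1[of q1 r2 q2 r1 s2 s1]) (simp_all add: add.commute mult.commute coprime_commute)
      ultimately show "r1 = s1 \<and> r2 = s2" using h eqI by blast
    qed
    show "card {0..<q1 * q2} \<le> card ({0..<q1} \<times> {0..<q2})" using q by (simp add: card_cartesian_product nat_mult_distrib)
  qed (use Q in \<open>auto simp: f_def\<close>)
  finally show ?thesis by (simp add: gS_def)
qed

lemma gS_norm_le: "0 < q \<Longrightarrow> cmod (gS k q a) \<le> of_int q"
  unfolding gS_def by (rule order.trans[OF norm_sum]) simp

text \<open>Multiplying r by 1 + p^m t permutes the units, and (1 + p^m t)^k = 1 + k p^m t modulo
  p^j because 2 m >= j. Averaging over t modulo p^(v+1) gives a complete sum with frequency a r^k k,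
  which vanishes as p^(v+1) does not divide k.\<close>

lemma gS_units_zero:
  assumes p: "prime p" and v: "\<not> p ^ Suc v dvd int k" and j: "2 * v + 2 \<le> j" and a: "\<not> p dvd a"
  shows "(\<Sum>r\<in>{r\<in>{0..<p ^ j}. \<not> p dvd r}. emod (p ^ j) (a * r ^ k)) = 0"
proof -
  define m where "m = j - v - 1"
  have m: "1 \<le> m" "j \<le> 2 * m" "j = Suc v + m" using j by (auto simp: m_def)
  have m4: "p ^ j = p ^ Suc v * p ^ m" unfolding m(3) by (rule power_add)
  define U where "U = {r\<in>{0..<p ^ j}. \<not> p dvd r}"
  have p0: "0 < p" using p by (rule prime_gt_0_int)
  define q where "q = p ^ j"
  have q: "0 < q" using p0 by (simp add: q_def)
  have U: "finite U" by (rule finite_subset[of _ "{0..<p ^ j}"]) (auto simp: U_def)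
  have pm: "p dvd p ^ m" using m by (simp add: dvd_power)
  have perm: "(\<Sum>r\<in>U. emod q (a * (r * (1 + p ^ m * t)) ^ k)) = (\<Sum>r\<in>U. emod q (a * r ^ k))" for t
  proof -
    define u where "u = 1 + p ^ m * t"
    have pu: "\<not> p dvd u"
    proof
      assume "p dvd u"
      then have "p dvd u - p ^ m * t" using pm by (intro dvd_diff) auto
      then show False using p by (simp add: u_def not_prime_unit)
    qed
    have cop: "coprime u q" unfolding q_def using prime_imp_coprime[OF p pu] by (simp add: coprime_commute)
    have "(\<Sum>r\<in>U. emod q (a * ((r * u) mod q) ^ k)) = (\<Sum>y\<in>U. emod q (a * y ^ k))"
    proof (rule sum_mod_inj[of _ "\<lambda>r. (r * u) mod q"])
      show "inj_on (\<lambda>r. (r * u) mod q) U"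
      proof (rule inj_onI)
        fix x y assume xy: "x \<in> U" "y \<in> U" "(x * u) mod q = (y * u) mod q"
        then have "q dvd x * u - y * u" unfolding mod_eq_dvd_iff by simp
        then have "q dvd (x - y) * u" by (simp add: left_diff_distrib)
        then have "q dvd x - y" using cop by (simp add: coprime_commute coprime_dvd_mult_left_iff)
        then have "x mod q = y mod q" unfolding mod_eq_dvd_iff .
        then show "x = y" using xy by (simp add: U_def q_def)
      qed
      show "(\<lambda>r. (r * u) mod q) ` U \<subseteq> U"
      proof clarify
        fix r assume r: "r \<in> U"
        have "p dvd q" unfolding q_def using j by (simp add: dvd_power)
        then have "p dvd (r * u) mod q \<longleftrightarrow> p dvd r * u" by (rule dvd_mod_iff)
        then have "\<not> p dvd (r * u) mod q" using r pu p by (auto simp: U_def prime_dvd_mult_iff)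
        then show "(r * u) mod q \<in> U" using q by (simp add: U_def q_def[symmetric])
      qed
    qed (use U in auto)
    moreover have "emod q (a * ((r * u) mod q) ^ k) = emod q (a * (r * u) ^ k)" for r
      using q by (intro emod_pow_cong) (auto simp: cong_def)
    ultimately show ?thesis unfolding u_def by simp
  qed
  have bin: "[(1 + p ^ m * t) ^ k = 1 + int k * (p ^ m * t)] (mod q)" for t
  proof -
    have "q dvd p ^ m * p ^ m" unfolding q_def power_add[symmetric] using m by (intro le_imp_power_dvd) auto
    then have qd: "q dvd (p ^ m * t) * (p ^ m * t)" by (metis dvd_trans dvd_triv_left mult.assoc mult.left_commute)
    have "q dvd (1 + y) ^ k - (1 + int k * y)" if "q dvd y * y" for y
    proof (induction k)
      case (Suc n)
      have "(1 + y) ^ Suc n - (1 + int (Suc n) * y) = (1 + y) * ((1 + y) ^ n - (1 + int n * y)) + int n * (y * y)"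
        by (simp add: algebra_simps)
      then show ?case using Suc that by simp
    qed simp
    then show ?thesis using qd by (simp add: cong_iff_dvd_diff)
  qed
  have zero: "(\<Sum>t\<in>{0..<p ^ Suc v}. emod q (a * (r * (1 + p ^ m * t)) ^ k)) = 0" if r: "r \<in> U" for r
  proof -
    have "emod q (a * (r * (1 + p ^ m * t)) ^ k) = emod q (a * r ^ k) * emod (p ^ Suc v) (t * (a * r ^ k * int k))" for t
    proof -
      have "[a * (r * (1 + p ^ m * t)) ^ k = a * (r ^ k * (1 + int k * (p ^ m * t)))] (mod q)"
        unfolding power_mult_distrib using bin by (intro cong_mult cong_refl)
      then have "emod q (a * (r * (1 + p ^ m * t)) ^ k) = emod q (a * r ^ k + (t * (a * r ^ k * int k)) * p ^ m)"
        using q by (subst emod_cong[of _ "a * (r ^ k * (1 + int k * (p ^ m * t)))"]) (auto simp: algebra_simps)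
      also have "\<dots> = emod q (a * r ^ k) * emod (p ^ Suc v * p ^ m) ((t * (a * r ^ k * int k)) * p ^ m)"
        by (simp only: emod_add q_def m4)
      also have "emod (p ^ Suc v * p ^ m) ((t * (a * r ^ k * int k)) * p ^ m) = emod (p ^ Suc v) (t * (a * r ^ k * int k))"
        using p0 by (intro emod_mult_cancel) simp
      finally show ?thesis .
    qed
    then have "(\<Sum>t\<in>{0..<p ^ Suc v}. emod q (a * (r * (1 + p ^ m * t)) ^ k))
       = emod q (a * r ^ k) * (\<Sum>t\<in>{0..<p ^ Suc v}. emod (p ^ Suc v) (t * (a * r ^ k * int k)))"
      by (simp only: sum_distrib_left)
    moreover have "\<not> p ^ Suc v dvd a * r ^ k * int k"
    proof -
      have "coprime (p ^ Suc v) (a * r ^ k)" using p a r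
        by (auto simp: U_def intro!: coprime_power_left_iff[THEN iffD2] prime_imp_coprime simp: prime_dvd_mult_iff dest: prime_dvd_power)
      then show ?thesis using v by (simp add: coprime_dvd_mult_right_iff)
    qed
    ultimately show ?thesis using sum_emod[of "p ^ Suc v" "a * r ^ k * int k"] p0 by simp
  qed
  have "of_int (p ^ Suc v) * (\<Sum>r\<in>U. emod q (a * r ^ k)) = (\<Sum>t\<in>{0..<p ^ Suc v}. \<Sum>r\<in>U. emod q (a * (r * (1 + p ^ m * t)) ^ k))"
    unfolding perm using p0 by simp
  also have "\<dots> = (\<Sum>r\<in>U. \<Sum>t\<in>{0..<p ^ Suc v}. emod q (a * (r * (1 + p ^ m * t)) ^ k))" by (rule sum.swap)
  also have "\<dots> = 0" using zero by simp
  finally show ?thesis using p0 unfolding U_def q_def by simp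
qed

text \<open>Only the multiples r = p w survive, by \<open>gS_units_zero\<close>. For j <= k each of
  these p^(j-1) terms equals 1; otherwise w runs p^(k-1) times through a period modulo
  p^(j-k).\<close>

lemma gS_prime_power:
  assumes p: "prime p" and v: "\<not> p ^ Suc v dvd int k" and j: "2 * v + 2 \<le> j" and a: "\<not> p dvd a" and k: "1 \<le> k"
  shows "cmod (gS k (p ^ j) a) = (if j \<le> k then of_int p ^ (j - 1) else of_int p ^ (k - 1) * cmod (gS k (p ^ (j - k)) a))"
proof -
  have p0: "0 < p" using p by (rule prime_gt_0_int)
  define q where "q = p ^ j"
  have q: "0 < q" using p0 by (simp add: q_def)
  have qj: "q = p * p ^ (j - 1)" unfolding q_def using j by (simp flip: power_Suc)
  have "gS k q a = (\<Sum>r\<in>{r\<in>{0..<q}. p dvd r}. emod q (a * r ^ k)) + (\<Sum>r\<in>{r\<in>{0..<q}. \<not> p dvd r}. emod q (a * r ^ k))"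
  proof -
    have "finite {r\<in>{0..<q}. p dvd r}" "finite {r\<in>{0..<q}. \<not> p dvd r}"
      by (rule finite_subset[of _ "{0..<q}"]; auto)+
    moreover have "{0..<q} = {r\<in>{0..<q}. p dvd r} \<union> {r\<in>{0..<q}. \<not> p dvd r}" by auto
    ultimately show ?thesis unfolding gS_def by (metis (no_types, lifting) sum.union_disjoint disjoint_iff mem_Collect_eq)
  qed
  also have "(\<Sum>r\<in>{r\<in>{0..<q}. \<not> p dvd r}. emod q (a * r ^ k)) = 0"
    unfolding q_def by (rule gS_units_zero[OF p v j a])
  also have "(\<Sum>r\<in>{r\<in>{0..<q}. p dvd r}. emod q (a * r ^ k)) = (\<Sum>w\<in>{0..<p ^ (j - 1)}. emod q (a * (p * w) ^ k))"
  proof (rule sum.reindex_bij_witness[of _ "\<lambda>w. p * w" "\<lambda>r. r div p"])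
    fix r assume r: "r \<in> {r \<in> {0..<q}. p dvd r}"
    then show "r div p \<in> {0..<p ^ (j - 1)}" using p0 qj by (auto simp: pos_imp_zdiv_nonneg_iff elim!: dvdE)
  qed (use p0 qj in auto)
  finally have S: "gS k q a = (\<Sum>w\<in>{0..<p ^ (j - 1)}. emod q (a * (p * w) ^ k))" by simp
  show ?thesis
  proof (cases "j \<le> k")
    case True
    have "emod q (a * (p * w) ^ k) = 1" for w
    proof -
      have "q dvd p ^ k" unfolding q_def using True by (rule le_imp_power_dvd)
      then have "q dvd a * (p * w) ^ k" by (simp add: power_mult_distrib)
      then show ?thesis using emod_eq_1_iff[OF q] by simp
    qed
    then show ?thesis using True S p0 unfolding q_def[symmetric] by (simp add: norm_power)
  next
    case False
    define q' where "q' = p ^ (j - k)"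
    have q': "0 < q'" using p0 by (simp add: q'_def)
    have qq: "q = q' * p ^ k" unfolding q_def q'_def using False by (simp flip: power_add)
    have "emod q (a * (p * w) ^ k) = emod q' (a * w ^ k)" for w
    proof -
      have "emod q (a * (p * w) ^ k) = emod (q' * p ^ k) (a * w ^ k * p ^ k)" unfolding qq by (simp add: power_mult_distrib mult_ac)
      then show ?thesis using p0 by (simp add: emod_mult_cancel)
    qed
    then have "gS k q a = (\<Sum>w\<in>{0..<p ^ (j - 1)}. emod q' (a * w ^ k))" using S by simp
    also have "p ^ (j - 1) = p ^ (k - 1) * q'" unfolding q'_def using False k by (simp flip: power_add)
    also have "(\<Sum>w\<in>{0..<p ^ (k - 1) * q'}. emod q' (a * w ^ k)) = (\<Sum>(i, r)\<in>{0..<p ^ (k - 1)} \<times> {0..<q'}. emod q' (a * r ^ k))"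
    proof (rule sum.reindex_bij_witness[of _ "\<lambda>(i, r). i * q' + r" "\<lambda>w. (w div q', w mod q')"])
      fix w assume "w \<in> {0..<p ^ (k - 1) * q'}"
      then show "(w div q', w mod q') \<in> {0..<p ^ (k - 1)} \<times> {0..<q'}"
        using q' by (auto simp: pos_imp_zdiv_nonneg_iff int_div_less)
      show "(case (w div q', w mod q') of (i, r) \<Rightarrow> emod q' (a * r ^ k)) = emod q' (a * w ^ k)"
        using emod_pow_cong[OF q', of "w mod q'" w a k] by (simp add: cong_def)
    next
      fix z assume z: "z \<in> {0..<p ^ (k - 1)} \<times> {0..<q'}"
      obtain i r where ir: "z = (i, r)" "i \<in> {0..<p ^ (k - 1)}" "r \<in> {0..<q'}" using z by blast
      have "i * q' + r < (i + 1) * q'" using ir by (simp add: algebra_simps)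
      also have "\<dots> \<le> p ^ (k - 1) * q'" using ir q' by (intro mult_right_mono) auto
      finally show "(case z of (i, r) \<Rightarrow> i * q' + r) \<in> {0..<p ^ (k - 1) * q'}" using ir q' by auto
      show "((case z of (i, r) \<Rightarrow> i * q' + r) div q', (case z of (i, r) \<Rightarrow> i * q' + r) mod q') = z"
        using ir q' by auto
    qed auto
    also have "\<dots> = of_int (p ^ (k - 1)) * gS k q' a"
      unfolding gS_def using p0 by (simp add: sum.cartesian_product[symmetric])
    finally show ?thesis using False p0 unfolding q_def[symmetric] q'_def[symmetric] by (simp add: norm_mult norm_power)
  qed
qed

text \<open>Lagrange's bound, by splitting off x - r for a root r modulo p. If all coefficients of
  the quotient were divisible by p, so would be those of f.\<close>

lemma poly_roots_mod_prime:
  fixes f :: "int poly"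
  assumes p: "prime p"
  shows "degree f \<le> n \<Longrightarrow> \<not> p dvd coeff f i \<Longrightarrow> card {c\<in>{0..<p}. p dvd poly f c} \<le> n"
proof (induction n arbitrary: f i)
  case 0
  then obtain c where c: "f = [:c:]" by (metis degree_0_id bot_nat_0.extremum_uniqueI degree_eq_zeroE)
  have "\<not> p dvd c" using 0 c by (cases i) auto
  then show ?case using c by simp
next
  case (Suc n)
  show ?case
  proof (cases "\<exists>r\<in>{0..<p}. p dvd poly f r")
    case False
    then have e: "{c\<in>{0..<p}. p dvd poly f c} = {}" by auto
    show ?thesis unfolding e by simp
  next
    case True
    then obtain r where r: "r \<in> {0..<p}" "p dvd poly f r" by blast
    define g where "g = synthetic_div f r"
    have fg: "f = [:- r, 1:] * g + [:poly f r:]" unfolding g_def using synthetic_div_correct'[of r f] by simp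
    have dg: "degree g \<le> n" unfolding g_def degree_synthetic_div using Suc.prems by simp
    have "\<exists>i. \<not> p dvd coeff g i"
    proof (rule ccontr)
      assume "\<not> ?thesis"
      then have "[:p:] dvd g" by (simp add: const_poly_dvd_iff)
      moreover have "[:p:] dvd [:poly f r:]" using r(2) by (simp add: const_poly_dvd_iff coeff_pCons split: nat.split)
      ultimately have "[:p:] dvd f" by (subst fg) (intro dvd_add dvd_mult)
      then show False using Suc.prems(2) by (simp add: const_poly_dvd_iff)
    qed
    then obtain i' where i': "\<not> p dvd coeff g i'" by blast
    have "{c\<in>{0..<p}. p dvd poly f c} \<subseteq> insert r {c\<in>{0..<p}. p dvd poly g c}"
    proof
      fix c assume c: "c \<in> {c\<in>{0..<p}. p dvd poly f c}"
      have "poly f c = (c - r) * poly g c + poly f r" by (subst fg) (simp add: algebra_simps)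
      then have "p dvd (c - r) * poly g c" using c r(2) by (simp add: dvd_add_left_iff)
      then have "p dvd c - r \<or> p dvd poly g c" using p by (simp add: prime_dvd_mult_iff)
      moreover have "c = r" if "p dvd c - r"
      proof -
        have "c mod p = r mod p" using that unfolding mod_eq_dvd_iff .
        then show ?thesis using c r(1) by simp
      qed
      ultimately show "c \<in> insert r {c\<in>{0..<p}. p dvd poly g c}" using c by auto
    qed
    then have "card {c\<in>{0..<p}. p dvd poly f c} \<le> card (insert r {c\<in>{0..<p}. p dvd poly g c})"
      by (intro card_mono finite.insertI finite_Ico_filter)
    also have "\<dots> \<le> Suc (card {c\<in>{0..<p}. p dvd poly g c})" using finite_Ico_filter[of 0 p "\<lambda>c. p dvd poly g c"] by (simp add: card_insert_if)
    also have "\<dots> \<le> Suc n" using Suc.IH[OF dg i'] by simp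
    finally show ?thesis .
  qed
qed

lemma power_roots_mod_prime:
  fixes b :: int
  assumes p: "prime p" and k: "1 \<le> k"
  shows "card {c\<in>{0..<p}. p dvd c ^ k - b} \<le> k"
proof -
  let ?f = "monom 1 k - [:b:] :: int poly"
  have "degree ?f \<le> k" using k by (intro degree_diff_le) (auto simp: degree_monom_eq)
  moreover have "\<not> p dvd coeff ?f k" using k p by (auto simp: coeff_pCons not_prime_unit split: nat.split)
  ultimately have "card {c\<in>{0..<p}. p dvd poly ?f c} \<le> k" by (rule poly_roots_mod_prime[OF p])
  then show ?thesis by (simp add: poly_monom)
qed

text \<open>An elementary substitute for Weil's bound. The sum depends only on a modulo k-th powers,
  so it occurs with each of the p - 1 multipliers c^k, and a residue b is hit by at most k of them.
  Comparing with the second moment over all b, which is at most k p^2, gives (p-1) |S|^2 <= k^2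
  p^2.\<close>

lemma gS_prime:
  assumes p: "prime p" and a: "\<not> p dvd a" and k: "1 \<le> k"
  shows "(cmod (gS k p a))\<^sup>2 \<le> 2 * real k ^ 2 * of_int p"
proof -
  have p0: "0 < p" using p by (rule prime_gt_0_int)
  have p2: "2 \<le> p" using p by (rule prime_ge_2_int)
  have inv: "gS k p (a * c ^ k) = gS k p a" if c: "c \<in> {1..<p}" for c
  proof -
    have pc: "\<not> p dvd c" using c zdvd_not_zless by auto
    have cop: "coprime c p" using prime_imp_coprime[OF p pc] by (simp add: coprime_commute)
    have "gS k p (a * c ^ k) = (\<Sum>r\<in>{0..<p}. emod p (a * ((r * c) mod p) ^ k))"
      unfolding gS_def
    proof (rule sum.cong[OF refl])
      fix r
      have "emod p (a * ((r * c) mod p) ^ k) = emod p (a * (r * c) ^ k)"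
        using p0 by (intro emod_pow_cong) (auto simp: cong_def)
      then show "emod p (a * c ^ k * r ^ k) = emod p (a * ((r * c) mod p) ^ k)" by (simp add: power_mult_distrib mult_ac)
    qed
    also have "\<dots> = (\<Sum>y\<in>{0..<p}. emod p (a * y ^ k))"
    proof (rule sum_mod_inj[of _ "\<lambda>r. (r * c) mod p"])
      show "inj_on (\<lambda>r. (r * c) mod p) {0..<p}"
      proof (rule inj_onI)
        fix x y assume xy: "x \<in> {0..<p}" "y \<in> {0..<p}" "(x * c) mod p = (y * c) mod p"
        then have "p dvd x * c - y * c" unfolding mod_eq_dvd_iff by simp
        then have "p dvd (x - y) * c" by (simp add: left_diff_distrib)
        then have "p dvd x - y" using cop by (simp add: coprime_commute coprime_dvd_mult_left_iff)
        then have "x mod p = y mod p" unfolding mod_eq_dvd_iff .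
        then show "x = y" using xy by simp
      qed
    qed (use p0 in auto)
    finally show ?thesis by (simp add: gS_def)
  qed
  have total: "(\<Sum>b\<in>{0..<p}. (cmod (gS k p b))\<^sup>2) \<le> of_int p * (of_int p * real k)"
  proof -
    have "complex_of_real (\<Sum>b\<in>{0..<p}. (cmod (gS k p b))\<^sup>2) = (\<Sum>b\<in>{0..<p}. \<Sum>r\<in>{0..<p}. \<Sum>s\<in>{0..<p}. emod p (b * (r ^ k - s ^ k)))"
      unfolding of_real_sum gS_def norm_sum_square
      by (intro sum.cong refl) (simp add: cnj_emod emod_add[symmetric] algebra_simps)
    also have "\<dots> = (\<Sum>r\<in>{0..<p}. \<Sum>s\<in>{0..<p}. \<Sum>b\<in>{0..<p}. emod p (b * (r ^ k - s ^ k)))"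
      by (subst sum.swap, intro sum.cong refl sum.swap)
    also have "\<dots> = complex_of_real (\<Sum>r\<in>{0..<p}. \<Sum>s\<in>{0..<p}. if p dvd r ^ k - s ^ k then of_int p else 0)"
      unfolding sum_emod[OF p0] of_real_sum by (intro sum.cong refl) auto
    finally have "(\<Sum>b\<in>{0..<p}. (cmod (gS k p b))\<^sup>2) = (\<Sum>r\<in>{0..<p}. \<Sum>s\<in>{0..<p}. if p dvd r ^ k - s ^ k then of_int p else 0)"
      unfolding of_real_eq_iff .
    also have "\<dots> = (\<Sum>s\<in>{0..<p}. \<Sum>r\<in>{0..<p}. if p dvd r ^ k - s ^ k then of_int p else 0)" by (rule sum.swap)
    also have "\<dots> = (\<Sum>s\<in>{0..<p}. of_int p * real (card {r\<in>{0..<p}. p dvd r ^ k - s ^ k}))"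
      by (intro sum.cong refl) (simp add: sum.inter_filter[symmetric])
    also have "\<dots> \<le> (\<Sum>s\<in>{0..<p}. of_int p * real k)"
      using power_roots_mod_prime[OF p k] p0 by (intro sum_mono mult_left_mono) auto
    also have "\<dots> = of_int p * (of_int p * real k)" using p0 by simp
    finally show ?thesis .
  qed
  have gmod: "gS k p (b mod p) = gS k p b" for b
    unfolding gS_def using p0 by (intro sum.cong refl emod_cong cong_mult) (auto simp: cong_def)
  have "real_of_int (p - 1) * (cmod (gS k p a))\<^sup>2 = (\<Sum>c\<in>{1..<p}. (cmod (gS k p (a * c ^ k)))\<^sup>2)"
    using p2 by (simp add: inv)
  also have "\<dots> = (\<Sum>b\<in>{0..<p}. \<Sum>c\<in>{c\<in>{1..<p}. (a * c ^ k) mod p = b}. (cmod (gS k p (a * c ^ k)))\<^sup>2)"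
    using p0 by (intro sum.group[symmetric]) auto
  also have "\<dots> = (\<Sum>b\<in>{0..<p}. real (card {c\<in>{1..<p}. (a * c ^ k) mod p = b}) * (cmod (gS k p b))\<^sup>2)"
  proof (rule sum.cong[OF refl])
    fix b
    have "(\<Sum>c\<in>{c\<in>{1..<p}. (a * c ^ k) mod p = b}. (cmod (gS k p (a * c ^ k)))\<^sup>2) = (\<Sum>c\<in>{c\<in>{1..<p}. (a * c ^ k) mod p = b}. (cmod (gS k p b))\<^sup>2)"
      by (intro sum.cong refl) (metis (mono_tags, lifting) gmod mem_Collect_eq)
    then show "(\<Sum>c\<in>{c\<in>{1..<p}. (a * c ^ k) mod p = b}. (cmod (gS k p (a * c ^ k)))\<^sup>2)
       = real (card {c\<in>{1..<p}. (a * c ^ k) mod p = b}) * (cmod (gS k p b))\<^sup>2" by simp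
  qed
  also have "\<dots> \<le> (\<Sum>b\<in>{0..<p}. real k * (cmod (gS k p b))\<^sup>2)"
  proof (intro sum_mono mult_right_mono)
    fix b
    obtain a' where a': "[a * a' = 1] (mod p)" using a p
      by (metis cong_solve_coprime_int prime_imp_coprime coprime_commute)
    have "{c\<in>{1..<p}. (a * c ^ k) mod p = b} \<subseteq> {c\<in>{0..<p}. p dvd c ^ k - a' * b}"
    proof
      fix c assume c: "c \<in> {c\<in>{1..<p}. (a * c ^ k) mod p = b}"
      then have "[a * c ^ k = b] (mod p)" by (auto simp: cong_def)
      then have "[a' * (a * c ^ k) = a' * b] (mod p)" by (intro cong_mult cong_refl)
      moreover have "[a * a' * c ^ k = 1 * c ^ k] (mod p)" using a' by (intro cong_mult cong_refl)
      ultimately have "[c ^ k = a' * b] (mod p)" by (metis cong_sym cong_trans mult.assoc mult.commute mult_1)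
      then show "c \<in> {c\<in>{0..<p}. p dvd c ^ k - a' * b}" using c by (simp add: cong_iff_dvd_diff)
    qed
    then have "card {c\<in>{1..<p}. (a * c ^ k) mod p = b} \<le> card {c\<in>{0..<p}. p dvd c ^ k - a' * b}"
      by (intro card_mono finite_Ico_filter)
    also have "\<dots> \<le> k" by (rule power_roots_mod_prime[OF p k])
    finally show "real (card {c\<in>{1..<p}. (a * c ^ k) mod p = b}) \<le> real k" by simp
  qed simp
  also have "\<dots> \<le> real k * (of_int p * (of_int p * real k))"
    unfolding sum_distrib_left[symmetric] using total by (intro mult_left_mono) auto
  finally have 1: "real_of_int (p - 1) * (cmod (gS k p a))\<^sup>2 \<le> real k ^ 2 * of_int p * of_int p" by (simp add: power2_eq_square mult_ac)
  have "of_int p / 2 * (cmod (gS k p a))\<^sup>2 \<le> real_of_int (p - 1) * (cmod (gS k p a))\<^sup>2"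
    using p2 by (intro mult_right_mono) auto
  then have "of_int p * (cmod (gS k p a))\<^sup>2 \<le> of_int p * (2 * real k ^ 2 * of_int p)" using 1 by (simp add: mult_ac)
  then show ?thesis by (rule mult_left_le_imp_le) (use p0 in simp)
qed

text \<open>Induction on j in steps of k by \<open>gS_prime_power\<close>, each step gaining exactly
  p^(k-1) = p^(k (1-1/k)). For small p the constant p^(2k+2) absorbs the trivial bound for the
  initial j; for large p the only initial cases are j = 0 and j = 1.\<close>

lemma gS_prime_power_bound:
  assumes k: "3 \<le> k" and p: "prime p" and a: "\<not> p dvd a"
  shows "cmod (gS k (p ^ j) a) \<le> (if p \<le> 8 * int k ^ 6 then of_int p ^ (2 * k + 2) else 1) * (of_int p ^ j) powr (1 - 1 / real k)"
proof -
  define P where "P = real_of_int p"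
  have P2: "2 \<le> P" using prime_ge_2_int[OF p] by (simp add: P_def)
  have p0: "0 < p" using p by (rule prime_gt_0_int)
  have k1: "1 \<le> k" using k by simp
  define \<sigma> where "\<sigma> = 1 - 1 / real k"
  have \<sigma>: "0 \<le> \<sigma>" using k by (simp add: \<sigma>_def)
  define c where "c = (if p \<le> 8 * int k ^ 6 then P ^ (2 * k + 2) else 1)"
  have "1 \<le> P ^ (2 * k + 2)" by (rule one_le_power) (use P2 in simp)
  then have c1: "1 \<le> c" unfolding c_def by simp
  have Pj: "(P ^ j) powr \<sigma> = P powr (real j * \<sigma>)" for j
    using P2 by (simp add: powr_realpow[symmetric] powr_powr)
  have Pn: "P ^ (n - 1) = P powr (real n - 1)" if "1 \<le> n" for n
  proof -
    have "P powr real (n - 1) = P ^ (n - 1)" using P2 by (intro powr_realpow) auto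
    then show ?thesis using that by (simp add: of_nat_diff)
  qed
  have Pj1: "1 \<le> (P ^ j) powr \<sigma>" for j unfolding Pj using P2 \<sigma> by (intro ge_one_powr_ge_zero) auto
  \<comment> \<open>A large prime exceeds k and so does not divide it, whence v = 0. For small
    primes v = k is crude but valid, as p^(k+1) > k.\<close>
  define v where "v = (if p \<le> 8 * int k ^ 6 then k else 0)"
  have v: "\<not> p ^ Suc v dvd int k"
  proof
    assume dv: "p ^ Suc v dvd int k"
    then have le: "p ^ Suc v \<le> int k" using k by (intro zdvd_imp_le) auto
    show False
    proof (cases "p \<le> 8 * int k ^ 6")
      case True
      have "int k < 2 ^ k" by (rule of_nat_less_two_power)
      also have "\<dots> \<le> 2 ^ Suc k" by simp
      also have "\<dots> \<le> p ^ Suc k" using prime_ge_2_int[OF p] by (intro power_mono) auto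
      finally show False using le True by (simp add: v_def)
    next
      case False
      have "int k ^ 1 \<le> int k ^ 6" using k by (intro power_increasing) auto
      then have "int k \<le> int k ^ 6" by (simp only: power_one_right)
      moreover have "p \<le> int k" using le False by (simp add: v_def)
      ultimately show False using False k by linarith
    qed
  qed
  have "cmod (gS k (p ^ j) a) \<le> c * (P ^ j) powr \<sigma>"
  proof (induction j rule: less_induct)
    case (less j)
    show ?case
    proof (cases "2 * v + 2 \<le> j")
      case True
      show ?thesis
      proof (cases "j \<le> k")
        case jk: True
        have "cmod (gS k (p ^ j) a) = P ^ (j - 1)"
          using gS_prime_power[OF p v True a k1] unfolding P_def by (simp only: jk if_True)
        also have "\<dots> = P powr (real j - 1)" using True by (intro Pn) auto
        also have "\<dots> \<le> P powr (real j * \<sigma>)"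
        proof (rule powr_mono)
          have "real j / real k \<le> 1" using jk k by simp
          then show "real j - 1 \<le> real j * \<sigma>" by (simp add: \<sigma>_def algebra_simps)
        qed (use P2 in simp)
        also have "\<dots> \<le> c * (P ^ j) powr \<sigma>" unfolding Pj using mult_right_mono[OF c1, of "P powr (real j * \<sigma>)"] by simp
        finally show ?thesis .
      next
        case jk: False
        have "cmod (gS k (p ^ j) a) = P ^ (k - 1) * cmod (gS k (p ^ (j - k)) a)"
          using gS_prime_power[OF p v True a k1] unfolding P_def by (simp only: jk if_False)
        also have "\<dots> \<le> P ^ (k - 1) * (c * (P ^ (j - k)) powr \<sigma>)"
        proof (rule mult_left_mono)
          have "j - k < j" using jk k by linarith
          then show "cmod (gS k (p ^ (j - k)) a) \<le> c * (P ^ (j - k)) powr \<sigma>" by (rule less.IH)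
        qed (use P2 in simp)
        also have "\<dots> = c * (P powr (real k - 1) * P powr (real (j - k) * \<sigma>))"
        proof -
          have "P ^ (k - 1) = P powr (real k - 1)" using k by (intro Pn) auto
          then show ?thesis unfolding Pj by (simp only: mult_ac)
        qed
        also have "P powr (real k - 1) * P powr (real (j - k) * \<sigma>) = P powr (real j * \<sigma>)"
        proof -
          have "real k - 1 + real (j - k) * \<sigma> = real j * \<sigma>"
            using jk k by (simp add: \<sigma>_def of_nat_diff field_simps)
          then show ?thesis by (simp flip: powr_add)
        qed
        finally show ?thesis unfolding Pj .
      qed
    next
      case False
      show ?thesis
      proof (cases "p \<le> 8 * int k ^ 6")
        case True
        have "cmod (gS k (p ^ j) a) \<le> P ^ j" using gS_norm_le[of "p ^ j" k a] p0 by (simp add: P_def)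
        also have "\<dots> \<le> P ^ (2 * k + 2)" using True False P2 by (intro power_increasing) (auto simp: v_def)
        also have "\<dots> \<le> c * 1" unfolding c_def using True by simp
        also have "\<dots> \<le> c * (P ^ j) powr \<sigma>" using Pj1 c1 by (intro mult_left_mono) auto
        finally show ?thesis .
      next
        case big: False
        then have "j < 2" using False by (simp add: v_def)
        then consider "j = 0" | "j = 1" by linarith
        then show ?thesis
        proof cases
          case 1
          then have "cmod (gS k (p ^ j) a) \<le> 1" using gS_norm_le[of 1 k a] by simp
          then show ?thesis using 1 c1 by simp
        next
          case 2
          \<comment> \<open>The origin of the threshold 8 k^6: the bound 2 k^2 p for |S|^2 must not
            exceed p^(2 - 2/k), and 1 - 2/k >= 1/3 for k >= 3.\<close>
          have "P powr (1 / 3) \<ge> 2 * real k ^ 2"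
          proof -
            have "(2 * real k ^ 2) ^ 3 \<le> P"
            proof -
              have "real_of_int (8 * int k ^ 6) \<le> real_of_int p" using big by (simp only: of_int_le_iff)
              moreover have "(2 * x ^ 2) ^ 3 = 8 * x ^ 6" for x :: real by (simp add: power_mult_distrib flip: power_mult)
              ultimately show ?thesis by (simp add: P_def)
            qed
            then have "((2 * real k ^ 2) ^ 3) powr (1 / 3) \<le> P powr (1 / 3)" by (intro powr_mono2) auto
            moreover have "((2 * real k ^ 2) ^ 3) powr (1 / 3) = 2 * real k ^ 2"
            proof -
              have t3: "(t ^ 3) powr (1 / 3) = t" if "0 < t" for t :: real
                using powr_powr[of t 3 "1 / 3"] that by (simp add: powr_numeral)
              show ?thesis by (rule t3) (use k in simp)
            qed
            ultimately show ?thesis by simp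
          qed
          also have "P powr (1 / 3) \<le> P powr (2 * \<sigma> - 1)"
          proof (rule powr_mono)
            have "2 / real k \<le> 2 / 3" using k by (intro divide_left_mono) auto
            then show "1 / 3 \<le> 2 * \<sigma> - 1" by (simp add: \<sigma>_def)
          qed (use P2 in simp)
          finally have "2 * real k ^ 2 * P \<le> P powr (2 * \<sigma> - 1) * P powr 1" using P2 by (intro mult_mono) auto
          also have "\<dots> = P powr (2 * \<sigma>)" unfolding powr_add[symmetric] by simp
          finally have "(cmod (gS k p a))\<^sup>2 \<le> P powr (2 * \<sigma>)"
            using gS_prime[OF p a, of k] k unfolding P_def by linarith
          also have "P powr (2 * \<sigma>) = (P powr \<sigma>)\<^sup>2" using P2 by (simp add: powr_power mult.commute)
          finally have "cmod (gS k p a) \<le> P powr \<sigma>" by (rule power2_le_imp_le) simp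
          also have "\<dots> \<le> c * P powr \<sigma>" using mult_right_mono[OF c1, of "P powr \<sigma>"] by simp
          finally show ?thesis using 2 P2 by simp
        qed
      qed
    qed
  qed
  then show ?thesis unfolding c_def P_def \<sigma>_def .
qed

text \<open>Only the primes p \<le> 8 k^6 contribute: for larger p the second moment bound for prime moduli is
  already at most p^(1-1/k), without a constant that could accumulate over the factors of q.\<close>

definition gS_const :: "nat \<Rightarrow> real" where
  "gS_const k = (\<Prod>p\<in>{p\<in>{2..8 * k ^ 6}. prime p}. real p ^ (2 * k + 2))"

lemma finite_Icc_filter: "finite {x\<in>{a..b::nat}. P x}"
  by (rule finite_subset[of _ "{a..b}"]) auto

text \<open>Induction on q, splitting off the full power of one prime divisor at a time; the
  multipliers produced by \<open>gS_mult\<close> stay coprime to the respective moduli. Each small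
  prime contributes its constant at most once.\<close>

lemma gS_bound:
  assumes k: "3 \<le> k" and q: "1 \<le> q" and cop: "coprime a (int q)"
  shows "cmod (gS k (int q) a) \<le> gS_const k * real q powr (1 - 1 / real k)"
proof -
  define S where "S q = {p\<in>{2..8 * k ^ 6}. prime p \<and> p dvd q}" for q :: nat
  have fS: "finite (S q)" for q unfolding S_def by (rule finite_Icc_filter)
  define \<sigma> where "\<sigma> = 1 - 1 / real k"
  have "1 \<le> q \<Longrightarrow> coprime a (int q) \<Longrightarrow> cmod (gS k (int q) a) \<le> (\<Prod>p\<in>S q. real p ^ (2 * k + 2)) * real q powr \<sigma>"
  proof (induction q arbitrary: a rule: less_induct)
    case (less q)
    show ?case
    proof (cases "q = 1")
      case True
      have "S 1 = {}" by (auto simp: S_def)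
      then show ?thesis using True gS_norm_le[of 1 k a] by simp
    next
      case False
      then obtain p where p: "prime p" "p dvd q" using prime_factor_nat by blast
      have "q \<noteq> 0" using less.prems by simp
      define j where "j = multiplicity p q"
      obtain m where m: "q = p ^ j * m" "\<not> p dvd m"
        using multiplicity_decompose'[of q p] \<open>q \<noteq> 0\<close> p(1) unfolding j_def by (metis not_prime_unit)
      have j: "1 \<le> j" using m p by (cases j) auto
      have m0: "0 < m" using m \<open>q \<noteq> 0\<close> by (cases m) auto
      have p2: "2 \<le> p" using p(1) by (rule prime_ge_2_nat)
      have "p ^ 1 \<le> p ^ j" using j p2 by (intro power_increasing) auto
      then have "2 \<le> p ^ j" using p2 by simp
      then have mq: "m < q" unfolding m(1) using m0 by simp
      have pi: "prime (int p)" using p(1) by simp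
      have copa: "coprime a (int p ^ j)" "coprime a (int m)" using less.prems(2) unfolding m(1) by auto
      have pa: "\<not> int p dvd a"
      proof
        assume "int p dvd a"
        moreover have "int p dvd int p ^ j" using j by (simp add: dvd_power)
        ultimately have "is_unit (int p)" using copa(1) by (meson coprime_common_divisor)
        then show False using pi not_prime_unit by blast
      qed
      have cpm: "coprime (int p) (int m)" using prime_imp_coprime[OF pi, of "int m"] m(2) by simp
      have mul: "gS k (int q) a = gS k (int p ^ j) (a * int m ^ (k - 1)) * gS k (int m) (a * (int p ^ j) ^ (k - 1))"
        unfolding m(1) of_nat_mult of_nat_power using m0 p2 k cpm by (intro gS_mult) auto
      have b1: "cmod (gS k (int p ^ j) (a * int m ^ (k - 1))) \<le> (if p \<le> 8 * k ^ 6 then real p ^ (2 * k + 2) else 1) * (real p ^ j) powr \<sigma>"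
      proof -
        have "\<not> int p dvd int m" using m(2) by simp
        then have "\<not> int p dvd a * int m ^ (k - 1)" using pa pi by (meson prime_dvd_mult_iff prime_dvd_power)
        from gS_prime_power_bound[OF k pi this, of j]
        have "cmod (gS k (int p ^ j) (a * int m ^ (k - 1))) \<le> (if int p \<le> int (8 * k ^ 6) then real p ^ (2 * k + 2) else 1) * (real p ^ j) powr \<sigma>"
          by (simp only: \<sigma>_def of_nat_mult of_nat_power of_nat_numeral of_int_of_nat_eq)
        then show ?thesis by (simp only: of_nat_le_iff)
      qed
      have b2: "cmod (gS k (int m) (a * (int p ^ j) ^ (k - 1))) \<le> (\<Prod>p\<in>S m. real p ^ (2 * k + 2)) * real m powr \<sigma>"
        using m0 copa(2) cpm by (intro less.IH[OF mq]) auto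
      have rq: "real q = real p ^ j * real m" by (simp add: m(1))
      have "S q = (if p \<le> 8 * k ^ 6 then insert p (S m) else S m)"
      proof -
        have "p' dvd q \<longleftrightarrow> p' = p \<or> p' dvd m" if "prime p'" for p'
          unfolding m(1) using that p(1) j
          by (auto simp: prime_dvd_mult_iff prime_dvd_power_nat_iff primes_dvd_imp_eq)
        then show ?thesis unfolding S_def using p p2 by auto
      qed
      moreover have "p \<notin> S m" using m(2) by (simp add: S_def)
      ultimately have prodS: "(\<Prod>p\<in>S q. real p ^ (2 * k + 2)) = (if p \<le> 8 * k ^ 6 then real p ^ (2 * k + 2) else 1) * (\<Prod>p\<in>S m. real p ^ (2 * k + 2))"
        using fS[of m] by simp
      have "cmod (gS k (int q) a) \<le> ((if p \<le> 8 * k ^ 6 then real p ^ (2 * k + 2) else 1) * (real p ^ j) powr \<sigma>) * ((\<Prod>p\<in>S m. real p ^ (2 * k + 2)) * real m powr \<sigma>)"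
        unfolding mul norm_mult using b1 b2 by (intro mult_mono) auto
      also have "\<dots> = (\<Prod>p\<in>S q. real p ^ (2 * k + 2)) * real q powr \<sigma>"
        unfolding prodS rq by (simp add: powr_mult mult_ac)
      finally show ?thesis .
    qed
  qed
  from this[OF q cop] have "cmod (gS k (int q) a) \<le> (\<Prod>p\<in>S q. real p ^ (2 * k + 2)) * real q powr \<sigma>" .
  also have "\<dots> \<le> gS_const k * real q powr \<sigma>"
    unfolding gS_const_def S_def
    by (intro mult_right_mono prod_mono2) (auto simp: finite_Icc_filter simp del: power_Suc power_Suc2 add_2_eq_Suc add_2_eq_Suc' intro!: one_le_power)
  finally show ?thesis unfolding \<sigma>_def .
qed

lemma gS_const_ge_1: "1 \<le> gS_const k"
  unfolding gS_const_def
proof (rule prod_ge_1)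
  fix p assume "p \<in> {p\<in>{2..8 * k ^ 6}. prime p}"
  then have "1 \<le> real p" by auto
  then show "1 \<le> real p ^ (2 * k + 2)" by (rule one_le_power)
qed

section \<open>Convergence of the singular series\<close>

lemma e2pi_of_real: "e2pi (complex_of_real x) = ee x"
  by (simp add: e2pi_def ee_def cis_conv_exp mult_ac)

lemma e2pi_eq_emod: "e2pi (of_int m / of_nat q) = emod (int q) m"
  using e2pi_of_real[of "of_int m / real q"] by (simp add: emod_def)

lemma singular_term_altdef:
  assumes "1 \<le> q"
  shows "singular_term s k n q = (\<Sum>a | 1 \<le> a \<and> a \<le> q \<and> coprime a q. (gS k (int q) (int a) / of_nat q) ^ s * emod (int q) (- (int n * int a)))"
proof -
  have g: "(\<Sum>r = 1..q. e2pi (of_nat a * of_nat r ^ k / of_nat q)) = gS k (int q) (int a)" for a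
  proof -
    have "(\<Sum>r = 1..q. e2pi (of_nat a * of_nat r ^ k / of_nat q)) = (\<Sum>r\<in>{1..q}. emod (int q) (int a * int r ^ k))"
      using e2pi_eq_emod[of "int a * int _ ^ k" q] by (intro sum.cong refl) simp
    also have "\<dots> = (\<Sum>r\<in>{1..q}. emod (int q) (int a * (int r mod int q) ^ k))"
      using assms by (intro sum.cong refl emod_pow_cong) (auto simp: cong_def)
    also have "\<dots> = (\<Sum>y\<in>{0..<int q}. emod (int q) (int a * y ^ k))"
    proof (rule sum_mod_inj[of _ "\<lambda>r. int r mod int q"])
      show "inj_on (\<lambda>r. int r mod int q) {1..q}"
      proof (rule inj_onI)
        fix x y assume xy: "x \<in> {1..q}" "y \<in> {1..q}" "int x mod int q = int y mod int q"
        then have "int q dvd int x - int y" unfolding mod_eq_dvd_iff by simp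
        moreover have "\<bar>int x - int y\<bar> < int q" using xy by auto
        ultimately show "x = y" using zdvd_not_zless[of "\<bar>int x - int y\<bar>" "int q"] by auto
      qed
    qed (use assms in auto)
    finally show ?thesis by (simp add: gS_def)
  qed
  have e: "e2pi (- (of_nat n * of_nat a / of_nat q)) = emod (int q) (- (int n * int a))" for a
    using e2pi_eq_emod[of "- (int n * int a)" q] by simp
  show ?thesis unfolding singular_term_def g e ..
qed

lemma gS_ratio_bound:
  assumes k: "3 \<le> k" and q: "1 \<le> q" and cop: "coprime a q"
  shows "cmod (gS k (int q) (int a) / of_nat q) \<le> gS_const k * real q powr (- 1 / real k)"
proof -
  have "cmod (gS k (int q) (int a) / of_nat q) = cmod (gS k (int q) (int a)) / real q" by (simp add: norm_divide)
  also have "\<dots> \<le> (gS_const k * real q powr (1 - 1 / real k)) / real q"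
    using gS_bound[OF k q, of "int a"] cop by (intro divide_right_mono) auto
  also have "\<dots> = gS_const k * (real q powr (1 - 1 / real k) / real q powr 1)" using q by simp
  also have "real q powr (1 - 1 / real k) / real q powr 1 = real q powr (- 1 / real k)" unfolding powr_diff[symmetric] by simp
  finally show ?thesis .
qed

lemma norm_singular_term_le:
  assumes k: "3 \<le> k" and q: "1 \<le> q"
  shows "cmod (singular_term s k n q) \<le> gS_const k ^ s * real q powr (1 - real s / real k)"
proof -
  let ?A = "{a. 1 \<le> a \<and> a \<le> q \<and> coprime a q}"
  have fin: "finite ?A" by (rule finite_subset[of _ "{1..q}"]) auto
  have "cmod (singular_term s k n q) \<le> (\<Sum>a\<in>?A. gS_const k ^ s * real q powr (- real s / real k))"
    unfolding singular_term_altdef[OF q]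
  proof (rule order.trans[OF norm_sum], rule sum_mono)
    fix a assume a: "a \<in> ?A"
    have "cmod ((gS k (int q) (int a) / of_nat q) ^ s * emod (int q) (- (int n * int a))) = cmod (gS k (int q) (int a) / of_nat q) ^ s"
      by (simp add: norm_mult norm_power)
    also have "\<dots> \<le> (gS_const k * real q powr (- 1 / real k)) ^ s"
      using a by (intro power_mono gS_ratio_bound k q) auto
    also have "\<dots> = gS_const k ^ s * real q powr (- real s / real k)"
      using q by (simp add: power_mult_distrib powr_power)
    finally show "cmod ((gS k (int q) (int a) / of_nat q) ^ s * emod (int q) (- (int n * int a))) \<le> gS_const k ^ s * real q powr (- real s / real k)" .
  qed
  also have "\<dots> = real (card ?A) * (gS_const k ^ s * real q powr (- real s / real k))" by simp
  also have "\<dots> \<le> real q * (gS_const k ^ s * real q powr (- real s / real k))"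
  proof (rule mult_right_mono)
    have "card ?A \<le> card {1..q}" by (intro card_mono) auto
    then show "real (card ?A) \<le> real q" by simp
    show "0 \<le> gS_const k ^ s * real q powr (- real s / real k)" using gS_const_ge_1[of k] by (intro mult_nonneg_nonneg) auto
  qed
  also have "\<dots> = gS_const k ^ s * (real q powr 1 * real q powr (- real s / real k))" using q by simp
  also have "real q powr 1 * real q powr (- real s / real k) = real q powr (1 - real s / real k)" unfolding powr_add[symmetric] by simp
  finally show ?thesis .
qed

lemma summable_qpow:
  assumes "2 * k < s" "1 \<le> k"
  shows "summable (\<lambda>q. real (Suc q) powr (1 - real s / real k))"
proof -
  have "2 < real s / real k" using assms by (simp add: field_simps flip: of_nat_mult)
  then have "summable (\<lambda>q. real q powr (1 - real s / real k))" by (subst summable_real_powr_iff) auto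
  then show ?thesis by (subst summable_Suc_iff)
qed

text \<open>At most q residues, each of size q^(-s/k), give terms of order q^(1-s/k), which are
  summable for s > 2 k.\<close>

lemma summable_singular:
  assumes k: "3 \<le> k" and s: "2 * k < s"
  shows "summable (\<lambda>q. singular_term s k n (Suc q))"
proof (rule summable_comparison_test')
  show "summable (\<lambda>q. gS_const k ^ s * real (Suc q) powr (1 - real s / real k))"
    using s k by (intro summable_mult summable_qpow) auto
  show "cmod (singular_term s k n (Suc q)) \<le> gS_const k ^ s * real (Suc q) powr (1 - real s / real k)" if "0 \<le> q" for q
    by (intro norm_singular_term_le k) simp
qed

section \<open>Major arcs\<close>

text \<open>The usual weights m^(1/k-1)/k are replaced by the coefficients of (1-z)^(-1/k), which have the
  same partial sums up to a bounded error and whose convolutions are explicit.\<close>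

definition wv :: "nat \<Rightarrow> nat \<Rightarrow> real" where "wv k m = pochhammer (1 / real k) m / fact m"

definition vv :: "nat \<Rightarrow> nat \<Rightarrow> real \<Rightarrow> complex" where
  "vv k n \<beta> = of_real (Gamma (1 + 1 / real k)) * (\<Sum>m\<le>n. of_real (wv k m) * ee (\<beta> * real m))"

lemma wv_nonneg: "0 \<le> wv k m" unfolding wv_def pochhammer_prod by (intro divide_nonneg_nonneg prod_nonneg) auto

lemma wv_Suc: "wv k (Suc m) = wv k m * ((1 / real k + real m) / (1 + real m))"
  unfolding wv_def pochhammer_Suc fact_Suc of_nat_mult of_nat_Suc times_divide_times_eq by (simp only: mult.commute)

lemma wv_decr: assumes "1 \<le> k" shows "wv k (Suc m) \<le> wv k m"
proof -
  have "1 / real k + real m \<le> 1 + real m" using assms by simp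
  then have "(1 / real k + real m) / (1 + real m) \<le> 1" by (simp add: divide_le_eq_1)
  then show ?thesis unfolding wv_Suc using wv_nonneg by (intro mult_left_le) auto
qed

text \<open>Partial sums correspond to a division by 1 - z, so they are the coefficients of
  (1-z)^(-1-1/k).\<close>

lemma sum_wv: "(\<Sum>m\<le>M. wv k m) = pochhammer (1 + 1 / real k) M / fact M"
proof (induction M)
  case (Suc M)
  define a where "a = 1 / real k"
  have "wv k (Suc M) = a * pochhammer (1 + a) M / fact (Suc M)"
    unfolding wv_def a_def[symmetric] pochhammer_rec by (simp add: add.commute)
  moreover have "pochhammer (1 + a) (Suc M) = pochhammer (1 + a) M * (1 + a + real M)" by (simp add: pochhammer_Suc)
  moreover have "pochhammer (1 + a) M / fact M = pochhammer (1 + a) M * (1 + real M) / fact (Suc M)" by simp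
  ultimately show ?case using Suc unfolding a_def[symmetric] by (simp add: add_divide_distrib[symmetric] algebra_simps del: fact_Suc)
qed (simp add: wv_def)

lemma ln_Gamma_convex:
  assumes "0 < x" "0 < y" "0 \<le> t" "t \<le> 1"
  shows "ln (Gamma ((1 - t) * x + t * y)) \<le> (1 - t) * ln (Gamma x) + t * ln (Gamma (y::real))"
proof -
  have "(ln \<circ> Gamma) ((1 - t) *\<^sub>R x + t *\<^sub>R y) \<le> (1 - t) * (ln \<circ> Gamma) x + t * (ln \<circ> Gamma) y"
    by (rule convex_onD[OF log_convex_Gamma_real]) (use assms in auto)
  then show ?thesis by simp
qed

lemma Gamma_sum_wv: assumes "1 \<le> k"
  shows "Gamma (1 + 1 / real k) * (\<Sum>m\<le>M. wv k m) = Gamma (real M + 1 + 1 / real k) / Gamma (real M + 1)"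
proof -
  have "1 + 1 / real k \<notin> \<int>\<^sub>\<le>\<^sub>0" using assms by (auto elim!: nonpos_Ints_cases) (smt (verit) divide_nonneg_nonneg of_nat_0_le_iff of_int_le_0_iff)
  then have "pochhammer (1 + 1 / real k) M = Gamma (1 + 1 / real k + real M) / Gamma (1 + 1 / real k)"
    by (rule pochhammer_Gamma)
  moreover have "fact M = Gamma (real M + 1)" using Gamma_fact[of M, where 'a = real] by (simp add: add.commute)
  moreover have "Gamma (1 + 1 / real k) > 0" by (intro Gamma_real_pos) (simp add: add_pos_nonneg)
  ultimately show ?thesis unfolding sum_wv by (simp add: add_ac)
qed

text \<open>Log-convexity of Gamma between x = M + 1 and x + 1: \<Gamma>(x + a) <= \<Gamma>(x) x^a.
  With the companion lower bound this pins the partial sums between M^(1/k) and (M+1)^(1/k).\<close>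

lemma sum_wv_upper: assumes k: "1 \<le> k"
  shows "Gamma (1 + 1 / real k) * (\<Sum>m\<le>M. wv k m) \<le> (real M + 1) powr (1 / real k)"
proof -
  define a where "a = 1 / real k"
  have a: "0 < a" "a \<le> 1" using k by (auto simp: a_def)
  define x where "x = real M + 1"
  have x: "0 < x" by (simp add: x_def)
  have "ln (Gamma (x + a)) \<le> (1 - a) * ln (Gamma x) + a * ln (Gamma (x + 1))"
    using ln_Gamma_convex[of x "x + 1" a] a x by (simp add: algebra_simps)
  also have "Gamma (x + 1) = x * Gamma x" using x by (intro Gamma_plus1) (auto elim!: nonpos_Ints_cases)
  also have "ln (x * Gamma x) = ln x + ln (Gamma x)" using x by (intro ln_mult_pos) auto
  finally have "ln (Gamma (x + a)) - ln (Gamma x) \<le> a * ln x" by (simp add: algebra_simps)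
  then have "ln (Gamma (x + a) / Gamma x) \<le> a * ln x" using x a by (subst ln_divide_pos) auto
  then have "exp (ln (Gamma (x + a) / Gamma x)) \<le> exp (a * ln x)" by simp
  moreover have "0 < Gamma (x + a) / Gamma x" using x a by (intro divide_pos_pos Gamma_real_pos) auto
  ultimately have "Gamma (x + a) / Gamma x \<le> exp (a * ln x)" by simp
  also have "\<dots> = x powr a" using x by (simp add: powr_def)
  finally show ?thesis unfolding Gamma_sum_wv[OF k] a_def x_def by simp
qed

text \<open>Log-convexity again, now with M + 1 as a convex combination of x = M + 1/k and x +
  1.\<close>

lemma sum_wv_lower: assumes k: "1 \<le> k"
  shows "real M powr (1 / real k) \<le> Gamma (1 + 1 / real k) * (\<Sum>m\<le>M. wv k m)"
proof -
  define a where "a = 1 / real k"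
  have a: "0 < a" "a \<le> 1" using k by (auto simp: a_def)
  define x where "x = real M + a"
  have x: "0 < x" using a by (simp add: x_def add_nonneg_pos)
  have xx: "a * x + (1 - a) * (x + 1) = real M + 1" by (simp add: x_def algebra_simps)
  have "ln (Gamma (real M + 1)) \<le> a * ln (Gamma x) + (1 - a) * ln (Gamma (x + 1))"
    using ln_Gamma_convex[of x "x + 1" "1 - a"] a x xx by simp
  moreover have "ln (Gamma (x + 1)) = ln x + ln (Gamma x)"
    using x Gamma_plus1[of x] by (subst Gamma_plus1) (auto elim!: nonpos_Ints_cases simp: ln_mult_pos)
  ultimately have "a * ln x \<le> ln (Gamma (x + 1)) - ln (Gamma (real M + 1))" by (simp add: algebra_simps)
  then have "a * ln x \<le> ln (Gamma (x + 1) / Gamma (real M + 1))" using x by (subst ln_divide_pos) auto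
  then have "exp (a * ln x) \<le> Gamma (x + 1) / Gamma (real M + 1)" using x by (subst ln_ge_iff[symmetric]) auto
  moreover have "exp (a * ln x) = x powr a" using x by (simp add: powr_def)
  moreover have "real M powr a \<le> x powr a" using a by (intro powr_mono2) (auto simp: x_def)
  ultimately have "real M powr a \<le> Gamma (x + 1) / Gamma (real M + 1)" by linarith
  then show ?thesis unfolding Gamma_sum_wv[OF k] unfolding a_def[symmetric] x_def by (simp add: add_ac)
qed

lemma powr_add_one_le:
  assumes "0 \<le> x" "0 < a" "a \<le> (1::real)" shows "(x + 1) powr a \<le> x powr a + 1"
proof (cases "x = 0")
  case False
  then have x: "0 < x" using assms by simp
  have "(x + 1) powr a = (x + 1) powr (a - 1) * (x + 1)" using x by (simp add: powr_diff)
  also have "\<dots> = x * (x + 1) powr (a - 1) + (x + 1) powr (a - 1)" by (simp add: algebra_simps)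
  also have "\<dots> \<le> x * x powr (a - 1) + 1"
  proof (intro add_mono mult_left_mono)
    show "(x + 1) powr (a - 1) \<le> x powr (a - 1)" using x assms by (intro powr_mono2') auto
    show "(x + 1) powr (a - 1) \<le> 1" using powr_mono[of "a - 1" 0 "x + 1"] x assms by simp
  qed (use x in simp)
  also have "x * x powr (a - 1) = x powr a" using x by (simp add: powr_diff)
  finally show ?thesis .
qed simp

lemma Gamma_ge_0: "0 < Gamma (1 + 1 / real k)" by (intro Gamma_real_pos) (simp add: add_pos_nonneg)

text \<open>The weights decrease, so the last one is at most the mean of the first M + 1.\<close>

lemma wv_upper: assumes k: "1 \<le> k"
  shows "Gamma (1 + 1 / real k) * wv k M \<le> (real M + 1) powr (1 / real k - 1)"
proof -
  have "wv k M \<le> wv k m" if "m \<le> M" for m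
    using that by (induction rule: dec_induct) (auto intro: order.trans[OF wv_decr[OF k]])
  then have "(\<Sum>m\<le>M. wv k M) \<le> (\<Sum>m\<le>M. wv k m)" by (intro sum_mono) auto
  then have "(real M + 1) * wv k M \<le> (\<Sum>m\<le>M. wv k m)" by (simp add: add.commute)
  then have "Gamma (1 + 1 / real k) * ((real M + 1) * wv k M) \<le> Gamma (1 + 1 / real k) * (\<Sum>m\<le>M. wv k m)"
    using Gamma_ge_0[of k] by (intro mult_left_mono) auto
  also have "\<dots> \<le> (real M + 1) powr (1 / real k)" by (rule sum_wv_upper[OF k])
  also have "\<dots> = (real M + 1) powr (1 / real k - 1) * (real M + 1)" by (simp add: powr_diff)
  finally have "Gamma (1 + 1 / real k) * wv k M * (real M + 1) \<le> (real M + 1) powr (1 / real k - 1) * (real M + 1)" by (simp add: mult_ac)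
  then show ?thesis by (rule mult_right_le_imp_le) simp
qed

lemma abel_identity:
  fixes w :: "nat \<Rightarrow> real" and z :: "nat \<Rightarrow> complex"
  assumes "A \<le> N"
  shows "(\<Sum>m\<in>{A..<N}. of_real (w m) * z m) = of_real (w N) * (\<Sum>m\<in>{A..<N}. z m)
     + (\<Sum>m\<in>{A..<N}. of_real (w m - w (Suc m)) * (\<Sum>i\<in>{A..<Suc m}. z i))"
  using assms
proof (induction rule: dec_induct)
  case (step n)
  then show ?case by (simp add: algebra_simps)
qed simp

lemma abel_decreasing:
  fixes w :: "nat \<Rightarrow> real" and z :: "nat \<Rightarrow> complex"
  assumes w: "\<And>m. 0 \<le> w m" "\<And>m. w (Suc m) \<le> w m" and B: "\<And>N. cmod (\<Sum>m\<in>{A..<N}. z m) \<le> B"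
  shows "cmod (\<Sum>m\<in>{A..<N}. of_real (w m) * z m) \<le> w A * B"
proof (cases "A \<le> N")
  case True
  have "cmod (\<Sum>m\<in>{A..<N}. of_real (w m) * z m) \<le> w N * B + (\<Sum>m\<in>{A..<N}. (w m - w (Suc m)) * B)"
    unfolding abel_identity[OF True, of w z]
  proof (rule order.trans[OF norm_triangle_ineq], rule add_mono)
    show "cmod (of_real (w N) * (\<Sum>m\<in>{A..<N}. z m)) \<le> w N * B"
      unfolding norm_mult norm_of_real abs_of_nonneg[OF w(1)] by (rule mult_left_mono[OF B w(1)])
    show "cmod (\<Sum>m\<in>{A..<N}. of_real (w m - w (Suc m)) * (\<Sum>i\<in>{A..<Suc m}. z i)) \<le> (\<Sum>m\<in>{A..<N}. (w m - w (Suc m)) * B)"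
    proof (rule order.trans[OF norm_sum], rule sum_mono)
      fix m
      have "cmod (of_real (w m - w (Suc m)) * (\<Sum>i\<in>{A..<Suc m}. z i)) = (w m - w (Suc m)) * cmod (\<Sum>i\<in>{A..<Suc m}. z i)"
        unfolding norm_mult norm_of_real using w(2)[of m] by (simp only: abs_of_nonneg diff_ge_0_iff_ge)
      also have "\<dots> \<le> (w m - w (Suc m)) * B" using w(2)[of m] B[of "Suc m"] by (intro mult_left_mono) auto
      finally show "cmod (of_real (w m - w (Suc m)) * (\<Sum>i\<in>{A..<Suc m}. z i)) \<le> (w m - w (Suc m)) * B" .
    qed
  qed
  also have "\<dots> = w A * B"
  proof -
    have "(\<Sum>m\<in>{A..<N}. w m - w (Suc m)) = w A - w N" using True by (induction rule: dec_induct) simp_all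
    then show ?thesis unfolding sum_distrib_right[symmetric] by (simp only: left_diff_distrib)
  qed
  finally show ?thesis .
next
  case False
  have "0 \<le> B" using B[of A] by simp
  then show ?thesis using False w(1)[of A] by simp
qed

lemma vv_upper: assumes k: "1 \<le> k" shows "cmod (vv k n \<beta>) \<le> (real n + 1) powr (1 / real k)"
proof -
  have "cmod (vv k n \<beta>) \<le> Gamma (1 + 1 / real k) * (\<Sum>m\<le>n. wv k m)"
    unfolding vv_def norm_mult
  proof (rule mult_mono)
    show "cmod (\<Sum>m\<le>n. of_real (wv k m) * ee (\<beta> * real m)) \<le> (\<Sum>m\<le>n. wv k m)"
      by (rule order.trans[OF norm_sum]) (simp add: norm_mult wv_nonneg)
  qed (use Gamma_ge_0[of k] in auto)
  also have "\<dots> \<le> (real n + 1) powr (1 / real k)" by (rule sum_wv_upper[OF k])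
  finally show ?thesis .
qed

lemma geometric_ee_bound_nat: "0 < dn \<beta> \<Longrightarrow> cmod (\<Sum>m\<in>{A..<N}. ee (\<beta> * real m)) \<le> 1 / dn \<beta>"
proof -
  assume d: "0 < dn \<beta>"
  have "(\<Sum>m\<in>{A..<N}. ee (\<beta> * real m)) = (\<Sum>m\<in>{int A..<int A + int (N - A)}. ee (\<beta> * of_int m))"
    by (rule sum.reindex_bij_witness[of _ nat int]) auto
  then have "cmod (\<Sum>m\<in>{A..<N}. ee (\<beta> * real m)) \<le> nb (real (N - A)) \<beta>" by (simp only: geometric_ee_bound)
  then show ?thesis using nb_le_inv[OF d, of "real (N - A)"] by linarith
qed

text \<open>The sum is cut at D = 1 / dn \<beta>. The initial part is bounded trivially by a
  multiple of D^(1/k); in the rest, partial summation with decreasing weights of size at most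
  D^(1/k-1) meets geometric sums bounded by D.\<close>

lemma vv_decay: assumes k: "1 \<le> k" and d: "0 < dn \<beta>" shows "cmod (vv k n \<beta>) \<le> 3 * dn \<beta> powr (- 1 / real k)"
proof -
  define a where "a = 1 / real k"
  have a: "0 < a" "a \<le> 1" using k by (auto simp: a_def)
  define D where "D = 1 / dn \<beta>"
  have D: "2 \<le> D" unfolding D_def using d dn_le_half[of \<beta>] by (simp add: field_simps)
  have Da: "D powr a = dn \<beta> powr (- 1 / real k)" unfolding D_def a_def using d
    by (simp add: inverse_powr powr_minus divide_inverse)
  define M where "M = nat \<lfloor>D\<rfloor>"
  have M: "real M \<le> D" "D < real M + 1" unfolding M_def using D by linarith+
  have M1: "(real M + 1) powr a \<le> 2 * D powr a"
  proof -
    have "(real M + 1) powr a \<le> (2 * D) powr a" using M D a by (intro powr_mono2) auto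
    also have "\<dots> = 2 powr a * D powr a" using D by (simp add: powr_mult)
    also have "2 powr a \<le> 2 powr 1" using a by (intro powr_mono) auto
    finally show ?thesis by (simp add: mult_right_mono)
  qed
  show ?thesis
  proof (cases "n \<le> M")
    case True
    have "cmod (vv k n \<beta>) \<le> (real n + 1) powr a" unfolding a_def by (rule vv_upper[OF k])
    also have "\<dots> \<le> (real M + 1) powr a" using True a by (intro powr_mono2) auto
    also have "\<dots> \<le> 3 * D powr a" using M1 by (smt (verit) powr_ge_zero)
    finally show ?thesis unfolding Da .
  next
    case False
    define \<Gamma> where "\<Gamma> = Gamma (1 + 1 / real k)"
    have \<Gamma>: "0 < \<Gamma>" unfolding \<Gamma>_def by (rule Gamma_ge_0)
    have "{..n} = {..M} \<union> {Suc M..<Suc n}" using False by auto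
    then have "vv k n \<beta> = vv k M \<beta> + of_real \<Gamma> * (\<Sum>m\<in>{Suc M..<Suc n}. of_real (wv k m) * ee (\<beta> * real m))"
      unfolding vv_def \<Gamma>_def by (simp only:) (subst sum.union_disjoint, auto simp: distrib_left)
    then have "cmod (vv k n \<beta>) \<le> cmod (vv k M \<beta>) + \<Gamma> * cmod (\<Sum>m\<in>{Suc M..<Suc n}. of_real (wv k m) * ee (\<beta> * real m))"
      using \<Gamma> norm_triangle_ineq by (metis abs_of_pos norm_mult norm_of_real)
    also have "cmod (vv k M \<beta>) \<le> 2 * D powr a" using vv_upper[OF k, of M \<beta>] M1 unfolding a_def by linarith
    also have "\<Gamma> * cmod (\<Sum>m\<in>{Suc M..<Suc n}. of_real (wv k m) * ee (\<beta> * real m)) \<le> \<Gamma> * (wv k (Suc M) * D)"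
      unfolding D_def using \<Gamma> by (intro mult_left_mono abel_decreasing geometric_ee_bound_nat d) (auto simp: wv_nonneg wv_decr[OF k])
    also have "\<dots> \<le> D powr (a - 1) * D"
    proof -
      have "\<Gamma> * wv k (Suc M) \<le> (real (Suc M) + 1) powr (a - 1)" unfolding \<Gamma>_def a_def by (rule wv_upper[OF k])
      also have "\<dots> \<le> D powr (a - 1)" using M D a by (intro powr_mono2') auto
      finally show ?thesis using D by (simp add: mult.assoc[symmetric] mult_right_mono)
    qed
    also have "\<dots> = D powr a" using D by (simp add: powr_diff)
    finally show ?thesis unfolding Da by simp
  qed
qed

text \<open>The s-fold convolution of the coefficients of (1-z)^(-1/k), by the Vandermonde identity
  for Pochhammer symbols in an induction on s.\<close>

lemma sum_tup_wv:
  assumes k: "1 \<le> k"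
  shows "n' \<le> n \<Longrightarrow> (\<Sum>ms\<in>{ms \<in> tup s {..n}. sum_list ms = n'}. prod_list (map (wv k) ms)) = pochhammer (real s / real k) n' / fact n'"
proof (induction s arbitrary: n')
  case 0
  have "{ms \<in> tup 0 {..n}. sum_list ms = n'} = (if n' = 0 then {[]} else {})" by (auto simp: tup_def)
  then show ?case by (simp add: pochhammer_0_left)
next
  case (Suc s)
  have fin: "finite {ms \<in> tup s {..n}. sum_list ms = m}" for m by (rule finite_subset[of _ "tup s {..n}"]) auto
  have "(\<Sum>ms\<in>{ms \<in> tup (Suc s) {..n}. sum_list ms = n'}. prod_list (map (wv k) ms))
     = (\<Sum>(m, ms)\<in>(SIGMA m:{..n'}. {ms \<in> tup s {..n}. sum_list ms = n' - m}). wv k m * prod_list (map (wv k) ms))"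
  proof (rule sum.reindex_bij_witness[of _ "\<lambda>(m, ms). m # ms" "\<lambda>ms. (hd ms, tl ms)"])
    fix ms assume "ms \<in> {ms \<in> tup (Suc s) {..n}. sum_list ms = n'}"
    then obtain m ms' where "ms = m # ms'" "m \<le> n" "ms' \<in> tup s {..n}" "m + sum_list ms' = n'"
      by (cases ms) (auto simp: tup_def)
    then show "(hd ms, tl ms) \<in> (SIGMA m:{..n'}. {ms \<in> tup s {..n}. sum_list ms = n' - m})"
      "(case (hd ms, tl ms) of (m, ms) \<Rightarrow> m # ms) = ms"
      "(case (hd ms, tl ms) of (m, ms) \<Rightarrow> wv k m * prod_list (map (wv k) ms)) = prod_list (map (wv k) ms)" by auto
  next
    fix z assume "z \<in> (SIGMA m:{..n'}. {ms \<in> tup s {..n}. sum_list ms = n' - m})"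
    then show "(hd (case z of (m, ms) \<Rightarrow> m # ms), tl (case z of (m, ms) \<Rightarrow> m # ms)) = z"
      "(case z of (m, ms) \<Rightarrow> m # ms) \<in> {ms \<in> tup (Suc s) {..n}. sum_list ms = n'}"
      using Suc.prems by (auto simp: tup_def)
  qed
  also have "\<dots> = (\<Sum>m\<in>{..n'}. wv k m * (\<Sum>ms\<in>{ms \<in> tup s {..n}. sum_list ms = n' - m}. prod_list (map (wv k) ms)))"
    using fin by (subst sum.Sigma[symmetric]) (auto simp: sum_distrib_left)
  also have "\<dots> = (\<Sum>m\<in>{..n'}. wv k m * (pochhammer (real s / real k) (n' - m) / fact (n' - m)))"
    using Suc by (intro sum.cong refl) auto
  also have "\<dots> = (\<Sum>m\<le>n'. of_nat (n' choose m) * pochhammer (1 / real k) m * pochhammer (real s / real k) (n' - m)) / fact n'"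
    unfolding sum_divide_distrib by (intro sum.cong refl) (simp add: wv_def binomial_fact)
  also have "\<dots> = pochhammer (1 / real k + real s / real k) n' / fact n'" by (simp add: pochhammer_binomial_sum)
  also have "1 / real k + real s / real k = real (Suc s) / real k" by (simp add: add_divide_distrib)
  finally show ?case .
qed

lemma prod_list_of_real_ee:
  "prod_list (map (\<lambda>m. complex_of_real (w m) * ee (\<beta> * real m)) ms) = of_real (prod_list (map w ms)) * ee (\<beta> * real (sum_list ms))"
  by (induction ms) (simp_all add: distrib_left ee_add)

lemma sum_list_le_tup: "ms \<in> tup s {..n} \<Longrightarrow> sum_list ms \<le> s * n" for n :: nat
proof -
  have "set ms \<subseteq> {..n} \<Longrightarrow> sum_list ms \<le> length ms * n" by (induction ms) auto
  then show "ms \<in> tup s {..n} \<Longrightarrow> sum_list ms \<le> s * n" by (auto simp: tup_def)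
qed

text \<open>Orthogonality extracts the coefficient of z^n exactly, as M is larger than all
  differences of exponents. The translation \<theta> only multiplies the frequency d by a phase,
  which is 1 at d = 0; so every arc has the same singular integral.\<close>

lemma vv_grid:
  assumes k: "1 \<le> k" and M: "int (s * n) < M" "int n < M"
  shows "(\<Sum>h\<in>{0..<M}. vv k n (of_int h / of_int M - \<theta>) ^ s * ee (- (real n * (of_int h / of_int M - \<theta>))))
     = of_real (of_int M * (Gamma (1 + 1 / real k) ^ s * (pochhammer (real s / real k) n / fact n)))"
proof -
  define \<Gamma> where "\<Gamma> = Gamma (1 + 1 / real k)"
  have M0: "0 < M" using M by linarith
  have "vv k n \<beta> ^ s * ee (- (real n * \<beta>)) = of_real (\<Gamma> ^ s) * (\<Sum>ms\<in>tup s {..n}. of_real (prod_list (map (wv k) ms)) * ee (\<beta> * (real (sum_list ms) - real n)))" for \<beta>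
  proof -
    have "(\<Sum>m\<le>n. of_real (wv k m) * ee (\<beta> * real m)) ^ s = (\<Sum>ms\<in>tup s {..n}. of_real (prod_list (map (wv k) ms)) * ee (\<beta> * real (sum_list ms)))"
      by (subst sum_power_tup) (simp_all add: prod_list_of_real_ee)
    moreover have "ee (\<beta> * real (sum_list ms)) * ee (- (real n * \<beta>)) = ee (\<beta> * (real (sum_list ms) - real n))" for ms
      by (simp add: ee_add[symmetric] algebra_simps)
    ultimately show ?thesis
      unfolding vv_def \<Gamma>_def power_mult_distrib by (simp add: sum_distrib_left sum_distrib_right mult.assoc)
  qed
  then have "(\<Sum>h\<in>{0..<M}. vv k n (of_int h / of_int M - \<theta>) ^ s * ee (- (real n * (of_int h / of_int M - \<theta>))))
    = of_real (\<Gamma> ^ s) * (\<Sum>ms\<in>tup s {..n}. \<Sum>h\<in>{0..<M}. of_real (prod_list (map (wv k) ms)) * ee ((of_int h / of_int M - \<theta>) * (real (sum_list ms) - real n)))"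
    by (simp only: sum_distrib_left[of "of_real (\<Gamma> ^ s)", symmetric]) (subst sum.swap, rule refl)
  also have "(\<Sum>ms\<in>tup s {..n}. \<Sum>h\<in>{0..<M}. of_real (prod_list (map (wv k) ms)) * ee ((of_int h / of_int M - \<theta>) * (real (sum_list ms) - real n)))
    = (\<Sum>ms\<in>tup s {..n}. if sum_list ms = n then of_int M * of_real (prod_list (map (wv k) ms)) else 0)"
  proof (rule sum.cong[OF refl])
    fix ms assume ms: "ms \<in> tup s {..n}"
    define d where "d = int (sum_list ms) - int n"
    have "int (sum_list ms) \<le> int (s * n)" using sum_list_le_tup[OF ms] by (simp only: of_nat_le_iff)
    then have "\<bar>d\<bar> < M" using M unfolding d_def by linarith
    then have dM: "M dvd d \<longleftrightarrow> sum_list ms = n" using zdvd_not_zless[of "\<bar>d\<bar>" M] by (auto simp: d_def)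
    have "ee ((of_int h / of_int M - \<theta>) * (real (sum_list ms) - real n)) = ee (- \<theta> * of_int d) * emod M (h * d)" for h
      by (simp add: emod_def ee_add[symmetric] d_def algebra_simps diff_divide_distrib)
    then have "(\<Sum>h\<in>{0..<M}. of_real (prod_list (map (wv k) ms)) * ee ((of_int h / of_int M - \<theta>) * (real (sum_list ms) - real n)))
       = of_real (prod_list (map (wv k) ms)) * (ee (- \<theta> * of_int d) * (\<Sum>h\<in>{0..<M}. emod M (h * d)))"
      by (simp only: sum_distrib_left)
    also have "\<dots> = (if sum_list ms = n then of_int M * of_real (prod_list (map (wv k) ms)) else 0)"
      unfolding sum_emod[OF M0] dM by (auto simp: d_def)
    finally show "(\<Sum>h\<in>{0..<M}. of_real (prod_list (map (wv k) ms)) * ee ((of_int h / of_int M - \<theta>) * (real (sum_list ms) - real n)))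
       = (if sum_list ms = n then of_int M * of_real (prod_list (map (wv k) ms)) else 0)" .
  qed
  also have "\<dots> = (\<Sum>ms\<in>{ms \<in> tup s {..n}. sum_list ms = n}. of_int M * of_real (prod_list (map (wv k) ms)))"
    by (rule sum.inter_filter[symmetric]) simp
  also have "\<dots> = of_int M * of_real (\<Sum>ms\<in>{ms \<in> tup s {..n}. sum_list ms = n}. prod_list (map (wv k) ms))"
    by (simp only: sum_distrib_left of_real_sum)
  also have "\<dots> = of_int M * of_real (pochhammer (real s / real k) n / fact n)"
    by (subst sum_tup_wv[OF k]) auto
  finally show ?thesis unfolding \<Gamma>_def by (simp add: mult_ac)
qed

text \<open>Euler's limit for Gamma, rewritten: \<open>Gamma_series\<close> contains one more factor
  b + n, which n / (b + n) compensates.\<close>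

lemma pochhammer_asymp:
  assumes b: "0 < (b::real)"
  shows "(\<lambda>n. pochhammer b n / fact n / real n powr (b - 1)) \<longlonglongrightarrow> 1 / Gamma b"
proof -
  have "(\<lambda>n. (1 / Gamma_series b n) * (real n / (b + real n))) \<longlonglongrightarrow> (1 / Gamma b) * 1"
  proof (rule tendsto_mult)
    show "(\<lambda>n. 1 / Gamma_series b n) \<longlonglongrightarrow> 1 / Gamma b"
      using Gamma_real_pos[OF b] by (intro tendsto_divide tendsto_const Gamma_series_LIMSEQ) auto
    have "(\<lambda>n. 1 / (1 + b * inverse (real n))) \<longlonglongrightarrow> 1 / (1 + b * 0)"
      by (intro tendsto_intros LIMSEQ_inverse_real_of_nat_add) (auto intro: lim_inverse_n)
    then have L: "(\<lambda>n. 1 / (1 + b * inverse (real n))) \<longlonglongrightarrow> 1" by simp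
    show "(\<lambda>n. real n / (b + real n)) \<longlonglongrightarrow> 1"
      by (rule Lim_transform_eventually[OF L])
         (use eventually_gt_at_top[of 0] in \<open>eventually_elim, use b in \<open>auto simp: field_simps\<close>\<close>)
  qed
  moreover have "eventually (\<lambda>n. (1 / Gamma_series b n) * (real n / (b + real n)) = pochhammer b n / fact n / real n powr (b - 1)) sequentially"
    using eventually_gt_at_top[of 0]
  proof eventually_elim
    case (elim n)
    have "exp (b * ln (real n)) = real n powr b" using elim by (simp add: powr_def)
    then have "Gamma_series b n = fact n * real n powr b / (pochhammer b n * (b + real n))"
      by (simp add: Gamma_series_def pochhammer_Suc)
    moreover have "real n powr b = real n powr (b - 1) * real n" using elim by (simp add: powr_diff)
    moreover have "1 / (F * (r * N) / (p * D)) * (N / D) = p / F / r" if "F \<noteq> 0" "r \<noteq> 0" "N \<noteq> 0" "p \<noteq> 0" "D \<noteq> 0" for F r N p D :: real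
      using that by (simp add: field_simps)
    ultimately show ?case using elim b pochhammer_pos[OF b, of n] by simp
  qed
  ultimately show ?thesis using Lim_transform_eventually by fastforce
qed

lemma nat_root_ex: fixes M :: nat assumes "1 \<le> k" shows "\<exists>Y. Y ^ k \<le> M \<and> M < Suc Y ^ k"
proof (induction M)
  case 0
  show ?case using assms by (intro exI[of _ 0]) auto
next
  case (Suc M)
  then obtain Y where Y: "Y ^ k \<le> M" "M < Suc Y ^ k" by blast
  show ?case
  proof (cases "Suc M < Suc Y ^ k")
    case True
    then show ?thesis using Y(1) le_SucI by blast
  next
    case False
    have "Suc Y ^ k < Suc (Suc Y) ^ k" using assms by (intro power_strict_mono) auto
    then show ?thesis using False Y(2) by (intro exI[of _ "Suc Y"]) linarith
  qed
qed

text \<open>A full period contributes exactly the complete sum, so periods are removed one by one;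
  for Y < q both terms are at most q.\<close>

lemma incomplete_gS:
  assumes q: "0 < q"
  shows "cmod ((\<Sum>x\<in>{1..int Y}. emod (int q) (a * x ^ k)) - of_nat Y * (gS k (int q) a / of_nat q)) \<le> 2 * real q"
proof (induction Y rule: less_induct)
  case (less Y)
  define S where "S = gS k (int q) a"
  have S: "cmod S \<le> real q" unfolding S_def using gS_norm_le[of "int q" k a] q by simp
  show ?case
  proof (cases "Y < q")
    case True
    have "cmod (\<Sum>x\<in>{1..int Y}. emod (int q) (a * x ^ k)) \<le> (\<Sum>x\<in>{1..int Y}. cmod (emod (int q) (a * x ^ k)))" by (rule norm_sum)
    also have "\<dots> = real Y" by simp
    finally have 1: "cmod (\<Sum>x\<in>{1..int Y}. emod (int q) (a * x ^ k)) \<le> real q" using True by simp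
    have "cmod (of_nat Y * (S / of_nat q)) = real Y * (cmod S / real q)" by (simp add: norm_mult norm_divide)
    also have "\<dots> \<le> real q * 1" using True S q by (intro mult_mono) (auto simp: divide_le_eq_1)
    finally have 2: "cmod (of_nat Y * (S / of_nat q)) \<le> real q" by simp
    show ?thesis using norm_triangle_ineq4 1 2 unfolding S_def[symmetric] by (smt (verit))
  next
    case False
    have eq: "{1..int Y} = {1..int (Y - q)} \<union> {int (Y - q) + 1..int Y}" "{1..int (Y - q)} \<inter> {int (Y - q) + 1..int Y} = {}"
      using False q by auto
    have "(\<Sum>x\<in>{int (Y - q) + 1..int Y}. emod (int q) (a * x ^ k)) = (\<Sum>x\<in>{int (Y - q) + 1..int Y}. emod (int q) (a * (x mod int q) ^ k))"
      using q by (intro sum.cong refl emod_pow_cong) (auto simp: cong_def)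
    also have "\<dots> = (\<Sum>y\<in>{0..<int q}. emod (int q) (a * y ^ k))"
    proof (rule sum_mod_inj[of _ "\<lambda>x. x mod int q"])
      show "inj_on (\<lambda>x. x mod int q) {int (Y - q) + 1..int Y}"
      proof (rule inj_onI)
        fix x y assume xy: "x \<in> {int (Y - q) + 1..int Y}" "y \<in> {int (Y - q) + 1..int Y}" "x mod int q = y mod int q"
        then have "int q dvd x - y" unfolding mod_eq_dvd_iff by simp
        moreover have "\<bar>x - y\<bar> < int q" using xy False by auto
        ultimately show "x = y" using zdvd_not_zless[of "\<bar>x - y\<bar>" "int q"] by auto
      qed
    qed (use q False in auto)
    also have "\<dots> = S" by (simp add: S_def gS_def)
    finally have "(\<Sum>x\<in>{1..int Y}. emod (int q) (a * x ^ k)) = (\<Sum>x\<in>{1..int (Y - q)}. emod (int q) (a * x ^ k)) + S"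
      unfolding eq(1) by (subst sum.union_disjoint) (use eq(2) in auto)
    moreover have "of_nat Y * (S / of_nat q) = of_nat (Y - q) * (S / of_nat q) + S"
      using False q by (simp add: of_nat_diff field_simps)
    ultimately show ?thesis using less.IH[of "Y - q"] False q unfolding S_def[symmetric] by simp
  qed
qed

lemma norm_abel_le:
  fixes d e :: "nat \<Rightarrow> complex"
  assumes D: "\<And>M. M \<le> n \<Longrightarrow> cmod (\<Sum>m\<le>M. d m) \<le> B" and e: "\<And>m. cmod (e m) \<le> 1" "\<And>m. cmod (e m - e (Suc m)) \<le> \<delta>"
  shows "cmod (\<Sum>m\<le>n. d m * e m) \<le> B * (1 + real n * \<delta>)"
proof -
  have "(\<Sum>m\<le>n. d m * e m) = (\<Sum>m\<le>n. d m) * e n + (\<Sum>m<n. (\<Sum>i\<le>m. d i) * (e m - e (Suc m)))"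
  proof (induction n)
    case (Suc n)
    then show ?case by (simp add: algebra_simps)
  qed simp
  also have "cmod \<dots> \<le> B * 1 + (\<Sum>m<n. B * \<delta>)"
  proof (rule order.trans[OF norm_triangle_ineq], rule add_mono)
    have B0: "0 \<le> B" using D[of 0] norm_ge_zero[of "\<Sum>m\<le>0. d m"] by linarith
    show "cmod ((\<Sum>m\<le>n. d m) * e n) \<le> B * 1" unfolding norm_mult using D e B0 by (intro mult_mono) auto
    show "cmod (\<Sum>m<n. (\<Sum>i\<le>m. d i) * (e m - e (Suc m))) \<le> (\<Sum>m<n. B * \<delta>)"
      by (rule order.trans[OF norm_sum], rule sum_mono, unfold norm_mult, rule mult_mono) (use D e B0 in auto)
  qed
  finally show ?thesis by (simp add: algebra_simps)
qed

lemma norm_ee_minus_1_le: "cmod (ee x - 1) \<le> 7 * \<bar>x\<bar>"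
proof -
  have "cmod (ee x - 1) = 2 * \<bar>sin (pi * x)\<bar>"
    using dist_exp_i_1[of "2 * pi * x"] by (simp add: ee_def cis_conv_exp dist_norm mult_ac)
  also have "\<dots> \<le> 2 * \<bar>pi * x\<bar>" using abs_sin_x_le_abs_x[of "pi * x"] by simp
  also have "\<dots> = (2 * pi) * \<bar>x\<bar>" by (simp add: abs_mult)
  also have "\<dots> \<le> 7 * \<bar>x\<bar>" using pi_less_4 pi_approx by (intro mult_right_mono) auto
  finally show ?thesis .
qed

lemma fW_add_int: "fW k X (\<alpha> + of_int j) = fW k X \<alpha>"
proof -
  have "ee ((\<alpha> + of_int j) * of_int (x ^ k)) = ee (\<alpha> * of_int (x ^ k) + of_int (j * x ^ k))" for x
    by (simp add: distrib_right)
  then show ?thesis unfolding fW_def by (simp only: ee_add_of_int)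
qed

lemma vv_add_int: "vv k n (\<beta> + of_int j) = vv k n \<beta>"
proof -
  have "ee ((\<beta> + of_int j) * real m) = ee (\<beta> * real m + of_int (j * int m))" for m
    by (simp add: distrib_right)
  then show ?thesis unfolding vv_def by (simp only: ee_add_of_int)
qed

text \<open>Y counts the positive k-th powers up to M. One unit of error comes from rounding M^(1/k)
  down, one from the upper bound for the partial sums.\<close>

lemma sum_wv_root:
  assumes k: "1 \<le> k" and Y: "Y ^ k \<le> M" "M < Suc Y ^ k"
  shows "\<bar>Gamma (1 + 1 / real k) * (\<Sum>m\<le>M. wv k m) - real Y\<bar> \<le> 2"
proof -
  define R where "R = real M powr (1 / real k)"
  have pk: "(real Z ^ k) powr (1 / real k) = real Z" for Z
    using k by (cases "Z = 0") (simp_all add: powr_realpow[symmetric] powr_powr)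
  have "real Y ^ k \<le> real M" "real M \<le> real (Suc Y) ^ k"
    using Y by (simp_all only: of_nat_power[symmetric] of_nat_le_iff less_imp_le)
  then have "(real Y ^ k) powr (1 / real k) \<le> R" "R \<le> (real (Suc Y) ^ k) powr (1 / real k)"
    unfolding R_def by (intro powr_mono2; simp)+
  then have R: "real Y \<le> R" "R \<le> real Y + 1" unfolding pk by simp_all
  have "(real M + 1) powr (1 / real k) \<le> R + 1" unfolding R_def using k by (intro powr_add_one_le) auto
  then show ?thesis using sum_wv_lower[OF k, of M] sum_wv_upper[OF k, of M] R unfolding R_def by linarith
qed

text \<open>Both sums are read as series in e(\<beta> m) over m <= n. By
  \<open>incomplete_gS\<close> and \<open>sum_wv_root\<close> the partial sums of their coefficients
  differ by at most 2 q + 2 (the second error enters with |S/q| <= 1), and partial summation brings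
  in the variation n |\<beta>| of the exponentials.\<close>

lemma major_approx_real:
  assumes k: "1 \<le> k" and q: "0 < q" and X: "n < Suc X ^ k" "X ^ k \<le> n"
  shows "cmod (fW k X (of_int a / real q + \<beta>) - gS k (int q) a / of_nat q * vv k n \<beta>) \<le> (2 * real q + 2) * (1 + real n * (7 * \<bar>\<beta>\<bar>))"
proof -
  define A where "A = gS k (int q) a / complex_of_nat q"
  define \<Gamma> where "\<Gamma> = Gamma (1 + 1 / real k)"
  have A1: "cmod A \<le> 1" unfolding A_def using gS_norm_le[of "int q" k a] q by (simp add: norm_divide divide_le_eq_1)
  define c where "c m = (\<Sum>x\<in>{x\<in>{1..int X}. x ^ k = int m}. emod (int q) (a * x ^ k))" for m
  define d where "d m = c m - A * of_real (\<Gamma> * wv k m)" for m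
  have fin: "finite {x\<in>{1..int X}. P x}" for P by (rule finite_subset[of _ "{1..int X}"]) auto
  have regroup: "(\<Sum>m\<le>M. \<Sum>x\<in>{x\<in>{1..int X}. x ^ k = int m}. g x) = (\<Sum>x\<in>{x\<in>{1..int X}. x ^ k \<le> int M}. g x)" for M and g :: "int \<Rightarrow> complex"
  proof -
    have "(\<Sum>m\<le>M. \<Sum>x\<in>{x\<in>{1..int X}. x ^ k = int m}. g x) = (\<Sum>(m, x)\<in>(SIGMA m:{..M}. {x\<in>{1..int X}. x ^ k = int m}). g x)"
      using fin by (subst sum.Sigma) auto
    also have "\<dots> = (\<Sum>x\<in>{x\<in>{1..int X}. x ^ k \<le> int M}. g x)"
      by (rule sum.reindex_bij_witness[of _ "\<lambda>x. (nat (x ^ k), x)" snd]) auto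
    finally show ?thesis .
  qed
  have "fW k X (of_int a / real q + \<beta>) = (\<Sum>x\<in>{1..int X}. emod (int q) (a * x ^ k) * ee (\<beta> * of_int (x ^ k)))"
    unfolding fW_def by (intro sum.cong refl) (simp add: emod_def ee_add[symmetric] distrib_right)
  also have "{1..int X} = {x\<in>{1..int X}. x ^ k \<le> int n}"
  proof -
    have "x ^ k \<le> int n" if "x \<in> {1..int X}" for x
    proof -
      have "x ^ k \<le> int X ^ k" using that by (intro power_mono) auto
      also have "\<dots> \<le> int n" using X(2) by (simp only: of_nat_power[symmetric] of_nat_le_iff)
      finally show ?thesis .
    qed
    then show ?thesis by auto
  qed
  also have "(\<Sum>x\<in>{x\<in>{1..int X}. x ^ k \<le> int n}. emod (int q) (a * x ^ k) * ee (\<beta> * of_int (x ^ k)))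
     = (\<Sum>m\<le>n. c m * ee (\<beta> * real m))"
    unfolding regroup[symmetric] c_def sum_distrib_right by (intro sum.cong refl) auto
  finally have "fW k X (of_int a / real q + \<beta>) - A * vv k n \<beta> = (\<Sum>m\<le>n. d m * ee (\<beta> * real m))"
    unfolding vv_def d_def \<Gamma>_def by (simp add: left_diff_distrib sum_subtractf sum_distrib_left mult.assoc)
  also have "cmod \<dots> \<le> (2 * real q + 2) * (1 + real n * (7 * \<bar>\<beta>\<bar>))"
  proof (rule norm_abel_le)
    fix M assume M: "M \<le> n"
    obtain Y where Y: "Y ^ k \<le> M" "M < Suc Y ^ k" using nat_root_ex[OF k] by blast
    have eq: "{x\<in>{1..int X}. x ^ k \<le> int M} = {1..int Y}"
    proof (intro equalityI subsetI)
      fix x assume x: "x \<in> {x\<in>{1..int X}. x ^ k \<le> int M}"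
      then have "x ^ k < int (Suc Y) ^ k" using Y(2) by (simp only: mem_Collect_eq of_nat_power[symmetric] of_nat_less_iff) linarith
      then have "x < int (Suc Y)" by (rule power_less_imp_less_base) simp
      then show "x \<in> {1..int Y}" using x by auto
    next
      fix x assume x: "x \<in> {1..int Y}"
      then have "x ^ k \<le> int Y ^ k" by (intro power_mono) auto
      also have "\<dots> \<le> int M" using Y(1) by (simp only: of_nat_power[symmetric] of_nat_le_iff)
      finally have xM: "x ^ k \<le> int M" .
      have "Y ^ k < Suc X ^ k" using Y M X by linarith
      then have "Y < Suc X" by (rule power_less_imp_less_base) simp
      then show "x \<in> {x\<in>{1..int X}. x ^ k \<le> int M}" using x xM by auto
    qed
    have "(\<Sum>m\<le>M. d m) = (\<Sum>x\<in>{1..int Y}. emod (int q) (a * x ^ k)) - A * of_real (\<Gamma> * (\<Sum>m\<le>M. wv k m))"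
      unfolding d_def sum_subtractf c_def regroup eq by (simp add: sum_distrib_left)
    also have "\<dots> = ((\<Sum>x\<in>{1..int Y}. emod (int q) (a * x ^ k)) - of_nat Y * A) - A * of_real (\<Gamma> * (\<Sum>m\<le>M. wv k m) - real Y)"
      by (simp add: algebra_simps)
    also have "cmod \<dots> \<le> 2 * real q + 1 * 2"
    proof (rule order.trans[OF norm_triangle_ineq4], rule add_mono)
      show "cmod ((\<Sum>x\<in>{1..int Y}. emod (int q) (a * x ^ k)) - of_nat Y * A) \<le> 2 * real q"
        unfolding A_def by (rule incomplete_gS[OF q])
      show "cmod (A * of_real (\<Gamma> * (\<Sum>m\<le>M. wv k m) - real Y)) \<le> 1 * 2"
        unfolding norm_mult norm_of_real using A1 sum_wv_root[OF k Y] unfolding \<Gamma>_def by (intro mult_mono) auto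
    qed
    finally show "cmod (\<Sum>m\<le>M. d m) \<le> 2 * real q + 2" by simp
  next
    show "cmod (ee (\<beta> * real m)) \<le> 1" for m by simp
    show "cmod (ee (\<beta> * real m) - ee (\<beta> * real (Suc m))) \<le> 7 * \<bar>\<beta>\<bar>" for m
    proof -
      have "ee (\<beta> * real m) - ee (\<beta> * real (Suc m)) = - (ee (\<beta> * real m) * (ee \<beta> - 1))"
        by (simp add: algebra_simps ee_add)
      then show ?thesis using norm_ee_minus_1_le[of \<beta>] by (simp add: norm_mult)
    qed
  qed
  finally show ?thesis unfolding A_def .
qed

lemma major_approx:
  assumes k: "1 \<le> k" and q: "0 < q" and X: "n < Suc X ^ k" "X ^ k \<le> n"
  shows "cmod (fW k X \<alpha> - gS k (int q) a / of_nat q * vv k n (\<alpha> - of_int a / real q))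
     \<le> (2 * real q + 2) * (1 + real n * (7 * dn (\<alpha> - of_int a / real q)))"
proof -
  obtain j where j: "dn (\<alpha> - of_int a / real q) = \<bar>\<alpha> - of_int a / real q - of_int j\<bar>" using dn_ex by blast
  show ?thesis
    using major_approx_real[OF assms, of a "\<alpha> - of_int a / real q - of_int j"]
      fW_add_int[of k X "\<alpha> - of_int j" j] vv_add_int[of k n "\<alpha> - of_int a / real q - of_int j" j]
    unfolding j by simp
qed

section \<open>Sums over grid points near and far from an arc\<close>

lemma dn_diff_le: "dn (x - y) \<le> dn x + dn y"
proof -
  obtain m m' where m: "dn x = \<bar>x - of_int m\<bar>" "dn y = \<bar>y - of_int m'\<bar>" using dn_ex by metis
  show ?thesis unfolding m using dn_le[of "x - y" "m - m'"] by simp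
qed

text \<open>The discrete form of the bound of order 1/\<eta> for the integral of 1 / (\<eta> +
  |\<beta>|)^2. The condition \<eta> M >= 1 says that \<eta> is at least the mesh width, which makes
  Riemann sum and integral comparable. Both the count near an arc and the tail away from it follow
  from it.\<close>

lemma sum_inverse_square_grid:
  fixes \<eta> :: real
  assumes M: "0 < M" and \<eta>: "0 < \<eta>" "1 \<le> \<eta> * of_int M"
  shows "(\<Sum>h\<in>{0..<M}. 1 / (\<eta> + dn (of_int h / of_int M - \<theta>))\<^sup>2) \<le> 16 * of_int M / \<eta>"
proof -
  define m where "m = real_of_int M"
  have m: "0 < m" "1 / m \<le> \<eta>" using M \<eta> by (auto simp: m_def field_simps)
  define g where "g u = 1 / (\<eta> + of_int u / m)\<^sup>2" for u :: int
  have gsum: "(\<Sum>u\<in>{0..<int N}. g u) \<le> 2 * m * (1 / \<eta> - 1 / (\<eta> + real N / m))" for N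
  proof (induction N)
    case (Suc N)
    have "{0..<int (Suc N)} = insert (int N) {0..<int N}" by auto
    then have "(\<Sum>u\<in>{0..<int (Suc N)}. g u) = g (int N) + (\<Sum>u\<in>{0..<int N}. g u)" by simp
    moreover have "g (int N) \<le> 2 * m * (1 / (\<eta> + real N / m) - 1 / (\<eta> + real (Suc N) / m))"
    proof -
      define t where "t = \<eta> + real N / m"
      have t: "0 < t" "1 / m \<le> t" unfolding t_def using \<eta> m by (auto intro: add_pos_nonneg add_increasing2)
      have t': "\<eta> + real (Suc N) / m = t + 1 / m" by (simp add: t_def add_divide_distrib)
      \<comment> \<open>Since 1/m <= t, t + 1/m is at most 2 t; the right-hand side
        telescopes.\<close>
      have "1 / t\<^sup>2 \<le> 2 / (t * (t + 1 / m))"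
        using t m by (simp add: divide_simps power2_eq_square) (simp add: field_simps)
      also have "\<dots> = 2 * m * (1 / t - 1 / (t + 1 / m))"
      proof -
        have "1 / t - 1 / (t + 1 / m) = (1 / m) / (t * (t + 1 / m))" using t m add_pos_pos[of t "1 / m"] by (subst diff_frac_eq) auto
        then show ?thesis using m by simp
      qed
      finally show ?thesis unfolding g_def t' using t_def by simp
    qed
    ultimately show ?case using Suc by (simp add: algebra_simps)
  qed simp
  have gsum': "(\<Sum>u\<in>{0..<int N}. g u) \<le> 2 * m / \<eta>" for N
  proof -
    have "0 \<le> 2 * m * (1 / (\<eta> + real N / m))" using m \<eta> by (intro mult_nonneg_nonneg divide_nonneg_nonneg add_nonneg_nonneg) auto
    then show ?thesis using gsum[of N] by (simp add: right_diff_distrib)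
  qed
  \<comment> \<open>The grid is rotated by the grid point just below \<theta>; the remaining offset
    \<delta> / m is at most one mesh width and hence at most \<eta>.\<close>
  define c where "c = \<lfloor>m * \<theta>\<rfloor>"
  define \<delta> where "\<delta> = m * \<theta> - of_int c"
  have \<delta>: "0 \<le> \<delta>" "\<delta> \<le> 1" unfolding \<delta>_def c_def by linarith+
  define f where "f u = 1 / (\<eta> + dn (of_int u / m - \<delta> / m))\<^sup>2" for u :: int
  have "(\<Sum>h\<in>{0..<M}. 1 / (\<eta> + dn (of_int h / m - \<theta>))\<^sup>2) = (\<Sum>h\<in>{0..<M}. f ((h - c) mod M))"
  proof (rule sum.cong[OF refl])
    fix h
    have "h - c = (h - c) mod M + M * ((h - c) div M)" by simp
    then have "of_int h - of_int c = real_of_int ((h - c) mod M) + m * of_int ((h - c) div M)"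
      unfolding m_def by (metis of_int_add of_int_diff of_int_mult)
    then have "of_int h / m - \<theta> = of_int ((h - c) mod M) / m - \<delta> / m + of_int ((h - c) div M)"
      using m by (simp add: \<delta>_def field_simps)
    then show "1 / (\<eta> + dn (of_int h / m - \<theta>))\<^sup>2 = f ((h - c) mod M)" unfolding f_def by simp
  qed
  also have "\<dots> = (\<Sum>u\<in>{0..<M}. f u)"
  proof (rule sum_mod_inj[of _ "\<lambda>h. (h - c) mod M"])
    show "inj_on (\<lambda>h. (h - c) mod M) {0..<M}"
    proof (rule inj_onI)
      fix x y assume xy: "x \<in> {0..<M}" "y \<in> {0..<M}" "(x - c) mod M = (y - c) mod M"
      have "M dvd (x - c) - (y - c)" using xy(3) unfolding mod_eq_dvd_iff .
      moreover have "\<bar>(x - c) - (y - c)\<bar> < M" using xy by auto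
      ultimately show "x = y" using zdvd_not_zless[of "\<bar>(x - c) - (y - c)\<bar>" M] by auto
    qed
  qed (use M in auto)
  also have "\<dots> \<le> (\<Sum>u\<in>{0..<M}. 4 * (g u + g (M - u)))"
  proof (rule sum_mono)
    fix u assume u: "u \<in> {0..<M}"
    have g0: "0 \<le> g v" for v unfolding g_def by simp
    define y where "y = min u (M - u)"
    have y: "0 \<le> y" using u by (simp add: y_def)
    have "min (of_int u) (of_int (int (nat M) - u)) / real (nat M) - \<bar>- \<delta> / m\<bar> \<le> dn (of_int u / real (nat M) + - \<delta> / m)"
      using u M by (intro dn_frac_lower) auto
    then have "of_int y / m - \<delta> / m \<le> dn (of_int u / m - \<delta> / m)"
      using M \<delta> m by (simp add: y_def m_def of_int_min)
    moreover have avg: "A - B \<le> D \<Longrightarrow> B \<le> e \<Longrightarrow> 0 \<le> D \<Longrightarrow> (e + A) / 2 \<le> e + D" for A B D e :: real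
      by (simp add: field_simps)
    moreover have "\<delta> / m \<le> \<eta>" using \<delta> m by (meson divide_right_mono less_imp_le order.trans)
    ultimately have "(\<eta> + of_int y / m) / 2 \<le> \<eta> + dn (of_int u / m - \<delta> / m)"
      using avg[OF _ _ dn_nonneg[of "of_int u / m - \<delta> / m"]] by blast
    moreover have pos: "0 < \<eta> + of_int y / m" using y m \<eta> by (intro add_pos_nonneg) auto
    ultimately have "((\<eta> + of_int y / m) / 2)\<^sup>2 \<le> (\<eta> + dn (of_int u / m - \<delta> / m))\<^sup>2" by (intro power_mono) auto
    then have "f u \<le> 1 / ((\<eta> + of_int y / m) / 2)\<^sup>2" unfolding f_def using pos by (intro divide_left_mono) (auto intro!: mult_pos_pos zero_less_power add_pos_nonneg \<eta>)
    also have "\<dots> = 4 * g y" by (simp add: g_def power_divide)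
    also have "\<dots> \<le> 4 * (g u + g (M - u))" using g0[of u] g0[of "M - u"] by (simp add: y_def min_def)
    finally show "f u \<le> 4 * (g u + g (M - u))" .
  qed
  also have "\<dots> = 4 * ((\<Sum>u\<in>{0..<M}. g u) + (\<Sum>u\<in>{0..<M}. g (M - u)))"
    by (simp add: sum_distrib_left sum.distrib)
  also have "(\<Sum>u\<in>{0..<M}. g (M - u)) \<le> (\<Sum>u\<in>{0..<int (Suc (nat M))}. g u)"
  proof -
    have "(\<Sum>u\<in>{0..<M}. g (M - u)) = (\<Sum>u\<in>{1..M}. g u)"
      by (rule sum.reindex_bij_witness[of _ "\<lambda>u. M - u" "\<lambda>u. M - u"]) auto
    also have "\<dots> \<le> (\<Sum>u\<in>{0..<int (Suc (nat M))}. g u)" using M by (intro sum_mono2) (auto simp: g_def)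
    finally show ?thesis .
  qed
  also have "\<dots> \<le> 2 * m / \<eta>" by (rule gsum')
  also have "(\<Sum>u\<in>{0..<M}. g u) \<le> 2 * m / \<eta>" using gsum'[of "nat M"] M by simp
  finally show ?thesis unfolding m_def by simp
qed

lemma card_grid_near:
  assumes M: "0 < M" and \<eta>: "0 < \<eta>" "1 \<le> \<eta> * of_int M"
  shows "real (card {h\<in>{0..<M}. dn (of_int h / of_int M - \<theta>) \<le> \<eta>}) \<le> 64 * (of_int M * \<eta>)"
proof -
  let ?A = "{h\<in>{0..<M}. dn (of_int h / of_int M - \<theta>) \<le> \<eta>}"
  have "real (card ?A) * (1 / (2 * \<eta>)\<^sup>2) = (\<Sum>h\<in>?A. 1 / (2 * \<eta>)\<^sup>2)" by simp
  also have "\<dots> \<le> (\<Sum>h\<in>?A. 1 / (\<eta> + dn (of_int h / of_int M - \<theta>))\<^sup>2)"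
  proof (rule sum_mono)
    fix h assume h: "h \<in> ?A"
    have p: "0 < \<eta> + dn (of_int h / of_int M - \<theta>)" using \<eta> by (intro add_pos_nonneg) auto
    have "(\<eta> + dn (of_int h / of_int M - \<theta>))\<^sup>2 \<le> (2 * \<eta>)\<^sup>2" using h p by (intro power_mono) auto
    then show "1 / (2 * \<eta>)\<^sup>2 \<le> 1 / (\<eta> + dn (of_int h / of_int M - \<theta>))\<^sup>2"
      using p \<eta> by (intro divide_left_mono) auto
  qed
  also have "\<dots> \<le> (\<Sum>h\<in>{0..<M}. 1 / (\<eta> + dn (of_int h / of_int M - \<theta>))\<^sup>2)" by (intro sum_mono2) auto
  also have "\<dots> \<le> 16 * of_int M / \<eta>" by (rule sum_inverse_square_grid[OF assms])
  finally show ?thesis using \<eta> by (simp add: field_simps power2_eq_square)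
qed

text \<open>For \<sigma> >= 2, d^(-\<sigma>) <= \<eta>^(2-\<sigma>) d^(-2) outside the arc, which
  reduces the tail to the inverse square sum.\<close>

lemma sum_grid_far:
  assumes M: "0 < M" and \<eta>: "0 < \<eta>" "1 \<le> \<eta> * of_int M" and \<sigma>: "2 \<le> \<sigma>"
  shows "(\<Sum>h\<in>{h\<in>{0..<M}. \<not> dn (of_int h / of_int M - \<theta>) \<le> \<eta>}. dn (of_int h / of_int M - \<theta>) powr (- \<sigma>)) \<le> 64 * of_int M * \<eta> powr (1 - \<sigma>)"
proof -
  let ?A = "{h\<in>{0..<M}. \<not> dn (of_int h / of_int M - \<theta>) \<le> \<eta>}"
  have "(\<Sum>h\<in>?A. dn (of_int h / of_int M - \<theta>) powr (- \<sigma>)) \<le> (\<Sum>h\<in>?A. \<eta> powr (2 - \<sigma>) * (4 * (1 / (\<eta> + dn (of_int h / of_int M - \<theta>))\<^sup>2)))"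
  proof (rule sum_mono)
    fix h assume h: "h \<in> ?A"
    define d where "d = dn (of_int h / of_int M - \<theta>)"
    have d: "\<eta> < d" using h by (simp add: d_def)
    have "d powr (- \<sigma>) = d powr (2 - \<sigma>) * d powr (- 2)" unfolding powr_add[symmetric] by simp
    also have "\<dots> \<le> \<eta> powr (2 - \<sigma>) * (4 * (1 / (\<eta> + d)\<^sup>2))"
    proof (rule mult_mono)
      show "d powr (2 - \<sigma>) \<le> \<eta> powr (2 - \<sigma>)" using d \<eta> \<sigma> by (intro powr_mono2') auto
      have "(\<eta> + d)\<^sup>2 \<le> (2 * d)\<^sup>2" using d \<eta> by (intro power_mono) auto
      then have "1 / (2 * d)\<^sup>2 \<le> 1 / (\<eta> + d)\<^sup>2" using d \<eta> by (intro divide_left_mono) auto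
      moreover have "d powr (- 2) = 4 * (1 / (2 * d)\<^sup>2)" using d \<eta> by (simp add: powr_minus_divide powr_numeral power_mult_distrib)
      ultimately show "d powr (- 2) \<le> 4 * (1 / (\<eta> + d)\<^sup>2)" by simp
    qed auto
    finally show "dn (of_int h / of_int M - \<theta>) powr (- \<sigma>) \<le> \<eta> powr (2 - \<sigma>) * (4 * (1 / (\<eta> + dn (of_int h / of_int M - \<theta>))\<^sup>2))" unfolding d_def .
  qed
  also have "\<dots> = \<eta> powr (2 - \<sigma>) * (4 * (\<Sum>h\<in>?A. 1 / (\<eta> + dn (of_int h / of_int M - \<theta>))\<^sup>2))" by (simp only: sum_distrib_left)
  also have "\<dots> \<le> \<eta> powr (2 - \<sigma>) * (4 * (\<Sum>h\<in>{0..<M}. 1 / (\<eta> + dn (of_int h / of_int M - \<theta>))\<^sup>2))"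
    by (intro mult_left_mono sum_mono2) auto
  also have "\<dots> \<le> \<eta> powr (2 - \<sigma>) * (4 * (16 * of_int M / \<eta>))"
    by (intro mult_left_mono sum_inverse_square_grid assms) auto
  also have "\<dots> = 64 * of_int M * (\<eta> powr (2 - \<sigma>) / \<eta> powr 1)" using \<eta> by simp
  also have "\<eta> powr (2 - \<sigma>) / \<eta> powr 1 = \<eta> powr (1 - \<sigma>)" unfolding powr_diff[symmetric] by simp
  finally show ?thesis .
qed

lemma norm_power_diff_le:
  fixes z w :: complex
  assumes "cmod z \<le> B" "cmod w \<le> B" "0 < B"
  shows "cmod (z ^ s - w ^ s) \<le> real s * B ^ (s - 1) * cmod (z - w)"
proof (cases s)
  case (Suc t)
  have "cmod ((z / of_real B) ^ s - (w / of_real B) ^ s) \<le> real s * cmod (z / of_real B - w / of_real B)"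
    using assms by (intro norm_power_diff) (auto simp: norm_divide divide_le_eq_1)
  also have "(z / of_real B) ^ s - (w / of_real B) ^ s = (z ^ s - w ^ s) / of_real (B ^ s)" by (simp add: power_divide diff_divide_distrib)
  also have "z / of_real B - w / of_real B = (z - w) / of_real B" by (simp add: diff_divide_distrib)
  finally show ?thesis using assms(3) unfolding Suc by (simp add: norm_divide norm_power norm_mult field_simps)
qed simp

text \<open>Distances are taken modulo 1, so the arc with a = q = 1 includes both ends of the grid.
  The width w / (q n) matches Dirichlet approximation with denominators up to n / w.\<close>

definition arc :: "nat \<Rightarrow> nat \<Rightarrow> int \<Rightarrow> nat \<Rightarrow> nat \<Rightarrow> int set" where
  "arc w n M q a = {h\<in>{0..<M}. dn (of_int h / of_int M - real a / real q) \<le> real w / (real q * real n)}"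

definition farey :: "nat \<Rightarrow> (nat \<times> nat) set" where
  "farey w = (SIGMA q:{1..w}. {a. 1 \<le> a \<and> a \<le> q \<and> coprime a q})"

lemma finite_coprimes [simp]: "finite {a. 1 \<le> a \<and> a \<le> q \<and> coprime a (q::nat)}"
  by (rule finite_subset[of _ "{1..q}"]) auto

lemma finite_farey [simp]: "finite (farey w)" unfolding farey_def by (rule finite_SigmaI) auto

lemma finite_arc [simp]: "finite (arc w n M q a)" unfolding arc_def by (rule finite_Ico_filter)

text \<open>Two different fractions differ modulo 1 by at least 1 / w^2, whereas a common point
  would bring them within 2 w / n. Clearing denominators yields an integer of absolute value below
  1, hence an equation from which coprimality gives equality.\<close>

lemma arc_disjoint:
  assumes n: "2 * w ^ 3 < n" and qa: "(q, a) \<in> farey w" "(q', a') \<in> farey w"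
    and h: "h \<in> arc w n M q a" "h \<in> arc w n M q' a'"
  shows "(q, a) = (q', a')"
proof -
  have q: "1 \<le> q" "q \<le> w" "1 \<le> q'" "q' \<le> w" "1 \<le> a" "a \<le> q" "1 \<le> a'" "a' \<le> q'" "coprime a q" "coprime a' q'"
    using qa by (auto simp: farey_def)
  have n0: "0 < n" using n by simp
  have "real w / (real p * real n) \<le> real w / real n" if "1 \<le> p" for p
    using that n0 by (intro divide_left_mono) auto
  then have d1: "dn (of_int h / of_int M - real a / real q) \<le> real w / real n" "dn (of_int h / of_int M - real a' / real q') \<le> real w / real n"
    using h q unfolding arc_def by fastforce+
  have "dn (real a / real q - real a' / real q') \<le> 2 * real w / real n"
    using dn_diff_le[of "of_int h / of_int M - real a' / real q'" "of_int h / of_int M - real a / real q"] d1 by simp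
  then obtain j where j: "\<bar>real a / real q - real a' / real q' - of_int j\<bar> \<le> 2 * real w / real n" using dn_ex by metis
  have qq: "0 < real q * real q'" using q by simp
  have "\<bar>real a / real q - real a' / real q' - of_int j\<bar> * (real q * real q') \<le> 2 * real w / real n * (real w * real w)"
    using q j by (intro mult_mono) auto
  also have "\<dots> < 1"
  proof -
    have "real (2 * w ^ 3) < real n" using n by (simp only: of_nat_less_iff)
    then show ?thesis using n0 by (simp add: field_simps power3_eq_cube)
  qed
  finally have "\<bar>(real a / real q - real a' / real q' - of_int j) * (real q * real q')\<bar> < 1" by (simp add: abs_mult)
  also have "(real a / real q - real a' / real q' - of_int j) * (real q * real q') = of_int (int a * int q' - int a' * int q - j * int q * int q')"
    using q by (simp add: field_simps)
  finally have e: "int a * int q' = int a' * int q + j * int q * int q'" by linarith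
  have "int q dvd int a * int q'" unfolding e by simp
  then have 1: "q dvd q'" using q by (simp add: coprime_dvd_mult_right_iff coprime_commute)
  have "int a' * int q = int q' * (int a - j * int q)" using e by (simp add: algebra_simps)
  then have "int q' dvd int a' * int q" by simp
  then have 2: "q' dvd q" using q by (simp add: coprime_dvd_mult_right_iff coprime_commute)
  have eq: "q = q'" using 1 2 by (rule dvd_antisym)
  have "int q * (int a - int a') = int q * (j * int q)" using e unfolding eq by (simp add: algebra_simps)
  then have "int a - int a' = j * int q" using q by simp
  then have "int q dvd int a - int a'" by simp
  moreover have "\<bar>int a - int a'\<bar> < int q" using q eq by linarith
  ultimately have "a = a'" using zdvd_not_zless[of "\<bar>int a - int a'\<bar>" "int q"] by auto
  then show ?thesis using eq by simp
qed

text \<open>The singular integral in exact form, a coefficient of (1-z)^(-s/k) up to the Gamma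
  factor; its asymptotic value enters only at the end.\<close>

definition gint :: "nat \<Rightarrow> nat \<Rightarrow> nat \<Rightarrow> real" where
  "gint s k n = Gamma (1 + 1 / real k) ^ s * (pochhammer (real s / real k) n / fact n)"

text \<open>The sum over the arc is compared with the complete grid sum of (A v)^s, which is known
  exactly. The first error comes from replacing f by A v on the arc, the second from the points
  outside the arc, where \<open>vv_decay\<close> makes v^s of size dn^(-s/k), with s/k >= 2.\<close>

lemma single_arc:
  assumes k: "3 \<le> k" and s: "2 * k \<le> s" and X: "n < Suc X ^ k" "X ^ k \<le> n" and n: "0 < n"
    and w: "1 \<le> q" "q \<le> w" and cop: "coprime a q" and M: "int (s * n) < M" "int n < M"
  shows "cmod ((\<Sum>h\<in>arc w n M q a. fW k X (of_int h / of_int M) ^ s * ee (- (real n * (of_int h / of_int M))))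
      - of_real (of_int M * gint s k n) * ((gS k (int q) (int a) / of_nat q) ^ s * emod (int q) (- (int n * int a))))
    \<le> of_int M * (2048 * real s * real w ^ 2 * (real X + 1) ^ (s - 1) / (real q * real n)
         + 64 * (3 * gS_const k) ^ s * real n powr (real s / real k - 1) * real w powr (1 - real s / real k) / real q)"
proof -
  define \<sigma> where "\<sigma> = real s / real k"
  have k1: "1 \<le> k" using k by simp
  have "real (2 * k) \<le> real s" using s by (simp only: of_nat_le_iff)
  then have \<sigma>: "2 \<le> \<sigma>" unfolding \<sigma>_def using k by (simp add: pos_le_divide_eq)
  define \<eta> where "\<eta> = real w / (real q * real n)"
  have w0: "0 < w" using w by simp
  have M0: "0 < M" using M by linarith
  have \<eta>0: "0 < \<eta>" unfolding \<eta>_def using w0 w n by simp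
  have "real q * real n \<le> real w * of_int M"
  proof (rule mult_mono)
    have "real_of_int (int n) \<le> of_int M" using M by (simp only: of_int_le_iff)
    then show "real n \<le> of_int M" by simp
  qed (use w in auto)
  then have \<eta>1: "1 \<le> \<eta> * of_int M" unfolding \<eta>_def using w n by (simp add: field_simps)
  define \<theta> where "\<theta> = real a / real q"
  define A where "A = gS k (int q) (int a) / complex_of_nat q"
  define E where "E = emod (int q) (- (int n * int a))"
  define f where "f h = fW k X (of_int h / of_int M)" for h
  define v where "v h = vv k n (of_int h / of_int M - \<theta>)" for h
  define \<epsilon> where "\<epsilon> h = ee (- (real n * (of_int h / of_int M)))" for h
  define R where "R = arc w n M q a"
  have R: "R = {h\<in>{0..<M}. dn (of_int h / of_int M - \<theta>) \<le> \<eta>}" by (simp add: R_def arc_def \<eta>_def \<theta>_def)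
  have RM: "R \<subseteq> {0..<M}" "{0..<M} - R = {h\<in>{0..<M}. \<not> dn (of_int h / of_int M - \<theta>) \<le> \<eta>}" by (auto simp: R)
  have \<epsilon>E: "\<epsilon> h = E * ee (- (real n * (of_int h / of_int M - \<theta>)))" for h
  proof -
    have "E = ee (- (real n * \<theta>))" by (simp add: E_def emod_def \<theta>_def)
    then show ?thesis unfolding \<epsilon>_def by (simp add: ee_add[symmetric] algebra_simps)
  qed
  have A: "cmod A \<le> gS_const k * real q powr (- 1 / real k)" unfolding A_def by (rule gS_ratio_bound[OF k w(1) cop])
  have A1: "cmod A \<le> 1" unfolding A_def using gS_norm_le[of "int q" k "int a"] w by (simp add: norm_divide divide_le_eq_1)
  have grid: "(\<Sum>h\<in>{0..<M}. (A * v h) ^ s * \<epsilon> h) = of_real (of_int M * gint s k n) * (A ^ s * E)"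
  proof -
    have "(\<Sum>h\<in>{0..<M}. (A * v h) ^ s * \<epsilon> h) = A ^ s * E * (\<Sum>h\<in>{0..<M}. v h ^ s * ee (- (real n * (of_int h / of_int M - \<theta>))))"
      unfolding sum_distrib_left \<epsilon>E by (intro sum.cong refl) (simp add: power_mult_distrib mult_ac)
    also have "\<dots> = A ^ s * E * of_real (of_int M * gint s k n)"
      unfolding v_def gint_def by (subst vv_grid[OF k1 M]) (rule refl)
    finally show ?thesis by (simp add: mult_ac)
  qed
  have "(\<Sum>h\<in>{0..<M}. (A * v h) ^ s * \<epsilon> h) = (\<Sum>h\<in>{0..<M} - R. (A * v h) ^ s * \<epsilon> h) + (\<Sum>h\<in>R. (A * v h) ^ s * \<epsilon> h)"
    by (rule sum.subset_diff[OF RM(1)]) simp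
  then have eq: "(\<Sum>h\<in>R. f h ^ s * \<epsilon> h) - of_real (of_int M * gint s k n) * (A ^ s * E)
      = (\<Sum>h\<in>R. (f h ^ s - (A * v h) ^ s) * \<epsilon> h) - (\<Sum>h\<in>{0..<M} - R. (A * v h) ^ s * \<epsilon> h)"
    unfolding grid by (simp add: left_diff_distrib sum_subtractf)
  have near: "cmod (\<Sum>h\<in>R. (f h ^ s - (A * v h) ^ s) * \<epsilon> h) \<le> of_int M * (2048 * real s * real w ^ 2 * (real X + 1) ^ (s - 1) / (real q * real n))"
  proof -
    have "cmod (\<Sum>h\<in>R. (f h ^ s - (A * v h) ^ s) * \<epsilon> h) \<le> (\<Sum>h\<in>R. real s * (real X + 1) ^ (s - 1) * (32 * real w))"
    proof (rule order.trans[OF norm_sum], rule sum_mono)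
      fix h assume h: "h \<in> R"
      have fX: "cmod (f h) \<le> real X + 1"
      proof -
        have "cmod (f h) \<le> (\<Sum>x\<in>{1..int X}. 1)" unfolding f_def fW_def by (rule order.trans[OF norm_sum]) simp
        then show ?thesis by simp
      qed
      have vX: "cmod (v h) \<le> real X + 1"
      proof -
        have "cmod (v h) \<le> (real n + 1) powr (1 / real k)" unfolding v_def by (rule vv_upper[OF k1])
        also have "\<dots> \<le> (real (Suc X) ^ k) powr (1 / real k)"
        proof (rule powr_mono2)
          have "real (n + 1) \<le> real (Suc X ^ k)" using X(1) by (simp only: of_nat_le_iff)
          then show "real n + 1 \<le> real (Suc X) ^ k" by simp
        qed auto
        also have "\<dots> = real (Suc X)" using k by (simp add: powr_realpow[symmetric] powr_powr del: of_nat_Suc)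
        finally show ?thesis by simp
      qed
      have AvX: "cmod (A * v h) \<le> real X + 1"
        using mult_mono[OF A1 vX] by (simp add: norm_mult)
      have "cmod ((f h ^ s - (A * v h) ^ s) * \<epsilon> h) = cmod (f h ^ s - (A * v h) ^ s)" by (simp add: norm_mult \<epsilon>_def)
      also have "\<dots> \<le> real s * (real X + 1) ^ (s - 1) * cmod (f h - A * v h)"
        by (rule norm_power_diff_le[OF fX AvX]) simp
      also have "\<dots> \<le> real s * (real X + 1) ^ (s - 1) * (32 * real w)"
      proof (rule mult_left_mono)
        have "cmod (f h - A * v h) \<le> (2 * real q + 2) * (1 + real n * (7 * dn (of_int h / of_int M - \<theta>)))"
          using major_approx[OF k1 _ X, of q "of_int h / of_int M" "int a"] w unfolding f_def v_def A_def \<theta>_def by simp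
        also have "\<dots> \<le> (2 * real q + 2) * (1 + real n * (7 * \<eta>))" using h unfolding R by (intro mult_left_mono add_mono) auto
        also have "\<dots> = (2 * real q + 2) * (1 + 7 * (real w / real q))" unfolding \<eta>_def using n by simp
        also have "\<dots> \<le> (4 * real q) * (8 * (real w / real q))"
        proof (rule mult_mono)
          have "1 \<le> real w / real q" using w by simp
          then show "1 + 7 * (real w / real q) \<le> 8 * (real w / real q)" by simp
        qed (use w in auto)
        also have "\<dots> = 32 * real w" using w by simp
        finally show "cmod (f h - A * v h) \<le> 32 * real w" .
      qed simp
      finally show "cmod ((f h ^ s - (A * v h) ^ s) * \<epsilon> h) \<le> real s * (real X + 1) ^ (s - 1) * (32 * real w)" .
    qed
    also have "\<dots> = real (card R) * (real s * (real X + 1) ^ (s - 1) * (32 * real w))" by simp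
    also have "\<dots> \<le> (64 * (of_int M * \<eta>)) * (real s * (real X + 1) ^ (s - 1) * (32 * real w))"
      unfolding R by (intro mult_right_mono card_grid_near M0 \<eta>0 \<eta>1) auto
    also have "\<dots> = of_int M * (2048 * real s * real w ^ 2 * (real X + 1) ^ (s - 1) / (real q * real n))"
      by (simp add: \<eta>_def power2_eq_square)
    finally show ?thesis .
  qed
  have far: "cmod (\<Sum>h\<in>{0..<M} - R. (A * v h) ^ s * \<epsilon> h) \<le> of_int M * (64 * (3 * gS_const k) ^ s * real n powr (\<sigma> - 1) * real w powr (1 - \<sigma>) / real q)"
  proof -
    define B where "B = (3 * gS_const k) ^ s * real q powr (- \<sigma>)"
    have g1: "0 \<le> gS_const k" using gS_const_ge_1[of k] by simp
    have B0: "0 \<le> B" unfolding B_def using g1 by simp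
    have "cmod (\<Sum>h\<in>{0..<M} - R. (A * v h) ^ s * \<epsilon> h) \<le> (\<Sum>h\<in>{0..<M} - R. B * dn (of_int h / of_int M - \<theta>) powr (- \<sigma>))"
    proof (rule order.trans[OF norm_sum], rule sum_mono)
      fix h assume h: "h \<in> {0..<M} - R"
      define d where "d = dn (of_int h / of_int M - \<theta>)"
      have d: "0 < d" using h \<eta>0 unfolding RM(2) d_def by auto
      have "cmod ((A * v h) ^ s * \<epsilon> h) = (cmod A * cmod (v h)) ^ s" by (simp add: norm_mult norm_power \<epsilon>_def)
      also have "\<dots> \<le> ((gS_const k * real q powr (- 1 / real k)) * (3 * d powr (- 1 / real k))) ^ s"
      proof (intro power_mono mult_mono)
        show "cmod (v h) \<le> 3 * d powr (- 1 / real k)" unfolding v_def d_def using d[unfolded d_def] by (rule vv_decay[OF k1])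
      qed (use A g1 in auto)
      also have "\<dots> = B * d powr (- \<sigma>)"
      proof -
        have p: "(x powr (- 1 / real k)) ^ s = x powr (- \<sigma>)" if "0 < x" for x :: real
          using that by (simp add: powr_power \<sigma>_def)
        have "((gS_const k * real q powr (- 1 / real k)) * (3 * d powr (- 1 / real k))) ^ s
          = (3 * gS_const k) ^ s * (real q powr (- 1 / real k)) ^ s * (d powr (- 1 / real k)) ^ s"
          unfolding power_mult_distrib[symmetric] by (simp only: mult_ac)
        then show ?thesis unfolding B_def using p[of "real q"] p[of d] d w by simp
      qed
      finally show "cmod ((A * v h) ^ s * \<epsilon> h) \<le> B * dn (of_int h / of_int M - \<theta>) powr (- \<sigma>)" unfolding d_def .
    qed
    also have "\<dots> = B * (\<Sum>h\<in>{0..<M} - R. dn (of_int h / of_int M - \<theta>) powr (- \<sigma>))" by (simp only: sum_distrib_left)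
    also have "\<dots> \<le> B * (64 * of_int M * \<eta> powr (1 - \<sigma>))"
      unfolding RM(2) by (intro mult_left_mono sum_grid_far M0 \<eta>0 \<eta>1 \<sigma> B0)
    also have "\<eta> powr (1 - \<sigma>) = real w powr (1 - \<sigma>) * (real q powr (\<sigma> - 1) * real n powr (\<sigma> - 1))"
    proof -
      have "\<eta> powr (1 - \<sigma>) = real w powr (1 - \<sigma>) * inverse ((real q * real n) powr (1 - \<sigma>))"
        unfolding \<eta>_def by (subst powr_divide) (auto simp: divide_inverse)
      also have "inverse ((real q * real n) powr (1 - \<sigma>)) = (real q * real n) powr (\<sigma> - 1)"
        unfolding powr_minus[symmetric] by simp
      also have "\<dots> = real q powr (\<sigma> - 1) * real n powr (\<sigma> - 1)" by (simp add: powr_mult)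
      finally show ?thesis .
    qed
    also have "B * (64 * of_int M * (real w powr (1 - \<sigma>) * (real q powr (\<sigma> - 1) * real n powr (\<sigma> - 1))))
       = of_int M * (64 * (3 * gS_const k) ^ s * real n powr (\<sigma> - 1) * real w powr (1 - \<sigma>) * (real q powr (- \<sigma>) * real q powr (\<sigma> - 1)))"
      unfolding B_def by (simp only: mult_ac)
    also have "real q powr (- \<sigma>) * real q powr (\<sigma> - 1) = 1 / real q"
      unfolding powr_add[symmetric] using w by (simp add: powr_minus_divide)
    finally show ?thesis by simp
  qed
  have "cmod ((\<Sum>h\<in>R. f h ^ s * \<epsilon> h) - of_real (of_int M * gint s k n) * (A ^ s * E)) \<le>
     of_int M * (2048 * real s * real w ^ 2 * (real X + 1) ^ (s - 1) / (real q * real n)) +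
     of_int M * (64 * (3 * gS_const k) ^ s * real n powr (\<sigma> - 1) * real w powr (1 - \<sigma>) / real q)"
    unfolding eq by (rule order.trans[OF norm_triangle_ineq4 add_mono[OF near far]])
  then show ?thesis unfolding R_def f_def \<epsilon>_def A_def E_def \<sigma>_def distrib_left .
qed

text \<open>The arcs are disjoint, so the errors add up: at most q numerators cancel the 1/q of
  \<open>single_arc\<close>, and the w denominators contribute a factor w.\<close>

lemma major_arcs:
  assumes k: "3 \<le> k" and s: "2 * k \<le> s" and X: "n < Suc X ^ k" "X ^ k \<le> n"
    and w: "2 * w ^ 3 < n" "1 \<le> w" and M: "int (s * n) < M" "int n < M"
  shows "cmod ((\<Sum>h\<in>(\<Union>(q, a)\<in>farey w. arc w n M q a). fW k X (of_int h / of_int M) ^ s * ee (- (real n * (of_int h / of_int M))))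
      - of_real (of_int M * gint s k n) * (\<Sum>q\<in>{1..w}. singular_term s k n q))
    \<le> of_int M * (2048 * real s * real w ^ 3 * (real X + 1) ^ (s - 1) / real n
         + 64 * (3 * gS_const k) ^ s * real n powr (real s / real k - 1) * real w powr (2 - real s / real k))"
proof -
  define F where "F h = fW k X (of_int h / of_int M) ^ s * ee (- (real n * (of_int h / of_int M)))" for h
  define T where "T q a = (gS k (int q) (int a) / of_nat q) ^ s * emod (int q) (- (int n * int a))" for q a :: nat
  define c where "c = complex_of_real (of_int M * gint s k n)"
  define K where "K = 2048 * real s * real w ^ 2 * (real X + 1) ^ (s - 1) / real n
         + 64 * (3 * gS_const k) ^ s * real n powr (real s / real k - 1) * real w powr (1 - real s / real k)"
  have n0: "0 < n" using w by simp
  have M0: "0 \<le> real_of_int M" using M by simp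
  have K0: "0 \<le> K" unfolding K_def using gS_const_ge_1[of k] by (intro add_nonneg_nonneg mult_nonneg_nonneg divide_nonneg_nonneg zero_le_power) auto
  have "(\<Sum>h\<in>(\<Union>(q, a)\<in>farey w. arc w n M q a). F h) = (\<Sum>(q, a)\<in>farey w. \<Sum>h\<in>arc w n M q a. F h)"
  proof (subst sum.UNION_disjoint)
    show "\<forall>i\<in>farey w. \<forall>j\<in>farey w. i \<noteq> j \<longrightarrow> (case i of (q, a) \<Rightarrow> arc w n M q a) \<inter> (case j of (q, a) \<Rightarrow> arc w n M q a) = {}"
      using arc_disjoint[OF w(1)] by fastforce
  qed (auto intro!: sum.cong)
  moreover have "(\<Sum>q\<in>{1..w}. singular_term s k n q) = (\<Sum>(q, a)\<in>farey w. T q a)"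
    unfolding farey_def T_def by (subst sum.Sigma[symmetric]) (auto intro!: sum.cong simp: singular_term_altdef)
  ultimately have "cmod ((\<Sum>h\<in>(\<Union>(q, a)\<in>farey w. arc w n M q a). F h) - c * (\<Sum>q\<in>{1..w}. singular_term s k n q))
     = cmod (\<Sum>(q, a)\<in>farey w. (\<Sum>h\<in>arc w n M q a. F h) - c * T q a)"
    by (simp add: sum_distrib_left sum_subtractf case_prod_unfold)
  also have "\<dots> \<le> (\<Sum>(q, a)\<in>farey w. of_int M * (K / real q))"
  proof (rule order.trans[OF norm_sum], rule sum_mono, clarify)
    fix q a assume "(q, a) \<in> farey w"
    then have q: "1 \<le> q" "q \<le> w" "coprime a q" by (auto simp: farey_def)
    show "cmod ((\<Sum>h\<in>arc w n M q a. F h) - c * T q a) \<le> of_int M * (K / real q)"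
      using single_arc[OF k s X n0 q M] unfolding F_def c_def T_def K_def by (simp add: add_divide_distrib mult.commute)
  qed
  also have "\<dots> = (\<Sum>q\<in>{1..w}. real (card {a. 1 \<le> a \<and> a \<le> q \<and> coprime a q}) * (of_int M * (K / real q)))"
    unfolding farey_def by (subst sum.Sigma[symmetric]) auto
  also have "\<dots> \<le> (\<Sum>q\<in>{1..w}. of_int M * K)"
  proof (rule sum_mono)
    fix q assume q: "q \<in> {1..w}"
    have "card {a. 1 \<le> a \<and> a \<le> q \<and> coprime a q} \<le> card {1..q}" by (intro card_mono) auto
    then have "real (card {a. 1 \<le> a \<and> a \<le> q \<and> coprime a q}) * (of_int M * (K / real q)) \<le> real q * (of_int M * (K / real q))"
      using M0 K0 by (intro mult_right_mono) auto
    also have "\<dots> = of_int M * K" using q by simp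
    finally show "real (card {a. 1 \<le> a \<and> a \<le> q \<and> coprime a q}) * (of_int M * (K / real q)) \<le> of_int M * K" .
  qed
  also have "\<dots> = of_int M * (real w * K)" by simp
  also have "real w * K = 2048 * real s * real w ^ 3 * (real X + 1) ^ (s - 1) / real n
         + 64 * (3 * gS_const k) ^ s * real n powr (real s / real k - 1) * (real w powr 1 * real w powr (1 - real s / real k))"
    unfolding K_def by (simp add: distrib_left power2_eq_square power3_eq_cube mult_ac)
  also have "real w powr 1 * real w powr (1 - real s / real k) = real w powr (2 - real s / real k)"
    unfolding powr_add[symmetric] by simp
  finally show ?thesis unfolding F_def c_def .
qed

section \<open>The counting function on the grid and the minor arcs\<close>

lemma card_waring_tup:
  assumes X: "n < Suc X ^ k"
  shows "waring_count s k n = card {xs \<in> tup s {1..int X}. psum k xs = int n}"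
  unfolding waring_count_def
proof (rule bij_betw_same_card, rule bij_betw_byWitness[of _ "map nat" "map int"])
  have ps: "psum k (map int xs) = int (\<Sum>x\<leftarrow>xs. x ^ k)" for xs
    by (induction xs) (simp_all add: psum_def)
  have nn: "map nat (map int xs) = xs" for xs by (induction xs) auto
  have ii: "map int (map nat xs) = xs" if "set xs \<subseteq> {1..int X}" for xs using that by (induction xs) auto
  let ?A = "{xs. length xs = s \<and> (\<forall>x\<in>set xs. 1 \<le> x) \<and> (\<Sum>x\<leftarrow>xs. x ^ k) = n}"
  let ?B = "{xs \<in> tup s {1..int X}. psum k xs = int n}"
  show "\<forall>a\<in>?A. map nat (map int a) = a" using nn by blast
  show "\<forall>b\<in>?B. map int (map nat b) = b" using ii by (auto simp: tup_def)
  show "map int ` ?A \<subseteq> ?B"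
  proof (rule image_subsetI)
    fix xs assume xs: "xs \<in> ?A"
    have "x \<le> X" if "x \<in> set xs" for x
    proof -
      have "x ^ k \<le> (\<Sum>x\<leftarrow>xs. x ^ k)" using that by (intro member_le_sum_list) auto
      then have "x ^ k < Suc X ^ k" using xs X by simp
      then have "x < Suc X" by (rule power_less_imp_less_base) simp
      then show ?thesis by simp
    qed
    then show "map int xs \<in> ?B" using xs by (auto simp: tup_def ps)
  qed
  show "map nat ` ?B \<subseteq> ?A"
  proof (rule image_subsetI)
    fix xs assume xs: "xs \<in> ?B"
    then have "int (\<Sum>x\<leftarrow>map nat xs. x ^ k) = int n" using ps[of "map nat xs"] ii[of xs] by (auto simp: tup_def)
    moreover have "1 \<le> nat x" if "x \<in> set xs" for x using xs that by (force simp: tup_def)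
    ultimately show "map nat xs \<in> ?A" using xs by (auto simp: tup_def simp del: map_map)
  qed
qed

lemma fW_emod: "fW k X (of_int h / of_int M) = (\<Sum>x\<in>{1..int X}. 1 * emod M (h * x ^ k))"
  unfolding fW_def by (intro sum.cong refl) (simp add: emod_def)

text \<open>X is the integral k-th root of n, so all relevant summands are present; M exceeds s n
  and n, so congruence modulo M is equality.\<close>

lemma waring_fourier:
  assumes X: "n < Suc X ^ k" "X ^ k \<le> n" and M: "int (s * n) < M" "int n < M"
  shows "(\<Sum>h\<in>{0..<M}. fW k X (of_int h / of_int M) ^ s * ee (- (real n * (of_int h / of_int M)))) = of_int M * of_nat (waring_count s k n)"
proof -
  have M0: "0 < M" using M by linarith
  have "fW k X (of_int h / of_int M) ^ s * ee (- (real n * (of_int h / of_int M))) = (\<Sum>xs\<in>tup s {1..int X}. emod M (h * (psum k xs - int n)))" for h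
  proof -
    have e: "ee (- (real n * (of_int h / of_int M))) = emod M (h * (- int n))" by (simp add: emod_def mult.commute)
    have p: "(\<Sum>x\<leftarrow>xs. h * x ^ k) = h * psum k xs" for xs by (simp add: psum_def sum_list_const_mult)
    have "fW k X (of_int h / of_int M) ^ s = (\<Sum>xs\<in>tup s {1..int X}. emod M (h * psum k xs))"
      unfolding fW_emod mult_1 by (subst sum_power_tup) (simp_all add: prod_list_emod p)
    then show ?thesis unfolding e by (simp only: sum_distrib_right emod_add[symmetric] distrib_left diff_conv_add_uminus)
  qed
  then have "(\<Sum>h\<in>{0..<M}. fW k X (of_int h / of_int M) ^ s * ee (- (real n * (of_int h / of_int M))))
     = (\<Sum>xs\<in>tup s {1..int X}. \<Sum>h\<in>{0..<M}. emod M (h * (psum k xs - int n)))"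
    by (simp only:) (rule sum.swap)
  also have "\<dots> = (\<Sum>xs\<in>tup s {1..int X}. if psum k xs = int n then of_int M else 0)"
  proof (rule sum.cong[OF refl])
    fix xs assume xs: "xs \<in> tup s {1..int X}"
    have ps: "0 \<le> psum k xs" "psum k xs \<le> int (s * X ^ k)" using psum_bounds[OF xs, of k] by auto
    have "s * X ^ k \<le> s * n" using X(2) by simp
    then have "int (s * X ^ k) \<le> int (s * n)" by (simp only: of_nat_le_iff)
    then have "\<bar>psum k xs - int n\<bar> < M" using ps M by linarith
    then have "M dvd psum k xs - int n \<longleftrightarrow> psum k xs = int n"
      using zdvd_not_zless[of "\<bar>psum k xs - int n\<bar>" M] by auto
    then show "(\<Sum>h\<in>{0..<M}. emod M (h * (psum k xs - int n))) = (if psum k xs = int n then of_int M else 0)"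
      unfolding sum_emod[OF M0] by simp
  qed
  also have "\<dots> = of_int M * of_nat (card {xs \<in> tup s {1..int X}. psum k xs = int n})"
    by (simp add: sum.inter_filter[symmetric])
  finally show ?thesis unfolding card_waring_tup[OF X(1)] .
qed

text \<open>Dirichlet approximation with denominators up to about n / w. A denominator q <= w would
  place the point on an arc; hence w < q, and the error 1 / (q N) is at most 1 / q^2.\<close>

lemma dirichlet_minor:
  assumes h: "h \<in> {0..<M}" "h \<notin> (\<Union>(q, a)\<in>farey w. arc w n M q a)" and w: "1 \<le> w" "w \<le> n"
  shows "\<exists>a q. 0 < q \<and> coprime a (int q) \<and> real w < real q \<and> real q \<le> 2 * real n / real w \<and> \<bar>of_int h / of_int M - of_int a / real q\<bar> \<le> 1 / (real q)\<^sup>2"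
proof -
  define \<alpha> where "\<alpha> = of_int h / (of_int M :: real)"
  define N where "N = nat \<lceil>real n / real w\<rceil>"
  have nw: "1 \<le> real n / real w" using w by simp
  have N: "real n / real w \<le> real N" "real N \<le> real n / real w + 1" unfolding N_def using nw by linarith+
  then have N0: "0 < N" using nw by simp
  obtain a q' where a: "coprime a q'" "0 < q'" "q' \<le> int N" "\<bar>of_int q' * \<alpha> - of_int a\<bar> < 1 / real N"
    using Dirichlet_approx_coprime[OF N0, of \<alpha>] by metis
  define q where "q = nat q'"
  have q: "q' = int q" "1 \<le> q" "q \<le> N" using a by (auto simp: q_def)
  have "\<bar>of_int q' * \<alpha> - of_int a\<bar> = real q * \<bar>\<alpha> - of_int a / real q\<bar>"
  proof -
    have "of_int q' * \<alpha> - of_int a = real q * (\<alpha> - of_int a / real q)" using q by (simp add: right_diff_distrib)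
    then show ?thesis using q by (simp add: abs_mult)
  qed
  then have ap: "\<bar>\<alpha> - of_int a / real q\<bar> \<le> 1 / (real q * real N)"
    using a(4) q N0 by (simp add: field_simps)
  have "w < q"
  proof (rule ccontr)
    assume "\<not> w < q"
    \<comment> \<open>The representative of a in 1..q rather than 0..q-1, as \<open>farey\<close>
      requires; for q = 1 it is 1.\<close>
    define a' where "a' = nat ((a - 1) mod int q + 1)"
    have a': "int a' = (a - 1) mod int q + 1" unfolding a'_def using q by simp
    have aa: "a = int a' + int q * ((a - 1) div int q)"
      using mult_div_mod_eq[of "int q" "a - 1"] a' by simp
    have "1 \<le> a'" "a' \<le> q"
    proof -
      have "0 \<le> (a - 1) mod int q" "(a - 1) mod int q < int q" using q by auto
      then show "1 \<le> a'" "a' \<le> q" using a' by linarith+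
    qed
    moreover have "coprime a' q"
    proof -
      have "coprime (int a' + int q * ((a - 1) div int q)) (int q)" using a(1) q(1) aa by simp
      then have "coprime (int a') (int q)" by (metis gcd_add_mult coprime_iff_gcd_eq_1 gcd.commute add.commute mult.commute)
      then show ?thesis by simp
    qed
    ultimately have fa: "(q, a') \<in> farey w" using q \<open>\<not> w < q\<close> by (auto simp: farey_def)
    have "real_of_int a = real a' + real q * of_int ((a - 1) div int q)"
      by (subst aa) simp
    then have "\<alpha> - real a' / real q = (\<alpha> - of_int a / real q) + of_int ((a - 1) div int q)"
      using q by (simp add: field_simps)
    then have "dn (\<alpha> - real a' / real q) = dn (\<alpha> - of_int a / real q)" by (simp only: dn_add_int)
    also have "\<dots> \<le> \<bar>\<alpha> - of_int a / real q\<bar>" using dn_le[of _ 0] by simp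
    also have "\<dots> \<le> 1 / (real q * real N)" by (rule ap)
    also have "\<dots> \<le> 1 / (real q * (real n / real w))" using q N w nw by (intro divide_left_mono mult_left_mono) auto
    also have "\<dots> = real w / (real q * real n)" by simp
    finally have "h \<in> arc w n M q a'" using h(1) unfolding arc_def \<alpha>_def by blast
    then show False using h(2) fa by blast
  qed
  moreover have "real q \<le> 2 * real n / real w" using q N nw by linarith
  moreover have "\<bar>\<alpha> - of_int a / real q\<bar> \<le> 1 / (real q)\<^sup>2"
  proof -
    have "1 / (real q * real N) \<le> 1 / (real q)\<^sup>2" unfolding power2_eq_square using q N0 by (intro divide_left_mono mult_left_mono) auto
    then show ?thesis using ap by linarith
  qed
  ultimately show ?thesis using a(1) q unfolding \<alpha>_def by (intro exI[of _ a] exI[of _ q]) auto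
qed

lemma fW_mean_square:
  assumes k: "1 \<le> k" and M: "int (X ^ k) < M"
  shows "(\<Sum>h\<in>{0..<M}. cmod (fW k X (of_int h / of_int M)) ^ 2) = of_int M * real X"
proof -
  have M0: "0 < M" using M by linarith
  have "(\<Sum>h\<in>{0..<M}. cmod (\<Sum>x\<in>{1..int X}. 1 * emod M (h * x ^ k)) ^ 2) = of_int M * (\<Sum>x\<in>{1..int X}. (cmod 1)\<^sup>2)"
  proof (rule parseval[OF M0])
    fix x y assume xy: "x \<in> {1..int X}" "y \<in> {1..int X}" and dv: "M dvd x ^ k - y ^ k"
    have "0 \<le> z ^ k \<and> z ^ k < M" if "z \<in> {1..int X}" for z
    proof -
      have "z ^ k \<le> int X ^ k" using that by (intro power_mono) auto
      then show ?thesis using that M by simp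
    qed
    from this[OF xy(1)] this[OF xy(2)] have "\<bar>x ^ k - y ^ k\<bar> < M" by linarith
    then have "x ^ k = y ^ k" using dv zdvd_not_zless[of "\<bar>x ^ k - y ^ k\<bar>" M] by auto
    then show "x = y" using xy k by (intro power_eq_imp_eq_base[of x k y]) auto
  qed simp
  then show ?thesis unfolding fW_emod by simp
qed

section \<open>Assembly\<close>

text \<open>Splitting at the threshold T interpolates between the second and the 2 r-th moment.\<close>

lemma sum_power_split_le:
  fixes F :: "'a \<Rightarrow> real"
  assumes T: "0 < T" and B: "\<And>h. h \<in> A \<Longrightarrow> 0 \<le> F h \<and> F h \<le> B" "1 \<le> B" and r: "2 \<le> r" and s: "2 * r - 2 \<le> s" and A: "finite A"
  shows "(\<Sum>h\<in>A. F h ^ s) \<le> B ^ (s - (2 * r - 2)) * (T ^ (2 * r - 4) * (\<Sum>h\<in>A. F h ^ 2) + (\<Sum>h\<in>A. F h ^ (2 * r)) / T ^ 2)"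
proof -
  have "F h ^ s \<le> B ^ (s - (2 * r - 2)) * (T ^ (2 * r - 4) * F h ^ 2 + F h ^ (2 * r) / T ^ 2)" if h: "h \<in> A" for h
  proof -
    have F: "0 \<le> F h" "F h \<le> B" using B(1)[OF h] by auto
    have "F h ^ s = F h ^ (s - (2 * r - 2)) * F h ^ (2 * r - 2)" using s by (simp flip: power_add)
    also have "\<dots> \<le> B ^ (s - (2 * r - 2)) * (T ^ (2 * r - 4) * F h ^ 2 + F h ^ (2 * r) / T ^ 2)"
    proof (intro mult_mono power_mono F)
      show "F h ^ (2 * r - 2) \<le> T ^ (2 * r - 4) * F h ^ 2 + F h ^ (2 * r) / T ^ 2"
      proof (cases "F h \<le> T")
        case True
        have "2 * r - 2 = (2 * r - 4) + 2" using r by simp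
        then have "F h ^ (2 * r - 2) = F h ^ (2 * r - 4) * F h ^ 2" by (simp only: power_add)
        also have "\<dots> \<le> T ^ (2 * r - 4) * F h ^ 2" using F True by (intro mult_right_mono power_mono) auto
        finally show ?thesis using F T by (simp add: add_increasing2)
      next
        case False
        have e: "2 * r = (2 * r - 2) + 2" using r by simp
        have "F h ^ (2 * r - 2) * T ^ 2 \<le> F h ^ (2 * r - 2) * F h ^ 2" using F T False by (intro mult_left_mono power_mono) auto
        also have "\<dots> = F h ^ (2 * r)" by (subst e) (simp only: power_add)
        finally have "F h ^ (2 * r - 2) \<le> F h ^ (2 * r) / T ^ 2" using T by (simp add: pos_le_divide_eq)
        then show ?thesis using F T by (simp add: add_increasing)
      qed
    qed (use B(2) F in auto)
    finally show ?thesis .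
  qed
  then have "(\<Sum>h\<in>A. F h ^ s) \<le> (\<Sum>h\<in>A. B ^ (s - (2 * r - 2)) * (T ^ (2 * r - 4) * F h ^ 2 + F h ^ (2 * r) / T ^ 2))" by (rule sum_mono)
  also have "\<dots> = B ^ (s - (2 * r - 2)) * (T ^ (2 * r - 4) * (\<Sum>h\<in>A. F h ^ 2) + (\<Sum>h\<in>A. F h ^ (2 * r)) / T ^ 2)"
    by (simp only: sum_distrib_left[symmetric] sum.distrib sum_divide_distrib[symmetric])
  finally show ?thesis .
qed

text \<open>The width w = X^(8/25) is below X^(1/3), as the major arcs require, and the threshold for the
  splitting is T = X^(169/200). The two error terms are admissible if the saving 8/25 exceeds
  2 (k-1) / (k^2+k-4), which is where k \<ge> 5 enters.\<close>

lemma minor_arcs_bound: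
  assumes k: "5 \<le> k" and s: "k * k + k - 2 \<le> s"
  shows "\<exists>C>0. \<forall>X n w M. 2 \<le> X \<longrightarrow> X ^ k \<le> n \<longrightarrow> n < Suc X ^ k \<longrightarrow> 1 \<le> w \<longrightarrow> real w \<le> real X powr (8 / 25) \<longrightarrow>
     real X powr (8 / 25) \<le> 2 * real w \<longrightarrow> int (rr k) * int (2 * X) ^ k < M \<longrightarrow> int (X ^ k) < M \<longrightarrow>
     (\<Sum>h\<in>{0..<M} - (\<Union>(q, a)\<in>farey w. arc w n M q a). cmod (fW k X (of_int h / of_int M)) ^ s) \<le> of_int M * (C * real X powr (real s - real k - 1 / 200))"
proof -
  obtain C where C: "0 < C" and mean: "\<And>X W n M HH. 1 \<le> X \<Longrightarrow> 1 \<le> W \<Longrightarrow> W \<le> real X \<Longrightarrow> n \<le> real (2 * X) ^ k \<Longrightarrow>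
      int (rr k) * int (2 * X) ^ k < M \<Longrightarrow> HH \<subseteq> {0..<M} \<Longrightarrow>
      (\<forall>h\<in>HH. \<exists>a q. 0 < q \<and> coprime a (int q) \<and> W < real q \<and> real q \<le> n / W \<and> \<bar>of_int h / of_int M - of_int a / real q\<bar> \<le> 1 / (real q)\<^sup>2) \<Longrightarrow>
      (\<Sum>h\<in>HH. cmod (fW k X (of_int h / of_int M)) ^ (2 * rr k)) \<le> of_int M * (C * real X powr (real (2 * rr k) - real k + 1 / 200) / W)"
    using minor_arc_mean[of k "1 / 200"] k by auto
  have main: "(\<Sum>h\<in>{0..<M} - (\<Union>(q, a)\<in>farey w. arc w n M q a). cmod (fW k X (of_int h / of_int M)) ^ s) \<le> of_int M * ((1 + 2 * C) * real X powr (real s - real k - 1 / 200))"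
    if X: "2 \<le> X" "X ^ k \<le> n" "n < Suc X ^ k" and w: "1 \<le> w" "real w \<le> real X powr (8 / 25)" "real X powr (8 / 25) \<le> 2 * real w"
      and M: "int (rr k) * int (2 * X) ^ k < M" "int (X ^ k) < M" for X n w M
  proof -
    define U where "U = {0..<M} - (\<Union>(q, a)\<in>farey w. arc w n M q a)"
    define F where "F h = cmod (fW k X (of_int h / of_int M))" for h
    define x where "x = real X"
    have x: "2 \<le> x" using X(1) by (simp add: x_def)
    have "0 \<le> M" using M(2) of_nat_0_le_iff[of "X ^ k"] by linarith
    then have M0: "0 \<le> real_of_int M" by simp
    have xM: "real X powr (8 / 25) \<le> x powr 1" unfolding x_def using X(1) by (intro powr_mono) auto
    then have wx: "real w \<le> x" using w(2) x by simp
    have wn: "w \<le> n"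
    proof -
      have "w \<le> X" using wx by (simp add: x_def)
      also have "X ^ 1 \<le> X ^ k" using X(1) k by (intro power_increasing) auto
      finally show ?thesis using X(2) by simp
    qed
    \<comment> \<open>The factor 2 comes from rounding up in Dirichlet's theorem; it fits because
      (X+1)^k <= (3X/2)^k for X >= 2 and (4/3)^k >= 2.\<close>
    have n2: "2 * real n \<le> real (2 * X) ^ k"
    proof -
      have "real n \<le> real (Suc X ^ k)" using X(3) by (simp only: of_nat_le_iff less_imp_le)
      also have "\<dots> = (x + 1) ^ k" by (simp add: x_def add.commute)
      also have "\<dots> \<le> (3 / 2 * x) ^ k" using x by (intro power_mono) auto
      finally have "2 * real n \<le> 2 * (3 / 2 * x) ^ k" by simp
      also have "\<dots> \<le> (4 / 3) ^ k * (3 / 2 * x) ^ k"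
      proof (rule mult_right_mono)
        have "(4 / 3) ^ 3 \<le> (4 / 3 :: real) ^ k" using k by (intro power_increasing) auto
        then show "2 \<le> (4 / 3 :: real) ^ k" by (simp add: power3_eq_cube)
      qed (use x in simp)
      also have "\<dots> = (2 * x) ^ k" unfolding power_mult_distrib[symmetric] by simp
      finally show ?thesis by (simp add: x_def)
    qed
    have big: "(\<Sum>h\<in>U. F h ^ (2 * rr k)) \<le> of_int M * (C * x powr (real (2 * rr k) - real k + 1 / 200) / real w)"
      unfolding F_def x_def
    proof (rule mean[of X "real w" "2 * real n"])
      show "\<forall>h\<in>U. \<exists>a q. 0 < q \<and> coprime a (int q) \<and> real w < real q \<and> real q \<le> 2 * real n / real w \<and> \<bar>of_int h / of_int M - of_int a / real q\<bar> \<le> 1 / (real q)\<^sup>2"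
        unfolding U_def by (intro ballI dirichlet_minor w(1) wn) auto
    qed (use X w wx n2 M in \<open>auto simp: U_def x_def\<close>)
    have small: "(\<Sum>h\<in>U. F h ^ 2) \<le> of_int M * x"
    proof -
      have "(\<Sum>h\<in>U. F h ^ 2) \<le> (\<Sum>h\<in>{0..<M}. F h ^ 2)" unfolding U_def by (intro sum_mono2) auto
      also have "\<dots> = of_int M * x" unfolding F_def x_def using k M by (intro fW_mean_square) auto
      finally show ?thesis .
    qed
    have rr: "2 * rr k = k * k + k" using rr_double[of k] by simp
    have kk: "25 \<le> k * k" using mult_le_mono[OF k k] by simp
    \<comment> \<open>The exponent solves 2 + 1/200 - 2 t - 8/25 = -1/200: it is the smallest for
      which the high moment, divided by T^2 and by w, still leaves the saving X^(-1/200).\<close>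
    define T where "T = x powr (169 / 200)"
    have T0: "0 < T" using x by (simp add: T_def)
    have "(\<Sum>h\<in>U. F h ^ s) \<le> x ^ (s - (2 * rr k - 2)) * (T ^ (2 * rr k - 4) * (\<Sum>h\<in>U. F h ^ 2) + (\<Sum>h\<in>U. F h ^ (2 * rr k)) / T ^ 2)"
    proof (rule sum_power_split_le[OF T0])
      have "cmod (fW k X \<alpha>) \<le> real X" for \<alpha>
      proof -
        have "cmod (fW k X \<alpha>) \<le> (\<Sum>x\<in>{1..int X}. 1)" unfolding fW_def by (rule order.trans[OF norm_sum]) simp
        then show ?thesis by simp
      qed
      then show "0 \<le> F h \<and> F h \<le> x" for h by (simp add: F_def x_def)
    qed (use x rr kk s in \<open>auto simp: U_def\<close>)
    also have "\<dots> \<le> x ^ (s - (2 * rr k - 2)) * (T ^ (2 * rr k - 4) * (of_int M * x) + of_int M * (C * x powr (real (2 * rr k) - real k + 1 / 200) / real w) / T ^ 2)"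
      using small big T0 x by (intro mult_left_mono add_mono divide_right_mono) auto
    also have "\<dots> = of_int M * (x ^ (s - (2 * rr k - 2)) * T ^ (2 * rr k - 4) * x + C * (x ^ (s - (2 * rr k - 2)) * x powr (real (2 * rr k) - real k + 1 / 200) / T ^ 2) * (1 / real w))"
      using T0 w(1) by (simp add: field_simps)
    also have "\<dots> \<le> of_int M * (x powr (real s - real k - 1 / 200) + C * (x powr (real s - real k - 1 / 200 + 8 / 25)) * (2 * x powr (- (8 / 25))))"
    proof (intro mult_left_mono add_mono M0 mult_mono)
      have p1: "x ^ m = x powr real m" for m using x by (simp add: powr_realpow)
      have p2: "T ^ m = x powr (169 / 200 * real m)" for m unfolding T_def using x by (simp add: powr_power mult.commute)
      have r1: "real (s - (2 * rr k - 2)) = real s - (real k * real k + real k) + 2"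
        using s rr kk by (simp add: of_nat_diff)
      have r2: "real (2 * rr k - 4) = real k * real k + real k - 4" using rr kk by (simp add: of_nat_diff)
      have r3: "real (2 * rr k) = real k * real k + real k" using rr by simp
      \<comment> \<open>The condition from the mean square term, where 155/1000 = 1 - 169/200. It is
        nearly sharp at k = 5, hence the factorisation with k - 5.\<close>
      have kq: "real k \<le> 155 / 1000 * (real k * real k + real k) + 375 / 1000"
      proof -
        have "0 \<le> (real k - 5) * (155 / 1000 * real k - 70 / 1000)" using k by (intro mult_nonneg_nonneg) auto
        moreover have "(real k - 5) * (155 / 1000 * real k - 70 / 1000) = 155 / 1000 * (real k * real k) - 845 / 1000 * real k + 35 / 100"
          by (simp add: field_simps)
        ultimately show ?thesis unfolding distrib_left by linarith
      qed
      have "x ^ (s - (2 * rr k - 2)) * T ^ (2 * rr k - 4) * x = x powr (real (s - (2 * rr k - 2)) + 169 / 200 * real (2 * rr k - 4) + 1)"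
        unfolding p1 p2 powr_add using x by simp
      also have "\<dots> \<le> x powr (real s - real k - 1 / 200)"
      proof (rule powr_mono)
        show "real (s - (2 * rr k - 2)) + 169 / 200 * real (2 * rr k - 4) + 1 \<le> real s - real k - 1 / 200"
          using kq unfolding r1 r2 by (simp add: field_simps)
      qed (use x in simp)
      finally show "x ^ (s - (2 * rr k - 2)) * T ^ (2 * rr k - 4) * x \<le> x powr (real s - real k - 1 / 200)" .
      have "x ^ (s - (2 * rr k - 2)) * x powr (real (2 * rr k) - real k + 1 / 200) / T ^ 2
         = x powr (real (s - (2 * rr k - 2)) + (real (2 * rr k) - real k + 1 / 200) - 169 / 200 * real 2)"
        unfolding p1 p2 powr_add powr_diff ..
      also have "real (s - (2 * rr k - 2)) + (real (2 * rr k) - real k + 1 / 200) - 169 / 200 * real 2 = real s - real k - 1 / 200 + 8 / 25"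
        unfolding r1 r3 by simp
      finally show "x ^ (s - (2 * rr k - 2)) * x powr (real (2 * rr k) - real k + 1 / 200) / T ^ 2 \<le> x powr (real s - real k - 1 / 200 + 8 / 25)" by simp
      show "1 / real w \<le> 2 * x powr (- (8 / 25))"
      proof -
        have "1 * x powr (8 / 25) \<le> 2 * real w" using w(3) by (simp add: x_def)
        then show ?thesis using w(1) x by (simp add: powr_minus field_simps)
      qed
    qed (use C x in auto)
    also have "C * (x powr (real s - real k - 1 / 200 + 8 / 25)) * (2 * x powr (- (8 / 25))) = 2 * C * (x powr (real s - real k - 1 / 200 + 8 / 25) * x powr (- (8 / 25)))"
      by (simp only: mult_ac)
    also have "x powr (real s - real k - 1 / 200 + 8 / 25) * x powr (- (8 / 25)) = x powr (real s - real k - 1 / 200)"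
      unfolding powr_add[symmetric] by simp
    finally show ?thesis unfolding U_def F_def x_def by (simp add: distrib_right)
  qed
  show ?thesis by (rule exI[of _ "1 + 2 * C"]) (use C main in auto)
qed

text \<open>The width w depends only on X, hence on n; the series stays truncated at w here, since
  its tail is estimated together with the convergence of the singular series.\<close>

lemma waring_estimate:
  assumes k: "5 \<le> k" and s: "k * k + k - 2 \<le> s"
  shows "\<exists>D. \<forall>X n. 2 \<le> X \<longrightarrow> X ^ k \<le> n \<longrightarrow> n < Suc X ^ k \<longrightarrow> (\<exists>w. real X powr (8 / 25) \<le> 2 * real w \<and>
     cmod (of_nat (waring_count s k n) - of_real (gint s k n) * (\<Sum>q\<in>{1..w}. singular_term s k n q))
       \<le> D * real X powr (- (1 / 200)) * real n powr (real s / real k - 1))"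
proof -
  obtain C where C: "0 < C" and minor: "\<And>X n w M. 2 \<le> X \<Longrightarrow> X ^ k \<le> n \<Longrightarrow> n < Suc X ^ k \<Longrightarrow> 1 \<le> w \<Longrightarrow> real w \<le> real X powr (8 / 25) \<Longrightarrow>
     real X powr (8 / 25) \<le> 2 * real w \<Longrightarrow> int (rr k) * int (2 * X) ^ k < M \<Longrightarrow> int (X ^ k) < M \<Longrightarrow>
     (\<Sum>h\<in>{0..<M} - (\<Union>(q, a)\<in>farey w. arc w n M q a). cmod (fW k X (of_int h / of_int M)) ^ s) \<le> of_int M * (C * real X powr (real s - real k - 1 / 200))"
    using minor_arcs_bound[OF assms] by auto
  define D1 where "D1 = 2048 * real s * 2 ^ (s - 1)"
  define D2 where "D2 = 64 * (3 * gS_const k) ^ s"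
  have D1: "0 \<le> D1" by (simp add: D1_def)
  have D2: "0 \<le> D2" unfolding D2_def using gS_const_ge_1[of k] by simp
  have main: "\<exists>w. real X powr (8 / 25) \<le> 2 * real w \<and>
     cmod (of_nat (waring_count s k n) - of_real (gint s k n) * (\<Sum>q\<in>{1..w}. singular_term s k n q))
       \<le> (C + D1 + 2 * D2) * real X powr (- (1 / 200)) * real n powr (real s / real k - 1)"
    if X: "2 \<le> X" "X ^ k \<le> n" "n < Suc X ^ k" for X n
  proof -
    define x where "x = real X"
    have x: "2 \<le> x" using X(1) by (simp add: x_def)
    define \<sigma> where "\<sigma> = real s / real k"
    have kk: "5 * k \<le> k * k" using k by simp
    then have s3: "3 * k \<le> s" "1 \<le> s" using s k by linarith+
    have "real (3 * k) \<le> real s" using s3 by (simp only: of_nat_le_iff)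
    then have \<sigma>: "3 \<le> \<sigma>" unfolding \<sigma>_def using k by (simp add: pos_le_divide_eq)
    define w where "w = nat \<lfloor>x powr (8 / 25)\<rfloor>"
    have "1 \<le> x powr (8 / 25)" using x by (intro ge_one_powr_ge_zero) auto
    moreover have "real (nat \<lfloor>y\<rfloor>) \<le> y" "y < real (nat \<lfloor>y\<rfloor>) + 1" if "1 \<le> y" for y
      using that by linarith+
    ultimately have "1 \<le> x powr (8 / 25)" "real w \<le> x powr (8 / 25)" "x powr (8 / 25) < real w + 1"
      unfolding w_def by blast+
    moreover from this have "0 < real w" by linarith
    moreover from this have "1 \<le> real w" "1 \<le> w" by simp_all
    ultimately have w: "1 \<le> w" "real w \<le> x powr (8 / 25)" "x powr (8 / 25) \<le> 2 * real w" by linarith+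
    have wi: "1 / real w \<le> 2 * x powr (- (8 / 25))"
      using w x by (simp add: powr_minus field_simps)
    have w3: "real w ^ 3 \<le> x powr (24 / 25)"
    proof -
      have "real w ^ 3 \<le> (x powr (8 / 25)) ^ 3" using w by (intro power_mono) auto
      also have "\<dots> = x powr (24 / 25)" using x by (simp add: powr_power)
      finally show ?thesis .
    qed
    have nx: "x ^ k \<le> real n" using X(2) by (simp add: x_def of_nat_power[symmetric] del: of_nat_power)
    have w3n: "2 * w ^ 3 < n"
    proof -
      have "x powr (24 / 25) \<le> x powr 1" using x by (intro powr_mono) auto
      then have "2 * real w ^ 3 \<le> 2 * x" using w3 x by simp
      also have "\<dots> < x * x ^ 2"
      proof -
        have "2 * 2 \<le> x * x" using x by (intro mult_mono) auto
        then have "2 < x ^ 2" by (simp add: power2_eq_square)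
        then show ?thesis using x by simp
      qed
      also have "\<dots> = x ^ 3" by (simp add: power2_eq_square power3_eq_cube)
      also have "\<dots> \<le> x ^ k" using x k by (intro power_increasing) auto
      finally have "real (2 * w ^ 3) < real n" using nx by simp
      then show ?thesis by (simp only: of_nat_less_iff)
    qed
    \<comment> \<open>Large enough to exceed s n, n, rr k (2X)^k and X^k simultaneously, so that all
      orthogonality relations on the grid detect genuine equality.\<close>
    define M where "M = int ((s + rr k + 2) * (2 * Suc X) ^ k)"
    have SX: "1 \<le> (2 * Suc X) ^ k" "Suc X ^ k \<le> (2 * Suc X) ^ k" "(2 * X) ^ k \<le> (2 * Suc X) ^ k"
      by (auto intro!: power_mono one_le_power simp del: mult_Suc_right)
    have Meq: "M = int s * int ((2 * Suc X) ^ k) + int (rr k) * int ((2 * Suc X) ^ k) + 2 * int ((2 * Suc X) ^ k)"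
      unfolding M_def by (simp only: of_nat_mult of_nat_add distrib_right of_nat_numeral)
    have "n < (2 * Suc X) ^ k" using X(3) SX by linarith
    then have nM: "int n < int ((2 * Suc X) ^ k)" "int s * int n \<le> int s * int ((2 * Suc X) ^ k)"
      by (simp_all only: of_nat_less_iff of_nat_le_iff mult_left_mono less_imp_le of_nat_0_le_iff)
    have rM: "int (rr k) * int ((2 * X) ^ k) \<le> int (rr k) * int ((2 * Suc X) ^ k)"
      using SX(3) by (intro mult_left_mono) (simp_all only: of_nat_le_iff of_nat_0_le_iff)
    have nn: "0 \<le> int s * int n" "0 \<le> int (rr k) * int ((2 * X) ^ k)" "0 \<le> int n" by simp_all
    have M1: "int (s * n) < M" "int n < M" "int (rr k) * int (2 * X) ^ k < M" "int (X ^ k) < M"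
    proof -
      show "int (s * n) < M" using Meq nM rM nn unfolding of_nat_mult by linarith
      show nM': "int n < M" using Meq nM rM nn by linarith
      show "int (rr k) * int (2 * X) ^ k < M" using Meq nM rM nn unfolding of_nat_power by linarith
      have "int (X ^ k) \<le> int n" using X(2) by (simp only: of_nat_le_iff)
      then show "int (X ^ k) < M" using nM' by linarith
    qed
    have M0: "0 < real_of_int M" using M1(2) by simp
    define U where "U = (\<Union>(q, a)\<in>farey w. arc w n M q a)"
    define G where "G h = fW k X (of_int h / of_int M) ^ s * ee (- (real n * (of_int h / of_int M)))" for h
    define Z where "Z = of_real (gint s k n) * (\<Sum>q\<in>{1..w}. singular_term s k n q)"
    have UM: "U \<subseteq> {0..<M}" by (auto simp: U_def arc_def)
    have "of_int M * of_nat (waring_count s k n) = (\<Sum>h\<in>{0..<M}. G h)"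
      unfolding G_def by (rule waring_fourier[OF X(3,2) M1(1,2), symmetric])
    also have "\<dots> = (\<Sum>h\<in>{0..<M} - U. G h) + (\<Sum>h\<in>U. G h)"
      by (rule sum.subset_diff[OF UM]) simp
    finally have split: "of_int M * (of_nat (waring_count s k n) - Z) = (\<Sum>h\<in>{0..<M} - U. G h) + ((\<Sum>h\<in>U. G h) - of_int M * Z)"
      by (simp add: right_diff_distrib)
    have xn: "x powr (real s - real k - 1 / 200) \<le> x powr (- (1 / 200)) * real n powr (\<sigma> - 1)"
    proof -
      have "x powr (real s - real k - 1 / 200) = x powr (- (1 / 200)) * x powr (real s - real k)" unfolding powr_add[symmetric] by simp
      also have "x powr (real s - real k) = (x ^ k) powr (\<sigma> - 1)"
        using x k by (simp add: powr_realpow[symmetric] powr_powr \<sigma>_def right_diff_distrib)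
      also have "x powr (- (1 / 200)) * (x ^ k) powr (\<sigma> - 1) \<le> x powr (- (1 / 200)) * real n powr (\<sigma> - 1)"
        using nx \<sigma> x by (intro mult_left_mono powr_mono2) auto
      finally show ?thesis .
    qed
    define P where "P = x powr (- (1 / 200)) * real n powr (\<sigma> - 1)"
    have e1: "cmod (\<Sum>h\<in>{0..<M} - U. G h) \<le> of_int M * (C * P)"
    proof -
      have "cmod (\<Sum>h\<in>{0..<M} - U. G h) \<le> (\<Sum>h\<in>{0..<M} - U. cmod (fW k X (of_int h / of_int M)) ^ s)"
        by (rule order.trans[OF norm_sum]) (simp add: G_def norm_mult norm_power)
      also have "\<dots> \<le> of_int M * (C * real X powr (real s - real k - 1 / 200))"
        unfolding U_def using w unfolding x_def by (intro minor X M1) auto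
      also have "\<dots> \<le> of_int M * (C * P)" using xn C M0 unfolding P_def x_def by (intro mult_left_mono) auto
      finally show ?thesis .
    qed
    \<comment> \<open>With w^3 <= X^(24/25) and n >= X^k this error is of order X^(s-k-1/25), which
      is why the width must stay below X^(1/3).\<close>
    have "2048 * real s * real w ^ 3 * (real X + 1) ^ (s - 1) / real n \<le> D1 * P"
    proof -
      have "(real X + 1) ^ (s - 1) \<le> (2 * x) ^ (s - 1)" using x by (intro power_mono) (auto simp: x_def)
      also have "\<dots> = 2 ^ (s - 1) * x powr (real s - 1)"
        using x s3 by (simp add: power_mult_distrib powr_realpow[symmetric] of_nat_diff)
      finally have X1: "(real X + 1) ^ (s - 1) \<le> 2 ^ (s - 1) * x powr (real s - 1)" .
      have "2048 * real s * real w ^ 3 * (real X + 1) ^ (s - 1) / real n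
          \<le> 2048 * real s * x powr (24 / 25) * (2 ^ (s - 1) * x powr (real s - 1)) / x ^ k"
        using w3 X1 nx x by (intro frac_le mult_mono) auto
      also have "\<dots> = D1 * (x powr (24 / 25) * x powr (real s - 1) / x powr real k)"
        using x by (simp add: D1_def powr_realpow)
      also have "x powr (24 / 25) * x powr (real s - 1) / x powr real k = x powr (24 / 25 + (real s - 1) - real k)"
        unfolding powr_add powr_diff ..
      also have "\<dots> \<le> x powr (real s - real k - 1 / 200)" using x by (intro powr_mono) auto
      also have "\<dots> \<le> P" unfolding P_def by (rule xn)
      finally show ?thesis using D1 by (simp add: mult_left_mono)
    qed
    moreover have "64 * (3 * gS_const k) ^ s * real n powr (real s / real k - 1) * real w powr (2 - real s / real k) \<le> 2 * D2 * P"
    proof -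
      \<comment> \<open>Here s >= 3 k enters; the truncation of the singular integral then saves a
        full factor w.\<close>
      have "real w powr (2 - \<sigma>) \<le> real w powr (- 1)" using w \<sigma> by (intro powr_mono) auto
      also have "\<dots> = 1 / real w" using w by (simp add: powr_minus_divide)
      also have "\<dots> \<le> 2 * x powr (- (8 / 25))" by (rule wi)
      also have "\<dots> \<le> 2 * x powr (- (1 / 200))" using x by (intro mult_left_mono powr_mono) auto
      finally have "D2 * real n powr (\<sigma> - 1) * real w powr (2 - \<sigma>) \<le> D2 * real n powr (\<sigma> - 1) * (2 * x powr (- (1 / 200)))"
        using D2 by (intro mult_left_mono) auto
      then show ?thesis unfolding D2_def P_def \<sigma>_def by (simp only: mult_ac)
    qed
    moreover have "cmod ((\<Sum>h\<in>U. G h) - of_int M * Z) \<le> of_int M * (2048 * real s * real w ^ 3 * (real X + 1) ^ (s - 1) / real n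
         + 64 * (3 * gS_const k) ^ s * real n powr (real s / real k - 1) * real w powr (2 - real s / real k))"
      using major_arcs[OF _ _ X(3,2) w3n w(1) M1(1,2)] k s3 unfolding G_def U_def Z_def by (simp add: mult.assoc)
    ultimately have e2: "cmod ((\<Sum>h\<in>U. G h) - of_int M * Z) \<le> of_int M * (D1 * P + 2 * D2 * P)"
      using M0 by (smt (verit) mult_left_mono)
    have "of_int M * cmod (of_nat (waring_count s k n) - Z) = cmod (of_int M * (of_nat (waring_count s k n) - Z))"
      using M0 by (simp add: norm_mult)
    also have "\<dots> \<le> of_int M * (C * P) + of_int M * (D1 * P + 2 * D2 * P)"
      unfolding split by (rule order.trans[OF norm_triangle_ineq add_mono[OF e1 e2]])
    also have "\<dots> = of_int M * ((C + D1 + 2 * D2) * P)" by (simp add: algebra_simps)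
    finally have "cmod (of_nat (waring_count s k n) - Z) \<le> (C + D1 + 2 * D2) * P" using M0 by simp
    then show ?thesis using w(3) unfolding Z_def P_def x_def \<sigma>_def by (intro exI[of _ w]) (simp add: mult.assoc)
  qed
  show ?thesis by (rule exI[of _ "C + D1 + 2 * D2"]) (use main in blast)
qed

text \<open>Three replacements, each small relative to n^(s/k-1): the counting function by
  \<open>gint\<close> times the truncated series, the truncated series by the full one with a tail
  bounded uniformly in n, and \<open>gint\<close> by its limit times n^(s/k-1).\<close>

theorem asymptotic_formula_holds:
  assumes k: "5 \<le> k" and s: "k * k + k - 2 \<le> s"
  shows "asymptotic_formula s k"
proof -
  have k1: "1 \<le> k" "3 \<le> k" using k by simp_all
  have "5 * k \<le> k * k" using k by simp
  then have s2: "2 * k < s" using s k by linarith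
  define \<sigma> where "\<sigma> = real s / real k"
  define P where "P n = real n powr (\<sigma> - 1)" for n :: nat
  define L where "L = Gamma (1 + 1 / real k) ^ s / Gamma \<sigma>"
  define a where "a q = gS_const k ^ s * real (Suc q) powr (1 - \<sigma>)" for q
  have a: "summable a" unfolding a_def \<sigma>_def using s2 k1 by (intro summable_mult summable_qpow)
  have st: "cmod (singular_term s k n (Suc q)) \<le> a q" for n q
    unfolding a_def \<sigma>_def by (intro norm_singular_term_le k1) simp
  have ss: "summable (\<lambda>q. singular_term s k n (Suc q))" for n by (rule summable_singular[OF k1(2) s2])
  define t where "t w = (\<Sum>q. a (q + w))" for w
  have t0: "t \<longlonglongrightarrow> 0"
  proof -
    have "(\<lambda>w. suminf a - (\<Sum>i<w. a i)) \<longlonglongrightarrow> suminf a - suminf a"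
      by (intro tendsto_diff tendsto_const summable_LIMSEQ a)
    then show ?thesis unfolding t_def suminf_minus_initial_segment[OF a] by simp
  qed
  have tail: "cmod (singular_series s k n - (\<Sum>q\<in>{1..w}. singular_term s k n q)) \<le> t w" for n w
  proof -
    have "(\<Sum>q\<in>{1..w}. singular_term s k n q) = (\<Sum>q<w. singular_term s k n (Suc q))"
      by (rule sum.reindex_bij_witness[of _ Suc "\<lambda>q. q - 1"]) auto
    then have "singular_series s k n - (\<Sum>q\<in>{1..w}. singular_term s k n q) = (\<Sum>q. singular_term s k n (Suc (q + w)))"
      unfolding singular_series_def using suminf_minus_initial_segment[OF ss[of n], of w] by simp
    also have "cmod \<dots> \<le> t w"
      unfolding t_def using summable_ignore_initial_segment[OF a] by (intro norm_suminf_le st)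
    finally show ?thesis .
  qed
  have S0: "cmod (singular_series s k n) \<le> t 0" for n using tail[of n 0] by simp
  obtain D where D: "\<And>X n. 2 \<le> X \<Longrightarrow> X ^ k \<le> n \<Longrightarrow> n < Suc X ^ k \<Longrightarrow> \<exists>w. real X powr (8 / 25) \<le> 2 * real w \<and>
     cmod (of_nat (waring_count s k n) - of_real (gint s k n) * (\<Sum>q\<in>{1..w}. singular_term s k n q)) \<le> D * real X powr (- (1 / 200)) * P n"
    using waring_estimate[OF k s] unfolding P_def \<sigma>_def by blast
  obtain X where X: "\<And>n. X n ^ k \<le> n" "\<And>n. n < Suc (X n) ^ k" using nat_root_ex[OF k1(1)] by metis
  have Xlim: "filterlim X at_top sequentially"
    unfolding filterlim_at_top
  proof
    fix Z :: nat
    show "eventually (\<lambda>n. Z \<le> X n) sequentially"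
      using eventually_ge_at_top[of "Z ^ k"]
    proof eventually_elim
      case (elim n)
      then have "Z ^ k < Suc (X n) ^ k" using X(2)[of n] by linarith
      then have "Z < Suc (X n)" by (rule power_less_imp_less_base) simp
      then show ?case by simp
    qed
  qed
  have "\<exists>w. 2 \<le> X n \<longrightarrow> real (X n) powr (8 / 25) \<le> 2 * real w \<and>
     cmod (of_nat (waring_count s k n) - of_real (gint s k n) * (\<Sum>q\<in>{1..w}. singular_term s k n q)) \<le> D * real (X n) powr (- (1 / 200)) * P n" for n
    using D[OF _ X, of n] by blast
  then obtain w where w: "\<And>n. 2 \<le> X n \<Longrightarrow> real (X n) powr (8 / 25) \<le> 2 * real (w n)"
     "\<And>n. 2 \<le> X n \<Longrightarrow> cmod (of_nat (waring_count s k n) - of_real (gint s k n) * (\<Sum>q\<in>{1..w n}. singular_term s k n q)) \<le> D * real (X n) powr (- (1 / 200)) * P n"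
    by metis
  have X2: "eventually (\<lambda>n. 2 \<le> X n) sequentially" using Xlim unfolding filterlim_at_top by blast
  have rX: "filterlim (\<lambda>n. real (X n)) at_top sequentially"
    by (rule filterlim_compose[OF filterlim_real_sequentially Xlim])
  have Xpow: "(\<lambda>n. real (X n) powr (- (1 / 200))) \<longlonglongrightarrow> 0"
    by (rule tendsto_neg_powr[OF _ rX]) simp
  have wlim: "filterlim w at_top sequentially"
    unfolding filterlim_at_top
  proof
    fix Z :: nat
    have "filterlim (\<lambda>n. real (X n) powr (8 / 25)) at_top sequentially"
      by (rule filterlim_compose[OF real_powr_at_top rX]) simp
    then have "eventually (\<lambda>n. 2 * real Z \<le> real (X n) powr (8 / 25)) sequentially" unfolding filterlim_at_top by blast
    then show "eventually (\<lambda>n. Z \<le> w n) sequentially"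
      using X2
    proof eventually_elim
      case (elim n)
      then show ?case using w(1)[of n] by linarith
    qed
  qed
  have glim: "(\<lambda>n. gint s k n / P n) \<longlonglongrightarrow> L"
  proof -
    have "0 < \<sigma>" unfolding \<sigma>_def using s2 k1 by simp
    then have "(\<lambda>n. Gamma (1 + 1 / real k) ^ s * (pochhammer \<sigma> n / fact n / real n powr (\<sigma> - 1))) \<longlonglongrightarrow> Gamma (1 + 1 / real k) ^ s * (1 / Gamma \<sigma>)"
      by (intro tendsto_mult_left pochhammer_asymp)
    then show ?thesis by (simp add: gint_def P_def L_def \<sigma>_def mult.assoc)
  qed
  define f where "f n = of_nat (waring_count s k n) - of_real L * singular_series s k n * of_real (P n)" for n
  define b where "b n = D * real (X n) powr (- (1 / 200)) + \<bar>gint s k n / P n\<bar> * t (w n) + \<bar>gint s k n / P n - L\<bar> * t 0" for n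
  have "b \<longlonglongrightarrow> D * 0 + \<bar>L\<bar> * 0 + \<bar>L - L\<bar> * t 0"
    unfolding b_def by (intro tendsto_intros Xpow glim filterlim_compose[OF t0 wlim])
  then have b0: "b \<longlonglongrightarrow> 0" by simp
  have Pp: "0 < P n" if "0 < n" for n using that by (simp add: P_def)
  have "(\<lambda>n. f n / of_real (P n)) \<longlonglongrightarrow> 0"
  proof (rule Lim_null_comparison[OF _ b0])
    show "eventually (\<lambda>n. cmod (f n / of_real (P n)) \<le> b n) sequentially"
      using X2 eventually_gt_at_top[of 0]
    proof eventually_elim
      case (elim n)
      define T where "T = (\<Sum>q\<in>{1..w n}. singular_term s k n q)"
      have P: "0 < P n" using elim by (intro Pp)
      have "f n = (of_nat (waring_count s k n) - of_real (gint s k n) * T)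
          - of_real (gint s k n) * (singular_series s k n - T) + of_real (gint s k n - L * P n) * singular_series s k n"
        by (simp add: f_def algebra_simps)
      also have "cmod \<dots> \<le> D * real (X n) powr (- (1 / 200)) * P n + \<bar>gint s k n\<bar> * t (w n) + \<bar>gint s k n - L * P n\<bar> * t 0"
      proof (rule order.trans[OF norm_triangle_ineq add_mono[OF order.trans[OF norm_triangle_ineq4 add_mono]]])
        show "cmod (of_nat (waring_count s k n) - of_real (gint s k n) * T) \<le> D * real (X n) powr (- (1 / 200)) * P n"
          unfolding T_def using elim by (intro w(2))
        show "cmod (of_real (gint s k n) * (singular_series s k n - T)) \<le> \<bar>gint s k n\<bar> * t (w n)"
          unfolding norm_mult norm_of_real T_def by (intro mult_left_mono tail) simp
        show "cmod (of_real (gint s k n - L * P n) * singular_series s k n) \<le> \<bar>gint s k n - L * P n\<bar> * t 0"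
          unfolding norm_mult norm_of_real by (intro mult_left_mono S0) simp
      qed
      also have "\<dots> = b n * P n"
      proof -
        have "\<bar>gint s k n\<bar> = \<bar>gint s k n / P n\<bar> * P n" using P by (simp add: abs_divide)
        moreover have "gint s k n - L * P n = (gint s k n / P n - L) * P n" using P by (simp add: left_diff_distrib)
        then have "\<bar>gint s k n - L * P n\<bar> = \<bar>gint s k n / P n - L\<bar> * P n" using P by (simp add: abs_mult)
        ultimately show ?thesis using P by (simp add: b_def algebra_simps abs_of_pos)
      qed
      finally show "cmod (f n / of_real (P n)) \<le> b n" using P by (simp add: norm_divide pos_divide_le_eq)
    qed
  qed
  moreover have "eventually (\<lambda>n. complex_of_real (P n) \<noteq> 0) sequentially"
    using eventually_gt_at_top[of 0]
  proof eventually_elim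
    case (elim n)
    then show ?case using Pp[of n] by simp
  qed
  ultimately have "f \<in> o[sequentially](\<lambda>n. complex_of_real (P n))" by (intro smalloI_tendsto)
  then show ?thesis unfolding asymptotic_formula_def f_def P_def L_def \<sigma>_def using ss by (intro conjI always_eventually allI)
qed

theorem theorem1p4:
  fixes k :: nat
  assumes "5 \<le> k" and "k \<le> 20"
  shows "G_tilde k \<le> enat (H k)"
proof -
  have "k \<in> set [5..<21]" unfolding set_upt atLeastLessThan_iff using assms by linarith
  then have "k \<in> {5, 6, 7, 8, 9, 10, 11, 12, 13, 14, 15, 16, 17, 18, 19, 20}" by simp
  \<comment> \<open>Equality holds at k = 5, where both sides are 28; for the larger k there is
    room.\<close>
  then have Hk: "k * k + k - 2 \<le> H k" by (elim insertE emptyE) (simp_all add: H_def)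
  have "25 \<le> k * k" using mult_le_mono[OF assms(1) assms(1)] by simp
  then have "1 \<le> H k" using Hk by linarith
  moreover have "asymptotic_formula s k" if "H k \<le> s" for s
    using Hk that by (intro asymptotic_formula_holds assms(1)) simp
  ultimately show ?thesis unfolding G_tilde_def by (intro Inf_lower) blast
qed

end
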